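(* Let $1\le k\le m$ and let $\mathfrak v_{\omega_k,\lambda}\in L^2_x(\mathbb R,\mathbb C^2)$ be any element of $\ker(\mathcal H_{\omega_k}-\lambda\,\mathrm{Id})$ for some eigenvalue $\lambda$ of $\mathcal H_{\omega_k}$. There exist constants $K>0$, $L,C\gg1$, $\beta>0$, depending only on the potentials $V_1,\dots,V_m$, such that if $\min_\ell(y_\ell-y_{\ell+1})>L$ and $\min_\ell(v_\ell-v_{\ell+1})>C$, then there is a unique solution of (CT) of the form $$\mathfrak G_{\omega_k,v_k,y_k,\gamma_k}(\mathfrak v_{\omega_k,\lambda})(t,x):=e^{-i\lambda t}\,\mathfrak g_{\omega_k,v_k,y_k,\gamma_k}(\mathfrak v_{\omega_k,\lambda})(t,x)+r(t,x)$$ satisfying $$\|r(t,\cdot)\|_{L^2_x(\mathbb R)}\le Ke^{-\beta\min_\ell(y_\ell-y_{\ell+1})-\beta\min_\ell(v_\ell-v_{\ell+1})t}\quad\text{for all }t\ge0 .$$ Moreover, if $\mathfrak z_{\omega_k}\in\ker\mathcal H_{\omega_k}^2$ and $\mathcal H_{\omega_k}\mathfrak z_{\omega_k}=i\mathfrak v_{\omega_k,0}$, then there exists a unique solution of (CT) of the form $$\mathfrak G_{\omega_k,v_k,y_k,\gamma_k}(\mathfrak z_{\omega_k})(t,x):=\mathfrak g_{\omega_k,v_k,y_k,\gamma_k}(\mathfrak z_{\omega_k})(t,x)+t\,\mathfrak g_{\omega_k,v_k,y_k,\gamma_k}(\mathfrak v_{\omega_k,0})(t,x)+r(t,x)$$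 satisfying $\|r(t,\cdot)\|_{L^2_x(\mathbb R)}\le Ke^{-\beta\min_\ell(y_\ell-y_{\ell+1})-\beta\min_\ell(v_\ell-v_{\ell+1})t}$ for all $t\ge0$.
   Context: Notation: $\sigma_3=\begin{pmatrix}1&0\\0&-1\end{pmatrix}$. Minima of $y_\ell-y_{\ell+1}$ and $v_\ell-v_{\ell+1}$ run over $1\le\ell\le m-1$. Potentials. Fix $m\in\mathbb N$. For $1\le \ell\le m$ let $\omega_\ell>0$, $U_\ell,W_\ell:\mathbb R\to\mathbb R$ smooth, $V_\ell=\begin{pmatrix}U_\ell&-W_\ell\\ W_\ell&-U_\ell\end{pmatrix}$, $V_\ell(x)=V_\ell(-x)$, and for some $0<\gamma<1$, $\|V_\ell^{(k)}(x)\|\le C_{k,\ell}e^{-\gamma|x|}$ for all $k\ge0$. Put $\mathcal H_\ell=\mathcal H_{\omega_\ell}=\sigma_3(-\partial_x^2+\omega_\ell)+V_\ell$ on $L^2(\mathbb R,\mathbb C^2)$. Standing assumptions for each $\ell$: (H1) $\mathcal H_\ell$ has no embedded eigenvalue in its essential spectrum; (H2) $\mathcal H_\ell$ has $2N_\ell$ nonzero simple eigenvalues on the real line with absolute value less than $\omega_\ell$ and $2M_\ell$ nonzero simple eigenvalues on the imaginary line, for some $N_\ell,M_\ell\in\mathbb N$; (H3) $\ker\mathcal H_\ell^n=\ker\mathcal H_\ell^2$ for all $n\ge2$. Equation (CT). Let $v_1>\dots>v_m$, $y_1>\dots>y_m$, $\gamma_\ell\in\mathbb R$, $\theta_\ell(t,x)=\frac{v_\ell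 x}{2}-\frac{v_\ell^2t}{4}+\omega_\ell t+\gamma_\ell$, and $V_\ell^{\sigma_\ell}(t)=\begin{pmatrix}U_\ell(x-v_\ell t-y_\ell)&-e^{2i\theta_\ell(t,x)}W_\ell(x-v_\ell t-y_\ell)\\ e^{-2i\theta_\ell(t,x)}W_\ell(x-v_\ell t-y_\ell)&-U_\ell(x-v_\ell t-y_\ell)\end{pmatrix}$. (CT) is $i\partial_t\vec\psi+\sigma_3\partial_x^2\vec\psi-\sum_{\ell=1}^mV_\ell^{\sigma_\ell}(t)\vec\psi=0$ with $\vec\psi(0)\in L^2_x(\mathbb R,\mathbb C^2)$. Galilei transform: $\mathfrak g_{\omega_k,v_k,y_k,\gamma_k}(g)(t,x)=e^{i\sigma_3\theta_k(t,x)}g(x-v_kt-y_k)$.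
   Formalization: The bounds on r carry the factor max(1, ‖𝔳‖), resp. max(1, ‖𝔷‖), next to K: since (CT) is linear, K depending only on the potentials cannot serve kernel elements of arbitrary size. For m = 1 the empty minimum is read as +∞. *)

theory Defs
  imports "HOL-Analysis.Analysis"
begin

section \<open>Square integrable functions with values in \<open>C\<^sup>2\<close>\<close>

text \<open>Elements of \<open>L\<^sup>2(\<real>, C\<^sup>2)\<close> are represented by Borel functions; every equality between
  elements of \<open>L\<^sup>2\<close> is an equality almost everywhere.\<close>

type_synonym field2 = "real \<Rightarrow> complex ^ 2"

definition L2 :: "field2 \<Rightarrow> bool" where
  "L2 f \<longleftrightarrow> f \<in> borel_measurable lborel \<and> integrable lborel (\<lambda>x. (norm (f x))\<^sup>2)"

definition L2norm :: "field2 \<Rightarrow> real" where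
  "L2norm f = sqrt (\<integral>x. (norm (f x))\<^sup>2 \<partial>lborel)"

definition smooth :: "(real \<Rightarrow> real) \<Rightarrow> bool" where
  "smooth \<phi> \<longleftrightarrow> (\<forall>n x. (deriv ^^ n) \<phi> differentiable (at x))"

definition test_function :: "(real \<Rightarrow> real) \<Rightarrow> bool" where
  "test_function \<phi> \<longleftrightarrow> smooth \<phi> \<and> (\<exists>R. \<forall>x. \<bar>x\<bar> > R \<longrightarrow> \<phi> x = 0)"

text \<open>Real-valued test functions suffice, since the integrals are \<open>C\<^sup>2\<close>-valued.\<close>

definition weak_derivative :: "field2 \<Rightarrow> field2 \<Rightarrow> bool" where
  "weak_derivative f g \<longleftrightarrow>
     (\<forall>\<phi>. test_function \<phi> \<longrightarrow>
        (\<integral>x. deriv \<phi> x *\<^sub>R f x \<partial>lborel) = - (\<integral>x. \<phi> x *\<^sub>R g x \<partial>lborel))"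


section \<open>The matrix Schroedinger operators\<close>

definition sigma3 :: "complex ^ 2 ^ 2" where
  "sigma3 = vector [vector [1, 0], vector [0, -1]]"

definition potential :: "(real \<Rightarrow> real) \<Rightarrow> (real \<Rightarrow> real) \<Rightarrow> real \<Rightarrow> complex ^ 2 ^ 2" where
  "potential U W x = vector
     [vector [of_real (U x), - of_real (W x)],
      vector [of_real (W x), - of_real (U x)]]"

text \<open>\<open>H_graph \<omega> U W f h\<close>: \<open>f\<close> lies in the Sobolev space \<open>H\<^sup>2(\<real>, C\<^sup>2)\<close>, the domain of
  \<open>H = \<sigma>\<^sub>3 (-\<partial>\<^sub>x\<^sup>2 + \<omega>) + V\<close> as a closed operator on \<open>L\<^sup>2\<close>, and \<open>H f = h\<close>.
  Here \<open>f1\<close> and \<open>f2\<close> are the first and second weak derivatives of \<open>f\<close>.\<close>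

definition H_graph ::
  "real \<Rightarrow> (real \<Rightarrow> real) \<Rightarrow> (real \<Rightarrow> real) \<Rightarrow> field2 \<Rightarrow> field2 \<Rightarrow> bool" where
  "H_graph \<omega> U W f h \<longleftrightarrow> L2 f \<and> L2 h \<and>
     (\<exists>f1 f2. L2 f1 \<and> L2 f2 \<and> weak_derivative f f1 \<and> weak_derivative f1 f2 \<and>
        (AE x in lborel. h x = sigma3 *v (- f2 x + \<omega> *\<^sub>R f x) + potential U W x *v f x))"

text \<open>\<open>H_kernel \<omega> U W \<mu> n f\<close>: \<open>f \<in> ker (H - \<mu>)\<^sup>n\<close>, with the natural domain of the power.\<close>

primrec H_kernel ::
  "real \<Rightarrow> (real \<Rightarrow> real) \<Rightarrow> (real \<Rightarrow> real) \<Rightarrow> complex \<Rightarrow> nat \<Rightarrow> field2 \<Rightarrow> bool" where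
  "H_kernel \<omega> U W \<mu> 0 f \<longleftrightarrow> L2 f \<and> (AE x in lborel. f x = 0)"
| "H_kernel \<omega> U W \<mu> (Suc n) f \<longleftrightarrow>
     (\<exists>h. H_graph \<omega> U W f h \<and> H_kernel \<omega> U W \<mu> n (\<lambda>x. h x - \<mu> *s f x))"

definition eigenvalue ::
  "real \<Rightarrow> (real \<Rightarrow> real) \<Rightarrow> (real \<Rightarrow> real) \<Rightarrow> complex \<Rightarrow> bool" where
  "eigenvalue \<omega> U W \<mu> \<longleftrightarrow>
     (\<exists>f. H_kernel \<omega> U W \<mu> 1 f \<and> \<not> (AE x in lborel. f x = 0))"

text \<open>Simple means of algebraic multiplicity one: the generalized eigenspace is a line.\<close>

definition simple_eigenvalue ::
  "real \<Rightarrow> (real \<Rightarrow> real) \<Rightarrow> (real \<Rightarrow> real) \<Rightarrow> complex \<Rightarrow> bool" where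
  "simple_eigenvalue \<omega> U W \<mu> \<longleftrightarrow>
     (\<exists>f. H_kernel \<omega> U W \<mu> 1 f \<and> \<not> (AE x in lborel. f x = 0) \<and>
        (\<forall>n g. H_kernel \<omega> U W \<mu> n g \<longrightarrow> (\<exists>c. AE x in lborel. g x = c *s f x)))"

text \<open>The essential spectrum, by singular Weyl sequences: normalized, weakly null in \<open>L\<^sup>2\<close>,
  with \<open>(H - \<mu>) u\<^sub>n \<rightarrow> 0\<close>. (Testing against the real inner product with all \<open>g\<close> gives weak
  convergence over the complex numbers as well, because \<open>g\<close> may be multiplied by \<open>\<i>\<close>.)\<close>

definition essential_spectrum ::
  "real \<Rightarrow> (real \<Rightarrow> real) \<Rightarrow> (real \<Rightarrow> real) \<Rightarrow> complex set" where
  "essential_spectrum \<omega> U W =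
     {\<mu>. \<exists>u h. (\<forall>n. H_graph \<omega> U W (u n) (h n) \<and> L2norm (u n) = 1) \<and>
          (\<forall>g. L2 g \<longrightarrow> (\<lambda>n::nat. \<integral>x. u n x \<bullet> g x \<partial>lborel) \<longlonglongrightarrow> 0) \<and>
          (\<lambda>n. L2norm (\<lambda>x. h n x - \<mu> *s u n x)) \<longlonglongrightarrow> 0}"

definition hypothesis_H1 ::
  "real \<Rightarrow> (real \<Rightarrow> real) \<Rightarrow> (real \<Rightarrow> real) \<Rightarrow> bool" where
  "hypothesis_H1 \<omega> U W \<longleftrightarrow> (\<forall>\<mu> \<in> essential_spectrum \<omega> U W. \<not> eigenvalue \<omega> U W \<mu>)"

definition real_eigenvalues ::
  "real \<Rightarrow> (real \<Rightarrow> real) \<Rightarrow> (real \<Rightarrow> real) \<Rightarrow> complex set" where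
  "real_eigenvalues \<omega> U W =
     {\<mu>. Im \<mu> = 0 \<and> \<mu> \<noteq> 0 \<and> norm \<mu> < \<omega> \<and> eigenvalue \<omega> U W \<mu>}"

definition imaginary_eigenvalues ::
  "real \<Rightarrow> (real \<Rightarrow> real) \<Rightarrow> (real \<Rightarrow> real) \<Rightarrow> complex set" where
  "imaginary_eigenvalues \<omega> U W = {\<mu>. Re \<mu> = 0 \<and> \<mu> \<noteq> 0 \<and> eigenvalue \<omega> U W \<mu>}"

definition hypothesis_H2 ::
  "real \<Rightarrow> (real \<Rightarrow> real) \<Rightarrow> (real \<Rightarrow> real) \<Rightarrow> bool" where
  "hypothesis_H2 \<omega> U W \<longleftrightarrow>
     (\<exists>N M. finite (real_eigenvalues \<omega> U W) \<and> card (real_eigenvalues \<omega> U W) = 2 * N \<and>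
            finite (imaginary_eigenvalues \<omega> U W) \<and>
            card (imaginary_eigenvalues \<omega> U W) = 2 * M \<and>
            (\<forall>\<mu> \<in> real_eigenvalues \<omega> U W \<union> imaginary_eigenvalues \<omega> U W.
               simple_eigenvalue \<omega> U W \<mu>))"

definition hypothesis_H3 ::
  "real \<Rightarrow> (real \<Rightarrow> real) \<Rightarrow> (real \<Rightarrow> real) \<Rightarrow> bool" where
  "hypothesis_H3 \<omega> U W \<longleftrightarrow>
     (\<forall>n\<ge>2. \<forall>f. H_kernel \<omega> U W 0 n f \<longleftrightarrow> H_kernel \<omega> U W 0 2 f)"


section \<open>The charge transfer equation\<close>

definition phase :: "real \<Rightarrow> real \<Rightarrow> real \<Rightarrow> real \<Rightarrow> real \<Rightarrow> real" where
  "phase \<omega> v \<gamma> t x = v * x / 2 - v\<^sup>2 * t / 4 + \<omega> * t + \<gamma>"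

definition moving_potential ::
  "real \<Rightarrow> (real \<Rightarrow> real) \<Rightarrow> (real \<Rightarrow> real) \<Rightarrow> real \<Rightarrow> real \<Rightarrow> real \<Rightarrow> real \<Rightarrow> real
    \<Rightarrow> complex ^ 2 ^ 2" where
  "moving_potential \<omega> U W v y \<gamma> t x =
     (let \<theta> = phase \<omega> v \<gamma> t x; \<xi> = x - v * t - y in
      vector
       [vector [of_real (U \<xi>), - exp (2 * \<i> * of_real \<theta>) * of_real (W \<xi>)],
        vector [exp (- 2 * \<i> * of_real \<theta>) * of_real (W \<xi>), - of_real (U \<xi>)]])"

text \<open>Solutions on \<open>t \<ge> 0\<close>: \<open>\<psi> \<in> C([0,\<infinity>); L\<^sup>2)\<close>, and the equation, in the form
  \<open>\<partial>\<^sub>t \<psi> = \<i> \<sigma>\<^sub>3 \<partial>\<^sub>x\<^sup>2 \<psi> - \<i> \<Sum>\<^sub>\<ell> V\<^sub>\<ell>(t) \<psi>\<close>, holds in the sense of distributions in \<open>x\<close>.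
  For initial data that are merely in \<open>L\<^sup>2\<close> this is the same as being a mild (Duhamel)
  solution.\<close>

definition CT_solution ::
  "nat \<Rightarrow> (nat \<Rightarrow> real) \<Rightarrow> (nat \<Rightarrow> real \<Rightarrow> real) \<Rightarrow> (nat \<Rightarrow> real \<Rightarrow> real) \<Rightarrow>
   (nat \<Rightarrow> real) \<Rightarrow> (nat \<Rightarrow> real) \<Rightarrow> (nat \<Rightarrow> real) \<Rightarrow> (real \<Rightarrow> field2) \<Rightarrow> bool" where
  "CT_solution m \<omega> U W v y \<gamma> \<psi> \<longleftrightarrow>
     (\<forall>t\<ge>0. L2 (\<psi> t)) \<and>
     (\<forall>t\<ge>0. ((\<lambda>s. L2norm (\<lambda>x. \<psi> s x - \<psi> t x)) \<longlongrightarrow> 0) (at t within {0..})) \<and>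
     (\<forall>\<phi>. test_function \<phi> \<longrightarrow> (\<forall>t\<ge>0.
        ((\<lambda>s. \<integral>x. \<phi> x *\<^sub>R \<psi> s x \<partial>lborel) has_vector_derivative
          (\<i> *s (\<integral>x. (deriv ^^ 2) \<phi> x *\<^sub>R (sigma3 *v \<psi> t x) \<partial>lborel)
           - \<i> *s (\<integral>x. \<phi> x *\<^sub>R
               (\<Sum>l=1..m. moving_potential (\<omega> l) (U l) (W l) (v l) (y l) (\<gamma> l) t x *v \<psi> t x)
               \<partial>lborel)))
        (at t within {0..})))"

text \<open>The matrix is \<open>exp (\<i> \<sigma>\<^sub>3 \<theta>)\<close>.\<close>

definition galilei :: "real \<Rightarrow> real \<Rightarrow> real \<Rightarrow> real \<Rightarrow> field2 \<Rightarrow> real \<Rightarrow> field2" where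
  "galilei \<omega> v y \<gamma> g t x =
     (let \<theta> = phase \<omega> v \<gamma> t x in
      vector [vector [exp (\<i> * of_real \<theta>), 0], vector [0, exp (- \<i> * of_real \<theta>)]]
        *v g (x - v * t - y))"


section \<open>Separation of the potentials\<close>

definition min_gap :: "nat \<Rightarrow> (nat \<Rightarrow> real) \<Rightarrow> real" where
  "min_gap m a = Min ((\<lambda>l. a l - a (l + 1)) ` {1..m - 1})"

text \<open>For \<open>m = 1\<close> the minimum is taken over the empty set and is understood as \<open>+\<infinity>\<close>: every
  threshold is exceeded and the decay factor is \<open>0\<close>. This is why \<open>m \<ge> 2\<close> is singled out.\<close>

definition gap_exceeds :: "nat \<Rightarrow> (nat \<Rightarrow> real) \<Rightarrow> real \<Rightarrow> bool" where
  "gap_exceeds m a L \<longleftrightarrow> (2 \<le> m \<longrightarrow> min_gap m a > L)"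

definition separation_decay ::
  "nat \<Rightarrow> (nat \<Rightarrow> real) \<Rightarrow> (nat \<Rightarrow> real) \<Rightarrow> real \<Rightarrow> real \<Rightarrow> real" where
  "separation_decay m y v \<beta> t =
     (if 2 \<le> m then exp (- \<beta> * min_gap m y - \<beta> * min_gap m v * t) else 0)"

text \<open>There is exactly one solution of the form \<open>P + r\<close> with \<open>\<parallel>r(t)\<parallel> \<le> B(t)\<close> for \<open>t \<ge> 0\<close>.\<close>

definition unique_CT_solution_near ::
  "nat \<Rightarrow> (nat \<Rightarrow> real) \<Rightarrow> (nat \<Rightarrow> real \<Rightarrow> real) \<Rightarrow> (nat \<Rightarrow> real \<Rightarrow> real) \<Rightarrow>
   (nat \<Rightarrow> real) \<Rightarrow> (nat \<Rightarrow> real) \<Rightarrow> (nat \<Rightarrow> real) \<Rightarrow>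
   (real \<Rightarrow> field2) \<Rightarrow> (real \<Rightarrow> real) \<Rightarrow> bool" where
  "unique_CT_solution_near m \<omega> U W v y \<gamma> P B \<longleftrightarrow>
     (let admissible = (\<lambda>r. CT_solution m \<omega> U W v y \<gamma> (\<lambda>t x. P t x + r t x) \<and>
                            (\<forall>t\<ge>0. L2 (r t) \<and> L2norm (r t) \<le> B t))
      in \<exists>r. admissible r \<and>
             (\<forall>r'. admissible r' \<longrightarrow> (\<forall>t\<ge>0. AE x in lborel. r' t x = r t x)))"

end

theory Submission imports Defs begin

text \<open>The main term of the solution solves the equation with the \<open>k\<close>-th potential alone, so the
  remainder \<open>r\<close> has to solve (CT) with a source made of the other potentials applied to the main
  term. Eigenfunctions decay exponentially, hence the source is small by the separation of the
  potentials and decays in time at a rate \<open>\<lambda>\<close> proportional to the velocity gap. When the gap is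
  large, \<open>\<lambda>\<close> dominates the norm \<open>M\<close> of the whole potential, and Duhamel's formula from \<open>t = \<infinity>\<close>
  is a contraction with factor \<open>M / \<lambda> \<le> 1 / 2\<close> in the norm \<open>sup e\<^sup>\<lambda>\<^sup>t \<parallel>r(t)\<parallel>\<close>; this
  gives existence, and uniqueness because no nonzero solution can decay faster than \<open>e\<^sup>-\<^sup>M\<^sup>t\<close>.
  The free group is the strong limit of the exponentials of finite difference operators.

  The constants must not depend on the eigenvalue. The decay rate of an eigenfunction comes from
  factorizing \<open>\<partial>\<^sup>2 - \<kappa>\<^sup>2\<close> with \<open>\<kappa>\<^sup>2 = \<omega> \<mp> \<mu>\<close>, where for real \<open>\<mu>\<close> the real part of \<open>\<kappa>\<close> is zero,
  which is harmless in \<open>L\<^sup>2\<close>, or bounded below. Non-real eigenvalues on one side of the real axis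
  are never conjugate to each other, so their eigenfunctions
  span an isotropic subspace of the symmetric form \<open>\<langle>F, \<sigma>\<^sub>3 H F\<rangle>\<close>; this form is positive
  definite on a subspace of finite codimension, so there are only finitely many of them.\<close>

subsection \<open>The exponential of a bounded skew-symmetric operator\<close>

text \<open>Solutions of (CT) are merely continuous in L^2, so their norm cannot be differentiated;
  estimates come from pairing them with a flow for which all computations are bounded, and passing
  to the limit. The main term itself may grow, like exp (|Im \<mu>| t) for a non-real eigenvalue or
  linearly on the generalized kernel, and the decay of the source has to beat this growth as well as
  the perturbation. Hence the threshold on the velocity gap involves a bound on the imaginary parts
  of all eigenvalues. The tail rate b of the profiles is spent twice: half is lost when the line is
  split midway between two potentials, and half of the rest pays for the growth, which leaves
  \<beta> = b / 4. In a Jordan chain H z = i f the error is to be measured by z alone, so f has to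
  be bounded by z with a constant depending on the potential only; symmetry of \<sigma>3 H provides
  this although H is unbounded.\<close>

definition bexp :: "('h::banach \<Rightarrow> 'h) \<Rightarrow> real \<Rightarrow> 'h \<Rightarrow> 'h" where
  "bexp A t x = (\<Sum>n. (t ^ n / fact n) *\<^sub>R (A ^^ n) x)"

lemma funpow_norm_le:
  fixes A :: "'h::real_normed_vector \<Rightarrow> 'h"
  assumes "bounded_linear A"
  shows "norm ((A ^^ n) x) \<le> onorm A ^ n * norm x"
proof (induction n)
  case (Suc n)
  have "norm (A ((A ^^ n) x)) \<le> onorm A * norm ((A ^^ n) x)"
    by (rule onorm[OF assms])
  also have "\<dots> \<le> onorm A * (onorm A ^ n * norm x)"
    by (intro mult_left_mono Suc.IH onorm_pos_le assms)
  finally show ?case by (simp add: mult_ac)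
qed simp

lemma bexp_term_le:
  fixes A :: "'h::banach \<Rightarrow> 'h"
  assumes "bounded_linear A" "\<bar>t\<bar> \<le> T"
  shows "norm ((t ^ n / fact n) *\<^sub>R (A ^^ n) x) \<le> (T * onorm A) ^ n /\<^sub>R fact n * norm x"
proof -
  have "norm ((t ^ n / fact n) *\<^sub>R (A ^^ n) x) = \<bar>t\<bar> ^ n / fact n * norm ((A ^^ n) x)"
    by (simp add: power_abs)
  also have "\<dots> \<le> T ^ n / fact n * (onorm A ^ n * norm x)"
    using assms(2) by (intro mult_mono divide_right_mono power_mono funpow_norm_le[OF assms(1)]) auto
  finally show ?thesis by (simp add: power_mult_distrib field_simps)
qed

lemma summable_bexp_bound: "summable (\<lambda>n. (K::real) ^ n /\<^sub>R fact n * c)"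
  by (intro summable_mult2 summable_exp_generic)

lemma summable_bexp:
  fixes A :: "'h::banach \<Rightarrow> 'h"
  assumes "bounded_linear A"
  shows "summable (\<lambda>n. (t ^ n / fact n) *\<^sub>R (A ^^ n) x)"
proof (rule summable_comparison_test'[OF summable_bexp_bound])
  show "norm ((t ^ n / fact n) *\<^sub>R (A ^^ n) x) \<le> (\<bar>t\<bar> * onorm A) ^ n /\<^sub>R fact n * norm x" for n
    by (rule bexp_term_le[OF assms order_refl])
qed

lemma bexp_uniform:
  fixes A :: "'h::banach \<Rightarrow> 'h"
  assumes "bounded_linear A"
  shows "uniform_limit {-T..T} (\<lambda>n t. \<Sum>i<n. (t ^ i / fact i) *\<^sub>R (A ^^ i) x) (\<lambda>t. bexp A t x) sequentially"
  unfolding bexp_def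
  by (rule Weierstrass_m_test[OF bexp_term_le[OF assms, where T = T] summable_bexp_bound]) auto

lemma bexp_0 [simp]: "bexp A 0 x = x"
proof -
  have "(\<lambda>n. (0 ^ n / fact n) *\<^sub>R (A ^^ n) x) = (\<lambda>n. if n = 0 then x else 0)"
    by (auto simp: fun_eq_iff power_0_left)
  then show ?thesis unfolding bexp_def using sums_unique[OF sums_single[of 0 "\<lambda>_. x"]] by simp
qed

lemma bexp_commute:
  fixes A :: "'h::banach \<Rightarrow> 'h"
  assumes "bounded_linear A" "bounded_linear B" "\<And>x. B (A x) = A (B x)"
  shows "B (bexp A t x) = bexp A t (B x)"
proof -
  have p: "B ((A ^^ n) y) = (A ^^ n) (B y)" for n y
    by (induction n) (auto simp: assms(3))
  have "B (bexp A t x) = (\<Sum>n. B ((t ^ n / fact n) *\<^sub>R (A ^^ n) x))"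
    unfolding bexp_def by (rule bounded_linear.suminf[OF assms(2) summable_bexp[OF assms(1)]])
  then show ?thesis
    unfolding bexp_def by (simp add: linear_simps[OF assms(2)] p)
qed

text \<open>The series is differentiated term by term. The differentiated partial sums are
  \<open>A\<close> applied to the partial sums one index shorter, and these converge uniformly on
  compact intervals.\<close>

lemma bexp_has_vector_derivative:
  fixes A :: "'h::banach \<Rightarrow> 'h"
  assumes "bounded_linear A"
  shows "((\<lambda>t. bexp A t x) has_vector_derivative A (bexp A t x)) (at t)"
proof -
  define T where "T = \<bar>t\<bar> + 1"
  define S where "S = {-T..T}"
  let ?f = "\<lambda>i t. (t ^ i / fact i) *\<^sub>R (A ^^ i) x"
  let ?f' = "\<lambda>i t. (real i * t ^ (i - 1) / fact i) *\<^sub>R (A ^^ i) x"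
  have part: "(\<Sum>i<Suc n. ?f' i s) = A (\<Sum>i<n. ?f i s)" for n s
  proof -
    have "(\<Sum>i<Suc n. ?f' i s) = (\<Sum>i<n. ?f' (Suc i) s)"
      by (simp only: sum.lessThan_Suc_shift) simp
    also have "\<dots> = (\<Sum>i<n. A (?f i s))"
      by (intro sum.cong refl) (simp add: linear_simps[OF assms] divide_simps)
    finally show ?thesis by (simp add: bounded_linear.linear[OF assms] linear_sum)
  qed
  have "\<exists>g. \<forall>s\<in>S. (\<lambda>n. ?f n s) sums (g s) \<and> (g has_derivative (\<lambda>h. h *\<^sub>R A (bexp A s x))) (at s within S)"
  proof (rule has_derivative_series)
    show "convex S" by (simp add: S_def)
    show "(?f n has_derivative (\<lambda>h. h *\<^sub>R ?f' n s)) (at s within S)" for n s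
      by (auto intro!: derivative_eq_intros simp: field_simps)
    show "0 \<in> S" by (simp add: S_def T_def)
    show "(\<lambda>n. ?f n 0) sums bexp A 0 x"
      unfolding bexp_def by (rule summable_sums[OF summable_bexp[OF assms]])
    fix e :: real assume "e > 0"
    have "uniform_limit S (\<lambda>n s. A (\<Sum>i<n. ?f i s)) (\<lambda>s. A (bexp A s x)) sequentially"
      unfolding S_def by (rule bounded_linear.uniform_limit[OF assms bexp_uniform[OF assms]])
    then have "\<forall>\<^sub>F n in sequentially. \<forall>s\<in>S. dist (A (\<Sum>i<n. ?f i s)) (A (bexp A s x)) < e"
      using \<open>e > 0\<close> by (simp add: uniform_limit_iff)
    then have "\<forall>\<^sub>F n in sequentially. \<forall>s\<in>S. dist (\<Sum>i<Suc n. ?f' i s) (A (bexp A s x)) < e"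
      unfolding part .
    then have "\<forall>\<^sub>F n in sequentially. \<forall>s\<in>S. dist (\<Sum>i<n. ?f' i s) (A (bexp A s x)) < e"
      by (subst (asm) eventually_sequentially_Suc)
    then show "\<forall>\<^sub>F n in sequentially. \<forall>s\<in>S. \<forall>h. norm ((\<Sum>i<n. h *\<^sub>R ?f' i s) - h *\<^sub>R A (bexp A s x)) \<le> e * norm h"
    proof eventually_elim
      case (elim n)
      show ?case
      proof (intro ballI allI)
        fix s h assume "s \<in> S"
        have "norm ((\<Sum>i<n. h *\<^sub>R ?f' i s) - h *\<^sub>R A (bexp A s x)) = norm h * dist (\<Sum>i<n. ?f' i s) (A (bexp A s x))"
          by (simp only: dist_norm norm_scaleR real_norm_def flip: scaleR_sum_right scaleR_diff_right)
        also have "\<dots> \<le> norm h * e"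
          using elim \<open>s \<in> S\<close> by (intro mult_left_mono) (auto intro: less_imp_le)
        finally show "norm ((\<Sum>i<n. h *\<^sub>R ?f' i s) - h *\<^sub>R A (bexp A s x)) \<le> e * norm h"
          by (simp only: mult.commute)
      qed
    qed
  qed
  then obtain g where g: "\<And>s. s \<in> S \<Longrightarrow> (\<lambda>n. ?f n s) sums (g s)"
    "\<And>s. s \<in> S \<Longrightarrow> (g has_derivative (\<lambda>h. h *\<^sub>R A (bexp A s x))) (at s within S)" by blast
  have t: "t \<in> interior S" by (auto simp: S_def T_def)
  then have tS: "t \<in> S" using interior_subset by blast
  have d: "(g has_derivative (\<lambda>h. h *\<^sub>R A (bexp A t x))) (at t)"
    using g(2)[OF tS] at_within_interior[OF t] by simp
  have eq: "g s = bexp A s x" if "s \<in> interior S" for s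
    using sums_unique[OF g(1)] that interior_subset unfolding bexp_def by blast
  have "((\<lambda>s. bexp A s x) has_derivative (\<lambda>h. h *\<^sub>R A (bexp A t x))) (at t)"
    by (rule has_derivative_transform_within_open[OF d open_interior t eq])
  then show ?thesis by (simp add: has_vector_derivative_def)
qed

lemma bexp_shift_has_vector_derivative:
  fixes A :: "'h::banach \<Rightarrow> 'h"
  assumes "bounded_linear A"
  shows "((\<lambda>s. bexp A (s - t) x) has_vector_derivative A (bexp A (s - t) x)) (at s within S)"
proof -
  have "((\<lambda>s. s - t) has_vector_derivative 1) (at s)"
    by (auto intro!: derivative_eq_intros)
  from vector_diff_chain_at[OF this bexp_has_vector_derivative[OF assms]]
  show ?thesis by (auto simp: o_def intro: has_vector_derivative_at_within)
qed

lemma bexp_add: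
  fixes A :: "'h::banach \<Rightarrow> 'h"
  assumes "bounded_linear A"
  shows "bexp A t (x + y) = bexp A t x + bexp A t y"
  unfolding bexp_def suminf_add[OF summable_bexp[OF assms] summable_bexp[OF assms]]
proof (rule suminf_cong)
  have "(A ^^ n) (x + y) = (A ^^ n) x + (A ^^ n) y" for n
    by (induction n) (auto simp: linear_simps[OF assms])
  then show "(t ^ n / fact n) *\<^sub>R (A ^^ n) (x + y) =
         (t ^ n / fact n) *\<^sub>R (A ^^ n) x + (t ^ n / fact n) *\<^sub>R (A ^^ n) y" for n
    by (simp add: scaleR_add_right)
qed

lemma bexp_diff: 
  fixes A :: "'h::banach \<Rightarrow> 'h"
  assumes "bounded_linear A"
  shows "bexp A t (x - y) = bexp A t x - bexp A t y"
  using bexp_add[OF assms, of t "x - y" y] by (simp add: algebra_simps)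

locale skew_operator =
  fixes A :: "'h::{real_inner,banach} \<Rightarrow> 'h"
  assumes bl: "bounded_linear A"
    and skew: "inner (A x) y = - inner x (A y)"
begin

lemma bexp_norm [simp]: "norm (bexp A t x) = norm x"
proof -
  have "((\<lambda>t. inner (bexp A t x) (bexp A t x)) has_vector_derivative
      inner (bexp A s x) (A (bexp A s x)) + inner (A (bexp A s x)) (bexp A s x)) (at s)" for s
    by (rule bounded_bilinear.has_vector_derivative[OF bounded_bilinear_inner];
        rule bexp_has_vector_derivative[OF bl])
  then have "((\<lambda>t. inner (bexp A t x) (bexp A t x)) has_real_derivative 0) (at s)" for s
    by (simp add: skew has_real_derivative_iff_has_vector_derivative)
  then have "inner (bexp A t x) (bexp A t x) = inner (bexp A 0 x) (bexp A 0 x)"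
    by (intro DERIV_isconst_all) auto
  then show ?thesis by (simp add: norm_eq_sqrt_inner)
qed

text \<open>Skewness moves the n-th power of \<open>A\<close> across the inner product with sign
  (-1)^n, which turns the series at t into the series at -t.\<close>

lemma bexp_adjoint: "inner (bexp A t x) y = inner x (bexp A (-t) y)"
proof -
  have p: "inner ((A ^^ n) x) y = (- 1) ^ n * inner x ((A ^^ n) y)" for n x y
  proof (induction n arbitrary: x y)
    case (Suc n)
    have "inner ((A ^^ Suc n) x) y = - inner ((A ^^ n) x) (A y)" by (simp add: skew)
    also have "\<dots> = - ((- 1) ^ n * inner x ((A ^^ n) (A y)))" by (simp add: Suc.IH)
    finally show ?case by (simp add: funpow_swap1)
  qed simp
  have "inner (bexp A t x) y = (\<Sum>n. inner ((t ^ n / fact n) *\<^sub>R (A ^^ n) x) y)"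
    unfolding bexp_def by (rule bounded_linear.suminf[OF bounded_linear_inner_left summable_bexp[OF bl]])
  also have "\<dots> = (\<Sum>n. inner x (((- t) ^ n / fact n) *\<^sub>R (A ^^ n) y))"
    by (intro suminf_cong) (simp add: p power_minus[of t] mult_ac)
  also have "\<dots> = inner x (bexp A (- t) y)"
    unfolding bexp_def by (rule bounded_linear.suminf[OF bounded_linear_inner_right summable_bexp[OF bl], symmetric])
  finally show ?thesis .
qed

lemma bexp_inner: "inner (bexp A t x) (bexp A t y) = inner x y"
proof -
  have "norm (bexp A t x + bexp A t y) = norm (x + y)"
    by (simp flip: bexp_add[OF bl])
  then have "(norm (bexp A t x + bexp A t y))\<^sup>2 = (norm (x + y))\<^sup>2" by simp
  then show ?thesis by (simp add: power2_norm_eq_inner inner_add_left inner_add_right inner_commute)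
    (simp flip: power2_norm_eq_inner)
qed

text \<open>The group law is bypassed: the adjoint of the exponential at t is the exponential at -t,
  and that one preserves inner products, so both sides have the same inner product with every
  vector.\<close>

lemma bexp_inverse: "bexp A t (bexp A (-t) x) = x"
proof -
  have "inner (bexp A t (bexp A (-t) x)) y = inner x y" for y
    using bexp_adjoint[of t "bexp A (-t) x" y] bexp_inner[of "-t" x y] by simp
  from this[of "bexp A t (bexp A (-t) x) - x"]
  have "inner (bexp A t (bexp A (-t) x) - x) (bexp A t (bexp A (-t) x) - x) = 0"
    by (simp add: inner_diff_left)
  then show ?thesis by simp
qed

end

subsection \<open>Evolution equations generated by a limit of commuting skew-symmetric operators\<close>

lemma has_vector_derivative_tendsto:
  assumes "(x has_vector_derivative x') (at t within S)"
  shows "((\<lambda>s. (x s - x t) /\<^sub>R (s - t)) \<longlongrightarrow> x') (at t within S)"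
proof -
  have "((\<lambda>s. norm ((x s - x t) - (s - t) *\<^sub>R x') / norm (s - t)) \<longlongrightarrow> 0) (at t within S)"
    using assms unfolding has_vector_derivative_def has_derivative_iff_norm by auto
  moreover have "\<forall>\<^sub>F s in at t within S. norm ((x s - x t) - (s - t) *\<^sub>R x') / norm (s - t) = norm ((x s - x t) /\<^sub>R (s - t) - x')"
    unfolding eventually_at_filter
  proof (intro always_eventually allI impI)
    fix s assume "s \<noteq> t"
    then have "(x s - x t) /\<^sub>R (s - t) - x' = ((x s - x t) - (s - t) *\<^sub>R x') /\<^sub>R (s - t)"
      by (simp add: scaleR_diff_right)
    then show "norm ((x s - x t) - (s - t) *\<^sub>R x') / norm (s - t) = norm ((x s - x t) /\<^sub>R (s - t) - x')"
      by (simp add: divide_inverse_commute)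
  qed
  ultimately have "((\<lambda>s. norm ((x s - x t) /\<^sub>R (s - t) - x')) \<longlongrightarrow> 0) (at t within S)"
    by (rule Lim_transform_eventually)
  then show ?thesis by (simp add: tendsto_norm_zero_iff LIM_zero_iff)
qed

lemma inner_weak_product_derivative:
  fixes u x :: "real \<Rightarrow> 'h::real_inner"
  assumes x: "(x has_vector_derivative x') (at t within S)"
    and u: "(u \<longlongrightarrow> u t) (at t within S)"
    and d: "((\<lambda>s. inner (x t) (u s)) has_vector_derivative d) (at t within S)"
  shows "((\<lambda>s. inner (x s) (u s)) has_vector_derivative inner x' (u t) + d) (at t within S)"
proof -
  have "((\<lambda>s. inner (x s - x t) (u s)) has_vector_derivative inner x' (u t)) (at t within S)"
    unfolding has_real_derivative_iff_has_vector_derivative[symmetric] has_field_derivative_iff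
  proof -
    have "((\<lambda>s. (x s - x t) /\<^sub>R (s - t)) \<longlongrightarrow> x') (at t within S)"
      by (rule has_vector_derivative_tendsto[OF x])
    from tendsto_inner[OF this u]
    show "((\<lambda>s. (inner (x s - x t) (u s) - inner (x t - x t) (u t)) / (s - t)) \<longlongrightarrow> inner x' (u t)) (at t within S)"
      by (simp add: divide_inverse_commute)
  qed
  from has_vector_derivative_add[OF this d] show ?thesis
    by (simp add: inner_diff_left)
qed

text \<open>The equation \<open>u' = A u + G\<close> tested against a core of the skew-adjoint operator \<open>A\<close>: the set
  \<open>D\<close> consists of pairs \<open>(p, A p)\<close>, and \<open>A\<close> moves to the test vector with a sign.\<close>

definition weak_solution ::
  "('h::{real_inner,banach} \<times> 'h) set \<Rightarrow> (real \<Rightarrow> 'h) \<Rightarrow> (real \<Rightarrow> 'h) \<Rightarrow> bool" where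
  "weak_solution D u G \<longleftrightarrow> (\<forall>p q. (p, q) \<in> D \<longrightarrow> (\<forall>t\<ge>0.
     ((\<lambda>s. inner p (u s)) has_vector_derivative (inner p (G t) - inner q (u t))) (at t within {0..})))"

lemma weak_solution_diff:
  assumes "weak_solution D u G" "weak_solution D w K"
  shows "weak_solution D (\<lambda>t. u t - w t) (\<lambda>t. G t - K t)"
  unfolding weak_solution_def
proof (intro allI impI)
  fix p q t assume *: "(p, q) \<in> D" "0 \<le> (t::real)"
  have "((\<lambda>s. inner p (u s) - inner p (w s)) has_vector_derivative
      ((inner p (G t) - inner q (u t)) - (inner p (K t) - inner q (w t)))) (at t within {0..})"
    using assms * unfolding weak_solution_def by (intro has_vector_derivative_diff) auto
  then show "((\<lambda>s. inner p (u s - w s)) has_vector_derivative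
      (inner p (G t - K t) - inner q (u t - w t))) (at t within {0..})"
    by (simp add: inner_diff_right algebra_simps)
qed

lemma weak_solution_add:
  assumes "weak_solution D u G" "weak_solution D w K"
  shows "weak_solution D (\<lambda>t. u t + w t) (\<lambda>t. G t + K t)"
  unfolding weak_solution_def
proof (intro allI impI)
  fix p q t assume *: "(p, q) \<in> D" "0 \<le> (t::real)"
  have "((\<lambda>s. inner p (u s) + inner p (w s)) has_vector_derivative
      ((inner p (G t) - inner q (u t)) + (inner p (K t) - inner q (w t)))) (at t within {0..})"
    using assms * unfolding weak_solution_def by (intro has_vector_derivative_add) auto
  then show "((\<lambda>s. inner p (u s + w s)) has_vector_derivative
      (inner p (G t + K t) - inner q (u t + w t))) (at t within {0..})"
    by (simp add: inner_add_right algebra_simps)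
qed

lemma weak_solution_cong:
  assumes "weak_solution D u G" "\<And>t. 0 \<le> t \<Longrightarrow> u t = u' t" "\<And>t. 0 \<le> t \<Longrightarrow> G t = G' t"
  shows "weak_solution D u' G'"
  unfolding weak_solution_def
proof (intro allI impI)
  fix p q t assume *: "(p, q) \<in> D" "0 \<le> (t::real)"
  have "((\<lambda>s. inner p (u s)) has_vector_derivative (inner p (G t) - inner q (u t))) (at t within {0..})"
    using assms(1) * unfolding weak_solution_def by auto
  then have "((\<lambda>s. inner p (u' s)) has_vector_derivative (inner p (G t) - inner q (u t))) (at t within {0..})"
    by (rule has_vector_derivative_transform[rotated -1]) (use * assms(2) in auto)
  then show "((\<lambda>s. inner p (u' s)) has_vector_derivative (inner p (G' t) - inner q (u' t))) (at t within {0..})"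
    using assms(2,3) * by simp
qed

lemma at_within_Icc_Ici: 
  fixes t :: real
  assumes "0 \<le> t" "t < T"
  shows "at t within {0..T} = at t within {0..}"
proof -
  show ?thesis
    by (rule at_within_nhd[of _ "{..<T}"]) (use assms in auto)
qed

lemma integral_deriv_Ici:
  fixes g :: "real \<Rightarrow> 'h::banach"
  assumes "continuous_on {0..} g" "0 \<le> t"
  shows "((\<lambda>s. integral {0..s} g) has_vector_derivative g t) (at t within {0..})"
proof -
  have "continuous_on {0..t+1} g" using assms(1) by (rule continuous_on_subset) auto
  from integral_has_vector_derivative[OF this, of t] assms show ?thesis
    by (simp add: at_within_Icc_Ici)
qed

text \<open>Integrated in time, the relation contains no derivative and is a closed condition on the
  pair \<open>(p, q)\<close>. It therefore extends to the closure, and differentiating the integrals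
  recovers the equation. This matters because the exponentials of the approximations are infinite
  series and map the core only into its closure.\<close>

lemma weak_solution_closure:
  fixes D :: "('h::{real_inner,banach} \<times> 'h) set"
  assumes ws: "weak_solution D u G" and u: "continuous_on {0..} u" and G: "continuous_on {0..} G"
  shows "weak_solution (closure D) u G"
proof -
  define I where "I g t = integral {0..t} g" for g :: "real \<Rightarrow> 'h" and t
  have int: "inner p (u t) = inner p (u 0) + inner p (I G t) - inner q (I u t)"
    if "(p, q) \<in> D" "0 \<le> t" for p q t
  proof -
    define h where "h s = inner p (u s) - inner p (I G s) + inner q (I u s)" for s
    have "(h has_vector_derivative 0) (at s within {0..})" if "s \<in> {0..}" for s
    proof -
      have "(h has_vector_derivative ((inner p (G s) - inner q (u s)) - inner p (G s) + inner q (u s))) (at s within {0..})"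
        unfolding h_def I_def using ws \<open>(p, q) \<in> D\<close> that unfolding weak_solution_def
        by (intro has_vector_derivative_add has_vector_derivative_diff
           bounded_linear.has_vector_derivative[OF bounded_linear_inner_right] integral_deriv_Ici u G) auto
      then show ?thesis by simp
    qed
    then obtain c where "\<And>s. s \<in> {0..} \<Longrightarrow> h s = c"
      using has_vector_derivative_zero_constant[of "{0..}" h] by auto
    then have "h t = h 0" using that by simp
    then show ?thesis unfolding h_def I_def by simp
  qed
  have int': "inner p (u t) = inner p (u 0) + inner p (I G t) - inner q (I u t)"
    if "(p, q) \<in> closure D" "0 \<le> t" for p q t
  proof -
    have "closed {z :: 'h \<times> 'h. inner (fst z) (u t) = inner (fst z) (u 0) + inner (fst z) (I G t) - inner (snd z) (I u t)}"
      by (intro closed_Collect_eq continuous_intros)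
    then have "closure D \<subseteq> {z. inner (fst z) (u t) = inner (fst z) (u 0) + inner (fst z) (I G t) - inner (snd z) (I u t)}"
    proof (rule closure_minimal[rotated])
      show "D \<subseteq> {z. inner (fst z) (u t) = inner (fst z) (u 0) + inner (fst z) (I G t) - inner (snd z) (I u t)}"
        using int[OF _ \<open>0 \<le> t\<close>] by (auto simp only: mem_Collect_eq fst_conv snd_conv)
    qed
    then show ?thesis using that by auto
  qed
  show ?thesis unfolding weak_solution_def
  proof (intro allI impI)
    fix p q t assume *: "(p, q) \<in> closure D" "0 \<le> (t::real)"
    have "((\<lambda>s. inner p (u 0) + inner p (I G s) - inner q (I u s)) has_vector_derivative
       (0 + inner p (G t) - inner q (u t))) (at t within {0..})"
      unfolding I_def
      by (intro has_vector_derivative_add has_vector_derivative_diff has_vector_derivative_const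
           bounded_linear.has_vector_derivative[OF bounded_linear_inner_right] integral_deriv_Ici u G *)
    then have "((\<lambda>s. inner p (u 0) + inner p (I G s) - inner q (I u s)) has_vector_derivative
       (inner p (G t) - inner q (u t))) (at t within {0..})" by simp
    then show "((\<lambda>s. inner p (u s)) has_vector_derivative (inner p (G t) - inner q (u t))) (at t within {0..})"
    proof (rule has_vector_derivative_transform[rotated -1])
      show "t \<in> {0..}" using *(2) by simp
      show "inner p (u s) = inner p (u 0) + inner p (I G s) - inner q (I u s)" if "s \<in> {0..}" for s
        by (rule int'[OF *(1)]) (use that in simp)
    qed
  qed
qed

lemma norm_le_by_duality:
  fixes w :: "'h::real_inner"
  assumes "closure P = UNIV" "\<And>p. p \<in> P \<Longrightarrow> \<bar>inner p w\<bar> \<le> norm p * R" "0 \<le> R"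
  shows "norm w \<le> R"
proof -
  have "closed {p. \<bar>inner p w\<bar> \<le> norm p * R}"
    by (intro closed_Collect_le continuous_intros)
  then have "closure P \<subseteq> {p. \<bar>inner p w\<bar> \<le> norm p * R}"
    by (rule closure_minimal[rotated]) (use assms in auto)
  then have "w \<in> {p. \<bar>inner p w\<bar> \<le> norm p * R}" using assms(1) by blast
  then have "\<bar>inner w w\<bar> \<le> norm w * R" by simp
  then show ?thesis using assms(3) by (cases "norm w = 0") (auto simp: power2_norm_eq_inner[symmetric] power2_eq_square)
qed

text \<open>\<open>D\<close> plays the role of the graph of a skew-adjoint generator restricted to a
  core, and the \<open>A n\<close> are bounded approximations converging to it on the core.
  Commutation makes their exponentials comparable with each other; invariance of \<open>D\<close>
  keeps test pairs in the closure of \<open>D\<close> under the approximate flows.\<close>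

locale core_approximation =
  fixes A :: "nat \<Rightarrow> 'h::{real_inner,banach} \<Rightarrow> 'h" and D :: "('h \<times> 'h) set"
  assumes A_skew: "skew_operator (A n)"
    and A_commute: "A n (A m x) = A m (A n x)"
    and D_subspace: "subspace D"
    and D_dense: "closure (fst ` D) = UNIV"
    and A_tendsto: "(p, q) \<in> D \<Longrightarrow> (\<lambda>n. A n p) \<longlonglongrightarrow> q"
    and A_invariant: "(p, q) \<in> D \<Longrightarrow> (A n p, A n q) \<in> D"
begin

lemma bl: "bounded_linear (A n)" using A_skew skew_operator.bl by blast

abbreviation "E n \<equiv> bexp (A n)"

lemma E_core: 
  assumes "(p, q) \<in> D"
  shows "(E n t p, E n t q) \<in> closure D"
proof -
  have "(((A n ^^ i) p, (A n ^^ i) q)) \<in> D" for i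
    by (induction i) (auto simp: assms A_invariant)
  then have 1: "(\<Sum>i<k. (t ^ i / fact i) *\<^sub>R ((A n ^^ i) p, (A n ^^ i) q)) \<in> D" for k
    by (intro subspace_sum subspace_scale D_subspace) auto
  have "(\<lambda>k. \<Sum>i<k. (t ^ i / fact i) *\<^sub>R (A n ^^ i) x) \<longlonglongrightarrow> E n t x" for x
    using summable_LIMSEQ[OF summable_bexp[OF bl]] unfolding bexp_def .
  from tendsto_Pair[OF this[of p] this[of q]]
  have "(\<lambda>k. \<Sum>i<k. (t ^ i / fact i) *\<^sub>R ((A n ^^ i) p, (A n ^^ i) q)) \<longlonglongrightarrow> (E n t p, E n t q)"
    by (simp add: sum_prod)
  then show ?thesis
    unfolding closure_sequential by (intro exI[of _ "\<lambda>k. \<Sum>i<k. (t ^ i / fact i) *\<^sub>R ((A n ^^ i) p, (A n ^^ i) q)"] conjI allI 1)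
qed

text \<open>Backward propagation of the norm. For a test pair the function
  \<open>inner (E n (\<tau> - t) p) (u \<tau>)\<close> is differentiable in \<tau>; the generator
  terms cancel up to the consistency error \<open>A n p - q\<close>, so that only the source
  survives as n grows. Integration from \<open>t\<close> to \<open>s\<close> and duality give the
  estimate.\<close>

lemma weak_solution_norm_le:
  assumes ws: "weak_solution D u G" and u: "continuous_on {0..} u" and G: "continuous_on {0..} G"
    and lam: "0 < lam" and Gle: "\<And>t. 0 \<le> t \<Longrightarrow> norm (G t) \<le> c * exp (- lam * t)"
    and t: "0 \<le> t" "t \<le> s" and c: "0 \<le> c"
  shows "norm (u t) \<le> norm (u s) + c / lam * exp (- lam * t)"
proof (rule norm_le_by_duality[OF D_dense])
  show "0 \<le> norm (u s) + c / lam * exp (- lam * t)" using c lam by simp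
  fix p assume "p \<in> fst ` D"
  then obtain q where pq: "(p, q) \<in> D" by auto
  \<comment> \<open>The consistency error gets multiplied by \<open>u\<close>, so a bound on the
    compact time interval is fixed before the limit in n.\<close>
  have "compact (u ` {t..s})"
    by (intro compact_continuous_image continuous_on_subset[OF u]) (use t in auto)
  then obtain N where N: "\<And>\<tau>. \<tau> \<in> {t..s} \<Longrightarrow> norm (u \<tau>) \<le> N"
    by (meson compact_imp_bounded bounded_iff imageI)
  have main: "\<bar>inner p (u t)\<bar> \<le> norm p * (norm (u s) + c / lam * exp (- lam * t)) + norm (A n p - q) * (N * (s - t))" for n
  proof -
    define x where "x \<tau> = E n (\<tau> - t) p" for \<tau>
    define a where "a \<tau> = inner (x \<tau>) (u \<tau>)" for \<tau>
    define a' where "a' \<tau> = inner (E n (\<tau> - t) (A n p - q)) (u \<tau>) + inner (x \<tau>) (G \<tau>)" for \<tau>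
    have x': "(x has_vector_derivative A n (x \<tau>)) (at \<tau> within S)" for \<tau> S
      unfolding x_def by (rule bexp_shift_has_vector_derivative[OF bl])
    have "(a has_vector_derivative a' \<tau>) (at \<tau> within {t..s})" if "\<tau> \<in> {t..s}" for \<tau>
    proof -
      have d: "((\<lambda>\<sigma>. inner (x \<tau>) (u \<sigma>)) has_vector_derivative
          (inner (x \<tau>) (G \<tau>) - inner (E n (\<tau> - t) q) (u \<tau>))) (at \<tau> within {t..s})"
        unfolding x_def
        by (rule has_vector_derivative_within_subset[OF weak_solution_closure[OF ws u G,
              unfolded weak_solution_def, rule_format, OF E_core[OF pq]]]) (use that t in auto)
      have "(u \<longlongrightarrow> u \<tau>) (at \<tau> within {t..s})"
        using continuous_on_subset[OF u, of "{t..s}"] that t by (auto simp: continuous_on_def)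
      from inner_weak_product_derivative[OF x' this d]
      have "(a has_vector_derivative (inner (A n (x \<tau>)) (u \<tau>) + (inner (x \<tau>) (G \<tau>) - inner (E n (\<tau> - t) q) (u \<tau>)))) (at \<tau> within {t..s})"
        unfolding a_def .
      moreover have "A n (x \<tau>) = E n (\<tau> - t) (A n p)"
        unfolding x_def by (rule bexp_commute[OF bl bl]) simp
      ultimately show ?thesis unfolding a'_def
        by (simp add: bexp_diff[OF bl] inner_diff_left algebra_simps)
    qed
    from fundamental_theorem_of_calculus[OF t(2) this]
    have I: "(a' has_integral (a s - a t)) {t..s}" .
    have J: "((\<lambda>\<tau>. norm (A n p - q) * N + norm p * (c * exp (- lam * \<tau>))) has_integral
        ((norm (A n p - q) * N * s - norm p * (c / lam) * exp (- lam * s)) - (norm (A n p - q) * N * t - norm p * (c / lam) * exp (- lam * t)))) {t..s}"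
      by (rule fundamental_theorem_of_calculus[OF t(2)])
        (use lam in \<open>auto intro!: derivative_eq_intros simp: has_real_derivative_iff_has_vector_derivative[symmetric] field_simps\<close>)
    have "norm (a' \<tau>) \<le> norm (A n p - q) * N + norm p * (c * exp (- lam * \<tau>))" if "\<tau> \<in> {t..s}" for \<tau>
    proof -
      have "norm (a' \<tau>) \<le> norm (A n p - q) * norm (u \<tau>) + norm p * norm (G \<tau>)"
        unfolding a'_def x_def
        by (rule norm_triangle_le[OF add_mono]; rule order_trans[OF Cauchy_Schwarz_ineq2[unfolded real_norm_def[symmetric]]])
           (simp_all add: skew_operator.bexp_norm[OF A_skew])
      also have "\<dots> \<le> norm (A n p - q) * N + norm p * (c * exp (- lam * \<tau>))"
        using that t by (intro add_mono mult_left_mono N Gle) auto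
      finally show ?thesis .
    qed
    from integral_norm_bound_integral[OF has_integral_integrable[OF I] has_integral_integrable[OF J] this]
    have "norm (a s - a t) \<le> norm (A n p - q) * (N * (s - t)) + norm p * (c / lam) * (exp (- lam * t) - exp (- lam * s))"
      unfolding integral_unique[OF I] integral_unique[OF J] by (simp add: algebra_simps)
    also have "\<dots> \<le> norm (A n p - q) * (N * (s - t)) + norm p * (c / lam) * exp (- lam * t)"
      using c lam by (intro add_left_mono mult_left_mono) auto
    finally have "\<bar>a t\<bar> \<le> \<bar>a s\<bar> + norm (A n p - q) * (N * (s - t)) + norm p * (c / lam) * exp (- lam * t)"
      by simp
    moreover have "a t = inner p (u t)" by (simp add: a_def x_def)
    moreover have "\<bar>a s\<bar> \<le> norm p * norm (u s)"
      unfolding a_def x_def using Cauchy_Schwarz_ineq2[of "E n (s - t) p" "u s"]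
      by (simp add: skew_operator.bexp_norm[OF A_skew])
    ultimately show ?thesis by (simp add: algebra_simps)
  qed
  have "(\<lambda>n. norm p * (norm (u s) + c / lam * exp (- lam * t)) + norm (A n p - q) * (N * (s - t)))
      \<longlonglongrightarrow> norm p * (norm (u s) + c / lam * exp (- lam * t)) + norm (q - q) * (N * (s - t))"
    by (intro tendsto_intros A_tendsto pq)
  then show "\<bar>inner p (u t)\<bar> \<le> norm p * (norm (u s) + c / lam * exp (- lam * t))"
    using main by (intro LIMSEQ_le_const[of _ _ "\<bar>inner p (u t)\<bar>"]) auto
qed

text \<open>As \<open>s\<close> tends to infinity the boundary term \<open>norm (u s)\<close>
  disappears, so the source alone controls the solution.\<close>

lemma weak_solution_decay:
  assumes ws: "weak_solution D u G" and u: "continuous_on {0..} u" and G: "continuous_on {0..} G"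
    and lam: "0 < lam" and Gle: "\<And>t. 0 \<le> t \<Longrightarrow> norm (G t) \<le> c * exp (- lam * t)"
    and t: "0 \<le> t" and c: "0 \<le> c" and u0: "(u \<longlongrightarrow> 0) at_top"
  shows "norm (u t) \<le> c / lam * exp (- lam * t)"
proof (rule tendsto_lowerbound)
  show "((\<lambda>s. norm (u s) + c / lam * exp (- lam * t)) \<longlongrightarrow> c / lam * exp (- lam * t)) at_top"
    by (rule tendsto_eq_intros tendsto_norm_zero u0 refl | simp)+
  show "\<forall>\<^sub>F s in at_top. norm (u t) \<le> norm (u s) + c / lam * exp (- lam * t)"
    using eventually_ge_at_top[of t]
    by eventually_elim (rule weak_solution_norm_le[OF ws u G lam Gle t _ c])
qed simp

end

section \<open>Exponential decay and improper integrals in time\<close>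

lemma continuous_on_if_has_vector_derivative:
  assumes "\<And>t. t \<in> X \<Longrightarrow> (f has_vector_derivative f' t) (at t within X)"
  shows "continuous_on X f"
  using has_vector_derivative_continuous[OF assms] by (simp add: continuous_on_eq_continuous_within)

lemma tendsto_exp_decay:
  fixes u :: "real \<Rightarrow> 'h::real_normed_vector"
  assumes "0 < lam" "\<And>t. 0 \<le> t \<Longrightarrow> norm (u t) \<le> N * exp (- lam * t)"
  shows "(u \<longlongrightarrow> 0) at_top"
proof (rule tendsto_norm_zero_cancel, rule tendsto_sandwich)
  show "\<forall>\<^sub>F t in at_top. 0 \<le> norm (u t)" by simp
  show "\<forall>\<^sub>F t in at_top. norm (u t) \<le> N * exp (- lam * t)"
    using eventually_ge_at_top[of 0] by eventually_elim (rule assms)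
  have "filterlim (\<lambda>t. - lam * t) at_bot at_top"
    using assms(1) by (intro filterlim_tendsto_neg_mult_at_bot[OF tendsto_const] filterlim_ident) auto
  then have "((\<lambda>t. exp (- lam * t)) \<longlongrightarrow> 0) at_top"
    by (rule filterlim_compose[OF exp_at_bot])
  from tendsto_mult_right_zero[OF this] show "((\<lambda>t. N * exp (- lam * t)) \<longlongrightarrow> 0) at_top" .
qed simp

lemma exp_mult_le:
  fixes x :: real
  assumes "x \<le> K * exp (- lam * t)"
  shows "exp (lam * t) * x \<le> K"
  using assms by (simp add: exp_minus field_simps)

text \<open>The integral up to infinity appears as a vector \<open>J\<close> together with the rate
  at which proper integrals approach it; these two facts are what Duhamel's formula from infinity
  uses.\<close>

lemma improper_integral_exp_decay:
  fixes g :: "real \<Rightarrow> 'h::banach"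
  assumes g: "continuous_on {0..} g" and lam: "0 < lam"
    and le: "\<And>s. 0 \<le> s \<Longrightarrow> norm (g s) \<le> c * exp (- lam * s)"
  shows "\<exists>J. \<forall>t\<ge>0. norm (J - integral {0..t} g) \<le> c / lam * exp (- lam * t)"
proof -
  have c: "0 \<le> c" using le[of 0] norm_ge_zero[of "g 0"] by (simp del: norm_ge_zero)
  have int: "g integrable_on {a..b}" if "0 \<le> a" for a b
    using that by (intro integrable_continuous_real continuous_on_subset[OF g]) auto
  have B: "norm (integral {0..b} g - integral {0..a} g) \<le> c / lam * exp (- lam * a)"
    if ab: "0 \<le> a" "a \<le> b" for a b
  proof -
    have J: "((\<lambda>s. c * exp (- lam * s)) has_integral (- (c / lam) * exp (- lam * b) - - (c / lam) * exp (- lam * a))) {a..b}"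
      by (rule fundamental_theorem_of_calculus[OF ab(2)])
        (use lam in \<open>auto intro!: derivative_eq_intros simp: has_real_derivative_iff_has_vector_derivative[symmetric] field_simps\<close>)
    have "integral {0..b} g - integral {0..a} g = integral {a..b} g"
      using Henstock_Kurzweil_Integration.integral_combine[OF ab int[of 0 b]] by (simp add: algebra_simps)
    also have "norm \<dots> \<le> integral {a..b} (\<lambda>s. c * exp (- lam * s))"
      by (rule integral_norm_bound_integral[OF int[OF ab(1)] has_integral_integrable[OF J] le]) (use ab in auto)
    also have "\<dots> \<le> c / lam * exp (- lam * a)"
      unfolding integral_unique[OF J] using c lam by simp
    finally show ?thesis .
  qed
  have lim0: "(\<lambda>n. c / lam * exp (- lam * real n)) \<longlonglongrightarrow> 0"
    using tendsto_exp_decay[OF lam, of "\<lambda>t. c / lam * exp (- lam * t)" "c / lam"] c lam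
    by (intro filterlim_compose[OF _ filterlim_real_sequentially]) auto
  have "Cauchy (\<lambda>n. integral {0..real n} g)"
  proof (rule CauchyI')
    fix e :: real assume "e > 0"
    then obtain M where M: "\<And>n. n \<ge> M \<Longrightarrow> c / lam * exp (- lam * real n) < e"
      using order_tendstoD(2)[OF lim0] by (auto simp: eventually_sequentially)
    show "\<exists>M. \<forall>m\<ge>M. \<forall>n>m. dist (integral {0..real m} g) (integral {0..real n} g) < e"
    proof (intro exI[of _ M] allI impI)
      fix m n :: nat assume "m \<ge> M" "n > m"
      then show "dist (integral {0..real m} g) (integral {0..real n} g) < e"
        using B[of "real m" "real n"] M[of m] by (simp add: dist_norm norm_minus_commute)
    qed
  qed
  then obtain J where J: "(\<lambda>n. integral {0..real n} g) \<longlonglongrightarrow> J"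
    using Cauchy_convergent_iff convergent_def by blast
  have "norm (J - integral {0..t} g) \<le> c / lam * exp (- lam * t)" if "0 \<le> t" for t
  proof (rule LIMSEQ_le_const2)
    show "(\<lambda>n. norm (integral {0..real n} g - integral {0..t} g)) \<longlonglongrightarrow> norm (J - integral {0..t} g)"
      by (intro tendsto_intros J)
    obtain N :: nat where "t \<le> real N" using real_arch_simple by blast
    then show "\<exists>N. \<forall>n\<ge>N. norm (integral {0..real n} g - integral {0..t} g) \<le> c / lam * exp (- lam * t)"
      using that by (intro exI[of _ N] allI impI B) auto
  qed
  then show ?thesis by blast
qed

section \<open>The limiting isometric flow and Duhamel's formula from infinity\<close>

context core_approximation
begin

lemma E_norm [simp]: "norm (E n t x) = norm x"
  by (rule skew_operator.bexp_norm[OF A_skew])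

text \<open>Since the approximations commute, differentiating
  \<open>inner (E n s \<eta>) (E m s p)\<close> produces only the difference
  \<open>A m p - A n p\<close>. Taking for \<eta> the backward evolution of the difference vector
  \<open>w\<close> turns this into a bound on the norm of \<open>w\<close> itself.\<close>

lemma E_difference_le: "norm (E n t p - E m t p) \<le> \<bar>t\<bar> * norm (A n p - A m p)"
proof -
  have main: "\<bar>inner (E n t \<eta>) (E m t p) - inner \<eta> p\<bar> \<le> norm \<eta> * norm (A n p - A m p) * \<bar>t\<bar>" for \<eta>
  proof -
    define b where "b s = inner (E n s \<eta>) (E m s p)" for s
    define b' where "b' s = inner (E n s \<eta>) (E m s (A m p - A n p))" for s
    have "(b has_real_derivative b' s) (at s within UNIV)" for s
    proof -
      have "(b has_vector_derivative (inner (E n s \<eta>) (A m (E m s p)) + inner (A n (E n s \<eta>)) (E m s p))) (at s)"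
        unfolding b_def by (rule bounded_bilinear.has_vector_derivative[OF bounded_bilinear_inner])
          (rule bexp_has_vector_derivative[OF bl])+
      moreover have "inner (A n (E n s \<eta>)) (E m s p) = - inner (E n s \<eta>) (A n (E m s p))"
        by (rule skew_operator.skew[OF A_skew])
      moreover have "A n (E m s p) = E m s (A n p)" "A m (E m s p) = E m s (A m p)"
        by (rule bexp_commute[OF bl bl], rule A_commute)+
      ultimately show ?thesis
        by (simp add: b'_def has_real_derivative_iff_has_vector_derivative bexp_diff[OF bl] inner_diff_right)
    qed
    moreover have "norm (b' s) \<le> norm \<eta> * norm (A n p - A m p)" for s
      unfolding b'_def using Cauchy_Schwarz_ineq2[of "E n s \<eta>" "E m s (A m p - A n p)"]
      by (simp add: norm_minus_commute)
    ultimately have "norm (b t - b 0) \<le> norm \<eta> * norm (A n p - A m p) * norm (t - 0)"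
      by (intro field_differentiable_bound[of UNIV]) auto
    then show ?thesis by (simp add: b_def)
  qed
  define w where "w = E n t p - E m t p"
  have "E n t (E n (-t) w) = w" by (rule skew_operator.bexp_inverse[OF A_skew])
  then have "inner (E n t (E n (-t) w)) (E m t p) = inner w (E m t p)" by simp
  moreover have "inner (E n (-t) w) p = inner w (E n t p)"
    using skew_operator.bexp_adjoint[OF A_skew, of n "-t" w p] by simp
  ultimately have "\<bar>inner w (E m t p) - inner w (E n t p)\<bar> \<le> norm w * norm (A n p - A m p) * \<bar>t\<bar>"
    using main[of "E n (-t) w"] by simp
  then have "\<bar>- inner w w\<bar> \<le> norm w * norm (A n p - A m p) * \<bar>t\<bar>"
    by (simp add: w_def inner_diff_right)
  then have "norm w * norm w \<le> norm w * (\<bar>t\<bar> * norm (A n p - A m p))"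
    by (simp add: power2_norm_eq_inner[symmetric] power2_eq_square mult_ac)
  then show ?thesis unfolding w_def[symmetric] by (cases "norm w = 0") auto
qed

text \<open>On core vectors the preceding estimate is uniform on bounded time intervals; isometry
  carries the convergence to all vectors by density.\<close>

lemma E_uniformly_Cauchy: "\<exists>l. uniform_limit {-T..T} (\<lambda>n t. E n t x) l sequentially"
proof -
  have "uniformly_Cauchy_on {-T..T} (\<lambda>n t. E n t x)"
  proof (rule uniformly_Cauchy_onI)
    fix e :: real assume "e > 0"
    have "x \<in> closure (fst ` D)" using D_dense by simp
    then obtain p q where p: "(p, q) \<in> D" "dist p x < e / 4"
      using \<open>e > 0\<close> unfolding closure_approachable by (metis divide_pos_pos fst_conv imageE prod.collapse zero_less_numeral)
    have "Cauchy (\<lambda>n. A n p)" using A_tendsto[OF p(1)] LIMSEQ_imp_Cauchy by blast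
    then obtain M where M: "\<And>m n. m \<ge> M \<Longrightarrow> n \<ge> M \<Longrightarrow> norm (A m p - A n p) < e / (2 * (\<bar>T\<bar> + 1))"
      using \<open>e > 0\<close> unfolding Cauchy_iff by (metis divide_pos_pos zero_less_numeral mult_pos_pos abs_ge_zero add_nonneg_pos zero_less_one)
    show "\<exists>M. \<forall>t\<in>{-T..T}. \<forall>m\<ge>M. \<forall>n\<ge>M. dist (E m t x) (E n t x) < e"
    proof (intro exI[of _ M] ballI allI impI)
      fix t m n assume *: "t \<in> {-T..T}" "m \<ge> M" "n \<ge> M"
      have "norm (E m t p - E n t p) \<le> \<bar>t\<bar> * norm (A m p - A n p)" by (rule E_difference_le)
      also have "\<dots> \<le> (\<bar>T\<bar> + 1) * (e / (2 * (\<bar>T\<bar> + 1)))"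
        using *(1) less_imp_le[OF M[OF *(2,3)]] by (intro mult_mono) auto
      also have "\<dots> = e / 2" by (simp add: divide_simps)
      finally have 1: "dist (E m t p) (E n t p) \<le> e / 2" by (simp add: dist_norm)
      have "dist (E k t p) (E k t x) = dist p x" for k
        by (simp add: dist_norm flip: bexp_diff[OF bl])
      then show "dist (E m t x) (E n t x) < e"
        using 1 p(2) dist_triangle[of "E m t x" "E n t x" "E m t p"] dist_triangle[of "E m t p" "E n t x" "E n t p"]
          dist_commute[of "E m t x" "E m t p"] by auto
    qed
  qed
  then show ?thesis
    using Cauchy_uniformly_convergent uniformly_convergent_on_def by blast
qed

definition S where "S t x = lim (\<lambda>n. E n t x)"

lemma S_uniform: "uniform_limit {-T..T} (\<lambda>n t. E n t x) (\<lambda>t. S t x) sequentially"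
proof -
  obtain l where l: "uniform_limit {-T..T} (\<lambda>n t. E n t x) l sequentially"
    using E_uniformly_Cauchy by blast
  have "S t x = l t" if "t \<in> {-T..T}" for t
    unfolding S_def using tendsto_uniform_limitI[OF l that] by (rule limI)
  then show ?thesis using l uniform_limit_cong'[of "{-T..T}" "\<lambda>n t. E n t x" "\<lambda>n t. E n t x" l "\<lambda>t. S t x"]
    by auto
qed

lemma S_tendsto: "(\<lambda>n. E n t x) \<longlonglongrightarrow> S t x"
  by (rule tendsto_uniform_limitI[OF S_uniform[where T = "\<bar>t\<bar>"]]) auto

lemma S_norm [simp]: "norm (S t x) = norm x"
  using LIMSEQ_unique[OF tendsto_norm[OF S_tendsto[of t x]]] by simp

lemma S_diff: "S t (x - y) = S t x - S t y"
  using tendsto_diff[OF S_tendsto[of t x] S_tendsto[of t y]] S_tendsto[of t "x - y"]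
  by (simp add: bexp_diff[OF bl] LIMSEQ_unique)

lemma S_adjoint: "inner (S t x) y = inner x (S (-t) y)"
proof (rule LIMSEQ_unique)
  show "(\<lambda>n. inner (E n t x) y) \<longlonglongrightarrow> inner (S t x) y"
    by (intro tendsto_intros S_tendsto)
  have "(\<lambda>n. inner x (E n (-t) y)) \<longlonglongrightarrow> inner x (S (-t) y)"
    by (intro tendsto_intros S_tendsto)
  then show "(\<lambda>n. inner (E n t x) y) \<longlonglongrightarrow> inner x (S (-t) y)"
    by (simp add: skew_operator.bexp_adjoint[OF A_skew])
qed

lemma S_inner: "inner (S t x) (S t y) = inner x y"
proof (rule LIMSEQ_unique)
  show "(\<lambda>n. inner (E n t x) (E n t y)) \<longlonglongrightarrow> inner (S t x) (S t y)"
    by (intro tendsto_intros S_tendsto)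
  show "(\<lambda>n. inner (E n t x) (E n t y)) \<longlonglongrightarrow> inner x y"
    by (simp add: skew_operator.bexp_inner[OF A_skew])
qed

lemma S_continuous: "continuous_on UNIV (\<lambda>t. S t x)"
proof -
  have "continuous_on {-T<..<T} (\<lambda>t. S t x)" for T
  proof (rule continuous_on_subset[OF uniform_limit_theorem[OF _ S_uniform]])
    show "\<forall>\<^sub>F n in sequentially. continuous_on {-T..T} (\<lambda>t. E n t x)"
      by (intro always_eventually allI continuous_on_if_has_vector_derivative[OF
            has_vector_derivative_at_within[OF bexp_has_vector_derivative[OF bl]]])
  qed auto
  then have "continuous_on (\<Union>T\<in>UNIV. {-T<..<T}) (\<lambda>t. S t x)"
    by (intro continuous_on_open_UN) auto
  moreover have "(\<Union>T\<in>UNIV. {-T<..<T}) = (UNIV :: real set)"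
  proof -
    have "t \<in> {-(\<bar>t\<bar> + 1)<..<\<bar>t\<bar> + 1}" for t :: real by auto
    then show ?thesis by blast
  qed
  ultimately show ?thesis by simp
qed

lemma S_continuous_compose:
  assumes g: "continuous_on X g" and f: "continuous_on X f"
  shows "continuous_on X (\<lambda>t. S (f t) (g t))"
  unfolding continuous_on_def
proof
  fix t assume "t \<in> X"
  have "((\<lambda>s. S (f s) (g t)) \<longlongrightarrow> S (f t) (g t)) (at t within X)"
    using continuous_on_compose2[OF S_continuous f] \<open>t \<in> X\<close> by (auto simp: continuous_on_def)
  moreover have "((\<lambda>s. S (f s) (g s - g t)) \<longlongrightarrow> 0) (at t within X)"
  proof (rule tendsto_norm_zero_cancel)
    have "((\<lambda>s. norm (g s - g t)) \<longlongrightarrow> 0) (at t within X)"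
      using g \<open>t \<in> X\<close> by (auto simp: continuous_on_def intro!: tendsto_norm_zero LIM_zero)
    then show "((\<lambda>s. norm (S (f s) (g s - g t))) \<longlongrightarrow> 0) (at t within X)" by simp
  qed
  ultimately have "((\<lambda>s. S (f s) (g t) + S (f s) (g s - g t)) \<longlongrightarrow> S (f t) (g t) + 0) (at t within X)"
    by (rule tendsto_add)
  then show "((\<lambda>s. S (f s) (g s)) \<longlongrightarrow> S (f t) (g t)) (at t within X)" by (simp add: S_diff)
qed

text \<open>In integrated form the differential equation of the exponentials passes to the limit,
  because \<open>A n p\<close> tends to \<open>q\<close> and the exponentials converge uniformly in
  time.\<close>

lemma S_core_integral:
  assumes "(p, q) \<in> D" "0 \<le> t"
  shows "S (-t) p = p - integral {0..t} (\<lambda>s. S (-s) q)"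
proof (rule LIMSEQ_unique)
  show "(\<lambda>n. E n (-t) p) \<longlonglongrightarrow> S (-t) p" by (rule S_tendsto)
  have eq: "E n (-t) p = p - integral {0..t} (\<lambda>s. E n (-s) (A n p))" for n
  proof -
    have "((\<lambda>s. E n (-s) (A n p)) has_integral (- E n (-t) p - - E n (-0) p)) {0..t}"
    proof (rule fundamental_theorem_of_calculus[OF assms(2)])
      fix s
      have "((\<lambda>s. -s) has_vector_derivative -1) (at s)" by (auto intro!: derivative_eq_intros)
      from has_vector_derivative_minus[OF vector_diff_chain_at[OF this bexp_has_vector_derivative[OF bl]]]
      have "((\<lambda>s. - E n (-s) p) has_vector_derivative A n (E n (-s) p)) (at s)"
        by (simp add: o_def)
      then show "((\<lambda>s. - E n (-s) p) has_vector_derivative E n (-s) (A n p)) (at s within {0..t})"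
        by (subst bexp_commute[OF bl bl, symmetric]) (auto intro: has_vector_derivative_at_within)
    qed
    from integral_unique[OF this] show ?thesis by simp
  qed
  have u1: "uniform_limit {0..t} (\<lambda>n s. E n (-s) (A n p)) (\<lambda>s. S (-s) q) sequentially"
  proof (rule uniform_limitI)
    fix e :: real assume "e > 0"
    have "\<forall>\<^sub>F n in sequentially. \<forall>s\<in>{-t..t}. dist (E n s q) (S s q) < e / 2"
      using S_uniform[where T = t and x = q, unfolded uniform_limit_iff, rule_format, of "e / 2"] \<open>e > 0\<close> by simp
    moreover have "\<forall>\<^sub>F n in sequentially. dist (A n p) q < e / 2"
      using A_tendsto[OF assms(1), unfolded tendsto_iff, rule_format, of "e / 2"] \<open>e > 0\<close> by simp
    ultimately show "\<forall>\<^sub>F n in sequentially. \<forall>s\<in>{0..t}. dist (E n (-s) (A n p)) (S (-s) q) < e"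
    proof eventually_elim
      case (elim n)
      show ?case
      proof
        fix s assume s: "s \<in> {0..t}"
        have "dist (E n (-s) (A n p)) (E n (-s) q) = dist (A n p) q"
          by (simp add: dist_norm flip: bexp_diff[OF bl])
        moreover have "dist (E n (-s) q) (S (-s) q) < e / 2" using elim(1) s by auto
        ultimately show "dist (E n (-s) (A n p)) (S (-s) q) < e"
          using elim(2) dist_triangle[of "E n (-s) (A n p)" "S (-s) q" "E n (-s) q"] by linarith
      qed
    qed
  qed
  have cont: "continuous_on {0..t} (\<lambda>s. E n (-s) (A n p))" for n
    by (intro continuous_on_compose2[OF continuous_on_if_has_vector_derivative[OF 
            has_vector_derivative_at_within[OF bexp_has_vector_derivative[OF bl]], of UNIV]] continuous_intros) auto
  from uniform_limit_integral[OF u1 cont] obtain I J where IJ: "\<And>n. ((\<lambda>s. E n (-s) (A n p)) has_integral I n) {0..t}"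
    "((\<lambda>s. S (-s) q) has_integral J) {0..t}" "I \<longlonglongrightarrow> J" by auto
  have "I = (\<lambda>n. integral {0..t} (\<lambda>s. E n (-s) (A n p)))"
    using integral_unique[OF IJ(1)] by auto
  then have "(\<lambda>n. integral {0..t} (\<lambda>s. E n (-s) (A n p))) \<longlonglongrightarrow> integral {0..t} (\<lambda>s. S (-s) q)"
    using IJ(3) integral_unique[OF IJ(2)] by simp
  then show "(\<lambda>n. E n (-t) p) \<longlonglongrightarrow> p - integral {0..t} (\<lambda>s. S (-s) q)"
    unfolding eq by (intro tendsto_intros)
qed

text \<open>The solution is minus the integral of \<open>S (t - s) (G s)\<close> over s from t to
  infinity. It is the one that vanishes at infinity, so it inherits the decay rate of the source
  with a factor 1 / lam.\<close>

lemma inhomogeneous_solution: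
  assumes G: "continuous_on {0..} G" and lam: "0 < lam"
    and Gle: "\<And>t. 0 \<le> t \<Longrightarrow> norm (G t) \<le> c * exp (- lam * t)"
  shows "\<exists>r. continuous_on {0..} r \<and> weak_solution D r G \<and> (\<forall>t\<ge>0. norm (r t) \<le> c / lam * exp (- lam * t))"
proof -
  define g where "g s = S (-s) (G s)" for s
  have g: "continuous_on {0..} g"
    unfolding g_def by (intro S_continuous_compose G continuous_intros)
  obtain J where J: "\<And>t. t \<ge> 0 \<Longrightarrow> norm (J - integral {0..t} g) \<le> c / lam * exp (- lam * t)"
    using improper_integral_exp_decay[OF g lam, of c] Gle by (auto simp: g_def)
  \<comment> \<open>In the frame moving with the flow a solution is an antiderivative of
    \<open>g\<close>; subtracting the full integral \<open>J\<close> makes it vanish at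
    infinity.\<close>
  define x where "x t = integral {0..t} g - J" for t
  have x': "(x has_vector_derivative g t) (at t within {0..})" if "0 \<le> t" for t
    using has_vector_derivative_diff[OF integral_deriv_Ici[OF g that] has_vector_derivative_const] 
    unfolding x_def by simp
  have xc: "continuous_on {0..} x"
    by (rule continuous_on_if_has_vector_derivative[OF x']) simp
  show ?thesis
  proof (intro exI[of _ "\<lambda>t. S t (x t)"] conjI allI impI)
    show "continuous_on {0..} (\<lambda>t. S t (x t))"
      by (intro S_continuous_compose xc continuous_intros)
    show "norm (S t (x t)) \<le> c / lam * exp (- lam * t)" if "0 \<le> t" for t
      using J[OF that] by (simp add: x_def norm_minus_commute)
    show "weak_solution D (\<lambda>t. S t (x t)) G"
      unfolding weak_solution_def
    proof (intro allI impI)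
      fix p q t assume pq: "(p, q) \<in> D" and t: "0 \<le> (t::real)"
      have Sc: "continuous_on {0..} (\<lambda>s. S (-s) q)"
        by (intro S_continuous_compose continuous_intros)
      have "((\<lambda>s. p - integral {0..s} (\<lambda>s. S (-s) q)) has_vector_derivative 0 - S (-t) q) (at t within {0..})"
        by (intro has_vector_derivative_diff has_vector_derivative_const integral_deriv_Ici Sc t)
      then have "((\<lambda>s. p - integral {0..s} (\<lambda>s. S (-s) q)) has_vector_derivative - S (-t) q) (at t within {0..})" by simp
      then have "((\<lambda>s. S (-s) p) has_vector_derivative - S (-t) q) (at t within {0..})"
        by (rule has_vector_derivative_transform[rotated -1]) (use t S_core_integral[OF pq] in auto)
      from bounded_bilinear.has_vector_derivative[OF bounded_bilinear_inner this x'[OF t]]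
      have "((\<lambda>s. inner (S (-s) p) (x s)) has_vector_derivative
          inner (S (-t) p) (g t) + inner (- S (-t) q) (x t)) (at t within {0..})" .
      moreover have "inner (S (-s) p) y = inner p (S s y)" for s p y
        using S_adjoint[of "-s" p y] by simp
      moreover have "inner (S (-t) p) (g t) = inner p (G t)" unfolding g_def by (rule S_inner)
      ultimately show "((\<lambda>s. inner p (S s (x s))) has_vector_derivative inner p (G t) - inner q (S t (x t))) (at t within {0..})"
        by simp
    qed
  qed
qed


text \<open>The a priori bound, with whatever constant \<open>N\<close>, only makes the solution
  vanish at infinity; the constant that comes out is that of the source. This self-improvement
  drives both uniqueness and contraction.\<close>

lemma weak_solution_decay_if_bounded:
  assumes ws: "weak_solution D u G" and u: "continuous_on {0..} u" and G: "continuous_on {0..} G"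
    and lam: "0 < lam" and ule: "\<And>t. 0 \<le> t \<Longrightarrow> norm (u t) \<le> N * exp (- lam * t)"
    and Gle: "\<And>t. 0 \<le> t \<Longrightarrow> norm (G t) \<le> c * exp (- lam * t)" and t: "0 \<le> t"
  shows "norm (u t) \<le> c / lam * exp (- lam * t)"
proof (rule weak_solution_decay[OF ws u G lam Gle t _ tendsto_exp_decay[OF lam ule]])
  show "0 \<le> c" using order_trans[OF norm_ge_zero Gle[of 0]] by simp
qed

text \<open>The difference of two solutions has the perturbation of itself as source. The
  perturbation is bounded by lam / 2 and the decay estimate divides by lam, so every application
  halves the constant in front of exp (- lam t).\<close>

theorem perturbed_solution_unique:
  assumes B_bound: "\<And>t x. 0 \<le> t \<Longrightarrow> norm (B t x) \<le> M * norm x"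
    and B_diff: "\<And>t x y. B t (x - y) = B t x - B t y"
    and B_cont: "\<And>u. continuous_on {0..} u \<Longrightarrow> continuous_on {0..} (\<lambda>t. B t (u t))"
    and lam: "0 < lam" "2 * M \<le> lam"
    and u: "continuous_on {0..} u" "weak_solution D u (\<lambda>t. B t (u t) + F t)"
    and w: "continuous_on {0..} w" "weak_solution D w (\<lambda>t. B t (w t) + F t)"
    and uw: "\<And>t. 0 \<le> t \<Longrightarrow> norm (u t - w t) \<le> N * exp (- lam * t)" and t: "0 \<le> t"
  shows "u t = w t"
proof -
  define d where "d t = u t - w t" for t
  have dc: "continuous_on {0..} d" unfolding d_def by (intro continuous_intros u w)
  have dw: "weak_solution D d (\<lambda>t. B t (d t))"
    using weak_solution_diff[OF u(2) w(2)] unfolding d_def by (simp add: B_diff)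
  have "norm (d t) \<le> N * (1 / 2) ^ k * exp (- lam * t)" if "0 \<le> t" for k t
    using that
  proof (induction k arbitrary: t)
    case (Suc k)
    have N: "0 \<le> N" using order_trans[OF norm_ge_zero uw[of 0]] by simp
    have "norm (B t (d t)) \<le> (lam / 2 * (N * (1 / 2) ^ k)) * exp (- lam * t)" if "0 \<le> t" for t
    proof -
      have "norm (B t (d t)) \<le> lam / 2 * norm (d t)"
        using B_bound[OF that, of "d t"] mult_right_mono[of M "lam / 2" "norm (d t)"] lam by simp
      also have "\<dots> \<le> lam / 2 * (N * (1 / 2) ^ k * exp (- lam * t))"
        using Suc.IH[OF that] lam by (intro mult_left_mono) auto
      finally show ?thesis by (simp add: mult_ac)
    qed
    from weak_solution_decay_if_bounded[OF dw dc B_cont[OF dc] lam(1) Suc.IH this Suc.prems]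
    show ?case using lam by simp
  next
    case 0
    then show ?case using uw[of t] by (simp add: d_def)
  qed
  note * = this[OF t]
  have "(\<lambda>k. N * (1 / 2) ^ k * exp (- lam * t)) \<longlonglongrightarrow> N * 0 * exp (- lam * t)"
    by (intro tendsto_intros LIMSEQ_power_zero) auto
  then have "norm (d t) \<le> N * 0 * exp (- lam * t)"
    by (rule LIMSEQ_le_const) (use * in auto)
  then show ?thesis by (simp add: d_def)
qed

text \<open>The fixed point is sought for \<open>\<rho>(t) = e\<^sup>\<lambda>\<^sup>t r(t)\<close> in the bounded continuous functions.\<close>

theorem perturbed_solution_exists:
  assumes B_bound: "\<And>t x. 0 \<le> t \<Longrightarrow> norm (B t x) \<le> M * norm x"
    and B_diff: "\<And>t x y. B t (x - y) = B t x - B t y"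
    and B_cont: "\<And>u. continuous_on {0..} u \<Longrightarrow> continuous_on {0..} (\<lambda>t. B t (u t))"
    and F: "continuous_on {0..} F" and Fle: "\<And>t. 0 \<le> t \<Longrightarrow> norm (F t) \<le> c * exp (- lam * t)"
    and lam: "0 < lam" "2 * M \<le> lam" and M: "0 \<le> M"
  shows "\<exists>r. continuous_on {0..} r \<and> weak_solution D r (\<lambda>t. B t (r t) + F t) \<and>
    (\<forall>t\<ge>0. norm (r t) \<le> 2 * c / lam * exp (- lam * t))"
proof -
  have c: "0 \<le> c" using order_trans[OF norm_ge_zero Fle[of 0]] by simp
  define e where "e \<rho> s = exp (- lam * s) *\<^sub>R apply_bcontfun \<rho> s" for \<rho> :: "real \<Rightarrow>\<^sub>C 'h" and s
  define G where "G \<rho> t = B t (e \<rho> t) + F t" for \<rho> t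
  have ec: "continuous_on {0..} (e \<rho>)" for \<rho>
    unfolding e_def by (intro continuous_intros continuous_on_apply_bcontfun)
  have Gc: "continuous_on {0..} (G \<rho>)" for \<rho>
    unfolding G_def by (intro continuous_on_add B_cont ec F)
  have Be: "norm (B t (e \<rho> t)) \<le> lam / 2 * norm \<rho> * exp (- lam * t)" if "0 \<le> t" for \<rho> t
  proof -
    have "norm (B t (e \<rho> t)) \<le> M * norm (e \<rho> t)" by (rule B_bound[OF that])
    also have "\<dots> \<le> lam / 2 * (exp (- lam * t) * norm \<rho>)"
      using lam M unfolding e_def by (intro mult_mono) (auto intro: norm_bounded)
    finally show ?thesis by (simp add: mult_ac)
  qed
  have Gle: "norm (G \<rho> t) \<le> (lam / 2 * norm \<rho> + c) * exp (- lam * t)" if "0 \<le> t" for \<rho> t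
    unfolding G_def distrib_right by (rule norm_triangle_le[OF add_mono[OF Be Fle]]; rule that)
  from inhomogeneous_solution[OF Gc lam(1) Gle] have "\<exists>r. \<forall>\<rho>. continuous_on {0..} (r \<rho>) \<and> weak_solution D (r \<rho>) (G \<rho>) \<and>
      (\<forall>t\<ge>0. norm (r \<rho> t) \<le> (lam / 2 * norm \<rho> + c) / lam * exp (- lam * t))"
    by (intro choice) blast
  then obtain r where r: "\<And>\<rho>. continuous_on {0..} (r \<rho>)" "\<And>\<rho>. weak_solution D (r \<rho>) (G \<rho>)"
    "\<And>\<rho> t. 0 \<le> t \<Longrightarrow> norm (r \<rho> t) \<le> (lam / 2 * norm \<rho> + c) / lam * exp (- lam * t)" by blast
  \<comment> \<open>Elements of the space of bounded continuous functions live on the whole line;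
    negative times get the value at time 0.\<close>
  define f where "f \<rho> t = exp (lam * max 0 t) *\<^sub>R r \<rho> (max 0 t)" for \<rho> t
  have fle: "norm (f \<rho> t) \<le> (lam / 2 * norm \<rho> + c) / lam" for \<rho> t
    using exp_mult_le[OF r(3)[of "max 0 t" \<rho>]] unfolding f_def by simp
  have fb: "f \<rho> \<in> bcontfun" for \<rho>
  proof (rule bcontfun_normI)
    show "continuous_on UNIV (f \<rho>)"
      unfolding f_def by (intro continuous_intros continuous_on_compose2[OF r(1)]) auto
  qed (rule fle)
  define \<Phi> where "\<Phi> \<rho> = Bcontfun (f \<rho>)" for \<rho>
  have \<Phi>: "apply_bcontfun (\<Phi> \<rho>) = f \<rho>" for \<rho>
    unfolding \<Phi>_def by (rule Bcontfun_inverse[OF fb])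
  have "dist (\<Phi> \<rho>) (\<Phi> \<rho>') \<le> 1 / 2 * dist \<rho> \<rho>'" for \<rho> \<rho>'
  proof (rule dist_bound)
    fix t
    define d where "d t = r \<rho> t - r \<rho>' t" for t
    have dc: "continuous_on {0..} d" unfolding d_def by (intro continuous_intros r)
    have dw: "weak_solution D d (\<lambda>t. G \<rho> t - G \<rho>' t)"
      unfolding d_def by (rule weak_solution_diff[OF r(2) r(2)])
    have "G \<rho> t - G \<rho>' t = B t (e (\<rho> - \<rho>') t)" for t
      unfolding G_def e_def by (simp add: B_diff scaleR_diff_right)
    then have le: "norm (G \<rho> t - G \<rho>' t) \<le> lam / 2 * dist \<rho> \<rho>' * exp (- lam * t)" if "0 \<le> t" for t
      using Be[OF that, of "\<rho> - \<rho>'"] by (simp add: dist_norm)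
    have "norm (d t) \<le> ((lam / 2 * norm \<rho> + c) / lam + (lam / 2 * norm \<rho>' + c) / lam) * exp (- lam * t)" if "0 \<le> t" for t
      unfolding d_def distrib_right by (intro norm_triangle_le_diff add_mono r that)
    from weak_solution_decay_if_bounded[OF dw dc continuous_on_diff[OF Gc Gc] lam(1) this le, of "max 0 t"]
    have "norm (d (max 0 t)) \<le> 1 / 2 * dist \<rho> \<rho>' * exp (- lam * max 0 t)"
      using lam(1) by simp
    from exp_mult_le[OF this]
    show "dist (apply_bcontfun (\<Phi> \<rho>) t) (apply_bcontfun (\<Phi> \<rho>') t) \<le> 1 / 2 * dist \<rho> \<rho>'"
      unfolding \<Phi> f_def by (simp add: dist_norm d_def flip: scaleR_diff_right)
  qed
  then obtain \<rho> where \<rho>: "\<Phi> \<rho> = \<rho>"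
    using banach_fix_type[of "1 / 2" \<Phi>] by auto
  \<comment> \<open>At the fixed point half of the norm is absorbed on the left, which is the origin
    of the factor 2 in \<open>2 * c / lam\<close>.\<close>
  have "norm \<rho> \<le> (lam / 2 * norm \<rho> + c) / lam"
    by (rule norm_bound) (metis \<rho> \<Phi> fle)
  then have n\<rho>: "norm \<rho> \<le> 2 * c / lam" using lam(1) by (simp add: field_simps)
  have er: "e \<rho> t = r \<rho> t" if "0 \<le> t" for t
  proof -
    have "apply_bcontfun \<rho> t = f \<rho> t" using \<Phi>[of \<rho>] \<rho> by simp
    then show ?thesis using that unfolding e_def f_def by (simp flip: exp_add)
  qed
  show ?thesis
  proof (intro exI[of _ "r \<rho>"] conjI allI impI r(1))
    show "weak_solution D (r \<rho>) (\<lambda>t. B t (r \<rho> t) + F t)"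
      using r(2)[of \<rho>] by (rule weak_solution_cong) (simp_all add: G_def er)
    fix t :: real assume t: "0 \<le> t"
    have "norm (r \<rho> t) = exp (- lam * t) * norm (apply_bcontfun \<rho> t)"
      using er[OF t] by (simp add: e_def flip: er[OF t])
    also have "\<dots> \<le> exp (- lam * t) * (2 * c / lam)"
      by (intro mult_left_mono order_trans[OF norm_bounded n\<rho>]) auto
    finally show "norm (r \<rho> t) \<le> 2 * c / lam * exp (- lam * t)" by (simp add: mult.commute)
  qed
qed

end

subsection \<open>Test functions\<close>

lemma smooth_iff_derivatives:
  "smooth \<phi> \<longleftrightarrow> (\<exists>d. d 0 = \<phi> \<and> (\<forall>n x. (d n has_real_derivative d (Suc n) x) (at x)))"
proof
  assume "smooth \<phi>"
  then show "\<exists>d. d 0 = \<phi> \<and> (\<forall>n x. (d n has_real_derivative d (Suc n) x) (at x))"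
    by (intro exI[of _ "\<lambda>n. (deriv ^^ n) \<phi>"])
      (auto simp: smooth_def DERIV_deriv_iff_real_differentiable)
next
  assume "\<exists>d. d 0 = \<phi> \<and> (\<forall>n x. (d n has_real_derivative d (Suc n) x) (at x))"
  then obtain d where d: "d 0 = \<phi>" "\<And>n x. (d n has_real_derivative d (Suc n) x) (at x)" by blast
  have "(deriv ^^ n) \<phi> = d n" for n
  proof (induction n)
    case (Suc n)
    have "deriv (d n) = d (Suc n)" by (rule ext, rule DERIV_imp_deriv[OF d(2)])
    then show ?case using Suc by simp
  qed (simp add: d(1))
  then show "smooth \<phi>"
    unfolding smooth_def using d(2) real_differentiable_def by auto
qed

text \<open>Coinduction: in a set closed under differentiation every member can be differentiated
  forever. Smoothness proofs thereby reduce to finding a closed family, without formulas for higher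
  derivatives.\<close>

lemma smooth_coinduct:
  assumes "\<phi> \<in> S" "\<And>f. f \<in> S \<Longrightarrow> \<exists>g\<in>S. \<forall>x. (f has_real_derivative g x) (at x)"
  shows "smooth \<phi>"
proof -
  obtain D where D: "\<And>f. f \<in> S \<Longrightarrow> D f \<in> S \<and> (\<forall>x. (f has_real_derivative D f x) (at x))"
    using assms(2) by metis
  have "(D ^^ n) \<phi> \<in> S" for n by (induction n) (auto simp: assms(1) D)
  then show ?thesis unfolding smooth_iff_derivatives
    by (intro exI[of _ "\<lambda>n. (D ^^ n) \<phi>"]) (auto simp: D)
qed

lemma smooth_has_derivative: "smooth \<phi> \<Longrightarrow> (\<phi> has_real_derivative deriv \<phi> x) (at x)"
  unfolding smooth_def DERIV_deriv_iff_real_differentiable by (metis funpow_0)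

lemma smooth_deriv: "smooth \<phi> \<Longrightarrow> smooth (deriv \<phi>)"
  unfolding smooth_def by (metis comp_apply funpow_Suc_right)

lemma smooth_continuous_on: "smooth \<phi> \<Longrightarrow> continuous_on X \<phi>"
  by (rule DERIV_continuous_on[OF has_field_derivative_at_within[OF smooth_has_derivative]])

lemma smooth_measurable [measurable_dest]: "smooth \<phi> \<Longrightarrow> \<phi> \<in> borel_measurable borel"
  by (intro borel_measurable_continuous_onI smooth_continuous_on)

lemma smooth_affine:
  assumes "smooth \<phi>"
  shows "smooth (\<lambda>x. c * \<phi> (a * x + b))"
proof (rule smooth_coinduct[of _ "{\<lambda>x. c * \<psi> (a * x + b) | c \<psi>. smooth \<psi>}"])
  fix f assume "f \<in> {\<lambda>x. c * \<psi> (a * x + b) | c \<psi>. smooth \<psi>}"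
  then obtain c \<psi> where f: "f = (\<lambda>x. c * \<psi> (a * x + b))" "smooth \<psi>" by auto
  have "(f has_real_derivative (c * a) * deriv \<psi> (a * x + b)) (at x)" for x
    unfolding f(1) by (auto intro!: derivative_eq_intros DERIV_chain2[OF smooth_has_derivative[OF f(2)]])
  then show "\<exists>g\<in>{\<lambda>x. c * \<psi> (a * x + b) | c \<psi>. smooth \<psi>}. \<forall>x. (f has_real_derivative g x) (at x)"
    using smooth_deriv[OF f(2)] by (intro bexI[of _ "\<lambda>x. (c * a) * deriv \<psi> (a * x + b)"]) blast+
qed (use assms in blast)

lemma smooth_add:
  assumes "smooth \<phi>" "smooth \<psi>"
  shows "smooth (\<lambda>x. \<phi> x + \<psi> x)"
proof (rule smooth_coinduct[of _ "{\<lambda>x. \<phi> x + \<psi> x | \<phi> \<psi>. smooth \<phi> \<and> smooth \<psi>}"])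
  fix f assume "f \<in> {\<lambda>x. \<phi> x + \<psi> x | \<phi> \<psi>. smooth \<phi> \<and> smooth \<psi>}"
  then obtain \<phi> \<psi> where f: "f = (\<lambda>x. \<phi> x + \<psi> x)" "smooth \<phi>" "smooth \<psi>" by auto
  have "\<forall>x. (f has_real_derivative deriv \<phi> x + deriv \<psi> x) (at x)"
    unfolding f(1) by (auto intro!: derivative_intros smooth_has_derivative f)
  then show "\<exists>g\<in>{\<lambda>x. \<phi> x + \<psi> x | \<phi> \<psi>. smooth \<phi> \<and> smooth \<psi>}. \<forall>x. (f has_real_derivative g x) (at x)"
    using smooth_deriv f(2,3) by (intro bexI[of _ "\<lambda>x. deriv \<phi> x + deriv \<psi> x"]) auto
qed (use assms in blast)

text \<open>The Leibniz rule doubles the number of terms at each differentiation, so the closed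
  family consists of finite sums of products of smooth functions.\<close>

lemma smooth_mult:
  assumes "smooth \<phi>" "smooth \<psi>"
  shows "smooth (\<lambda>x. \<phi> x * \<psi> x)"
proof -
  let ?S = "{\<lambda>x. \<Sum>i<n. a i x * b i x | (n::nat) a b. (\<forall>i. smooth (a i)) \<and> (\<forall>i. smooth (b i))}"
  show ?thesis
  proof (rule smooth_coinduct[of _ ?S])
    have "(\<lambda>x. \<phi> x * \<psi> x) = (\<lambda>x. \<Sum>i<1::nat. (\<lambda>_. \<phi>) i x * (\<lambda>_. \<psi>) i x)" by simp
    then show "(\<lambda>x. \<phi> x * \<psi> x) \<in> ?S"
      using assms by (intro CollectI exI[of _ "1::nat"] exI[of _ "\<lambda>_. \<phi>"] exI[of _ "\<lambda>_. \<psi>"]) auto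
  next
    fix f assume "f \<in> ?S"
    then obtain n :: nat and a b where f: "f = (\<lambda>x. \<Sum>i<n. a i x * b i x)" "\<And>i. smooth (a i)" "\<And>i. smooth (b i)" by auto
    define a' where "a' i = (if i < n then deriv (a i) else a (i - n))" for i
    define b' where "b' i = (if i < n then b i else deriv (b (i - n)))" for i
    have "(f has_real_derivative (\<Sum>i<n+n. a' i x * b' i x)) (at x)" for x
    proof -
      have "(f has_real_derivative (\<Sum>i<n. deriv (a i) x * b i x + deriv (b i) x * a i x)) (at x)"
        unfolding f(1) by (intro DERIV_sum DERIV_mult smooth_has_derivative f)
      also have "(\<Sum>i<n. deriv (a i) x * b i x + deriv (b i) x * a i x) = (\<Sum>i<n+n. a' i x * b' i x)"
        unfolding sum.nat_group[symmetric] sum.distrib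
      proof -
        have "(\<Sum>i<n+n. a' i x * b' i x) = (\<Sum>i<n. a' i x * b' i x) + (\<Sum>i<n. a' (n + i) x * b' (n + i) x)"
          by (simp only: lessThan_atLeast0 sum.atLeastLessThan_concat[of 0 n "n+n", symmetric])
            (simp add: sum.shift_bounds_nat_ivl[of _ 0 n n, simplified] add.commute)
        then show "(\<Sum>i<n. deriv (a i) x * b i x) + (\<Sum>i<n. deriv (b i) x * a i x) = (\<Sum>i<n+n. a' i x * b' i x)"
          by (simp add: a'_def b'_def mult.commute)
      qed
      finally show ?thesis .
    qed
    then show "\<exists>g\<in>?S. \<forall>x. (f has_real_derivative g x) (at x)"
      using f(2,3) smooth_deriv
      by (intro bexI[of _ "\<lambda>x. \<Sum>i<n+n. a' i x * b' i x"] allI CollectI exI[of _ "n+n"] exI[of _ a'] exI[of _ b'])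
        (auto simp: a'_def b'_def)
  qed
qed

lemma test_function_smooth: "test_function \<phi> \<Longrightarrow> smooth \<phi>"
  by (simp add: test_function_def)

lemma deriv_eq_0_outside:
  fixes \<phi> :: "real \<Rightarrow> real"
  assumes "\<And>x. \<bar>x\<bar> > R \<Longrightarrow> \<phi> x = 0" "\<bar>x\<bar> > R"
  shows "deriv \<phi> x = 0"
proof -
  have o: "open {x::real. \<bar>x\<bar> > R}" by (intro open_Collect_less continuous_intros)
  have "((\<lambda>_. 0) has_real_derivative 0) (at x)" by simp
  then have "(\<phi> has_real_derivative 0) (at x)"
    by (rule has_field_derivative_transform_within_open[OF _ o]) (use assms in auto)
  then show ?thesis by (rule DERIV_imp_deriv)
qed

lemma test_function_deriv: "test_function \<phi> \<Longrightarrow> test_function (deriv \<phi>)"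
  unfolding test_function_def using smooth_deriv deriv_eq_0_outside by blast

lemma test_function_affine:
  assumes "test_function \<phi>" "a \<noteq> 0"
  shows "test_function (\<lambda>x. c * \<phi> (a * x + b))"
proof -
  obtain R where R: "\<And>x. \<bar>x\<bar> > R \<Longrightarrow> \<phi> x = 0" using assms by (auto simp: test_function_def)
  have "c * \<phi> (a * x + b) = 0" if "\<bar>x\<bar> > (\<bar>R\<bar> + \<bar>b\<bar>) / \<bar>a\<bar>" for x
  proof -
    have "\<bar>a * x\<bar> > \<bar>R\<bar> + \<bar>b\<bar>" using that assms(2) by (simp add: field_simps abs_mult)
    then show ?thesis using R[of "a * x + b"] by simp
  qed
  then show ?thesis using smooth_affine assms(1) unfolding test_function_def by blast
qed

lemma test_function_scale: "test_function \<phi> \<Longrightarrow> test_function (\<lambda>x. c * \<phi> x)"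
  using test_function_affine[of \<phi> 1 c 0] by simp

lemma test_function_shift: "test_function \<phi> \<Longrightarrow> test_function (\<lambda>x. \<phi> (x + b))"
  using test_function_affine[of \<phi> 1 1 b] by simp

lemma test_function_add:
  assumes "test_function \<phi>" "test_function \<psi>"
  shows "test_function (\<lambda>x. \<phi> x + \<psi> x)"
proof -
  obtain R Q where "\<And>x. \<bar>x\<bar> > R \<Longrightarrow> \<phi> x = 0" "\<And>x. \<bar>x\<bar> > Q \<Longrightarrow> \<psi> x = 0"
    using assms by (auto simp: test_function_def)
  then have "\<forall>x. \<bar>x\<bar> > max R Q \<longrightarrow> \<phi> x + \<psi> x = 0" by simp
  then show ?thesis using assms smooth_add unfolding test_function_def by blast
qed

lemma test_function_bounded:
  assumes "test_function \<phi>"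
  obtains R B where "0 < R" "0 \<le> B" "\<And>x. \<bar>\<phi> x\<bar> \<le> B * indicator {-R..R} x"
proof -
  obtain R where R: "\<And>x. \<bar>x\<bar> > R \<Longrightarrow> \<phi> x = 0" using assms by (auto simp: test_function_def)
  define Q where "Q = max R 1"
  have "bounded (\<phi> ` {-Q..Q})"
    using assms by (intro compact_imp_bounded compact_continuous_image smooth_continuous_on) (auto dest: test_function_smooth)
  then obtain B where B: "\<forall>x\<in>{-Q..Q}. \<bar>\<phi> x\<bar> \<le> B" unfolding bounded_iff by auto
  have "\<bar>\<phi> x\<bar> \<le> max B 0 * indicator {-Q..Q} x" for x
    using B[rule_format, of x] R[of x] by (auto simp: indicator_def Q_def)
  then show ?thesis by (intro that[of Q "max B 0"]) (auto simp: Q_def)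
qed

subsection \<open>Bump functions\<close>

definition expinv :: "real \<Rightarrow> real" where
  "expinv x = (if x > 0 then exp (- (1 / x)) else 0)"

lemma poly_exp_tendsto_0: "((\<lambda>u::real. poly p u * exp (- u)) \<longlongrightarrow> 0) at_top"
proof -
  have "((\<lambda>u::real. \<Sum>i\<le>degree p. coeff p i * (u ^ i / exp u)) \<longlongrightarrow> (\<Sum>i\<le>degree p. coeff p i * 0)) at_top"
    by (intro tendsto_intros tendsto_power_div_exp_0)
  then show ?thesis
    by (simp add: poly_altdef exp_minus divide_inverse sum_distrib_right mult.assoc)
qed

text \<open>The closed family consists of the functions p(1/x) exp(-1/x) for x > 0, extended by 0,
  with p a polynomial. At the origin the difference quotient tends to 0 because the exponential
  beats every power of 1/x.\<close>

lemma smooth_expinv: "smooth expinv"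
proof -
  define h where "h p x = (if x > 0 then poly p (1 / x) * exp (- (1 / x)) else 0)" for p :: "real poly" and x
  show ?thesis
  proof (rule smooth_coinduct[of _ "range h"])
    show "expinv \<in> range h"
      by (rule image_eqI[of _ _ 1]) (auto simp: h_def expinv_def fun_eq_iff)
    fix f assume "f \<in> range h"
    then obtain p where f: "f = h p" by auto
    \<comment> \<open>The chain rule gives a factor 1/x^2, which is the square of the variable 1/x,
      with a plus sign on p and a minus sign on its derivative.\<close>
    define q where "q = [:0, 0, 1:] * (p - pderiv p)"
    have "(h p has_real_derivative h q x) (at x)" for x
    proof -
      consider "x < 0" | "x > 0" | "x = 0" by linarith
      then show ?thesis
      proof cases
        case 1
        have "((\<lambda>_. 0) has_real_derivative h q x) (at x)" using 1 by (simp add: h_def)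
        then show ?thesis
          by (rule has_field_derivative_transform_within_open[of _ _ _ "{..<0}"]) (use 1 in \<open>auto simp: h_def\<close>)
      next
        case 2
        have "((\<lambda>x. poly p (1 / x) * exp (- (1 / x))) has_real_derivative h q x) (at x)"
          using 2 by (auto intro!: derivative_eq_intros DERIV_chain2[OF poly_DERIV] simp: h_def q_def field_simps power2_eq_square)
        then show ?thesis
          by (rule has_field_derivative_transform_within_open[of _ _ _ "{0<..}"]) (use 2 in \<open>auto simp: h_def\<close>)
      next
        case 3
        have r: "((\<lambda>y. h p y / y) \<longlongrightarrow> 0) (at_right 0)"
        proof -
          have "filterlim (\<lambda>y::real. 1 / y) at_top (at_right 0)"
            by (simp add: filterlim_inverse_at_top_right divide_inverse)
          from filterlim_compose[OF poly_exp_tendsto_0[of "pCons 0 p"] this]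
          have "((\<lambda>y. poly (pCons 0 p) (1 / y) * exp (- (1 / y))) \<longlongrightarrow> 0) (at_right 0)" .
          then show ?thesis
            by (rule Lim_transform_eventually) (auto simp: eventually_at_filter h_def)
        qed
        have "((\<lambda>y. h p y / y) \<longlongrightarrow> 0) (at_left 0)"
          by (rule tendsto_eventually) (auto simp: eventually_at_filter h_def)
        from filterlim_split_at[OF this r] have "((\<lambda>y. h p y / y) \<longlongrightarrow> 0) (at 0)" .
        then show ?thesis using 3 by (simp add: has_field_derivative_iff h_def)
      qed
    qed
    then show "\<exists>g\<in>range h. \<forall>x. (f has_real_derivative g x) (at x)" unfolding f by blast
  qed
qed

text \<open>A product of two one-sided flat cutoffs. Steepening both with n makes the functions
  approach the indicator of the open interval pointwise, while they always vanish outside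
  it.\<close>

definition bump :: "real \<Rightarrow> real \<Rightarrow> nat \<Rightarrow> real \<Rightarrow> real" where
  "bump a b n x = expinv (real (Suc n) * (x - a)) * expinv (real (Suc n) * (b - x))"

lemma expinv_bounds: "0 \<le> expinv x" "expinv x \<le> 1" 
  by (auto simp: expinv_def)

lemma test_function_bump: "test_function (bump a b n)"
proof -
  have "smooth (bump a b n)"
    using smooth_mult[OF smooth_affine[OF smooth_expinv, of 1 "real (Suc n)" "- real (Suc n) * a"]
      smooth_affine[OF smooth_expinv, of 1 "- real (Suc n)" "real (Suc n) * b"]]
    unfolding bump_def by (simp add: algebra_simps del: of_nat_Suc)
  moreover have "bump a b n x = 0" if "\<bar>x\<bar> > max \<bar>a\<bar> \<bar>b\<bar>" for x
    using that by (cases "x > 0") (auto simp: bump_def expinv_def zero_less_mult_iff)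
  ultimately show ?thesis unfolding test_function_def by blast
qed

lemma bump_bounds: "\<bar>bump a b n x\<bar> \<le> indicator {a<..<b} x"
  using expinv_bounds by (auto simp: bump_def indicator_def expinv_def zero_less_mult_iff abs_mult intro!: mult_le_one)

lemma expinv_tendsto: "x > 0 \<Longrightarrow> (\<lambda>n. expinv (real (Suc n) * x)) \<longlonglongrightarrow> 1"
proof -
  assume x: "x > 0"
  have "(\<lambda>n. 1 / real (Suc n)) \<longlonglongrightarrow> 0"
    using LIMSEQ_inverse_real_of_nat by (simp add: divide_inverse)
  then have "(\<lambda>n. exp (- (1 / real (Suc n) * (1 / x)))) \<longlonglongrightarrow> exp (- (0 * (1 / x)))"
    by (intro tendsto_intros)
  then show ?thesis using x by (simp add: expinv_def zero_less_mult_iff del: of_nat_Suc)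
qed

lemma bump_tendsto: "(\<lambda>n. bump a b n x) \<longlonglongrightarrow> indicator {a<..<b} x"
proof (cases "x \<in> {a<..<b}")
  case True
  then have "(\<lambda>n. bump a b n x) \<longlonglongrightarrow> 1 * 1"
    unfolding bump_def by (intro tendsto_mult expinv_tendsto) auto
  then show ?thesis using True by simp
next
  case False
  then have "bump a b n x = 0" for n using bump_bounds[of a b n x] by simp
  then show ?thesis using False by simp
qed

subsection \<open>The Hilbert space of square integrable fields\<close>

lemma L2_measurable [measurable_dest]: "L2 f \<Longrightarrow> f \<in> borel_measurable borel"
  by (simp add: L2_def)

lemma L2_square_integrable: "L2 f \<Longrightarrow> integrable lborel (\<lambda>x. (norm (f x))\<^sup>2)"
  by (simp add: L2_def)

lemma L2_dominated:
  assumes f: "L2 f" and h: "h \<in> borel_measurable borel" and le: "\<And>x. norm (h x) \<le> C * norm (f x)"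
  shows "L2 h"
  unfolding L2_def
proof
  show "integrable lborel (\<lambda>x. (norm (h x))\<^sup>2)"
  proof (rule Bochner_Integration.integrable_bound)
    show "integrable lborel (\<lambda>x. C\<^sup>2 * (norm (f x))\<^sup>2)"
      using f by (intro integrable_mult_right L2_square_integrable)
    have "(norm (h x))\<^sup>2 \<le> (C * norm (f x))\<^sup>2" for x
      by (intro power_mono le) simp
    then show "AE x in lborel. norm ((norm (h x))\<^sup>2) \<le> norm (C\<^sup>2 * (norm (f x))\<^sup>2)"
      by (simp add: power_mult_distrib)
  qed (use h in measurable)
qed (use h in simp)

lemma L2_add:
  assumes f: "L2 f" and g: "L2 g"
  shows "L2 (\<lambda>x. f x + g x)"
  unfolding L2_def
proof
  note [measurable] = L2_measurable[OF f] L2_measurable[OF g]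
  show "(\<lambda>x. f x + g x) \<in> borel_measurable lborel" by simp
  show "integrable lborel (\<lambda>x. (norm (f x + g x))\<^sup>2)"
  proof (rule Bochner_Integration.integrable_bound)
    show "integrable lborel (\<lambda>x. 2 * (norm (f x))\<^sup>2 + 2 * (norm (g x))\<^sup>2)"
      using f g by (intro Bochner_Integration.integrable_add Bochner_Integration.integrable_mult_right L2_square_integrable)
    have "(norm (f x + g x))\<^sup>2 \<le> 2 * (norm (f x))\<^sup>2 + 2 * (norm (g x))\<^sup>2" for x
    proof -
      have "(norm (f x + g x))\<^sup>2 \<le> (norm (f x) + norm (g x))\<^sup>2"
        by (intro power_mono norm_triangle_ineq) simp
      then show ?thesis using sum_squares_bound[of "norm (f x)" "norm (g x)"] by (simp add: power2_sum)
    qed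
    then show "AE x in lborel. norm ((norm (f x + g x))\<^sup>2) \<le> norm (2 * (norm (f x))\<^sup>2 + 2 * (norm (g x))\<^sup>2)"
      by simp
  qed simp
qed

lemma L2_zero [simp]: "L2 (\<lambda>_. 0)"
  by (simp add: L2_def)

lemma L2_bounded_linear:
  assumes f: "L2 f" and A: "bounded_linear A"
  shows "L2 (\<lambda>x. A (f x))"
proof -
  obtain K where K: "\<And>x. norm (A x) \<le> norm x * K" using bounded_linear.bounded[OF A] by blast
  note [measurable] = L2_measurable[OF f] borel_measurable_continuous_onI[OF linear_continuous_on[OF A]]
  show ?thesis by (rule L2_dominated[OF f, of _ K]) (use K in \<open>auto simp: mult.commute\<close>)
qed

lemma L2_scaleR: "L2 f \<Longrightarrow> L2 (\<lambda>x. c *\<^sub>R f x)"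
  by (rule L2_bounded_linear[OF _ bounded_linear_scaleR_right])

lemma L2_minus: "L2 f \<Longrightarrow> L2 (\<lambda>x. - f x)"
  using L2_scaleR[of f "-1"] by simp

lemma L2_diff: "L2 f \<Longrightarrow> L2 g \<Longrightarrow> L2 (\<lambda>x. f x - g x)"
  using L2_add[OF _ L2_minus] by simp

lemma L2_sum: "(\<And>i. i \<in> I \<Longrightarrow> L2 (f i)) \<Longrightarrow> L2 (\<lambda>x. \<Sum>i\<in>I. f i x)"
  by (induction I rule: infinite_finite_induct) (auto intro: L2_add)

lemma L2_inner_integrable:
  assumes f: "L2 f" and g: "L2 g"
  shows "integrable lborel (\<lambda>x. f x \<bullet> g x)"
proof (rule Bochner_Integration.integrable_bound)
  note [measurable] = L2_measurable[OF f] L2_measurable[OF g]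
  show "(\<lambda>x. f x \<bullet> g x) \<in> borel_measurable lborel" by simp
  show "integrable lborel (\<lambda>x. (norm (f x))\<^sup>2 + (norm (g x))\<^sup>2)"
    using f g by (intro Bochner_Integration.integrable_add L2_square_integrable)
  have "\<bar>f x \<bullet> g x\<bar> \<le> (norm (f x))\<^sup>2 + (norm (g x))\<^sup>2" for x
    using Cauchy_Schwarz_ineq2[of "f x" "g x"] sum_squares_bound[of "norm (f x)" "norm (g x)"]
      mult_nonneg_nonneg[OF norm_ge_zero[of "f x"] norm_ge_zero[of "g x"]] by linarith
  then show "AE x in lborel. norm (f x \<bullet> g x) \<le> norm ((norm (f x))\<^sup>2 + (norm (g x))\<^sup>2)" by simp
qed

\<comment> \<open>The relation is partial because only square integrable functions represent
  elements. A type with class instances is wanted so that the abstract evolution theory applies to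
  it.\<close>
quotient_type l2 = field2 / partial: "\<lambda>f g. L2 f \<and> L2 g \<and> (AE x in lborel. f x = g x)"
  morphisms rep_l2 cls
proof (rule part_equivpI)
  show "\<exists>x. L2 x \<and> L2 x \<and> (AE y in lborel. x y = x y)"
    by (rule exI[of _ "\<lambda>_. 0"]) simp
qed (auto intro!: sympI transpI)

lemma L2_rep [simp]: "L2 (rep_l2 u)"
  using Quotient3_rep_reflp[OF Quotient3_l2, of u] by simp

lemma cls_rep [simp]: "cls (rep_l2 u) = u"
  by (rule Quotient3_abs_rep[OF Quotient3_l2])

lemma cls_eq_iff: "L2 f \<Longrightarrow> L2 g \<Longrightarrow> cls f = cls g \<longleftrightarrow> (AE x in lborel. f x = g x)"
  using Quotient3_rel[OF Quotient3_l2, of f g] by auto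

lemma l2_cases: obtains f where "L2 f" "u = cls f"
  by (metis L2_rep cls_rep)

instantiation l2 :: real_inner
begin

lift_definition zero_l2 :: l2 is "\<lambda>_. 0" by simp
lift_definition plus_l2 :: "l2 \<Rightarrow> l2 \<Rightarrow> l2" is "\<lambda>f g x. f x + g x"
  by (auto intro: L2_add)
lift_definition minus_l2 :: "l2 \<Rightarrow> l2 \<Rightarrow> l2" is "\<lambda>f g x. f x - g x"
  by (auto intro: L2_diff)
lift_definition uminus_l2 :: "l2 \<Rightarrow> l2" is "\<lambda>f x. - f x"
  by (auto intro: L2_minus)
lift_definition scaleR_l2 :: "real \<Rightarrow> l2 \<Rightarrow> l2" is "\<lambda>c f x. c *\<^sub>R f x"
  by (auto intro: L2_scaleR)
lift_definition inner_l2 :: "l2 \<Rightarrow> l2 \<Rightarrow> real" is "\<lambda>f g. \<integral>x. f x \<bullet> g x \<partial>lborel"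
proof -
  fix f f' g g' assume *: "L2 f \<and> L2 f' \<and> (AE x in lborel. f x = f' x)" "L2 g \<and> L2 g' \<and> (AE x in lborel. g x = g' x)"
  then have [measurable]: "f \<in> borel_measurable borel" "f' \<in> borel_measurable borel"
    "g \<in> borel_measurable borel" "g' \<in> borel_measurable borel" by (auto intro: L2_measurable)
  show "(\<integral>x. f x \<bullet> g x \<partial>lborel) = (\<integral>x. f' x \<bullet> g' x \<partial>lborel)"
    by (rule integral_cong_AE) (use * in auto)
qed

definition norm_l2 :: "l2 \<Rightarrow> real" where "norm_l2 u = sqrt (inner u u)"
definition dist_l2 :: "l2 \<Rightarrow> l2 \<Rightarrow> real" where "dist_l2 u v = norm (u - v)"
definition sgn_l2 :: "l2 \<Rightarrow> l2" where "sgn_l2 u = inverse (norm u) *\<^sub>R u"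
definition uniformity_l2 :: "(l2 \<times> l2) filter" where
  "uniformity_l2 = (INF e\<in>{0<..}. principal {(x, y). dist x y < e})"
definition open_l2 :: "l2 set \<Rightarrow> bool" where
  "open_l2 U = (\<forall>x\<in>U. \<forall>\<^sub>F (x', y) in uniformity. x' = x \<longrightarrow> y \<in> U)"

instance
proof
  fix u v w :: l2 and a b :: real
  show "u + v + w = u + (v + w)" by transfer (auto simp: add.assoc intro!: L2_add)
  show "u + v = v + u" by transfer (auto simp: add.commute intro!: L2_add)
  show "0 + u = u" by transfer auto
  show "- u + u = 0" by transfer (auto)
  show "u - v = u + - v" by transfer (auto intro: L2_diff L2_add L2_minus)
  show "a *\<^sub>R (u + v) = a *\<^sub>R u + a *\<^sub>R v" by transfer (auto simp: scaleR_add_right intro!: L2_add L2_scaleR)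
  show "(a + b) *\<^sub>R u = a *\<^sub>R u + b *\<^sub>R u" by transfer (auto simp: scaleR_add_left intro!: L2_add L2_scaleR)
  show "a *\<^sub>R b *\<^sub>R u = (a * b) *\<^sub>R u" by transfer (auto intro!: L2_scaleR)
  show "1 *\<^sub>R u = u" by transfer auto
  show "dist u v = norm (u - v)" by (rule dist_l2_def)
  show "sgn u = inverse (norm u) *\<^sub>R u" by (rule sgn_l2_def)
  show "uniformity = (INF e\<in>{0<..}. principal {(x::l2, y). dist x y < e})" by (rule uniformity_l2_def)
  show "open U = (\<forall>x\<in>U. \<forall>\<^sub>F (x', y) in uniformity. x' = x \<longrightarrow> y \<in> U)" for U :: "l2 set" by (rule open_l2_def)
  show "inner u v = inner v u" by transfer (simp add: inner_commute)
  show "inner (u + v) w = inner u w + inner v w"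
    by transfer (simp add: inner_add_left L2_inner_integrable)
  show "inner (a *\<^sub>R u) v = a * inner u v" by transfer simp
  show "0 \<le> inner u u" by transfer simp
  show "(inner u u = 0) = (u = 0)"
  proof transfer
    fix f assume "L2 f \<and> L2 f \<and> (AE x in lborel. f x = f x)"
    then have f: "L2 f" by simp
    have "(\<integral>x. f x \<bullet> f x \<partial>lborel) = 0 \<longleftrightarrow> (AE x in lborel. f x \<bullet> f x = 0)"
      by (rule integral_nonneg_eq_0_iff_AE[OF L2_inner_integrable[OF f f]]) simp
    then show "((\<integral>x. f x \<bullet> f x \<partial>lborel) = 0) = (L2 f \<and> L2 (\<lambda>_. 0) \<and> (AE x in lborel. f x = 0))"
      using f by simp
  qed
  show "norm u = sqrt (inner u u)" by (rule norm_l2_def)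
qed

end

lemma cls_add: "L2 f \<Longrightarrow> L2 g \<Longrightarrow> cls (\<lambda>x. f x + g x) = cls f + cls g"
  using plus_l2.abs_eq by simp
lemma cls_diff: "L2 f \<Longrightarrow> L2 g \<Longrightarrow> cls (\<lambda>x. f x - g x) = cls f - cls g"
  using minus_l2.abs_eq by simp
lemma cls_minus: "L2 f \<Longrightarrow> cls (\<lambda>x. - f x) = - cls f"
  using uminus_l2.abs_eq by simp
lemma cls_scaleR: "L2 f \<Longrightarrow> cls (\<lambda>x. c *\<^sub>R f x) = c *\<^sub>R cls f"
  using scaleR_l2.abs_eq by simp
lemma cls_inner: "L2 f \<Longrightarrow> L2 g \<Longrightarrow> inner (cls f) (cls g) = (\<integral>x. f x \<bullet> g x \<partial>lborel)"
  using inner_l2.abs_eq by simp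
lemma cls_zero: "cls (\<lambda>_. 0) = 0"
  using zero_l2.abs_eq by simp
lemma cls_norm: "L2 f \<Longrightarrow> norm (cls f) = L2norm f"
  by (simp add: norm_eq_sqrt_inner cls_inner L2norm_def power2_norm_eq_inner)
lemma cls_norm_square: "L2 f \<Longrightarrow> (norm (cls f))\<^sup>2 = (\<integral>x. (norm (f x))\<^sup>2 \<partial>lborel)"
  by (simp add: power2_norm_eq_inner cls_inner)
lemma cls_sum: "finite I \<Longrightarrow> (\<And>i. i \<in> I \<Longrightarrow> L2 (f i)) \<Longrightarrow> cls (\<lambda>x. \<Sum>i\<in>I. f i x) = (\<Sum>i\<in>I. cls (f i))"
  by (induction I rule: finite_induct) (auto simp: cls_zero cls_add L2_sum)

lemma cls_norm_le:
  assumes f: "L2 f" and g: "L2 g" and le: "AE x in lborel. norm (f x) \<le> C * norm (g x)" and C: "0 \<le> C"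
  shows "norm (cls f) \<le> C * norm (cls g)"
proof (rule power2_le_imp_le)
  have "(\<integral>x. (norm (f x))\<^sup>2 \<partial>lborel) \<le> (\<integral>x. C\<^sup>2 * (norm (g x))\<^sup>2 \<partial>lborel)"
  proof (rule integral_mono_AE)
    show "AE x in lborel. (norm (f x))\<^sup>2 \<le> C\<^sup>2 * (norm (g x))\<^sup>2"
      using le by eventually_elim (metis norm_ge_zero power_mono power_mult_distrib)
  qed (intro integrable_mult_right L2_square_integrable f g)+
  then show "(norm (cls f))\<^sup>2 \<le> (C * norm (cls g))\<^sup>2"
    by (simp add: cls_norm_square f g power_mult_distrib)
qed (use C in simp)

lemma l2_norm_square_nn:
  assumes "L2 f"
  shows "(\<integral>\<^sup>+x. ennreal ((norm (f x))\<^sup>2) \<partial>lborel) = ennreal ((norm (cls f))\<^sup>2)"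
  unfolding cls_norm_square[OF assms]
  by (rule nn_integral_eq_integral[OF L2_square_integrable[OF assms]]) simp

lemma L2_nn_bound:
  assumes [measurable]: "f \<in> borel_measurable borel"
    and le: "(\<integral>\<^sup>+x. ennreal ((norm (f x))\<^sup>2) \<partial>lborel) \<le> ennreal (c\<^sup>2)" and c: "0 \<le> c"
  shows "L2 f" "norm (cls f) \<le> c"
proof -
  show L: "L2 f" unfolding L2_def
    using le by (auto intro!: integrableI_bounded simp: le_less_trans)
  have "ennreal ((norm (cls f))\<^sup>2) \<le> ennreal (c\<^sup>2)" using le l2_norm_square_nn[OF L] by simp
  then have "(norm (cls f))\<^sup>2 \<le> c\<^sup>2" by simp
  then show "norm (cls f) \<le> c" using c by (rule power2_le_imp_le)
qed

text \<open>Riesz-Fischer: a rapidly converging subsequence converges almost everywhere, and Fatou's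
  lemma shows that its pointwise limit is the limit of the whole sequence in norm.\<close>

instance l2 :: banach
proof
  fix X :: "nat \<Rightarrow> l2" assume X: "Cauchy X"
  have "\<exists>M. \<forall>m\<ge>M. \<forall>n\<ge>M. norm (X m - X n) < (1 / 3) ^ k" for k :: nat
    using X unfolding Cauchy_iff by (metis zero_less_power zero_less_divide_1_iff zero_less_numeral)
  then obtain M where M: "\<And>k m n. m \<ge> M k \<Longrightarrow> n \<ge> M k \<Longrightarrow> norm (X m - X n) < (1 / 3) ^ k"
    by metis
  \<comment> \<open>A sum of thresholds is at least each of its terms, so the index
    \<open>r n\<close> serves every level up to n.\<close>
  define r where "r n = (\<Sum>k\<le>n. M k)" for n
  have r: "r n \<ge> M k" if "k \<le> n" for k n
    unfolding r_def using that by (intro member_le_sum) auto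
  define f where "f n = rep_l2 (X (r n))" for n
  have Lf: "L2 (f n)" for n by (simp add: f_def)
  note [measurable] = L2_measurable[OF Lf]
  \<comment> \<open>The increments have squared norm at most 9^(-n), so the squares remain summable
    in the mean with weights 2^n. Where the weighted sum is finite, the increments are at most a
    constant times 2^(-n/2), hence summable.\<close>
  define g where "g n x = f (Suc n) x - f n x" for n x
  have Lg: "L2 (g n)" for n unfolding g_def by (intro L2_diff Lf)
  note [measurable] = L2_measurable[OF Lg]
  have cg: "cls (g n) = X (r (Suc n)) - X (r n)" for n
    unfolding g_def cls_diff[OF Lf Lf] by (simp add: f_def)
  have "(\<integral>\<^sup>+x. (\<Sum>n. ennreal (2 ^ n * (norm (g n x))\<^sup>2)) \<partial>lborel) = (\<Sum>n. \<integral>\<^sup>+x. ennreal (2 ^ n * (norm (g n x))\<^sup>2) \<partial>lborel)"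
    by (intro nn_integral_suminf) simp
  also have "\<dots> \<le> (\<Sum>n. ennreal ((2 / 9) ^ n))"
  proof (intro suminf_le summableI)
    fix n
    have "(norm (cls (g n)))\<^sup>2 \<le> ((1 / 3) ^ n)\<^sup>2"
      unfolding cg using less_imp_le[OF M[of n "r (Suc n)" "r n"]] r by (intro power_mono) auto
    then have "2 ^ n * (norm (cls (g n)))\<^sup>2 \<le> 2 ^ n * ((1 / 3) ^ n)\<^sup>2" by simp
    also have "(2 :: real) ^ n * ((1 / 3) ^ n)\<^sup>2 = (2 / 9) ^ n"
      by (simp add: power2_eq_square flip: power_mult_distrib)
    finally have le: "2 ^ n * (norm (cls (g n)))\<^sup>2 \<le> (2 / 9) ^ n" .
    have "(\<integral>\<^sup>+x. ennreal (2 ^ n * (norm (g n x))\<^sup>2) \<partial>lborel) = ennreal (2 ^ n) * ennreal ((norm (cls (g n)))\<^sup>2)"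
      by (simp add: ennreal_mult nn_integral_cmult l2_norm_square_nn[OF Lg])
    also have "\<dots> \<le> ennreal ((2 / 9) ^ n)"
      using le by (simp flip: ennreal_mult)
    finally show "(\<integral>\<^sup>+x. ennreal (2 ^ n * (norm (g n x))\<^sup>2) \<partial>lborel) \<le> ennreal ((2 / 9) ^ n)" .
  qed
  also have "\<dots> < \<infinity>"
  proof -
    have "(\<Sum>n. ennreal ((2 / 9) ^ n)) = ennreal (\<Sum>n. (2 / 9) ^ n)"
      by (intro suminf_ennreal2) (auto intro: summable_geometric)
    then show ?thesis by simp
  qed
  finally have "(\<integral>\<^sup>+x. (\<Sum>n. ennreal (2 ^ n * (norm (g n x))\<^sup>2)) \<partial>lborel) \<noteq> \<infinity>" by simp
  then have "AE x in lborel. (\<Sum>n. ennreal (2 ^ n * (norm (g n x))\<^sup>2)) \<noteq> \<infinity>"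
    by (rule nn_integral_noteq_infinite[rotated]) measurable
  then have conv: "AE x in lborel. convergent (\<lambda>n. f n x)"
  proof eventually_elim
    case (elim x)
    obtain B where B: "(\<Sum>n. ennreal (2 ^ n * (norm (g n x))\<^sup>2)) = ennreal B" "0 \<le> B"
      using elim by (rule_tac ennreal_cases[of "\<Sum>n. ennreal (2 ^ n * (norm (g n x))\<^sup>2)"]) (blast, simp only: infinity_ennreal_def)
    have le: "norm (g n x) \<le> sqrt B * (1 / sqrt 2) ^ n" for n
    proof -
      have "ennreal (2 ^ n * (norm (g n x))\<^sup>2) \<le> ennreal B"
      proof -
        define a where "a n = ennreal (2 ^ n * (norm (g n x))\<^sup>2)" for n
        have "sum a {n} \<le> suminf a" by (rule sum_le_suminf[OF summableI]) auto
        then have "a n \<le> suminf a" by simp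
        then show ?thesis using B(1) unfolding a_def by (simp only:)
      qed
      then have "2 ^ n * (norm (g n x))\<^sup>2 \<le> B" using B(2) by simp
      then have "(norm (g n x))\<^sup>2 \<le> B * (1 / 2) ^ n" by (simp add: power_divide field_simps)
      also have "\<dots> = (sqrt B * (1 / sqrt 2) ^ n)\<^sup>2"
      proof -
        have "(sqrt 2 ^ n)\<^sup>2 = ((sqrt 2)\<^sup>2) ^ n" by (metis power_mult mult.commute)
        then show ?thesis using B(2) by (simp add: power_mult_distrib power_divide)
      qed
      finally show ?thesis by (rule power2_le_imp_le) (use B(2) in simp)
    qed
    have "summable (\<lambda>n. g n x)"
      by (rule summable_comparison_test'[OF summable_mult[OF summable_geometric] le]) simp
    then have "convergent (\<lambda>n. f 0 x + (\<Sum>i<n. g i x))"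
      by (intro convergent_add convergent_const) (simp add: summable_iff_convergent)
    moreover have "f 0 x + (\<Sum>i<n. g i x) = f n x" for n
      unfolding g_def using sum_lessThan_telescope[of "\<lambda>n. f n x" n] by simp
    ultimately show ?case by simp
  qed
  define F where "F x = lim (\<lambda>n. f n x)" for x
  have [measurable]: "F \<in> borel_measurable borel"
    unfolding F_def by measurable
  have lim: "AE x in lborel. (\<lambda>n. f n x) \<longlonglongrightarrow> F x"
    using conv unfolding F_def by eventually_elim (simp add: convergent_LIMSEQ_iff)
  have est: "L2 (\<lambda>x. rep_l2 (X n) x - F x) \<and> norm (cls (\<lambda>x. rep_l2 (X n) x - F x)) \<le> (1 / 3) ^ k"
    if "n \<ge> M k" for n k
  proof -
    define h where "h = rep_l2 (X n)"
    have Lh: "L2 h" by (simp add: h_def)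
    note [measurable] = L2_measurable[OF Lh]
    have "(\<integral>\<^sup>+x. ennreal ((norm (h x - F x))\<^sup>2) \<partial>lborel) = (\<integral>\<^sup>+x. liminf (\<lambda>m. ennreal ((norm (h x - f m x))\<^sup>2)) \<partial>lborel)"
    proof (rule nn_integral_cong_AE)
      show "AE x in lborel. ennreal ((norm (h x - F x))\<^sup>2) = liminf (\<lambda>m. ennreal ((norm (h x - f m x))\<^sup>2))"
        using lim
      proof eventually_elim
        case (elim x)
        have "(\<lambda>m. ennreal ((norm (h x - f m x))\<^sup>2)) \<longlonglongrightarrow> ennreal ((norm (h x - F x))\<^sup>2)"
          by (intro tendsto_ennrealI tendsto_intros elim)
        from lim_imp_Liminf[OF sequentially_bot this] show ?case by (rule sym)
      qed
    qed
    also have "\<dots> \<le> liminf (\<lambda>m. \<integral>\<^sup>+x. ennreal ((norm (h x - f m x))\<^sup>2) \<partial>lborel)"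
      by (rule nn_integral_liminf) simp
    also have "\<dots> \<le> ennreal (((1 / 3) ^ k)\<^sup>2)"
    proof (rule Liminf_le)
      show "\<forall>\<^sub>F m in sequentially. (\<integral>\<^sup>+x. ennreal ((norm (h x - f m x))\<^sup>2) \<partial>lborel) \<le> ennreal (((1 / 3) ^ k)\<^sup>2)"
        using eventually_ge_at_top[of k]
      proof eventually_elim
        case (elim m)
        have "cls (\<lambda>x. h x - f m x) = X n - X (r m)"
          unfolding cls_diff[OF Lh Lf] by (simp add: h_def f_def)
        then have "norm (cls (\<lambda>x. h x - f m x)) \<le> (1 / 3) ^ k"
          using M[OF that r[OF elim]] by simp
        then show ?case
          unfolding l2_norm_square_nn[OF L2_diff[OF Lh Lf]] by (intro ennreal_leI power_mono) auto
      qed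
    qed simp
    finally have le: "(\<integral>\<^sup>+x. ennreal ((norm (h x - F x))\<^sup>2) \<partial>lborel) \<le> ennreal (((1 / 3) ^ k)\<^sup>2)" .
    show ?thesis
      using L2_nn_bound[OF _ le] unfolding h_def[symmetric] by (intro conjI) auto
  qed
  have "L2 (\<lambda>x. rep_l2 (X (M 0)) x - (rep_l2 (X (M 0)) x - F x))"
    by (rule L2_diff[OF L2_rep conjunct1[OF est[OF order_refl]]])
  then have LF: "L2 F" by simp
  have "X \<longlonglongrightarrow> cls F"
  proof (rule LIMSEQ_I)
    fix e :: real assume "e > 0"
    then obtain k where k: "(1 / 3) ^ k < e" using real_arch_pow_inv[of e "1 / 3"] by auto
    have "norm (X n - cls F) < e" if "n \<ge> M k" for n
      using est[OF that] k unfolding cls_diff[OF L2_rep LF] by simp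
    then show "\<exists>no. \<forall>n\<ge>no. norm (X n - cls F) < e" by blast
  qed
  then show "convergent X" by (auto simp: convergent_def)
qed

subsection \<open>Density of the test functions\<close>

text \<open>The positive and negative parts of \<open>f\<close> are densities of two measures that
  agree on all half-lines, hence everywhere. Since \<open>ennreal\<close> cuts off negative values,
  equality of the two densities forces \<open>f\<close> to vanish.\<close>

lemma AE_zero_if_interval_integrals_zero:
  fixes f :: "real \<Rightarrow> real"
  assumes f: "integrable lborel f" and zero: "\<And>a b. (\<integral>x. indicator {a<..<b} x * f x \<partial>lborel) = 0"
  shows "AE x in lborel. f x = 0"
proof -
  note [measurable] = borel_measurable_integrable[OF f]
  let ?M = "density lborel (\<lambda>x. ennreal (f x))" and ?N = "density lborel (\<lambda>x. ennreal (- f x))"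
  have Ioi: "(\<integral>x. indicator {a<..} x * f x \<partial>lborel) = 0" for a
  proof (rule LIMSEQ_unique)
    show "(\<lambda>n. \<integral>x. indicator {a<..<real n} x * f x \<partial>lborel) \<longlonglongrightarrow> 0" by (simp add: zero)
    show "(\<lambda>n. \<integral>x. indicator {a<..<real n} x * f x \<partial>lborel) \<longlonglongrightarrow> (\<integral>x. indicator {a<..} x * f x \<partial>lborel)"
    proof (rule integral_dominated_convergence[where w = "\<lambda>x. norm (f x)"])
      show "AE x in lborel. (\<lambda>n. indicator {a<..<real n} x * f x) \<longlonglongrightarrow> indicator {a<..} x * f x"
      proof (rule AE_I2, rule tendsto_eventually)
        fix x
        obtain N :: nat where "x < real N" using reals_Archimedean2 by blast
        then show "\<forall>\<^sub>F n in sequentially. indicator {a<..<real n} x * f x = indicator {a<..} x * f x"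
          unfolding eventually_sequentially by (intro exI[of _ N]) (auto simp: indicator_def)
      qed
    qed (use f in \<open>auto simp: indicator_def\<close>)
  qed
  have em: "emeasure ?M {a<..} = emeasure ?N {a<..} \<and> emeasure ?M {a<..} < \<infinity>" for a
  proof -
    have 1: "integrable lborel (\<lambda>x. indicator {a<..} x * f x)"
      using integrable_mult_indicator[of "{a<..}" lborel f] f by simp
    have "ennreal (indicator {a<..} x * f x) = ennreal (f x) * indicator {a<..} x"
      "ennreal (- (indicator {a<..} x * f x)) = ennreal (- f x) * indicator {a<..} x" for x
      by (auto simp: indicator_def)
    then have e: "emeasure ?M {a<..} = (\<integral>\<^sup>+x. ennreal (indicator {a<..} x * f x) \<partial>lborel)"
      "emeasure ?N {a<..} = (\<integral>\<^sup>+x. ennreal (- (indicator {a<..} x * f x)) \<partial>lborel)"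
      by (simp_all add: emeasure_density)
    obtain r q where rq: "0 \<le> r" "0 \<le> q" "(\<integral>\<^sup>+x. ennreal (indicator {a<..} x * f x) \<partial>lborel) = ennreal r"
      "(\<integral>\<^sup>+x. ennreal (- (indicator {a<..} x * f x)) \<partial>lborel) = ennreal q"
      "(\<integral>x. indicator {a<..} x * f x \<partial>lborel) = r - q"
      by (rule integrableE[OF 1])
    then show ?thesis using Ioi[of a] e by simp
  qed
  have "?M = ?N" 
  proof (rule measure_eqI_lessThan)
    show "emeasure ?M {a<..} < \<infinity>" "emeasure ?M {a<..} = emeasure ?N {a<..}" for a
      using em[of a] by blast+
  qed simp_all
  then have "AE x in lborel. ennreal (f x) = ennreal (- f x)"
    by (intro sigma_finite_measure.density_unique[OF sigma_finite_lborel]) auto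
  then show ?thesis
  proof eventually_elim
    case (elim x)
    then show ?case by (cases "f x" "0 :: real" rule: linorder_cases) (auto simp: ennreal_neg ennreal_eq_0_iff)
  qed
qed

lemma L2_test:
  assumes "test_function \<phi>"
  shows "L2 (\<lambda>x. \<phi> x *\<^sub>R e)"
proof -
  obtain R B where RB: "0 < R" "0 \<le> B" "\<And>x. \<bar>\<phi> x\<bar> \<le> B * indicator {-R..R} x"
    using test_function_bounded[OF assms] by blast
  have [measurable]: "\<phi> \<in> borel_measurable borel"
    using test_function_smooth[OF assms] by (rule smooth_measurable)
  show ?thesis unfolding L2_def
  proof
    show "integrable lborel (\<lambda>x. (norm (\<phi> x *\<^sub>R e))\<^sup>2)"
    proof (rule Bochner_Integration.integrable_bound)
      show "integrable lborel (\<lambda>x. (B * norm e)\<^sup>2 * indicator {-R..R} x)"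
        by (intro integrable_mult_right integrable_real_indicator) (auto simp: emeasure_lborel_Icc_eq)
      show "AE x in lborel. norm ((norm (\<phi> x *\<^sub>R e))\<^sup>2) \<le> norm ((B * norm e)\<^sup>2 * indicator {-R..R} x)"
      proof (rule AE_I2)
        fix x
        have "(\<bar>\<phi> x\<bar> * norm e)\<^sup>2 \<le> (B * indicator {-R..R} x * norm e)\<^sup>2"
          by (intro power_mono mult_right_mono RB) auto
        then show "norm ((norm (\<phi> x *\<^sub>R e))\<^sup>2) \<le> norm ((B * norm e)\<^sup>2 * indicator {-R..R} x)"
          by (auto simp: indicator_def power_mult_distrib split: if_splits)
      qed
    qed simp
  qed simp
qed

lemma L2_test_integrable:
  assumes "test_function \<phi>" "L2 f"
  shows "integrable lborel (\<lambda>x. \<phi> x *\<^sub>R f x)"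
proof -
  have [measurable]: "\<phi> \<in> borel_measurable borel" "f \<in> borel_measurable borel"
    using test_function_smooth[OF assms(1)] assms(2) by (auto intro: smooth_measurable L2_measurable)
  have 1: "integrable lborel (\<lambda>x. (\<phi> x)\<^sup>2)"
    using L2_square_integrable[OF L2_test[OF assms(1), of "axis 1 1"]] by simp
  show ?thesis
  proof (rule Bochner_Integration.integrable_bound)
    show "integrable lborel (\<lambda>x. (\<phi> x)\<^sup>2 + (norm (f x))\<^sup>2)"
      by (intro Bochner_Integration.integrable_add 1 L2_square_integrable assms)
    have "\<bar>\<phi> x\<bar> * norm (f x) \<le> (\<phi> x)\<^sup>2 + (norm (f x))\<^sup>2" for x
      using sum_squares_bound[of "\<bar>\<phi> x\<bar>" "norm (f x)"]
        mult_nonneg_nonneg[OF abs_ge_zero[of "\<phi> x"] norm_ge_zero[of "f x"]]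
      by (simp only: power2_abs mult.assoc)
    then show "AE x in lborel. norm (\<phi> x *\<^sub>R f x) \<le> norm ((\<phi> x)\<^sup>2 + (norm (f x))\<^sup>2)" by simp
  qed simp
qed

definition tf :: "(real \<Rightarrow> real) \<Rightarrow> complex ^ 2 \<Rightarrow> l2" where
  "tf \<phi> e = cls (\<lambda>x. \<phi> x *\<^sub>R e)"

lemma tf_inner:
  assumes "test_function \<phi>" "L2 f"
  shows "inner (tf \<phi> e) (cls f) = inner e (\<integral>x. \<phi> x *\<^sub>R f x \<partial>lborel)"
  using integral_inner_right[OF L2_test_integrable[OF assms], of e]
  by (simp add: tf_def cls_inner L2_test assms)

text \<open>The fundamental lemma of the calculus of variations: bump functions transfer the
  vanishing from test functions to indicators of intervals. Cutting to a bounded interval makes each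
  real component of \<open>f\<close> integrable, as the criterion with intervals requires.\<close>

lemma L2_AE_zero_if_test_zero:
  assumes f: "L2 f" and zero: "\<And>\<phi>. test_function \<phi> \<Longrightarrow> (\<integral>x. \<phi> x *\<^sub>R f x \<partial>lborel) = 0"
  shows "AE x in lborel. f x = 0"
proof -
  note [measurable] = L2_measurable[OF f]
  have "AE x in lborel. indicator {-real R<..<real R} x * inner (f x) e = 0" for R :: nat and e
  proof (rule AE_zero_if_interval_integrals_zero)
    have Li: "L2 (\<lambda>x. indicator {c<..<d} x *\<^sub>R e)" for c d :: real
      unfolding L2_def
    proof
      have "(\<lambda>x. (norm (indicator {c<..<d} x *\<^sub>R e))\<^sup>2) = (\<lambda>x. (norm e)\<^sup>2 * indicator {c<..<d} x)"
        by (auto simp: indicator_def fun_eq_iff)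
      then show "integrable lborel (\<lambda>x. (norm (indicator {c<..<d} x *\<^sub>R e))\<^sup>2)"
        by (cases "c \<le> d") auto
    qed simp
    have Ii: "integrable lborel (\<lambda>x. indicator {c<..<d} x * inner (f x) e)" for c d :: real
      using L2_inner_integrable[OF f Li[of c d]] by simp
    show "integrable lborel (\<lambda>x. indicator {-real R<..<real R} x * inner (f x) e)" by (rule Ii)
    have z: "(\<integral>x. indicator {c<..<d} x * inner (f x) e \<partial>lborel) = 0" for c d :: real
    proof (rule LIMSEQ_unique)
      have "(\<integral>x. bump c d n x * inner (f x) e \<partial>lborel) = 0" for n
        using tf_inner[OF test_function_bump f, of c d n e] zero[OF test_function_bump[of c d n]]
        by (simp add: tf_def cls_inner L2_test test_function_bump f inner_commute)
      then show "(\<lambda>n. \<integral>x. bump c d n x * inner (f x) e \<partial>lborel) \<longlonglongrightarrow> 0" by simp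
      show "(\<lambda>n. \<integral>x. bump c d n x * inner (f x) e \<partial>lborel) \<longlonglongrightarrow> (\<integral>x. indicator {c<..<d} x * inner (f x) e \<partial>lborel)"
      proof (rule integral_dominated_convergence[where w = "\<lambda>x. norm (indicator {c<..<d} x * inner (f x) e)"])
        have [measurable]: "bump c d n \<in> borel_measurable borel" for n
          using test_function_smooth[OF test_function_bump] by (rule smooth_measurable)
        show "(\<lambda>x. bump c d n x * inner (f x) e) \<in> borel_measurable lborel" for n by simp
        show "AE x in lborel. (\<lambda>n. bump c d n x * inner (f x) e) \<longlonglongrightarrow> indicator {c<..<d} x * inner (f x) e"
          by (intro AE_I2 tendsto_intros bump_tendsto)
        show "AE x in lborel. norm (bump c d n x * inner (f x) e) \<le> norm (indicator {c<..<d} x * inner (f x) e)" for n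
          using bump_bounds[of c d n] by (auto simp: abs_mult intro!: mult_right_mono)
      qed (use Ii in auto)
    qed
    show "(\<integral>x. indicator {a<..<b} x * (indicator {-real R<..<real R} x * inner (f x) e) \<partial>lborel) = 0" for a b
    proof -
      have "(\<lambda>x. indicator {a<..<b} x * (indicator {-real R<..<real R} x * inner (f x) e)) =
          (\<lambda>x. indicator {max a (-real R)<..<min b (real R)} x * inner (f x) e)"
        by (auto simp: indicator_def fun_eq_iff)
      then show ?thesis by (simp only: z)
    qed
  qed
  then have "AE x in lborel. \<forall>R::nat. \<forall>e\<in>Basis. indicator {-real R<..<real R} x * inner (f x) e = 0"
    unfolding AE_all_countable by (intro allI AE_finite_allI) auto
  then show ?thesis
  proof eventually_elim
    case (elim x)
    obtain R :: nat where "\<bar>x\<bar> < real R" using reals_Archimedean2 by blast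
    then have "\<forall>e\<in>Basis. inner (f x) e = 0"
      using elim[rule_format, of _ R] by (auto simp: indicator_def abs_less_iff)
    then show ?case by (simp add: euclidean_all_zero_iff)
  qed
qed

text \<open>The projection argument: a minimizing sequence for the distance is Cauchy by the
  parallelogram identity, and the residual of its limit is orthogonal to \<open>M\<close>, hence
  zero.\<close>

lemma closed_subspace_UNIV_if_orthogonal_zero:
  fixes M :: "'h::{real_inner,banach} set"
  assumes M: "subspace M" "closed M" and orth: "\<And>x. (\<And>y. y \<in> M \<Longrightarrow> inner x y = 0) \<Longrightarrow> x = 0"
  shows "M = UNIV"
proof (rule UNIV_eq_I[symmetric])
  fix x
  have M0: "M \<noteq> {}" using subspace_0[OF M(1)] by auto
  define d where "d = infdist x M"
  have dle: "d \<le> norm (x - y)" if "y \<in> M" for y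
    unfolding d_def using infdist_le[OF that, of x] by (simp add: dist_norm)
  have "\<exists>y\<in>M. norm (x - y) < d + 1 / real (Suc n)" for n
  proof (rule ccontr)
    assume "\<not> ?thesis"
    then have "d + 1 / real (Suc n) \<le> infdist x M"
      unfolding infdist_notempty[OF M0] using M0 by (intro cINF_greatest) (auto simp: dist_norm)
    then show False by (simp add: d_def divide_simps split: if_splits)
  qed
  then obtain y where y: "\<And>n. y n \<in> M" "\<And>n. norm (x - y n) < d + 1 / real (Suc n)" by metis
  have d0: "0 \<le> d" by (simp add: d_def infdist_nonneg)
  have par: "(norm (u - v))\<^sup>2 = 2 * (norm (x - u))\<^sup>2 + 2 * (norm (x - v))\<^sup>2 - 4 * (norm (x - (1/2) *\<^sub>R (u + v)))\<^sup>2" for u v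
    unfolding power2_norm_eq_inner
    by (simp add: inner_diff_left inner_diff_right inner_add_left inner_add_right inner_commute algebra_simps)
  have C: "(norm (y m - y n))\<^sup>2 \<le> (8 * d + 4) / real (Suc N)" if "m \<ge> N" "n \<ge> N" for m n N
  proof -
    define e where "e = 1 / real (Suc N)"
    have e: "0 < e" "e \<le> 1" by (auto simp: e_def)
    have "norm (x - y k) \<le> d + e" if "k \<ge> N" for k
    proof -
      have "1 / real (Suc k) \<le> e" unfolding e_def using that by (intro divide_left_mono) auto
      then show ?thesis using y(2)[of k] by linarith
    qed
    then have le: "(norm (x - y m))\<^sup>2 \<le> (d + e)\<^sup>2" "(norm (x - y n))\<^sup>2 \<le> (d + e)\<^sup>2"
      using that by (auto intro!: power_mono)
    have "d\<^sup>2 \<le> (norm (x - (1/2) *\<^sub>R (y m + y n)))\<^sup>2"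
      by (intro power_mono dle d0 subspace_scale subspace_add M y)
    then have "(norm (y m - y n))\<^sup>2 \<le> 4 * (d + e)\<^sup>2 - 4 * d\<^sup>2"
      using le unfolding par[of "y m" "y n"] by linarith
    also have "\<dots> = 8 * d * e + 4 * (e * e)" by (simp add: power2_eq_square algebra_simps)
    also have "\<dots> \<le> 8 * d * e + 4 * (e * 1)"
      using e by (intro add_left_mono mult_left_mono) auto
    also have "\<dots> = (8 * d + 4) * e" by (simp add: algebra_simps)
    finally show ?thesis by (simp add: e_def)
  qed
  have "Cauchy y"
  proof (rule CauchyI)
    fix \<epsilon> :: real assume "\<epsilon> > 0"
    have "(\<lambda>N. (8 * d + 4) / real (Suc N)) \<longlonglongrightarrow> 0"
      using LIMSEQ_Suc[OF lim_const_over_n[of "8 * d + 4"]] by simp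
    then have "\<forall>\<^sub>F N in sequentially. (8 * d + 4) / real (Suc N) < \<epsilon>\<^sup>2"
      using \<open>\<epsilon> > 0\<close> by (intro order_tendstoD) auto
    then obtain N where N: "(8 * d + 4) / real (Suc N) < \<epsilon>\<^sup>2" by (auto simp: eventually_sequentially)
    have "norm (y m - y n) < \<epsilon>" if "m \<ge> N" "n \<ge> N" for m n
      using le_less_trans[OF C[OF that] N] \<open>\<epsilon> > 0\<close> by (intro power2_less_imp_less[of _ \<epsilon>]) auto
    then show "\<exists>N. \<forall>m\<ge>N. \<forall>n\<ge>N. norm (y m - y n) < \<epsilon>" by blast
  qed
  then obtain p where p: "y \<longlonglongrightarrow> p" using Cauchy_convergent_iff convergent_def by blast
  have pM: "p \<in> M" using closed_sequentially[OF M(2) _ p] y(1) by blast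
  have "(\<lambda>n. norm (x - y n)) \<longlonglongrightarrow> norm (x - p)" by (intro tendsto_intros p)
  moreover have "(\<lambda>n. d + 1 / real (Suc n)) \<longlonglongrightarrow> d + 0"
    using LIMSEQ_Suc[OF lim_const_over_n[of "1::real"]] by (intro tendsto_intros) simp
  ultimately have pd: "norm (x - p) \<le> d"
    using LIMSEQ_le[of "\<lambda>n. norm (x - y n)" "norm (x - p)" "\<lambda>n. d + 1 / real (Suc n)" "d + 0"] y(2) less_imp_le by auto
  have "inner (x - p) z = 0" if z: "z \<in> M" for z
  proof (cases "z = 0")
    case False
    \<comment> \<open>The optimal step along \<open>z\<close>; as the distance is already minimal,
      the gain it would bring has to vanish.\<close>
    define t where "t = inner (x - p) z / inner z z"
    have zz: "inner z z > 0" using False by simp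
    have "d \<le> norm (x - (p + t *\<^sub>R z))" by (intro dle subspace_add subspace_scale M pM z)
    then have "(norm (x - p))\<^sup>2 \<le> (norm (x - (p + t *\<^sub>R z)))\<^sup>2" using pd by (intro power_mono) auto
    also have "\<dots> = (norm (x - p))\<^sup>2 - 2 * t * inner (x - p) z + t\<^sup>2 * inner z z"
      unfolding power2_norm_eq_inner
      by (simp add: inner_diff_left inner_diff_right inner_add_left inner_add_right inner_commute algebra_simps power2_eq_square)
    also have "\<dots> = (norm (x - p))\<^sup>2 - (inner (x - p) z)\<^sup>2 / inner z z"
      using zz by (simp add: t_def power2_eq_square field_simps)
    finally have "(inner (x - p) z)\<^sup>2 / inner z z \<le> 0" by simp
    then show ?thesis using zz by (simp add: divide_le_0_iff)
  qed simp
  then have "x - p = 0" by (rule orth)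
  then show "x \<in> M" using pM by simp
qed

lemma tf_total:
  assumes "\<And>\<phi> e. test_function \<phi> \<Longrightarrow> inner (tf \<phi> e) u = 0"
  shows "u = 0"
proof -
  obtain f where f: "L2 f" "u = cls f" by (rule l2_cases)
  have "(\<integral>x. \<phi> x *\<^sub>R f x \<partial>lborel) = 0" if "test_function \<phi>" for \<phi>
    using assms[OF that, of "\<integral>x. \<phi> x *\<^sub>R f x \<partial>lborel"] unfolding f(2) tf_inner[OF that f(1)] by simp
  from L2_AE_zero_if_test_zero[OF f(1) this] show ?thesis
    unfolding f(2) cls_zero[symmetric] by (simp add: cls_eq_iff f(1))
qed

lemma subspace_closure_normed:
  fixes V :: "'a::real_normed_vector set"
  assumes "subspace V"
  shows "subspace (closure V)"
proof (rule subspaceI)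
  show "0 \<in> closure V" using subspace_0[OF assms] closure_subset by blast
next
  fix x y assume "x \<in> closure V" "y \<in> closure V"
  then obtain f g where fg: "\<And>n. f n \<in> V" "f \<longlonglongrightarrow> x" "\<And>n. g n \<in> V" "g \<longlonglongrightarrow> y"
    unfolding closure_sequential by blast
  then show "x + y \<in> closure V"
    unfolding closure_sequential
    by (intro exI[of _ "\<lambda>n. f n + g n"]) (auto intro: tendsto_add subspace_add[OF assms])
next
  fix x and c :: real assume "x \<in> closure V"
  then obtain f where f: "\<And>n. f n \<in> V" "f \<longlonglongrightarrow> x"
    unfolding closure_sequential by blast
  then show "c *\<^sub>R x \<in> closure V"
    unfolding closure_sequential
    by (intro exI[of _ "\<lambda>n. c *\<^sub>R f n"]) (auto intro: tendsto_scaleR subspace_scale[OF assms])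
qed

lemma tf_dense: "closure (span {tf \<phi> e | \<phi> e. test_function \<phi>}) = UNIV"
proof (rule closed_subspace_UNIV_if_orthogonal_zero)
  fix u :: l2 assume u: "\<And>y. y \<in> closure (span {tf \<phi> e | \<phi> e. test_function \<phi>}) \<Longrightarrow> inner u y = 0"
  show "u = 0"
  proof (rule tf_total)
    fix \<phi> e assume "test_function \<phi>"
    then have "tf \<phi> e \<in> span {tf \<phi> e | \<phi> e. test_function \<phi>}" by (intro span_base) auto
    from u[OF subsetD[OF closure_subset this]] show "inner (tf \<phi> e) u = 0"
      by (simp add: inner_commute)
  qed
qed (auto intro: subspace_closure_normed)

subsection \<open>Multiplication operators\<close>

definition bmat :: "(real \<Rightarrow> complex ^ 2 ^ 2) \<Rightarrow> bool" where
  "bmat M \<longleftrightarrow> (\<forall>i j. (\<lambda>x. M x $ i $ j) \<in> borel_measurable borel) \<and>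
     (\<exists>C\<ge>0. \<forall>x w. norm (M x *v w) \<le> C * norm w)"

definition mop :: "(real \<Rightarrow> complex ^ 2 ^ 2) \<Rightarrow> l2 \<Rightarrow> l2" where
  "mop M u = cls (\<lambda>x. M x *v rep_l2 u x)"

lemma vec2_measurable:
  fixes f :: "'a \<Rightarrow> complex ^ 2"
  assumes "\<And>i. (\<lambda>x. f x $ i) \<in> borel_measurable N"
  shows "f \<in> borel_measurable N"
proof (rule borel_measurable_euclidean_space[THEN iffD2], rule ballI)
  fix b :: "complex ^ 2" assume "b \<in> Basis"
  then obtain i c where b: "b = axis i c" by (auto simp: Basis_vec_def)
  show "(\<lambda>x. f x \<bullet> b) \<in> borel_measurable N"
    unfolding b inner_axis by (intro borel_measurable_inner assms) simp
qed

lemma matrix_vector_2: "((M :: complex ^ 2 ^ 2) *v w) $ i = M $ i $ 1 * w $ 1 + M $ i $ 2 * w $ 2"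
  by (simp add: matrix_vector_mult_def sum_2)

lemma matrix_vector_scaleR: "(M :: complex ^ 2 ^ 2) *v (c *\<^sub>R w) = c *\<^sub>R (M *v w)"
  by (simp add: vec_eq_iff matrix_vector_2 scaleR_add_right)

lemma matrix_vector_measurable:
  assumes M: "\<And>i j. (\<lambda>x. M x $ i $ j) \<in> borel_measurable borel" and f: "f \<in> borel_measurable borel"
  shows "(\<lambda>x. (M x :: complex ^ 2 ^ 2) *v f x) \<in> borel_measurable borel"
proof (rule vec2_measurable)
  fix i
  have [measurable]: "(\<lambda>x. f x $ j) \<in> borel_measurable borel" for j
    using f by (rule measurable_compose[OF _ borel_measurable_continuous_onI]) (intro continuous_intros)
  note [measurable] = M
  show "(\<lambda>x. (M x *v f x) $ i) \<in> borel_measurable borel"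
    unfolding matrix_vector_2 by measurable
qed

lemma bmatI:
  assumes M: "\<And>i j. (\<lambda>x. M x $ i $ j) \<in> borel_measurable borel" and le: "\<And>x i j. norm (M x $ i $ j) \<le> B"
  shows "bmat M" "norm (M x *v w) \<le> 4 * B * norm w"
proof -
  have B: "0 \<le> B" using order_trans[OF norm_ge_zero le[of 0 1 1]] .
  have le': "norm (M x *v w) \<le> 4 * B * norm w" for x w
  proof -
    have "norm (M x *v w) \<le> (\<Sum>i\<in>UNIV. norm ((M x *v w) $ i))" 
      unfolding norm_vec_def[of "M x *v w"] by (rule L2_set_le_sum) simp
    also have "\<dots> \<le> (\<Sum>i\<in>(UNIV::2 set). B * norm w + B * norm w)"
    proof (rule sum_mono)
      fix i
      show "norm ((M x *v w) $ i) \<le> B * norm w + B * norm w"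
        unfolding matrix_vector_2
        by (rule norm_triangle_le[OF add_mono]) (auto simp: norm_mult intro!: mult_mono le B Finite_Cartesian_Product.norm_nth_le)
    qed
    finally show ?thesis by simp
  qed
  show "norm (M x *v w) \<le> 4 * B * norm w" by (rule le')
  show "bmat M" unfolding bmat_def using M le' B by (intro conjI allI exI[of _ "4 * B"]) auto
qed

lemma bmat_measurable: "bmat M \<Longrightarrow> f \<in> borel_measurable borel \<Longrightarrow> (\<lambda>x. M x *v f x) \<in> borel_measurable borel"
  unfolding bmat_def using matrix_vector_measurable by blast

lemma L2_bmat:
  assumes "bmat M" "L2 f"
  shows "L2 (\<lambda>x. M x *v f x)"
proof -
  obtain C where "\<And>x w. norm (M x *v w) \<le> C * norm w" using assms(1) by (auto simp: bmat_def)
  then show ?thesis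
    by (intro L2_dominated[OF assms(2) bmat_measurable[OF assms(1) L2_measurable[OF assms(2)]]])
qed

lemma rep_cls_AE: "L2 f \<Longrightarrow> AE x in lborel. rep_l2 (cls f) x = f x"
  using cls_eq_iff[of "rep_l2 (cls f)" f] by simp

lemma mop_cls:
  assumes "bmat M" "L2 f"
  shows "mop M (cls f) = cls (\<lambda>x. M x *v f x)"
proof -
  have "AE x in lborel. M x *v rep_l2 (cls f) x = M x *v f x"
    using rep_cls_AE[OF assms(2)] by eventually_elim simp
  then show ?thesis unfolding mop_def by (simp add: cls_eq_iff L2_bmat assms)
qed

lemma mop_cong: "(\<And>x. M x = N x) \<Longrightarrow> mop M u = mop N u"
  by (simp add: mop_def)

lemma mop_add: "bmat M \<Longrightarrow> mop M (u + v) = mop M u + mop M v"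
  by (cases u rule: l2_cases; cases v rule: l2_cases)
    (simp add: mop_cls L2_bmat L2_add matrix_vector_right_distrib flip: cls_add)

lemma mop_scaleR: "bmat M \<Longrightarrow> mop M (c *\<^sub>R u) = c *\<^sub>R mop M u"
  by (cases u rule: l2_cases)
    (simp add: mop_cls L2_bmat L2_scaleR matrix_vector_scaleR flip: cls_scaleR)

lemma mop_norm_le:
  assumes "bmat M" "\<And>x w. norm (M x *v w) \<le> C * norm w" "0 \<le> C"
  shows "norm (mop M u) \<le> C * norm u"
proof -
  obtain f where f: "L2 f" "u = cls f" by (rule l2_cases)
  show ?thesis unfolding f(2) mop_cls[OF assms(1) f(1)]
    by (rule cls_norm_le) (use assms f in \<open>auto intro: L2_bmat\<close>)
qed

lemma mop_bounded_linear: 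
  assumes "bmat M"
  shows "bounded_linear (mop M)"
proof -
  obtain C where C: "0 \<le> C" "\<And>x w. norm (M x *v w) \<le> C * norm w" using assms by (auto simp: bmat_def)
  show ?thesis
    by (rule bounded_linear_intro[of _ C])
      (use mop_norm_le[OF assms C(2,1)] mop_add[OF assms] mop_scaleR[OF assms] in \<open>auto simp: mult.commute\<close>)
qed

lemma mop_diff: "bmat M \<Longrightarrow> mop M (u - v) = mop M u - mop M v"
  using linear_simps(2)[OF mop_bounded_linear] by blast

lemma mop_minus: "bmat M \<Longrightarrow> mop M (- u) = - mop M u"
  using linear_simps(4)[OF mop_bounded_linear] by blast

lemma mop_mult:
  assumes "bmat M" "bmat N"
  shows "mop M (mop N u) = mop (\<lambda>x. M x ** N x) u"
  by (cases u rule: l2_cases)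
    (simp add: mop_def mop_cls[unfolded mop_def, OF assms(1) L2_bmat[OF assms(2)]] matrix_vector_mul_assoc)

lemma bmat_mult:
  assumes "bmat M" "bmat N"
  shows "bmat (\<lambda>x. M x ** N x)"
proof -
  obtain C where C: "0 \<le> C" "\<And>x w. norm (M x *v w) \<le> C * norm w" using assms(1) by (auto simp: bmat_def)
  obtain D where D: "0 \<le> D" "\<And>x w. norm (N x *v w) \<le> D * norm w" using assms(2) by (auto simp: bmat_def)
  have "norm ((M x ** N x) *v w) \<le> (C * D) * norm w" for x w
    using order_trans[OF C(2) mult_left_mono[OF D(2) C(1)]]
    by (simp add: mult.assoc flip: matrix_vector_mul_assoc)
  moreover have "(\<lambda>x. (M x ** N x) $ i $ j) \<in> borel_measurable borel" for i j
  proof -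
    have [measurable]: "(\<lambda>x. M x $ i $ j) \<in> borel_measurable borel" "(\<lambda>x. N x $ i $ j) \<in> borel_measurable borel" for i j
      using assms by (auto simp: bmat_def)
    show ?thesis by (simp add: matrix_matrix_mult_def sum_2)
  qed
  ultimately show ?thesis unfolding bmat_def using C D by (intro conjI allI exI[of _ "C * D"]) auto
qed

lemma mop_adjoint:
  assumes "bmat M" "bmat N" "\<And>x w z. inner (M x *v w) z = inner w (N x *v z)"
  shows "inner (mop M u) v = inner u (mop N v)"
  by (cases u rule: l2_cases; cases v rule: l2_cases) (simp add: mop_cls assms cls_inner L2_bmat)

lemma bmat_const [simp]: "bmat (\<lambda>_. M)"
  by (rule bmatI(1)[of _ "norm M"])
    (auto intro: order_trans[OF Finite_Cartesian_Product.norm_nth_le Finite_Cartesian_Product.norm_nth_le])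

subsection \<open>Translations\<close>

definition tr :: "real \<Rightarrow> l2 \<Rightarrow> l2" where
  "tr s u = cls (\<lambda>x. rep_l2 u (x + s))"

lemma L2_shift:
  assumes "L2 f"
  shows "L2 (\<lambda>x. f (x + s))"
proof -
  note [measurable] = L2_measurable[OF assms]
  show ?thesis unfolding L2_def
    using lborel_integrable_real_affine[OF L2_square_integrable[OF assms], of 1 s] by (simp add: add.commute)
qed

lemma integral_shift: 
  fixes f :: "real \<Rightarrow> 'a::{banach, second_countable_topology}"
  shows "(\<integral>x. f (x + s) \<partial>lborel) = (\<integral>x. f x \<partial>lborel)"
  using lborel_integral_real_affine[of 1 f s] by (simp add: add.commute)

lemma tr_cls:
  assumes "L2 f"
  shows "tr s (cls f) = cls (\<lambda>x. f (x + s))"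
proof -
  note [measurable] = L2_measurable[OF assms] L2_measurable[OF L2_rep]
  have "AE x in lborel. rep_l2 (cls f) (s + 1 * x) = f (s + 1 * x)"
    by (rule AE_borel_affine[OF _ _ rep_cls_AE[OF assms]]) auto
  then show ?thesis unfolding tr_def by (simp add: cls_eq_iff L2_shift assms add.commute)
qed

lemma tr_0 [simp]: "tr 0 u = u" by (cases u rule: l2_cases) (simp add: tr_cls)

lemma tr_tr [simp]: "tr s (tr t u) = tr (s + t) u"
  by (cases u rule: l2_cases) (simp add: tr_cls L2_shift add.assoc)

lemma tr_add: "tr s (u + v) = tr s u + tr s v"
  by (cases u rule: l2_cases; cases v rule: l2_cases) (simp add: tr_cls L2_add L2_shift flip: cls_add)

lemma tr_scaleR: "tr s (c *\<^sub>R u) = c *\<^sub>R tr s u"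
  by (cases u rule: l2_cases) (simp add: tr_cls L2_scaleR L2_shift flip: cls_scaleR)

lemma tr_norm [simp]: "norm (tr s u) = norm u"
  by (cases u rule: l2_cases) (simp add: tr_cls cls_norm L2_shift L2norm_def integral_shift[of "\<lambda>x. (norm (_ x))\<^sup>2"])

lemma tr_bounded_linear: "bounded_linear (tr s)"
  by (rule bounded_linear_intro[of _ 1]) (auto simp: tr_add tr_scaleR)

lemma tr_diff: "tr s (u - v) = tr s u - tr s v"
  by (rule linear_simps(2)[OF tr_bounded_linear])

lemma tr_minus: "tr s (- u) = - tr s u"
  by (rule linear_simps(4)[OF tr_bounded_linear])

lemma tr_inner: "inner (tr s u) (tr s v) = inner u v"
  by (cases u rule: l2_cases; cases v rule: l2_cases)
    (simp add: tr_cls cls_inner L2_shift integral_shift[of "\<lambda>x. inner (_ x) (_ x)"])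

lemma tr_adjoint: "inner (tr s u) v = inner u (tr (-s) v)"
  using tr_inner[of s u "tr (-s) v"] by simp

lemma bmat_shift:
  assumes "bmat M"
  shows "bmat (\<lambda>x. M (x + s))"
proof -
  have "(\<lambda>x. M (x + s) $ i $ j) \<in> borel_measurable borel" for i j
    using assms by (intro measurable_compose[of "\<lambda>x. x + s" borel borel "\<lambda>x. M x $ i $ j"]) (auto simp: bmat_def)
  then show ?thesis using assms unfolding bmat_def by blast
qed

lemma tr_mop: "bmat M \<Longrightarrow> tr s (mop M u) = mop (\<lambda>x. M (x + s)) (tr s u)"
  by (cases u rule: l2_cases) (simp add: mop_cls tr_cls L2_bmat L2_shift bmat_shift)

lemma tr_mop_const: "tr s (mop (\<lambda>_. M) u) = mop (\<lambda>_. M) (tr s u)"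
  by (simp add: tr_mop)

lemma tr_tf: "test_function \<phi> \<Longrightarrow> tr s (tf \<phi> e) = tf (\<lambda>x. \<phi> (x + s)) e"
  by (simp add: tf_def tr_cls L2_test)

lemma mop_tf: "test_function \<phi> \<Longrightarrow> mop (\<lambda>_. M) (tf \<phi> e) = tf \<phi> (M *v e)"
  by (simp add: tf_def mop_cls L2_test matrix_vector_scaleR)

lemma tf_add: "test_function \<phi> \<Longrightarrow> test_function \<psi> \<Longrightarrow> tf (\<lambda>x. \<phi> x + \<psi> x) e = tf \<phi> e + tf \<psi> e"
  by (simp add: tf_def scaleR_add_left L2_test flip: cls_add)

lemma tf_scale: "test_function \<phi> \<Longrightarrow> tf (\<lambda>x. c * \<phi> x) e = c *\<^sub>R tf \<phi> e"
  by (simp add: tf_def L2_test flip: cls_scaleR)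

section \<open>Differentiability along translations\<close>

lemma tf_norm_le:
  assumes "test_function \<psi>" "\<And>x. \<bar>\<psi> x\<bar> \<le> c * indicator {-Q..Q} x" "0 \<le> c" "0 \<le> Q"
  shows "norm (tf \<psi> e) \<le> c * (sqrt (2 * Q) * norm e)"
proof (rule power2_le_imp_le)
  have "(norm (tf \<psi> e))\<^sup>2 = (\<integral>x. (norm (\<psi> x *\<^sub>R e))\<^sup>2 \<partial>lborel)"
    by (simp add: tf_def cls_norm_square L2_test assms del: norm_scaleR)
  also have "\<dots> \<le> (\<integral>x. (c * norm e)\<^sup>2 * indicator {-Q..Q} x \<partial>lborel)"
  proof (rule integral_mono)
    show "integrable lborel (\<lambda>x. (norm (\<psi> x *\<^sub>R e))\<^sup>2)" by (intro L2_square_integrable L2_test assms)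
    show "integrable lborel (\<lambda>x. (c * norm e)\<^sup>2 * indicator {-Q..Q} x)"
      by (intro integrable_mult_right integrable_real_indicator) (auto simp: emeasure_lborel_Icc_eq)
    fix x
    have "(\<bar>\<psi> x\<bar> * norm e)\<^sup>2 \<le> (c * indicator {-Q..Q} x * norm e)\<^sup>2"
      by (intro power_mono mult_right_mono assms) auto
    then show "(norm (\<psi> x *\<^sub>R e))\<^sup>2 \<le> (c * norm e)\<^sup>2 * indicator {-Q..Q} x"
      by (auto simp: indicator_def power_mult_distrib split: if_splits)
  qed
  also have "\<dots> = (c * norm e)\<^sup>2 * (2 * Q)" using assms by simp
  also have "\<dots> = (c * (sqrt (2 * Q) * norm e))\<^sup>2" using assms by (simp add: power_mult_distrib)
  finally show "(norm (tf \<psi> e))\<^sup>2 \<le> (c * (sqrt (2 * Q) * norm e))\<^sup>2" .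
qed (use assms in simp)

text \<open>The mean value inequality is applied to the derivative and again to the function minus
  its tangent, which gives B in place of the sharp B / 2.\<close>

lemma taylor1_bound:
  fixes \<phi> :: "real \<Rightarrow> real"
  assumes s: "smooth \<phi>" and B: "\<And>x. \<bar>deriv (deriv \<phi>) x\<bar> \<le> B"
  shows "\<bar>\<phi> (x + h) - \<phi> x - h * deriv \<phi> x\<bar> \<le> B * h\<^sup>2"
proof -
  have B0: "0 \<le> B" using order_trans[OF abs_ge_zero B[of 0]] .
  have "norm (deriv \<phi> z - deriv \<phi> x) \<le> B * norm (z - x)" for z
    by (rule field_differentiable_bound[of UNIV _ "deriv (deriv \<phi>)"])
      (use B smooth_has_derivative[OF smooth_deriv[OF s]] in auto)
  then have le: "norm (deriv \<phi> z - deriv \<phi> x) \<le> B * \<bar>h\<bar>" if "\<bar>z - x\<bar> \<le> \<bar>h\<bar>" for z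
    using order_trans[OF _ mult_left_mono[OF that B0]] by simp
  have "norm ((\<phi> (x + h) - (x + h) * deriv \<phi> x) - (\<phi> x - x * deriv \<phi> x)) \<le> (B * \<bar>h\<bar>) * norm (x + h - x)"
  proof (rule field_differentiable_bound[of "{x - \<bar>h\<bar>..x + \<bar>h\<bar>}" "\<lambda>z. \<phi> z - z * deriv \<phi> x" "\<lambda>z. deriv \<phi> z - deriv \<phi> x"])
    show "((\<lambda>z. \<phi> z - z * deriv \<phi> x) has_real_derivative deriv \<phi> z - deriv \<phi> x) (at z within {x - \<bar>h\<bar>..x + \<bar>h\<bar>})" for z
      by (auto intro!: derivative_eq_intros has_field_derivative_at_within[OF smooth_has_derivative[OF s]])
    show "norm (deriv \<phi> z - deriv \<phi> x) \<le> B * \<bar>h\<bar>" if "z \<in> {x - \<bar>h\<bar>..x + \<bar>h\<bar>}" for z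
      by (rule le) (use that in auto)
  qed auto
  then show ?thesis by (simp add: algebra_simps power2_eq_square)
qed

lemma deriv_smooth_shift:
  assumes "smooth \<phi>"
  shows "deriv (\<lambda>x. \<phi> (x + s)) = (\<lambda>x. deriv \<phi> (x + s))"
proof
  fix x
  have "((\<lambda>x. \<phi> (x + s)) has_real_derivative deriv \<phi> (x + s) * 1) (at x)"
    by (rule DERIV_chain2[OF smooth_has_derivative[OF assms]]) (auto intro!: derivative_eq_intros)
  then show "deriv (\<lambda>x. \<phi> (x + s)) x = deriv \<phi> (x + s)" by (simp add: DERIV_imp_deriv)
qed

lemma test_derivative_bounded:
  assumes "test_function \<phi>"
  obtains R B where "0 < R" "0 \<le> B" "\<And>x. \<bar>x\<bar> > R \<Longrightarrow> \<phi> x = 0"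
    "\<And>x. \<bar>deriv (deriv \<phi>) x\<bar> \<le> B" "\<And>x. \<bar>x\<bar> > R \<Longrightarrow> deriv \<phi> x = 0"
    "\<And>x. \<bar>x\<bar> > R \<Longrightarrow> deriv (deriv \<phi>) x = 0" "\<And>x. \<bar>deriv (deriv (deriv \<phi>)) x\<bar> \<le> B"
proof -
  obtain R B where RB: "0 < R" "0 \<le> B" "\<And>x. \<bar>\<phi> x\<bar> \<le> B * indicator {-R..R} x"
    using test_function_bounded[OF assms] by blast
  have 0: "\<phi> x = 0" if "\<bar>x\<bar> > R" for x
  proof -
    have "indicator {-R..R} x = (0 :: real)" using that by (auto simp: indicator_def)
    then show ?thesis using RB(3)[of x] by simp
  qed
  have 1: "deriv \<phi> x = 0" if "\<bar>x\<bar> > R" for x by (rule deriv_eq_0_outside[OF 0 that])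
  have 2: "deriv (deriv \<phi>) x = 0" if "\<bar>x\<bar> > R" for x by (rule deriv_eq_0_outside[OF 1 that])
  obtain R2 B2 where RB2: "0 \<le> B2" "\<And>x. \<bar>deriv (deriv \<phi>) x\<bar> \<le> B2 * indicator {-R2..R2} x"
    using test_function_bounded[OF test_function_deriv[OF test_function_deriv[OF assms]]] by metis
  obtain R3 B3 where RB3: "0 \<le> B3" "\<And>x. \<bar>deriv (deriv (deriv \<phi>)) x\<bar> \<le> B3 * indicator {-R3..R3} x"
    using test_function_bounded[OF test_function_deriv[OF test_function_deriv[OF test_function_deriv[OF assms]]]] by metis
  have "\<bar>deriv (deriv \<phi>) x\<bar> \<le> max B2 B3" "\<bar>deriv (deriv (deriv \<phi>)) x\<bar> \<le> max B2 B3" for x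
    using order_trans[OF RB2(2)[of x] mult_left_mono[OF indicator_le_1 RB2(1)]]
      order_trans[OF RB3(2)[of x] mult_left_mono[OF indicator_le_1 RB3(1)]] by auto
  then show ?thesis using that[of R "max B2 B3"] RB(1) RB2(1) 0 1 2 by auto
qed

lemma has_vector_derivative_if_quadratic:
  fixes f :: "real \<Rightarrow> 'a::real_normed_vector"
  assumes "\<And>h. \<bar>h\<bar> \<le> 1 \<Longrightarrow> norm (f (s + h) - f s - h *\<^sub>R f') \<le> K * h\<^sup>2"
  shows "(f has_vector_derivative f') (at s)"
  unfolding has_vector_derivative_def has_derivative_iff_norm
proof
  show "bounded_linear (\<lambda>h. h *\<^sub>R f')" by (rule bounded_linear_scaleR_left)
  show "((\<lambda>y. norm (f y - f s - (y - s) *\<^sub>R f') / norm (y - s)) \<longlongrightarrow> 0) (at s)"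
  proof (rule tendsto_sandwich)
    show "\<forall>\<^sub>F y in at s. 0 \<le> norm (f y - f s - (y - s) *\<^sub>R f') / norm (y - s)" by simp
    show "\<forall>\<^sub>F y in at s. norm (f y - f s - (y - s) *\<^sub>R f') / norm (y - s) \<le> K * \<bar>y - s\<bar>"
    proof -
      have "\<forall>\<^sub>F y in at s. dist y s < 1" by (rule eventually_at_ball'[of 1 s UNIV, simplified, THEN eventually_mono]) (auto simp: dist_commute)
      then show ?thesis
        unfolding eventually_at_filter
      proof eventually_elim
        case (elim y)
        show ?case
        proof (intro impI)
          assume "y \<noteq> s"
          then have "norm (f y - f s - (y - s) *\<^sub>R f') \<le> K * (y - s)\<^sup>2"
            using assms[of "y - s"] elim by (simp add: dist_real_def)
          also have "\<dots> = K * \<bar>y - s\<bar> * \<bar>y - s\<bar>"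
            by (simp only: power2_abs[of "y - s", symmetric] power2_eq_square mult.assoc)
          finally show "norm (f y - f s - (y - s) *\<^sub>R f') / norm (y - s) \<le> K * \<bar>y - s\<bar>"
            using \<open>y \<noteq> s\<close> by (simp add: divide_le_eq)
        qed
      qed
    qed
    show "((\<lambda>y. K * \<bar>y - s\<bar>) \<longlongrightarrow> 0) (at s)" by (rule tendsto_eq_intros refl | simp)+
  qed simp
qed

text \<open>The derivative in \<open>L\<^sup>2\<close>, as the generator of the translations; it agrees with the weak derivative,
  and allows integration along the translation group instead of pointwise representatives.\<close>

definition wd :: "l2 \<Rightarrow> l2 \<Rightarrow> bool" where
  "wd u u' \<longleftrightarrow> (\<forall>s. ((\<lambda>s. tr s u) has_vector_derivative tr s u') (at s))"

text \<open>The first order Taylor remainder is bounded by B h^2 and, for |h| at most 1, supported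
  in a fixed interval, so its L^2 norm is of order h^2.\<close>

lemma wd_tf:
  assumes "test_function \<phi>"
  shows "wd (tf \<phi> e) (tf (deriv \<phi>) e)"
  unfolding wd_def
proof
  fix s
  obtain R B where RB: "0 < R" "0 \<le> B" "\<And>x. \<bar>x\<bar> > R \<Longrightarrow> \<phi> x = 0" "\<And>x. \<bar>deriv (deriv \<phi>) x\<bar> \<le> B"
    "\<And>x. \<bar>x\<bar> > R \<Longrightarrow> deriv \<phi> x = 0" using test_derivative_bounded[OF assms] by metis
  show "((\<lambda>s. tr s (tf \<phi> e)) has_vector_derivative tr s (tf (deriv \<phi>) e)) (at s)"
  proof (rule has_vector_derivative_if_quadratic)
    fix h :: real assume h: "\<bar>h\<bar> \<le> 1"
    define \<psi> where "\<psi> x = \<phi> (x + h) + ((-1) * \<phi> x + (- h) * deriv \<phi> x)" for x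
    have \<psi>: "test_function \<psi>" unfolding \<psi>_def
      by (intro test_function_add test_function_shift test_function_scale test_function_deriv assms)
    have "tr (s + h) (tf \<phi> e) - tr s (tf \<phi> e) - h *\<^sub>R tr s (tf (deriv \<phi>) e) = tr s (tf \<psi> e)"
    proof -
      have "tf \<psi> e = tf (\<lambda>x. \<phi> (x + h)) e + tf (\<lambda>x. (-1) * \<phi> x + (- h) * deriv \<phi> x) e"
        unfolding \<psi>_def
        by (intro tf_add test_function_add test_function_shift test_function_scale test_function_deriv assms)
      also have "tf (\<lambda>x. (-1) * \<phi> x + (- h) * deriv \<phi> x) e = tf (\<lambda>x. (-1) * \<phi> x) e + tf (\<lambda>x. (- h) * deriv \<phi> x) e"
        by (intro tf_add test_function_scale test_function_deriv assms)
      also have "\<dots> = (-1) *\<^sub>R tf \<phi> e + (- h) *\<^sub>R tf (deriv \<phi>) e"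
        by (intro arg_cong2[where f = plus] tf_scale test_function_deriv assms)
      finally show ?thesis
        by (simp add: tr_add tr_scaleR tr_minus tr_diff flip: tr_tf[OF assms])
    qed
    moreover have "norm (tf \<psi> e) \<le> (B * h\<^sup>2) * (sqrt (2 * (R + 1)) * norm e)"
    proof (rule tf_norm_le[OF \<psi>])
      show "\<bar>\<psi> x\<bar> \<le> B * h\<^sup>2 * indicator {-(R+1)..R+1} x" for x
      proof (cases "\<bar>x\<bar> \<le> R + 1")
        case True
        then show ?thesis using taylor1_bound[OF test_function_smooth[OF assms] RB(4), of x h] by (simp add: \<psi>_def abs_le_iff)
      next
        case False
        then have "\<bar>x + h\<bar> > R" "\<bar>x\<bar> > R" using h by auto
        then show ?thesis using False RB(2) by (simp add: \<psi>_def RB(3,5))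
      qed
    qed (use RB in auto)
    ultimately show "norm (tr (s + h) (tf \<phi> e) - tr s (tf \<phi> e) - h *\<^sub>R tr s (tf (deriv \<phi>) e)) \<le> B * (sqrt (2 * (R + 1)) * norm e) * h\<^sup>2"
      by (simp add: mult_ac)
  qed
qed

text \<open>Orbits of test functions are differentiable, hence continuous; translations are
  isometries, so continuity extends to all of L^2 by density.\<close>

lemma tr_continuous: "continuous_on UNIV (\<lambda>s. tr s u)"
  unfolding continuous_on_iff
proof (intro ballI allI impI)
  fix s \<epsilon> :: real assume "\<epsilon> > 0"
  have "u \<in> closure (span {tf \<phi> e | \<phi> e. test_function \<phi>})" unfolding tf_dense by simp
  then obtain p where p: "p \<in> span {tf \<phi> e | \<phi> e. test_function \<phi>}" "dist p u < \<epsilon> / 4"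
    unfolding closure_approachable using \<open>\<epsilon> > 0\<close> by (meson divide_pos_pos zero_less_numeral)
  have "continuous_on UNIV (\<lambda>s. tr s p)" using p(1)
  proof (induction rule: span_induct_alt)
    case base
    show ?case using linear_0[OF bounded_linear.linear[OF tr_bounded_linear]] by simp
  next
    case (step c x y)
    then obtain \<phi> e where x: "x = tf \<phi> e" "test_function \<phi>" by auto
    have "continuous_on UNIV (\<lambda>s. tr s x)"
      by (rule continuous_on_if_has_vector_derivative) (use wd_tf[OF x(2)] in \<open>auto simp: wd_def x(1)\<close>)
    then show ?case unfolding tr_add tr_scaleR by (intro continuous_intros step)
  qed
  then obtain d where d: "d > 0" "\<And>s'. dist s' s < d \<Longrightarrow> dist (tr s' p) (tr s p) < \<epsilon> / 2"
    unfolding continuous_on_iff using \<open>\<epsilon> > 0\<close> by (meson UNIV_I half_gt_zero)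
  show "\<exists>d>0. \<forall>s'\<in>UNIV. dist s' s < d \<longrightarrow> dist (tr s' u) (tr s u) < \<epsilon>"
  proof (intro exI[of _ d] conjI d(1) ballI impI)
    fix s' assume "dist s' s < d"
    then have "dist (tr s' p) (tr s p) < \<epsilon> / 2" by (rule d(2))
    moreover have e: "dist (tr s p) (tr s u) = dist p u" for s by (simp add: dist_norm flip: tr_diff)
    ultimately show "dist (tr s' u) (tr s u) < \<epsilon>"
      using p(2) e[of s] e[of s'] dist_triangle[of "tr s' u" "tr s u" "tr s' p"] dist_triangle[of "tr s' p" "tr s u" "tr s p"]
        dist_commute[of "tr s' u" "tr s' p"] by linarith
  qed
qed

lemma tr_continuous_compose:
  assumes g: "continuous_on X g" and f: "continuous_on X f"
  shows "continuous_on X (\<lambda>t. tr (f t) (g t))"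
  unfolding continuous_on_def
proof
  fix t assume "t \<in> X"
  have "((\<lambda>s. tr (f s) (g t)) \<longlongrightarrow> tr (f t) (g t)) (at t within X)"
    using continuous_on_compose2[OF tr_continuous f] \<open>t \<in> X\<close> by (auto simp: continuous_on_def)
  moreover have "((\<lambda>s. tr (f s) (g s - g t)) \<longlongrightarrow> 0) (at t within X)"
  proof (rule tendsto_norm_zero_cancel)
    have "((\<lambda>s. norm (g s - g t)) \<longlongrightarrow> 0) (at t within X)"
      using g \<open>t \<in> X\<close> by (auto simp: continuous_on_def intro!: tendsto_norm_zero LIM_zero)
    then show "((\<lambda>s. norm (tr (f s) (g s - g t))) \<longlongrightarrow> 0) (at t within X)" by simp
  qed
  ultimately have "((\<lambda>s. tr (f s) (g t) + tr (f s) (g s - g t)) \<longlongrightarrow> tr (f t) (g t) + 0) (at t within X)"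
    by (rule tendsto_add)
  then show "((\<lambda>s. tr (f s) (g s)) \<longlongrightarrow> tr (f t) (g t)) (at t within X)" by (simp add: tr_diff)
qed

text \<open>Tested with translated test functions, the weak derivative expresses increments of the
  translation orbit of \<open>f\<close> as integrals over the orbit of \<open>g\<close>. Test
  functions are total, so this is an identity in L^2, and continuity of the orbit of
  \<open>g\<close> allows it to be differentiated.\<close>

lemma wd_weak_derivative:
  assumes f: "L2 f" and g: "L2 g" and w: "weak_derivative f g"
  shows "wd (cls f) (cls g)"
proof -
  have inc: "tr b (cls f) - tr a (cls f) = integral {a..b} (\<lambda>s. tr s (cls g))" if "a \<le> b" for a b
  proof -
    let ?I = "integral {a..b} (\<lambda>s. tr s (cls g))"
    have int: "(\<lambda>s. tr s (cls g)) integrable_on {a..b}"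
      by (intro integrable_continuous_real continuous_on_subset[OF tr_continuous]) auto
    have "tr b (cls f) - tr a (cls f) - ?I = 0"
    proof (rule tf_total)
      fix \<phi> e assume \<phi>: "test_function \<phi>"
      have sh: "test_function (\<lambda>x. \<phi> (x + s))" for s by (rule test_function_shift[OF \<phi>])
      have dsh: "deriv (\<lambda>x. \<phi> (x + s)) = (\<lambda>x. deriv \<phi> (x + s))" for s
        by (rule deriv_smooth_shift[OF test_function_smooth[OF \<phi>]])
      have "((\<lambda>s. inner (tf \<phi> e) (tr s (cls f))) has_vector_derivative inner (tf \<phi> e) (tr s (cls g))) (at s within {a..b})" for s
      proof -
        have "((\<lambda>s. - s) has_vector_derivative - 1) (at s)" by (auto intro!: derivative_eq_intros)
        from vector_diff_chain_at[OF this wd_tf[OF \<phi>, unfolded wd_def, rule_format]]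
        have "((\<lambda>s. tr (- s) (tf \<phi> e)) has_vector_derivative - tr (- s) (tf (deriv \<phi>) e)) (at s)" by (simp add: o_def)
        from bounded_linear.has_vector_derivative[OF bounded_linear_inner_left this, of "cls f"]
        have "((\<lambda>s. inner (tr (- s) (tf \<phi> e)) (cls f)) has_vector_derivative - inner (tr (- s) (tf (deriv \<phi>) e)) (cls f)) (at s)" by simp
        moreover have "inner (tr (- s) (tf (deriv \<phi>) e)) (cls f) = - inner (tr (- s) (tf \<phi> e)) (cls g)"
        proof -
          have "inner (tr (- s) (tf (deriv \<phi>) e)) (cls f) = inner e (\<integral>x. deriv \<phi> (x + - s) *\<^sub>R f x \<partial>lborel)"
            unfolding tr_tf[OF test_function_deriv[OF \<phi>]]
            by (rule tf_inner[OF test_function_shift[OF test_function_deriv[OF \<phi>]] f])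
          moreover have "inner (tr (- s) (tf \<phi> e)) (cls g) = inner e (\<integral>x. \<phi> (x + - s) *\<^sub>R g x \<partial>lborel)"
            unfolding tr_tf[OF \<phi>] by (rule tf_inner[OF sh g])
          ultimately show ?thesis
            using w[unfolded weak_derivative_def, rule_format, OF sh[of "- s"], unfolded dsh] by simp
        qed
        ultimately have "((\<lambda>s. inner (tr (- s) (tf \<phi> e)) (cls f)) has_vector_derivative inner (tr (- s) (tf \<phi> e)) (cls g)) (at s)" by simp
        then have "((\<lambda>s. inner (tf \<phi> e) (tr s (cls f))) has_vector_derivative inner (tf \<phi> e) (tr s (cls g))) (at s)"
          by (simp add: tr_adjoint)
        then show ?thesis by (rule has_vector_derivative_at_within)
      qed
      from fundamental_theorem_of_calculus[OF that this]
      have "((\<lambda>s. inner (tf \<phi> e) (tr s (cls g))) has_integral inner (tf \<phi> e) (tr b (cls f)) - inner (tf \<phi> e) (tr a (cls f))) {a..b}" .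
      moreover have "((\<lambda>s. inner (tf \<phi> e) (tr s (cls g))) has_integral inner (tf \<phi> e) ?I) {a..b}"
        using has_integral_linear[OF integrable_integral[OF int] bounded_linear_inner_right] by (simp add: o_def)
      ultimately show "inner (tf \<phi> e) (tr b (cls f) - tr a (cls f) - ?I) = 0"
        using has_integral_unique by (auto simp: inner_diff_right)
    qed
    then show ?thesis by simp
  qed
  show ?thesis unfolding wd_def
  proof
    fix s
    have c: "continuous_on {s-1..s+1} (\<lambda>s. tr s (cls g))"
      by (intro continuous_on_subset[OF tr_continuous]) auto
    have "((\<lambda>u. integral {s-1..u} (\<lambda>s. tr s (cls g))) has_vector_derivative tr s (cls g)) (at s within {s-1..s+1})"
      by (rule integral_has_vector_derivative[OF c]) simp
    then have "((\<lambda>u. tr (s-1) (cls f) + integral {s-1..u} (\<lambda>s. tr s (cls g))) has_vector_derivative 0 + tr s (cls g)) (at s within {s-1..s+1})"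
      by (intro has_vector_derivative_add has_vector_derivative_const)
    then have "((\<lambda>u. tr u (cls f)) has_vector_derivative 0 + tr s (cls g)) (at s within {s-1..s+1})"
    proof (rule has_vector_derivative_transform[rotated -1])
      show "tr u (cls f) = tr (s-1) (cls f) + integral {s-1..u} (\<lambda>s. tr s (cls g))" if "u \<in> {s-1..s+1}" for u
        using inc[of "s-1" u] that by (simp add: algebra_simps)
    qed simp
    then show "((\<lambda>u. tr u (cls f)) has_vector_derivative tr s (cls g)) (at s)"
      using at_within_interior[of s "{s-1..s+1}"] by simp
  qed
qed

subsection \<open>Calculus with weak derivatives\<close>

lemma wd_add: "wd u u' \<Longrightarrow> wd v v' \<Longrightarrow> wd (u + v) (u' + v')"
  unfolding wd_def tr_add by (auto intro: has_vector_derivative_add)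

lemma wd_bounded_linear:
  assumes "wd u u'" "bounded_linear A" "\<And>s u. tr s (A u) = A (tr s u)"
  shows "wd (A u) (A u')"
  using assms(1) unfolding wd_def assms(3) by (auto intro: bounded_linear.has_vector_derivative[OF assms(2)])

lemma wd_scaleR: "wd u u' \<Longrightarrow> wd (c *\<^sub>R u) (c *\<^sub>R u')"
  by (rule wd_bounded_linear) (auto intro: bounded_linear_scaleR_right simp: tr_scaleR)

lemma wd_mop: "wd u u' \<Longrightarrow> wd (mop (\<lambda>_. M) u) (mop (\<lambda>_. M) u')"
  by (rule wd_bounded_linear) (auto intro: mop_bounded_linear simp: tr_mop_const)

lemma wd_at_0: "wd u u' \<Longrightarrow> ((\<lambda>s. tr s u) has_vector_derivative u') (at 0)"
  unfolding wd_def by (metis tr_0)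

lemma wd_unique: "wd u v \<Longrightarrow> wd u w \<Longrightarrow> v = w"
  using vector_derivative_unique_at wd_at_0 by blast

lemma wd_zero: "wd 0 0"
  using wd_scaleR[OF wd_tf[OF test_function_bump[of 0 0 0], of 0], of 0] by simp

text \<open>Translations preserve the inner product; differentiating this constant at 0 is
  integration by parts, with no boundary terms to discuss.\<close>

lemma wd_by_parts:
  assumes "wd u u'" "wd v v'"
  shows "inner u' v = - inner u v'"
proof -
  have "((\<lambda>s. inner (tr s u) (tr s v)) has_vector_derivative (inner (tr 0 u) v' + inner u' (tr 0 v))) (at 0)"
    by (rule bounded_bilinear.has_vector_derivative[OF bounded_bilinear_inner]; rule wd_at_0; fact)
  then have "((\<lambda>s. inner u v) has_vector_derivative (inner u v' + inner u' v)) (at (0::real))"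
    by (simp add: tr_inner)
  then have "inner u v' + inner u' v = 0"
    using vector_derivative_unique_at[OF _ has_vector_derivative_const] by blast
  then show ?thesis by simp
qed

lemma wd_norm_le:
  assumes "wd u u'"
  shows "norm (tr s u - u) \<le> \<bar>s\<bar> * norm u'"
proof -
  have "norm (tr s u - tr 0 u) \<le> norm u' * norm (s - 0)"
  proof (rule differentiable_bound[of UNIV "\<lambda>s. tr s u" "\<lambda>s h. h *\<^sub>R tr s u'"])
    show "((\<lambda>s. tr s u) has_derivative (\<lambda>h. h *\<^sub>R tr s u')) (at s within UNIV)" for s
      using assms unfolding wd_def has_vector_derivative_def by auto
    show "onorm (\<lambda>h. h *\<^sub>R tr s u') \<le> norm u'" for s
      by (rule onorm_le) (simp add: mult.commute)
  qed auto
  then show ?thesis by (simp add: mult.commute)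
qed

subsection \<open>The free evolution\<close>

text \<open>Multiplication by i \<sigma>3 is a complex structure that is skew for the real inner
  product. In these terms the free equation has generator \<open>J\<close> times the second
  derivative, and the phases exp (i \<sigma>3 \<theta>) are rotations.\<close>

definition jm :: "complex ^ 2 ^ 2" where "jm = mat \<i> ** sigma3"

abbreviation "J \<equiv> mop (\<lambda>_. jm)"

lemma mat_mv: "(mat c :: complex ^ 2 ^ 2) *v w = c *s w"
  by (simp add: vec_eq_iff matrix_vector_2 mat_def forall_2)

lemma sigma3_mv: "(sigma3 *v w) $ 1 = w $ 1" "(sigma3 *v w) $ 2 = - (w $ 2)"
  by (simp_all add: matrix_vector_2 sigma3_def)

lemma jm_mv: "jm *v w = \<i> *s (sigma3 *v w)"
  unfolding jm_def by (simp flip: matrix_vector_mul_assoc add: mat_mv)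

lemma jm_skew: "inner (jm *v w) z = - inner w (jm *v z)"
  by (simp add: jm_mv inner_vec_def sum_2 sigma3_mv inner_complex_def)

lemma jm_jm: "jm *v (jm *v w) = - w"
  by (simp add: vec_eq_iff forall_2 jm_mv sigma3_mv flip: mult.assoc)

lemma J_skew: "inner (J u) v = - inner u (J v)"
proof -
  have "(mat (-1) ** jm) *v z = - (jm *v z)" for z
    by (simp flip: matrix_vector_mul_assoc add: mat_mv)
  then have "inner (J u) v = inner u (mop (\<lambda>_. mat (-1) ** jm) v)"
    by (intro mop_adjoint) (simp_all add: jm_skew)
  also have "mop (\<lambda>_. mat (-1) ** jm) v = - J v"
    using \<open>\<And>z. (mat (-1) ** jm) *v z = - (jm *v z)\<close>
    by (cases v rule: l2_cases) (simp add: mop_cls L2_bmat flip: cls_minus)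
  finally show ?thesis by simp
qed

lemma J_J: "J (J u) = - u"
  by (cases u rule: l2_cases) (simp add: mop_cls L2_bmat jm_jm cls_minus)

lemma bounded_linear_J: "bounded_linear J" by (simp add: mop_bounded_linear)

lemma tr_J: "tr s (J u) = J (tr s u)" by (rule tr_mop_const)

definition fd :: "nat \<Rightarrow> (real \<Rightarrow> real) \<Rightarrow> real \<Rightarrow> real" where
  "fd n \<phi> x = (real (Suc n))\<^sup>2 * (\<phi> (x + 1 / real (Suc n)) + (\<phi> (x + - (1 / real (Suc n))) + (- 2) * \<phi> x))"

text \<open>\<open>An n\<close> and \<open>core\<close> approximate and represent the operator \<open>i \<sigma>\<^sub>3 \<partial>\<^sup>2\<close>.\<close>

definition An :: "nat \<Rightarrow> l2 \<Rightarrow> l2" where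
  "An n u = (real (Suc n))\<^sup>2 *\<^sub>R J (tr (1 / real (Suc n)) u + (tr (- (1 / real (Suc n))) u + (- 2) *\<^sub>R u))"

definition core :: "(l2 \<times> l2) set" where
  "core = span {(tf \<phi> e, tf (deriv (deriv \<phi>)) (jm *v e)) | \<phi> e. test_function \<phi>}"

lemma fd_test: "test_function \<phi> \<Longrightarrow> test_function (fd n \<phi>)"
  unfolding fd_def by (intro test_function_scale test_function_add test_function_shift)

lemma An_tf:
  assumes "test_function \<phi>"
  shows "An n (tf \<phi> e) = tf (fd n \<phi>) (jm *v e)"
proof -
  let ?a = "1 / real (Suc n)"
  let ?\<psi> = "\<lambda>x. \<phi> (x + ?a) + (\<phi> (x + - ?a) + (- 2) * \<phi> x)"
  note ti = test_function_add test_function_shift test_function_scale assms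
  have "tf ?\<psi> e = tf (\<lambda>x. \<phi> (x + ?a)) e + tf (\<lambda>x. \<phi> (x + - ?a) + (- 2) * \<phi> x) e"
    by (intro tf_add ti)
  also have "tf (\<lambda>x. \<phi> (x + - ?a) + (- 2) * \<phi> x) e = tf (\<lambda>x. \<phi> (x + - ?a)) e + tf (\<lambda>x. (- 2) * \<phi> x) e"
    by (intro tf_add ti)
  also have "tf (\<lambda>x. (- 2) * \<phi> x) e = (- 2) *\<^sub>R tf \<phi> e" by (intro tf_scale ti)
  finally have "An n (tf \<phi> e) = (real (Suc n))\<^sup>2 *\<^sub>R J (tf ?\<psi> e)"
    unfolding An_def tr_tf[OF assms] by (simp only:)
  also have "J (tf ?\<psi> e) = tf ?\<psi> (jm *v e)" by (intro mop_tf ti)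
  also have "(real (Suc n))\<^sup>2 *\<^sub>R \<dots> = tf (fd n \<phi>) (jm *v e)"
    unfolding fd_def by (intro tf_scale[symmetric] ti)
  finally show ?thesis .
qed

lemma deriv_fd:
  assumes "smooth \<phi>"
  shows "deriv (fd n \<phi>) = fd n (deriv \<phi>)"
proof
  fix x
  have d: "((\<lambda>x. \<phi> (x + s)) has_real_derivative deriv \<phi> (x + s)) (at x)" for s
  proof -
    have "((\<lambda>x. \<phi> (x + s)) has_real_derivative deriv \<phi> (x + s) * 1) (at x)"
      by (rule DERIV_chain2[OF smooth_has_derivative[OF assms]]) (auto intro!: derivative_eq_intros)
    then show ?thesis by simp
  qed
  show "deriv (fd n \<phi>) x = fd n (deriv \<phi>) x"
    unfolding fd_def by (intro DERIV_imp_deriv DERIV_cmult DERIV_add d smooth_has_derivative[OF assms])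
qed

text \<open>Differentiated in the step z, the error of the symmetric second difference is a
  difference of two first order Taylor remainders of \<open>deriv \<phi>\<close>, each at most B
  z^2; the mean value inequality adds one power of h.\<close>

lemma taylor2_bound:
  assumes s: "smooth \<phi>" and B: "\<And>x. \<bar>deriv (deriv (deriv \<phi>)) x\<bar> \<le> B"
  shows "\<bar>\<phi> (x + h) + \<phi> (x - h) - 2 * \<phi> x - h\<^sup>2 * deriv (deriv \<phi>) x\<bar> \<le> 2 * B * \<bar>h\<bar> ^ 3"
proof -
  have B0: "0 \<le> B" using order_trans[OF abs_ge_zero B[of 0]] .
  define k where "k z = \<phi> (x + z) + \<phi> (x - z) - 2 * \<phi> x - z\<^sup>2 * deriv (deriv \<phi>) x" for z
  define k' where "k' z = deriv \<phi> (x + z) - deriv \<phi> (x - z) - 2 * z * deriv (deriv \<phi>) x" for z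
  have "norm (k h - k 0) \<le> (2 * B * h\<^sup>2) * norm (h - 0)"
  proof (rule field_differentiable_bound[of "{-\<bar>h\<bar>..\<bar>h\<bar>}" k k'])
    have "(k has_real_derivative k' z) (at z)" for z
      unfolding k_def k'_def
      by (auto intro!: derivative_eq_intros DERIV_chain2[OF smooth_has_derivative[OF s]])
    then show "(k has_field_derivative k' z) (at z within {-\<bar>h\<bar>..\<bar>h\<bar>})" for z
      by (rule has_field_derivative_at_within)
    show "norm (k' z) \<le> 2 * B * h\<^sup>2" if "z \<in> {-\<bar>h\<bar>..\<bar>h\<bar>}" for z
    proof -
      have "\<bar>k' z\<bar> \<le> 2 * B * z\<^sup>2"
        using taylor1_bound[OF smooth_deriv[OF s] B, of x z] taylor1_bound[OF smooth_deriv[OF s] B, of x "-z"]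
        unfolding k'_def by simp
      also have "z\<^sup>2 \<le> h\<^sup>2" using that by (simp add: abs_le_square_iff[symmetric] abs_le_iff)
      finally show ?thesis using B0 by (simp add: mult_left_mono)
    qed
  qed auto
  then show ?thesis by (simp add: k_def power3_eq_cube power2_eq_square mult.assoc)
qed

text \<open>The consistency error is of order h = 1 / (n + 1) pointwise, and since the step is at
  most 1 it lives in the support enlarged by 1; hence it is of order h in L^2.\<close>

lemma An_tf_tendsto:
  assumes "test_function \<phi>"
  shows "(\<lambda>n. An n (tf \<phi> e)) \<longlonglongrightarrow> tf (deriv (deriv \<phi>)) (jm *v e)"
proof -
  obtain R B where RB: "0 < R" "0 \<le> B" "\<And>x. \<bar>x\<bar> > R \<Longrightarrow> \<phi> x = 0"
    "\<And>x. \<bar>x\<bar> > R \<Longrightarrow> deriv (deriv \<phi>) x = 0" "\<And>x. \<bar>deriv (deriv (deriv \<phi>)) x\<bar> \<le> B"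
    using test_derivative_bounded[OF assms] by metis
  have t2: "test_function (deriv (deriv \<phi>))" by (intro test_function_deriv assms)
  define K where "K = sqrt (2 * (R + 1)) * norm (jm *v e)"
  have le: "norm (An n (tf \<phi> e) - tf (deriv (deriv \<phi>)) (jm *v e)) \<le> 2 * B * (1 / real (Suc n)) * K" for n
  proof -
    define h where "h = 1 / real (Suc n)"
    have h: "0 < h" "h \<le> 1" by (auto simp: h_def)
    define \<psi> where "\<psi> x = fd n \<phi> x + (-1) * deriv (deriv \<phi>) x" for x
    have \<psi>: "test_function \<psi>" unfolding \<psi>_def by (intro test_function_add test_function_scale fd_test assms t2)
    have "tf \<psi> (jm *v e) = tf (fd n \<phi>) (jm *v e) + tf (\<lambda>x. (-1) * deriv (deriv \<phi>) x) (jm *v e)"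
      unfolding \<psi>_def by (intro tf_add test_function_scale fd_test assms t2)
    also have "\<dots> = An n (tf \<phi> e) - tf (deriv (deriv \<phi>)) (jm *v e)"
      by (simp add: tf_scale[OF t2, of "-1", simplified] An_tf[OF assms])
    finally have eq: "An n (tf \<phi> e) - tf (deriv (deriv \<phi>)) (jm *v e) = tf \<psi> (jm *v e)" ..
    have "norm (tf \<psi> (jm *v e)) \<le> (2 * B * h) * (sqrt (2 * (R + 1)) * norm (jm *v e))"
    proof (rule tf_norm_le[OF \<psi>])
      fix x
      have \<psi>x: "h\<^sup>2 * \<psi> x = \<phi> (x + h) + \<phi> (x - h) - 2 * \<phi> x - h\<^sup>2 * deriv (deriv \<phi>) x"
      proof -
        have "h\<^sup>2 * (real (Suc n))\<^sup>2 = 1" by (simp add: h_def power_divide del: of_nat_Suc)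
        then have "h\<^sup>2 * fd n \<phi> x = \<phi> (x + h) + (\<phi> (x + - h) + (- 2) * \<phi> x)"
          unfolding fd_def h_def[symmetric] by (simp only: mult.assoc[symmetric]) simp
        then show ?thesis by (simp add: \<psi>_def algebra_simps)
      qed
      show "\<bar>\<psi> x\<bar> \<le> 2 * B * h * indicator {-(R+1)..R+1} x"
      proof (cases "\<bar>x\<bar> \<le> R + 1")
        case True
        have "h\<^sup>2 * \<bar>\<psi> x\<bar> = \<bar>h\<^sup>2 * \<psi> x\<bar>" by (simp add: abs_mult)
        also have "\<dots> \<le> 2 * B * \<bar>h\<bar> ^ 3" unfolding \<psi>x by (rule taylor2_bound[OF test_function_smooth[OF assms] RB(5)])
        also have "\<dots> = h\<^sup>2 * (2 * B * h)" using h by (simp add: power3_eq_cube power2_eq_square)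
        finally show ?thesis using True h by (simp add: abs_le_iff)
      next
        case False
        then have "\<bar>x + h\<bar> > R" "\<bar>x - h\<bar> > R" "\<bar>x\<bar> > R" using h by auto
        then have "h\<^sup>2 * \<psi> x = 0" unfolding \<psi>x by (simp add: RB)
        then show ?thesis using h RB(2) by simp
      qed
    qed (use RB h in auto)
    then show ?thesis by (simp add: eq K_def h_def)
  qed
  have "(\<lambda>n. 2 * B * (1 / real (Suc n)) * K) \<longlonglongrightarrow> 2 * B * 0 * K"
    using LIMSEQ_Suc[OF lim_const_over_n[of "1::real"]] by (intro tendsto_intros)
  then have "(\<lambda>n. An n (tf \<phi> e) - tf (deriv (deriv \<phi>)) (jm *v e)) \<longlonglongrightarrow> 0"
    by (intro Lim_null_comparison[OF always_eventually[OF allI[OF le]]]) simp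
  then show ?thesis by (rule LIM_zero_cancel)
qed

lemma An_bounded_linear: "bounded_linear (An n)"
  unfolding An_def
  by (intro bounded_linear_const_scaleR[THEN bounded_linear_compose, unfolded o_def]
     bounded_linear_compose[OF bounded_linear_scaleR_right] bounded_linear_compose[OF bounded_linear_J]
     bounded_linear_add tr_bounded_linear bounded_linear_scaleR_right)

lemma fst_core: "fst ` core = span {tf \<phi> e | \<phi> e. test_function \<phi>}"
proof -
  have "fst ` core = span (fst ` {(tf \<phi> e, tf (deriv (deriv \<phi>)) (jm *v e)) | \<phi> e. test_function \<phi>})"
    unfolding core_def by (rule linear_span_image[symmetric]) (simp add: bounded_linear.linear bounded_linear_fst)
  also have "fst ` {(tf \<phi> e, tf (deriv (deriv \<phi>)) (jm *v e)) | \<phi> e. test_function \<phi>} = {tf \<phi> e | \<phi> e. test_function \<phi>}"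
    by force
  finally show ?thesis .
qed

text \<open>Translations commute with each other and with \<open>J\<close>, which gives commutation;
  the adjoint of a translation is the opposite translation, so the symmetric difference is
  self-adjoint and the factor \<open>J\<close> makes it skew. Core pairs go to core pairs because
  differences commute with derivatives.\<close>

interpretation free: core_approximation An core
proof (rule core_approximation.intro)
  fix n m :: nat and u v :: l2
  show "skew_operator (An n)"
  proof (rule skew_operator.intro)
    fix u v
    show "bounded_linear (An n)" by (rule An_bounded_linear)
    have "inner (J (tr s u)) v = - inner u (J (tr (- s) v))" for s
      by (simp add: J_skew tr_adjoint tr_J)
    then show "inner (An n u) v = - inner u (An n v)"
      unfolding An_def by (simp add: J_skew inner_add_left inner_add_right inner_diff_left inner_diff_right
        linear_simps[OF bounded_linear_J] algebra_simps)
  qed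
  show "An n (An m u) = An m (An n u)"
    unfolding An_def by (simp add: linear_simps[OF bounded_linear_J] tr_J tr_add tr_diff tr_scaleR scaleR_add_right algebra_simps)
  show "subspace core" unfolding core_def by (rule subspace_span)
  show "closure (fst ` core) = UNIV" unfolding fst_core by (rule tf_dense)
next
  fix p q and n :: nat assume "(p, q) \<in> core"
  then have "(\<lambda>n. An n (fst (p, q))) \<longlonglongrightarrow> snd (p, q)" unfolding core_def
  proof (induction rule: span_induct_alt)
    case (step c x y)
    then have "(\<lambda>n. An n (fst x)) \<longlonglongrightarrow> snd x" by (auto intro: An_tf_tendsto)
    then have "(\<lambda>n. c *\<^sub>R An n (fst x) + An n (fst y)) \<longlonglongrightarrow> c *\<^sub>R snd x + snd y"
      by (intro tendsto_intros step.IH)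
    then show ?case by (simp add: linear_simps[OF An_bounded_linear])
  qed (simp add: linear_simps[OF An_bounded_linear])
  then show "(\<lambda>n. An n p) \<longlonglongrightarrow> q" by simp
  have "(An n (fst (p, q)), An n (snd (p, q))) \<in> core" using \<open>(p, q) \<in> core\<close> unfolding core_def
  proof (induction rule: span_induct_alt)
    case base
    show ?case using span_zero[of "{(tf \<phi> e, tf (deriv (deriv \<phi>)) (jm *v e)) | \<phi> e. test_function \<phi>}"]
      by (simp add: linear_simps[OF An_bounded_linear] zero_prod_def)
  next
    case (step c x y)
    then obtain \<phi> e where x: "x = (tf \<phi> e, tf (deriv (deriv \<phi>)) (jm *v e))" and \<phi>: "test_function \<phi>" by auto
    have "deriv (deriv (fd n \<phi>)) = fd n (deriv (deriv \<phi>))"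
      using test_function_smooth[OF \<phi>] by (simp add: deriv_fd smooth_deriv)
    then have "(An n (fst x), An n (snd x)) = (tf (fd n \<phi>) (jm *v e), tf (deriv (deriv (fd n \<phi>))) (jm *v (jm *v e)))"
      by (simp add: x An_tf \<phi> test_function_deriv)
    then have "(An n (fst x), An n (snd x)) \<in> span {(tf \<phi> e, tf (deriv (deriv \<phi>)) (jm *v e)) | \<phi> e. test_function \<phi>}"
      using fd_test[OF \<phi>] by (intro span_base) blast
    from span_add[OF span_scale[OF this, of c] step.IH] show ?case
      by (simp add: linear_simps[OF An_bounded_linear])
  qed
  then show "(An n p, An n q) \<in> core" by simp
qed

lemma weak_solution_coreI:
  assumes "\<And>\<phi> e t. test_function \<phi> \<Longrightarrow> 0 \<le> t \<Longrightarrow>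
    ((\<lambda>s. inner (tf \<phi> e) (u s)) has_vector_derivative
      (inner (tf \<phi> e) (G t) - inner (tf (deriv (deriv \<phi>)) (jm *v e)) (u t))) (at t within {0..})"
  shows "weak_solution core u G"
  unfolding weak_solution_def
proof (intro allI impI)
  fix p q t assume pq: "(p, q) \<in> core" and t: "0 \<le> (t::real)"
  have "((\<lambda>s. inner (fst z) (u s)) has_vector_derivative (inner (fst z) (G t) - inner (snd z) (u t))) (at t within {0..})"
    if "z \<in> core" for z
    using that unfolding core_def
  proof (induction rule: span_induct_alt)
    case (step c x y)
    obtain \<phi> e where x: "x = (tf \<phi> e, tf (deriv (deriv \<phi>)) (jm *v e))" "test_function \<phi>"
      using step by auto
    have "((\<lambda>s. c *\<^sub>R inner (fst x) (u s) + inner (fst y) (u s)) has_vector_derivative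
        c *\<^sub>R (inner (fst x) (G t) - inner (snd x) (u t)) + (inner (fst y) (G t) - inner (snd y) (u t))) (at t within {0..})"
      using assms[OF x(2) t, of e] step.IH
      by (intro has_vector_derivative_add bounded_linear.has_vector_derivative[OF bounded_linear_scaleR_right]) (auto simp: x)
    then show ?case by (simp add: inner_add_left algebra_simps)
  qed simp
  from this[OF pq] show "((\<lambda>s. inner p (u s)) has_vector_derivative (inner p (G t) - inner q (u t))) (at t within {0..})" by simp
qed

lemma weak_solution_coreD:
  assumes "weak_solution core u G" "test_function \<phi>" "0 \<le> t"
  shows "((\<lambda>s. inner (tf \<phi> e) (u s)) has_vector_derivative
      (inner (tf \<phi> e) (G t) - inner (tf (deriv (deriv \<phi>)) (jm *v e)) (u t))) (at t within {0..})"
proof -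
  have "(tf \<phi> e, tf (deriv (deriv \<phi>)) (jm *v e)) \<in> core"
    unfolding core_def using assms(2) by (intro span_base) blast
  then show ?thesis using assms unfolding weak_solution_def by blast
qed

text \<open>\<open>J\<close> moves to the test function with a sign and two integrations by parts
  move the second derivative. The explicit main terms, which are differentiable in L^2, enter the
  weak formulation this way.\<close>

lemma weak_solution_strong:
  assumes u: "\<And>t. 0 \<le> t \<Longrightarrow> (u has_vector_derivative (J (u2 t) + K t)) (at t within {0..})"
    and w1: "\<And>t. 0 \<le> t \<Longrightarrow> wd (u t) (u1 t)" and w2: "\<And>t. 0 \<le> t \<Longrightarrow> wd (u1 t) (u2 t)"
  shows "weak_solution core u K"
proof (rule weak_solution_coreI)
  fix \<phi> e t assume \<phi>: "test_function \<phi>" and t: "0 \<le> (t::real)"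
  have "inner (tf \<phi> e) (J (u2 t)) = - inner (tf \<phi> (jm *v e)) (u2 t)"
    by (simp add: J_skew flip: mop_tf[OF \<phi>])
  also have "inner (tf \<phi> (jm *v e)) (u2 t) = inner (tf (deriv (deriv \<phi>)) (jm *v e)) (u t)"
    using wd_by_parts[OF wd_tf[OF \<phi>] w2[OF t], of "jm *v e"]
      wd_by_parts[OF wd_tf[OF test_function_deriv[OF \<phi>]] w1[OF t], of "jm *v e"] by simp
  finally have "inner (tf \<phi> e) (J (u2 t)) = - inner (tf (deriv (deriv \<phi>)) (jm *v e)) (u t)" .
  with bounded_linear.has_vector_derivative[OF bounded_linear_inner_right u[OF t], of "tf \<phi> e"]
  show "((\<lambda>s. inner (tf \<phi> e) (u s)) has_vector_derivative
      (inner (tf \<phi> e) (K t) - inner (tf (deriv (deriv \<phi>)) (jm *v e)) (u t))) (at t within {0..})"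
    by (simp add: inner_add_right)
qed

subsection \<open>The charge transfer equation as an evolution equation\<close>

definition bdpot :: "(real \<Rightarrow> real) \<Rightarrow> (real \<Rightarrow> real) \<Rightarrow> real \<Rightarrow> bool" where
  "bdpot U W C \<longleftrightarrow> U \<in> borel_measurable borel \<and> W \<in> borel_measurable borel \<and> (\<forall>x. \<bar>U x\<bar> \<le> C \<and> \<bar>W x\<bar> \<le> C)"

text \<open>Multiplying (CT) by \<open>-i\<close> gives \<open>\<partial>\<^sub>t \<psi> = i \<sigma>\<^sub>3 \<partial>\<^sup>2 \<psi> - i V \<psi>\<close>.\<close>

abbreviation "mov \<omega> U W v y \<gamma> t x \<equiv> mat (- \<i>) ** moving_potential \<omega> U W v y \<gamma> t x"

lemma bmat_moving_potential:
  assumes "bdpot U W C"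
  shows "bmat (moving_potential \<omega> U W v y \<gamma> t)"
    "norm (moving_potential \<omega> U W v y \<gamma> t x *v w) \<le> 4 * C * norm w"
proof -
  have [measurable]: "U \<in> borel_measurable borel" "W \<in> borel_measurable borel"
    using assms by (auto simp: bdpot_def)
  have m: "(\<lambda>x. moving_potential \<omega> U W v y \<gamma> t x $ i $ j) \<in> borel_measurable borel" for i j
    using exhaust_2[of i] exhaust_2[of j] by (auto simp: moving_potential_def Let_def phase_def)
  have n: "norm (moving_potential \<omega> U W v y \<gamma> t x $ i $ j) \<le> C" for x i j
    using exhaust_2[of i] exhaust_2[of j] assms
    by (auto simp: moving_potential_def Let_def bdpot_def norm_mult norm_exp_eq_Re)
  show "bmat (moving_potential \<omega> U W v y \<gamma> t)"
    "norm (moving_potential \<omega> U W v y \<gamma> t x *v w) \<le> 4 * C * norm w"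
    by (rule bmatI[OF m n])+
qed

lemma norm_smult: "norm (c *s (w :: complex ^ 2)) = norm c * norm w"
  by (simp add: norm_vec_def L2_set_def norm_mult power_mult_distrib real_sqrt_mult flip: sum_distrib_left)

lemma bmat_mov:
  assumes "bdpot U W C"
  shows "bmat (mov \<omega> U W v y \<gamma> t)" "norm (mov \<omega> U W v y \<gamma> t x *v w) \<le> 4 * C * norm w"
  using bmat_moving_potential[OF assms]
  by (auto intro: bmat_mult simp: mat_mv norm_smult simp flip: matrix_vector_mul_assoc)

definition Bop ::
  "nat \<Rightarrow> (nat \<Rightarrow> real) \<Rightarrow> (nat \<Rightarrow> real \<Rightarrow> real) \<Rightarrow> (nat \<Rightarrow> real \<Rightarrow> real) \<Rightarrow>
   (nat \<Rightarrow> real) \<Rightarrow> (nat \<Rightarrow> real) \<Rightarrow> (nat \<Rightarrow> real) \<Rightarrow> real \<Rightarrow> l2 \<Rightarrow> l2" where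
  "Bop m \<omega> U W v y \<gamma> t u = (\<Sum>l=1..m. mop (mov (\<omega> l) (U l) (W l) (v l) (y l) (\<gamma> l) t) u)"

lemma L2_sum_moving_potential:
  assumes "\<And>l. l \<in> {1..m} \<Longrightarrow> bdpot (U l) (W l) (C l)" "L2 f"
  shows "L2 (\<lambda>x. \<Sum>l=1..m. moving_potential (\<omega> l) (U l) (W l) (v l) (y l) (\<gamma> l) t x *v f x)"
  by (intro L2_sum L2_bmat[OF bmat_moving_potential(1)[OF assms(1)]] assms(2))

lemma bounded_linear_smult: "bounded_linear (\<lambda>w :: complex ^ 2. c *s w)"
  unfolding mat_mv[symmetric] by (rule matrix_vector_mul_bounded_linear)

lemma bounded_linear_mv: "bounded_linear (\<lambda>w :: complex ^ 2. (M :: complex ^ 2 ^ 2) *v w)"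
  by (rule matrix_vector_mul_bounded_linear)

lemma inner_tf_Bop:
  assumes b: "\<And>l. l \<in> {1..m} \<Longrightarrow> bdpot (U l) (W l) (C l)" and f: "L2 f" and \<phi>: "test_function \<phi>"
  shows "inner (tf \<phi> e) (Bop m \<omega> U W v y \<gamma> t (cls f)) =
    inner e (- (\<i> *s (\<integral>x. \<phi> x *\<^sub>R (\<Sum>l=1..m. moving_potential (\<omega> l) (U l) (W l) (v l) (y l) (\<gamma> l) t x *v f x) \<partial>lborel)))"
proof -
  let ?V = "\<lambda>x. \<Sum>l=1..m. moving_potential (\<omega> l) (U l) (W l) (v l) (y l) (\<gamma> l) t x *v f x"
  have LV: "L2 ?V" by (rule L2_sum_moving_potential[OF b f])
  have "Bop m \<omega> U W v y \<gamma> t (cls f) = cls (\<lambda>x. \<Sum>l=1..m. mov (\<omega> l) (U l) (W l) (v l) (y l) (\<gamma> l) t x *v f x)"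
    unfolding Bop_def by (subst cls_sum) (auto intro!: sum.cong mop_cls[OF bmat_mov(1)[OF b] f] L2_bmat[OF bmat_mov(1)[OF b] f])
  also have "(\<lambda>x. \<Sum>l=1..m. mov (\<omega> l) (U l) (W l) (v l) (y l) (\<gamma> l) t x *v f x) = (\<lambda>x. (- \<i>) *s ?V x)"
    by (simp add: vector_smult_rneg vec.scale_sum_right mat_mv flip: matrix_vector_mul_assoc)
  finally have B: "Bop m \<omega> U W v y \<gamma> t (cls f) = cls (\<lambda>x. (- \<i>) *s ?V x)" .
  have "inner (tf \<phi> e) (Bop m \<omega> U W v y \<gamma> t (cls f)) = inner e (\<integral>x. \<phi> x *\<^sub>R ((- \<i>) *s ?V x) \<partial>lborel)"
    unfolding B by (rule tf_inner[OF \<phi> L2_bounded_linear[OF LV bounded_linear_smult]])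
  also have "(\<integral>x. \<phi> x *\<^sub>R ((- \<i>) *s ?V x) \<partial>lborel) = (- \<i>) *s (\<integral>x. \<phi> x *\<^sub>R ?V x \<partial>lborel)"
    using integral_bounded_linear[OF bounded_linear_smult L2_test_integrable[OF \<phi> LV], of "- \<i>"]
    unfolding linear_simps(5)[OF bounded_linear_smult] .
  also have "\<dots> = - (\<i> *s (\<integral>x. \<phi> x *\<^sub>R ?V x \<partial>lborel))" by (simp add: vec_eq_iff)
  finally show ?thesis .
qed

lemma inner_tf_J:
  assumes f: "L2 f" and \<phi>: "test_function \<phi>"
  shows "- inner (tf \<phi> (jm *v e)) (cls f) = inner e (\<i> *s (\<integral>x. \<phi> x *\<^sub>R (sigma3 *v f x) \<partial>lborel))"
proof -
  have "(\<integral>x. \<phi> x *\<^sub>R (sigma3 *v f x) \<partial>lborel) = sigma3 *v (\<integral>x. \<phi> x *\<^sub>R f x \<partial>lborel)"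
    using integral_bounded_linear[OF bounded_linear_mv L2_test_integrable[OF \<phi> f], of sigma3]
    by (simp add: linear_simps(5)[OF bounded_linear_mv])
  then show ?thesis unfolding tf_inner[OF \<phi> f] jm_skew minus_minus by (simp only: jm_mv)
qed

text \<open>The bridge from the equation as stated to the abstract evolution. Pairing the C^2-valued
  integrals with a constant vector \<open>e\<close> gives inner products with
  \<open>tf \<phi> e\<close>, and the factor i \<sigma>3 is moved onto \<open>e\<close>; a
  vector-valued derivative exists exactly when its real components do.\<close>

lemma CT_solution_iff_weak_solution:
  assumes b: "\<And>l. l \<in> {1..m} \<Longrightarrow> bdpot (U l) (W l) (C l)" and L: "\<And>t. 0 \<le> t \<Longrightarrow> L2 (\<psi> t)"
  shows "CT_solution m \<omega> U W v y \<gamma> \<psi> \<longleftrightarrow>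
    continuous_on {0..} (\<lambda>t. cls (\<psi> t)) \<and>
    weak_solution core (\<lambda>t. cls (\<psi> t)) (\<lambda>t. Bop m \<omega> U W v y \<gamma> t (cls (\<psi> t)))"
proof -
  define X where "X \<phi> t = \<i> *s (\<integral>x. (deriv ^^ 2) \<phi> x *\<^sub>R (sigma3 *v \<psi> t x) \<partial>lborel)
           - \<i> *s (\<integral>x. \<phi> x *\<^sub>R (\<Sum>l=1..m. moving_potential (\<omega> l) (U l) (W l) (v l) (y l) (\<gamma> l) t x *v \<psi> t x) \<partial>lborel)"
    for \<phi> t
  have 1: "(\<forall>t\<ge>0. ((\<lambda>s. L2norm (\<lambda>x. \<psi> s x - \<psi> t x)) \<longlongrightarrow> 0) (at t within {0..})) \<longleftrightarrow> continuous_on {0..} (\<lambda>t. cls (\<psi> t))"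
  proof -
    have "((\<lambda>s. L2norm (\<lambda>x. \<psi> s x - \<psi> t x)) \<longlongrightarrow> 0) (at t within {0..}) \<longleftrightarrow>
        ((\<lambda>s. dist (cls (\<psi> s)) (cls (\<psi> t))) \<longlongrightarrow> 0) (at t within {0..})" if "0 \<le> t" for t
      using that L by (intro tendsto_cong)
        (auto simp: eventually_at_filter dist_norm cls_norm L2_diff simp flip: cls_diff intro!: always_eventually)
    then show ?thesis unfolding continuous_on_def tendsto_dist_iff[of "\<lambda>t. cls (\<psi> t)"] by auto
  qed
  have 2: "((\<lambda>s. \<integral>x. \<phi> x *\<^sub>R \<psi> s x \<partial>lborel) has_vector_derivative X \<phi> t) (at t within {0..}) \<longleftrightarrow>
     (\<forall>e\<in>Basis. ((\<lambda>s. inner (tf \<phi> e) (cls (\<psi> s))) has_vector_derivative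
      (inner (tf \<phi> e) (Bop m \<omega> U W v y \<gamma> t (cls (\<psi> t))) - inner (tf (deriv (deriv \<phi>)) (jm *v e)) (cls (\<psi> t)))) (at t within {0..}))"
    if \<phi>: "test_function \<phi>" and t: "0 \<le> t" for \<phi> t
  proof -
    have e: "inner (tf \<phi> e) (Bop m \<omega> U W v y \<gamma> t (cls (\<psi> t))) - inner (tf (deriv (deriv \<phi>)) (jm *v e)) (cls (\<psi> t)) = inner (X \<phi> t) e" for e
      using inner_tf_Bop[OF b L[OF t] \<phi>, where m = m and e = e and \<omega> = \<omega> and v = v and y = y and \<gamma> = \<gamma> and t = t]
        inner_tf_J[OF L[OF t] test_function_deriv[OF test_function_deriv[OF \<phi>]], of e]
      by (simp add: X_def inner_commute[of _ e] inner_diff_right numeral_2_eq_2)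
    have c: "((\<lambda>s. inner (tf \<phi> e) (cls (\<psi> s))) has_vector_derivative d) (at t within {0..}) \<longleftrightarrow>
      ((\<lambda>s. inner (\<integral>x. \<phi> x *\<^sub>R \<psi> s x \<partial>lborel) e) has_vector_derivative d) (at t within {0..})" for e d
      using t by (intro has_vector_derivative_cong_ev always_eventually)
         (auto simp: tf_inner[OF \<phi> L] inner_commute[of _ e])
    have "((\<lambda>s. \<integral>x. \<phi> x *\<^sub>R \<psi> s x \<partial>lborel) has_vector_derivative X \<phi> t) (at t within {0..}) \<longleftrightarrow>
        (\<forall>e\<in>Basis. ((\<lambda>s. inner (\<integral>x. \<phi> x *\<^sub>R \<psi> s x \<partial>lborel) e) has_vector_derivative inner (X \<phi> t) e) (at t within {0..}))"
      unfolding has_vector_derivative_def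
      by (subst has_derivative_componentwise_within) simp
    then show ?thesis by (simp only: e c)
  qed
  have "CT_solution m \<omega> U W v y \<gamma> \<psi> \<longleftrightarrow> continuous_on {0..} (\<lambda>t. cls (\<psi> t)) \<and>
      (\<forall>\<phi>. test_function \<phi> \<longrightarrow> (\<forall>t\<ge>0. \<forall>e\<in>Basis. ((\<lambda>s. inner (tf \<phi> e) (cls (\<psi> s))) has_vector_derivative
      (inner (tf \<phi> e) (Bop m \<omega> U W v y \<gamma> t (cls (\<psi> t))) - inner (tf (deriv (deriv \<phi>)) (jm *v e)) (cls (\<psi> t)))) (at t within {0..})))"
    unfolding CT_solution_def 1 X_def[symmetric] using 2 L by auto
  also have "\<dots> \<longleftrightarrow> continuous_on {0..} (\<lambda>t. cls (\<psi> t)) \<and>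
    weak_solution core (\<lambda>t. cls (\<psi> t)) (\<lambda>t. Bop m \<omega> U W v y \<gamma> t (cls (\<psi> t)))"
  proof -
    \<comment> \<open>From the basis vectors the vector-valued derivative is recovered; pairing it
      with an arbitrary \<open>e\<close> then covers every generator of the core.\<close>
    have "weak_solution core (\<lambda>t. cls (\<psi> t)) (\<lambda>t. Bop m \<omega> U W v y \<gamma> t (cls (\<psi> t)))"
      if *: "\<forall>\<phi>. test_function \<phi> \<longrightarrow> (\<forall>t\<ge>0. \<forall>e\<in>Basis. ((\<lambda>s. inner (tf \<phi> e) (cls (\<psi> s))) has_vector_derivative
      (inner (tf \<phi> e) (Bop m \<omega> U W v y \<gamma> t (cls (\<psi> t))) - inner (tf (deriv (deriv \<phi>)) (jm *v e)) (cls (\<psi> t)))) (at t within {0..}))"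
    proof (rule weak_solution_coreI)
      fix \<phi> e t assume \<phi>: "test_function \<phi>" and t: "0 \<le> (t::real)"
      let ?d = "\<lambda>e. inner (tf \<phi> e) (Bop m \<omega> U W v y \<gamma> t (cls (\<psi> t))) - inner (tf (deriv (deriv \<phi>)) (jm *v e)) (cls (\<psi> t))"
      have "((\<lambda>s. inner (\<integral>x. \<phi> x *\<^sub>R \<psi> s x \<partial>lborel) e) has_vector_derivative inner (X \<phi> t) e) (at t within {0..})"
        using bounded_linear.has_vector_derivative[OF bounded_linear_inner_left] 2[OF \<phi> t] * \<phi> t by blast
      moreover have "inner (X \<phi> t) e = ?d e"
        using inner_tf_Bop[OF b L[OF t] \<phi>, where m = m and e = e and \<omega> = \<omega> and v = v and y = y and \<gamma> = \<gamma> and t = t]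
          inner_tf_J[OF L[OF t] test_function_deriv[OF test_function_deriv[OF \<phi>]], of e]
        by (simp add: X_def inner_commute[of _ e] inner_diff_right numeral_2_eq_2)
      ultimately have "((\<lambda>s. inner (\<integral>x. \<phi> x *\<^sub>R \<psi> s x \<partial>lborel) e) has_vector_derivative ?d e) (at t within {0..})" by simp
      then show "((\<lambda>s. inner (tf \<phi> e) (cls (\<psi> s))) has_vector_derivative ?d e) (at t within {0..})"
        by (rule has_vector_derivative_transform[rotated -1]) (use t in \<open>auto simp: tf_inner[OF \<phi> L] inner_commute[of _ e]\<close>)
    qed
    then show ?thesis using weak_solution_coreD by blast
  qed
  finally show ?thesis .
qed

subsection \<open>Galilei transforms\<close>

definition ph :: "real \<Rightarrow> complex ^ 2 ^ 2" where
  "ph \<theta> = vector [vector [exp (\<i> * of_real \<theta>), 0], vector [0, exp (- \<i> * of_real \<theta>)]]"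

lemma ph_nth: "ph \<theta> $ 1 $ 1 = exp (\<i> * of_real \<theta>)" "ph \<theta> $ 1 $ 2 = 0" "ph \<theta> $ 2 $ 1 = 0"
  "ph \<theta> $ 2 $ 2 = exp (- \<i> * of_real \<theta>)"
  by (simp_all add: ph_def)

text \<open>Since i \<sigma>3 squares to -1, this is Euler's formula. Dependence on the angle is
  thereby reduced to that of sine and cosine.\<close>

lemma ph_mv: "ph \<theta> *v w = cos \<theta> *\<^sub>R w + sin \<theta> *\<^sub>R (jm *v w)"
  by (simp add: vec_eq_iff forall_2 matrix_vector_2[of "ph \<theta>"] ph_nth jm_mv sigma3_mv exp_Euler cos_of_real sin_of_real
     scaleR_conv_of_real[where 'a = complex] algebra_simps exp_minus_Euler)

lemma ph_mult: "ph a ** ph b = ph (a + b)"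
  by (simp add: vec_eq_iff forall_2 ph_def matrix_matrix_mult_def sum_2 ring_distribs flip: exp_add)

lemma ph_0: "ph 0 = mat 1"
  by (simp add: vec_eq_iff forall_2 ph_def mat_def)

lemma norm_ph_mv: "norm (ph \<theta> *v w) = norm w"
  by (simp add: norm_vec_def L2_set_def sum_2 matrix_vector_2 ph_def norm_mult norm_exp_eq_Re)

lemma bmat_ph:
  assumes "\<theta> \<in> borel_measurable borel"
  shows "bmat (\<lambda>x. ph (\<theta> x))"
proof -
  note [measurable] = assms
  have "(\<lambda>x. ph (\<theta> x) $ i $ j) \<in> borel_measurable borel" for i j
    using exhaust_2[of i] exhaust_2[of j] by (auto simp: ph_def)
  then show ?thesis unfolding bmat_def by (auto intro!: exI[of _ 1] simp: norm_ph_mv)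
qed

lemma mop_ph_const: "mop (\<lambda>_. ph c) u = cos c *\<^sub>R u + sin c *\<^sub>R J u"
  by (cases u rule: l2_cases) (simp add: mop_cls ph_mv L2_scaleR L2_bmat cls_add cls_scaleR)

lemma mop_ph_norm: "\<theta> \<in> borel_measurable borel \<Longrightarrow> norm (mop (\<lambda>x. ph (\<theta> x)) u) = norm u"
  by (cases u rule: l2_cases) (simp add: mop_cls bmat_ph L2_bmat cls_norm L2norm_def norm_ph_mv)

lemma mop_ph_ph:
  assumes "\<theta> \<in> borel_measurable borel" "\<eta> \<in> borel_measurable borel"
  shows "mop (\<lambda>x. ph (\<theta> x)) (mop (\<lambda>x. ph (\<eta> x)) u) = mop (\<lambda>x. ph (\<theta> x + \<eta> x)) u"
  by (simp add: mop_mult bmat_ph assms ph_mult)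

lemma mop_mat1 [simp]: "mop (\<lambda>_. mat 1) u = u"
  by (simp add: mop_def)

definition gal :: "real \<Rightarrow> real \<Rightarrow> real \<Rightarrow> real \<Rightarrow> real \<Rightarrow> l2 \<Rightarrow> l2" where
  "gal \<omega> v y \<gamma> t u = mop (\<lambda>x. ph (phase \<omega> v \<gamma> t x)) (tr (- (v * t + y)) u)"

text \<open>The inverse of \<open>gal\<close>: the phase is undone before the shift.\<close>

definition gali :: "real \<Rightarrow> real \<Rightarrow> real \<Rightarrow> real \<Rightarrow> real \<Rightarrow> l2 \<Rightarrow> l2" where
  "gali \<omega> v y \<gamma> t u = tr (v * t + y) (mop (\<lambda>x. ph (- phase \<omega> v \<gamma> t x)) u)"

lemma phase_measurable [measurable]: "phase \<omega> v \<gamma> t \<in> borel_measurable borel"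
  unfolding phase_def by measurable

lemma cls_galilei:
  assumes "L2 f"
  shows "L2 (galilei \<omega> v y \<gamma> f t)" "cls (galilei \<omega> v y \<gamma> f t) = gal \<omega> v y \<gamma> t (cls f)"
proof -
  have eq: "galilei \<omega> v y \<gamma> f t = (\<lambda>x. ph (phase \<omega> v \<gamma> t x) *v f (x + - (v * t + y)))"
    by (simp add: fun_eq_iff galilei_def Let_def ph_def algebra_simps)
  show "L2 (galilei \<omega> v y \<gamma> f t)" unfolding eq by (intro L2_bmat bmat_ph L2_shift assms) simp
  show "cls (galilei \<omega> v y \<gamma> f t) = gal \<omega> v y \<gamma> t (cls f)"
    unfolding eq gal_def tr_cls[OF assms] by (subst mop_cls) (auto intro: bmat_ph L2_shift[OF assms])
qed

lemma gal_norm [simp]: "norm (gal \<omega> v y \<gamma> t u) = norm u"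
  by (simp add: gal_def mop_ph_norm)

lemma gali_norm [simp]: "norm (gali \<omega> v y \<gamma> t u) = norm u"
  by (simp add: gali_def mop_ph_norm)

lemma bounded_linear_gal: "bounded_linear (gal \<omega> v y \<gamma> t)"
  unfolding gal_def by (intro bounded_linear_compose[OF mop_bounded_linear tr_bounded_linear] bmat_ph) simp

lemma gali_gal: "gali \<omega> v y \<gamma> t (gal \<omega> v y \<gamma> t u) = u"
  by (simp add: gali_def gal_def mop_ph_ph ph_0)

text \<open>The phase splits into a part linear in x - v t - y and a part constant in x. The linear
  part becomes a fixed modulation applied before the translation, so time enters only through a
  rotation by a constant angle and through the translation, both strongly continuous.\<close>

lemma gal_eq: "gal \<omega> v y \<gamma> t u =
    mop (\<lambda>_. ph ((v\<^sup>2 / 4 + \<omega>) * t + v * y / 2 + \<gamma>)) (tr (- (v * t + y)) (mop (\<lambda>x. ph (v / 2 * x)) u))"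
proof -
  have "((v\<^sup>2 / 4 + \<omega>) * t + v * y / 2 + \<gamma>) + v / 2 * (x + - (v * t + y)) = phase \<omega> v \<gamma> t x" for x
    by (simp add: phase_def field_simps power2_eq_square)
  then show ?thesis
    by (subst tr_mop) (auto simp: gal_def mop_ph_ph bmat_ph)
qed

lemma gali_eq: "gali \<omega> v y \<gamma> t u =
    mop (\<lambda>x. ph (- (v / 2) * x)) (tr (v * t + y) (mop (\<lambda>_. ph (- ((v\<^sup>2 / 4 + \<omega>) * t + v * y / 2 + \<gamma>))) u))"
proof -
  have "- (v / 2) * x + - ((v\<^sup>2 / 4 + \<omega>) * t + v * y / 2 + \<gamma>) = - phase \<omega> v \<gamma> t (x + (v * t + y))" for x
    by (simp add: phase_def field_simps power2_eq_square)
  then show ?thesis unfolding gali_def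
    by (subst tr_mop, simp add: bmat_ph, subst tr_mop, simp, subst mop_ph_ph) (auto intro!: mop_cong arg_cong[where f = ph])
qed

lemma continuous_on_mop: "bmat M \<Longrightarrow> continuous_on X u \<Longrightarrow> continuous_on X (\<lambda>t. mop M (u t))"
  by (rule bounded_linear.continuous_on[OF mop_bounded_linear])

lemma continuous_on_gal: "continuous_on X u \<Longrightarrow> continuous_on X (\<lambda>t. gal \<omega> v y \<gamma> t (u t))"
  unfolding gal_eq mop_ph_const[of "_ + _"]
  by (intro continuous_intros tr_continuous_compose continuous_on_mop bmat_ph) auto

lemma continuous_on_gali: "continuous_on X u \<Longrightarrow> continuous_on X (\<lambda>t. gali \<omega> v y \<gamma> t (u t))"
  unfolding gali_eq mop_ph_const[of "- _"]
  by (intro continuous_intros tr_continuous_compose continuous_on_mop bmat_ph) auto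

lemma bmat_potential:
  assumes "bdpot U W C"
  shows "bmat (potential U W)" "bmat (\<lambda>x. mat (- \<i>) ** potential U W x)"
proof -
  have [measurable]: "U \<in> borel_measurable borel" "W \<in> borel_measurable borel"
    using assms by (auto simp: bdpot_def)
  have m: "(\<lambda>x. potential U W x $ i $ j) \<in> borel_measurable borel" for i j
    using exhaust_2[of i] exhaust_2[of j] by (auto simp: potential_def)
  have n: "norm (potential U W x $ i $ j) \<le> C" for x i j
    using exhaust_2[of i] exhaust_2[of j] assms by (auto simp: potential_def bdpot_def)
  show "bmat (potential U W)" by (rule bmatI[OF m n])
  then show "bmat (\<lambda>x. mat (- \<i>) ** potential U W x)" by (intro bmat_mult) auto
qed

text \<open>Conjugation by exp (i \<sigma>3 \<theta>) leaves the diagonal unchanged and multiplies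
  the off-diagonal entries by exp (2 i \<theta>) and by its inverse. A moving potential is thus the
  resting one in its Galilei frame, which gives continuity in time and places the interaction
  estimate in that frame.\<close>

lemma mop_mov:
  assumes b: "bdpot U W C"
  shows "mop (mov \<omega> U W v y \<gamma> t) u = gal \<omega> v y \<gamma> t (mop (\<lambda>x. mat (- \<i>) ** potential U W x) (gali \<omega> v y \<gamma> t u))"
proof -
  have "ph \<theta> ** ((mat (- \<i>) ** potential U W \<xi>) ** ph (- \<theta>)) = mat (- \<i>) ** 
    vector [vector [of_real (U \<xi>), - exp (2 * \<i> * of_real \<theta>) * of_real (W \<xi>)],
        vector [exp (- 2 * \<i> * of_real \<theta>) * of_real (W \<xi>), - of_real (U \<xi>)]]" for \<theta> \<xi>
  proof -
    have "exp (2 * \<i> * of_real \<theta>) = exp (\<i> * of_real \<theta>) * exp (\<i> * of_real \<theta>)"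
      "exp (- 2 * \<i> * of_real \<theta>) = inverse (exp (\<i> * of_real \<theta>)) * inverse (exp (\<i> * of_real \<theta>))"
      by (simp_all add: mult.assoc flip: exp_add exp_minus)
    then show ?thesis
      by (simp add: vec_eq_iff forall_2 ph_def matrix_matrix_mult_def sum_2 mat_def potential_def
         exp_minus field_simps)
  qed
  then have eq: "ph (phase \<omega> v \<gamma> t x) ** ((mat (- \<i>) ** potential U W (x + - (v * t + y))) ** ph (- phase \<omega> v \<gamma> t x)) = mov \<omega> U W v y \<gamma> t x" for x
    unfolding moving_potential_def Let_def by (simp add: algebra_simps)
  let ?N = "\<lambda>x. mat (- \<i>) ** potential U W x" and ?d = "v * t + y"
  have bN: "bmat ?N" by (rule bmat_potential[OF b])
  have bN': "bmat (\<lambda>x. ?N (x + - ?d))" by (rule bmat_shift[OF bN])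
  have bp: "bmat (\<lambda>x. ph (- phase \<omega> v \<gamma> t x))" "bmat (\<lambda>x. ph (phase \<omega> v \<gamma> t x))"
    by (rule bmat_ph; measurable)+
  have "tr (- ?d) (mop ?N (tr ?d w)) = mop (\<lambda>x. ?N (x + - ?d)) w" for w
    by (simp only: tr_mop[OF bN] tr_tr) simp
  then have "gal \<omega> v y \<gamma> t (mop ?N (gali \<omega> v y \<gamma> t u)) =
      mop (\<lambda>x. ph (phase \<omega> v \<gamma> t x)) (mop (\<lambda>x. ?N (x + - ?d)) (mop (\<lambda>x. ph (- phase \<omega> v \<gamma> t x)) u))"
    unfolding gal_def gali_def by (simp only:)
  also have "\<dots> = mop (\<lambda>x. ph (phase \<omega> v \<gamma> t x) ** (?N (x + - ?d) ** ph (- phase \<omega> v \<gamma> t x))) u"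
    by (simp only: mop_mult[OF bN' bp(1)] mop_mult[OF bp(2) bmat_mult[OF bN' bp(1)]])
  also have "\<dots> = mop (mov \<omega> U W v y \<gamma> t) u" by (rule mop_cong) (rule eq)
  finally show ?thesis ..
qed

lemma Bop_linear:
  assumes "\<And>l. l \<in> {1..m} \<Longrightarrow> bdpot (U l) (W l) (C l)"
  shows "Bop m \<omega> U W v y \<gamma> t (u - w) = Bop m \<omega> U W v y \<gamma> t u - Bop m \<omega> U W v y \<gamma> t w"
    "Bop m \<omega> U W v y \<gamma> t (u + w) = Bop m \<omega> U W v y \<gamma> t u + Bop m \<omega> U W v y \<gamma> t w"
  unfolding Bop_def using bmat_mov(1)[OF assms]
  by (simp_all add: mop_diff mop_add flip: sum_subtractf sum.distrib)

lemma Bop_norm_le: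
  assumes b: "\<And>l. l \<in> {1..m} \<Longrightarrow> bdpot (U l) (W l) (C l)"
  shows "norm (Bop m \<omega> U W v y \<gamma> t u) \<le> (\<Sum>l=1..m. 4 * C l) * norm u"
  unfolding Bop_def sum_distrib_right
proof (rule sum_norm_le)
  fix l assume l: "l \<in> {1..m}"
  have "0 \<le> C l" using b[OF l] by (auto simp: bdpot_def intro: order_trans[OF abs_ge_zero])
  then show "norm (mop (mov (\<omega> l) (U l) (W l) (v l) (y l) (\<gamma> l) t) u) \<le> 4 * C l * norm u"
    by (intro mop_norm_le bmat_mov[OF b[OF l]]) auto
qed

lemma Bop_continuous:
  assumes b: "\<And>l. l \<in> {1..m} \<Longrightarrow> bdpot (U l) (W l) (C l)" and u: "continuous_on X u"
  shows "continuous_on X (\<lambda>t. Bop m \<omega> U W v y \<gamma> t (u t))"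
proof -
  have "continuous_on X (\<lambda>t. mop (mov (\<omega> l) (U l) (W l) (v l) (y l) (\<gamma> l) t) (u t))" if "l \<in> {1..m}" for l
    unfolding mop_mov[OF b[OF that]]
    by (intro continuous_on_gal continuous_on_mop bmat_potential[OF b[OF that]] continuous_on_gali u)
  then show ?thesis unfolding Bop_def by (intro continuous_on_sum)
qed

subsection \<open>The main term\<close>

text \<open>Complex scalars act as operators, because \<open>l2\<close> carries only a real vector
  space structure.\<close>

definition cs :: "complex \<Rightarrow> l2 \<Rightarrow> l2" where "cs c = mop (\<lambda>_. mat c)"

lemma cs_cls: "L2 f \<Longrightarrow> cs c (cls f) = cls (\<lambda>x. c *s f x)"
  by (simp add: cs_def mop_cls mat_mv)

lemma L2_smult: "L2 f \<Longrightarrow> L2 (\<lambda>x. c *s f x)"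
  by (rule L2_bounded_linear[OF _ bounded_linear_smult])

lemma bounded_linear_cs: "bounded_linear (cs c)"
  unfolding cs_def by (rule mop_bounded_linear) simp

lemmas cs_simps = linear_simps[OF bounded_linear_cs]

lemma cs_cs [simp]: "cs a (cs b u) = cs (a * b) u"
  by (cases u rule: l2_cases) (simp add: cs_cls L2_smult vec_eq_iff mult.assoc)

lemma cs_add_left: "cs (a + b) u = cs a u + cs b u"
  by (cases u rule: l2_cases) (simp add: cs_cls L2_smult vector_sadd_rdistrib flip: cls_add)

lemma smult_of_real: "complex_of_real r *s w = r *\<^sub>R (w :: complex ^ 2)"
  by (simp add: vec_eq_iff scaleR_conv_of_real[where 'a = complex])

lemma cs_of_real: "cs (of_real r) u = r *\<^sub>R u"
  by (cases u rule: l2_cases) (simp add: cs_cls smult_of_real cls_scaleR)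

lemma cs_1 [simp]: "cs 1 u = u" using cs_of_real[of 1] by simp

lemma cs_0 [simp]: "cs 0 u = 0" using cs_of_real[of 0] by simp

lemma cs_minus_left: "cs (- a) u = - cs a u"
  using cs_add_left[of a "- a" u] by (simp add: eq_neg_iff_add_eq_0 add.commute)

lemma cs_norm [simp]: "norm (cs c u) = norm c * norm u"
  by (cases u rule: l2_cases) 
    (simp add: cs_cls cls_norm L2_smult L2norm_def norm_smult power_mult_distrib real_sqrt_mult)

lemma bounded_bilinear_cs: "bounded_bilinear cs"
proof
  show "cs (a + a') b = cs a b + cs a' b" for a a' b by (rule cs_add_left)
  show "cs a (b + b') = cs a b + cs a b'" for a b b' by (simp add: cs_simps)
  show "cs (r *\<^sub>R a) b = r *\<^sub>R cs a b" for r a b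
    by (simp add: scaleR_conv_of_real flip: cs_cs cs_of_real)
  show "cs a (r *\<^sub>R b) = r *\<^sub>R cs a b" for r a b by (simp add: cs_simps)
  show "\<exists>K. \<forall>a b. norm (cs a b) \<le> norm a * norm b * K" by (intro exI[of _ 1]) simp
qed

lemma mat_commute: "(M :: complex ^ 2 ^ 2) ** mat c = mat c ** M"
  by (simp add: vec_eq_iff forall_2 matrix_matrix_mult_def sum_2 mat_def)

lemma mop_cs: "bmat M \<Longrightarrow> mop M (cs c u) = cs c (mop M u)"
  by (simp add: cs_def mop_mult mat_commute)

lemma tr_cs: "tr s (cs c u) = cs c (tr s u)"
  unfolding cs_def by (rule tr_mop_const)

lemma wd_cs: "wd u u' \<Longrightarrow> wd (cs c u) (cs c u')"
  unfolding cs_def by (rule wd_mop)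

lemma gal_cs: "gal \<omega> v y \<gamma> t (cs c u) = cs c (gal \<omega> v y \<gamma> t u)"
  by (simp add: gal_def tr_cs mop_cs bmat_ph)

lemma J_mop_ph:
  assumes "\<theta> \<in> borel_measurable borel"
  shows "mop (\<lambda>x. ph (\<theta> x)) (J u) = J (mop (\<lambda>x. ph (\<theta> x)) u)"
proof -
  have "ph a ** jm = jm ** ph a" for a
    by (simp add: vec_eq_iff forall_2 matrix_matrix_mult_def sum_2 ph_def jm_def mat_def sigma3_def)
  then show ?thesis by (simp add: mop_mult bmat_ph assms)
qed

lemma gal_J: "gal \<omega> v y \<gamma> t (J u) = J (gal \<omega> v y \<gamma> t u)"
  by (simp add: gal_def tr_J J_mop_ph)

lemma rotation_has_vector_derivative:
  assumes "(w has_vector_derivative w') (at t)" "(c has_real_derivative c') (at t)"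
  shows "((\<lambda>s. mop (\<lambda>_. ph (c s)) (w s)) has_vector_derivative mop (\<lambda>_. ph (c t)) (w' + c' *\<^sub>R J (w t))) (at t)"
proof -
  have "((\<lambda>s. cos (c s) *\<^sub>R w s + sin (c s) *\<^sub>R J (w s)) has_vector_derivative
     (cos (c t) *\<^sub>R w' + (- sin (c t) * c') *\<^sub>R w t) + (sin (c t) *\<^sub>R J w' + (cos (c t) * c') *\<^sub>R J (w t))) (at t)"
    by (intro has_vector_derivative_add has_vector_derivative_scaleR assms
       bounded_linear.has_vector_derivative[OF bounded_linear_J] derivative_intros DERIV_chain2[OF DERIV_cos] DERIV_chain2[OF DERIV_sin])
  then show ?thesis unfolding mop_ph_const
    by (simp add: linear_simps[OF bounded_linear_J] J_J algebra_simps)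
qed

text \<open>Translating a modulated function by s adds a constant rotation by the angle a s; its
  derivative is the extra term a \<open>J\<close>.\<close>

lemma wd_phase:
  assumes "wd F F1"
  shows "wd (mop (\<lambda>x. ph (a * x)) F) (mop (\<lambda>x. ph (a * x)) (F1 + a *\<^sub>R J F))"
  unfolding wd_def
proof
  fix s
  have eq: "tr s (mop (\<lambda>x. ph (a * x)) u) = mop (\<lambda>x. ph (a * x)) (mop (\<lambda>_. ph (a * s)) (tr s u))" for s u
  proof -
    have "tr s (mop (\<lambda>x. ph (a * x)) u) = mop (\<lambda>x. ph (a * (x + s))) (tr s u)"
      by (rule tr_mop) (simp add: bmat_ph)
    also have "\<dots> = mop (\<lambda>x. ph (a * x)) (mop (\<lambda>_. ph (a * s)) (tr s u))"
      by (simp add: mop_ph_ph distrib_left)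
    finally show ?thesis .
  qed
  have "((\<lambda>s. tr s F) has_vector_derivative tr s F1) (at s)" using assms by (simp add: wd_def)
  moreover have "((\<lambda>s. a * s) has_real_derivative a) (at s)" by (auto intro!: derivative_eq_intros)
  ultimately have "((\<lambda>s. mop (\<lambda>x. ph (a * x)) (mop (\<lambda>_. ph (a * s)) (tr s F))) has_vector_derivative
      mop (\<lambda>x. ph (a * x)) (mop (\<lambda>_. ph (a * s)) (tr s F1 + a *\<^sub>R J (tr s F)))) (at s)"
    by (intro bounded_linear.has_vector_derivative[OF mop_bounded_linear] rotation_has_vector_derivative bmat_ph) auto
  then show "((\<lambda>s. tr s (mop (\<lambda>x. ph (a * x)) F)) has_vector_derivative tr s (mop (\<lambda>x. ph (a * x)) (F1 + a *\<^sub>R J F))) (at s)"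
    unfolding eq by (simp add: tr_add tr_scaleR tr_J)
qed

lemma wd_tr: "wd u u' \<Longrightarrow> wd (tr s u) (tr s u')"
  by (rule wd_bounded_linear) (auto intro: tr_bounded_linear simp: add.commute)

lemma wd_gal:
  assumes "wd F F1"
  shows "wd (gal \<omega> v y \<gamma> t F) (gal \<omega> v y \<gamma> t (F1 + (v / 2) *\<^sub>R J F))"
  unfolding gal_eq by (intro wd_mop wd_tr wd_phase assms)

lemma wd_J: "wd u u' \<Longrightarrow> wd (J u) (J u')" by (rule wd_mop)

text \<open>Galilei invariance of the free equation. The time derivative consists of transport with
  speed -v and of a rotation at rate v^2 / 4 + \<omega>; the modulated second derivative
  \<open>G2\<close> is a completed square that accounts for every term containing v, and what is
  left is the resting operator \<omega> - \<partial>^2.\<close>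

lemma gal_has_vector_derivative:
  fixes \<omega> v y \<gamma> :: real
  assumes F1: "wd F F1" and F2: "wd F1 F2"
  defines "G1 \<equiv> \<lambda>t. gal \<omega> v y \<gamma> t (F1 + (v / 2) *\<^sub>R J F)"
  defines "G2 \<equiv> \<lambda>t. gal \<omega> v y \<gamma> t ((F2 + (v / 2) *\<^sub>R J F1) + (v / 2) *\<^sub>R J (F1 + (v / 2) *\<^sub>R J F))"
  shows "wd (gal \<omega> v y \<gamma> t F) (G1 t)" "wd (G1 t) (G2 t)"
    "((\<lambda>t. gal \<omega> v y \<gamma> t F) has_vector_derivative (J (G2 t) + gal \<omega> v y \<gamma> t (J (\<omega> *\<^sub>R F - F2)))) (at t)"
proof -
  show "wd (gal \<omega> v y \<gamma> t F) (G1 t)" unfolding G1_def by (rule wd_gal[OF F1])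
  show "wd (G1 t) (G2 t)" unfolding G1_def G2_def by (intro wd_gal wd_add wd_scaleR wd_J F1 F2)
  let ?g = "mop (\<lambda>x. ph (v / 2 * x)) F" and ?g1 = "mop (\<lambda>x. ph (v / 2 * x)) (F1 + (v / 2) *\<^sub>R J F)"
  let ?c = "\<lambda>t. (v\<^sup>2 / 4 + \<omega>) * t + v * y / 2 + \<gamma>"
  have "((\<lambda>t. - (v * t + y)) has_vector_derivative (- v)) (at t)"
    by (auto intro!: derivative_eq_intros simp: has_real_derivative_iff_has_vector_derivative[symmetric])
  from vector_diff_chain_at[OF this wd_phase[OF F1, of "v / 2", unfolded wd_def, rule_format]]
  have 1: "((\<lambda>t. tr (- (v * t + y)) ?g) has_vector_derivative (- v) *\<^sub>R tr (- (v * t + y)) ?g1) (at t)"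
    by (simp add: o_def)
  have 2: "(?c has_real_derivative (v\<^sup>2 / 4 + \<omega>)) (at t)"
    by (auto intro!: derivative_eq_intros)
  have "((\<lambda>t. gal \<omega> v y \<gamma> t F) has_vector_derivative
      mop (\<lambda>_. ph (?c t)) ((- v) *\<^sub>R tr (- (v * t + y)) ?g1 + (v\<^sup>2 / 4 + \<omega>) *\<^sub>R J (tr (- (v * t + y)) ?g))) (at t)"
    unfolding gal_eq by (rule rotation_has_vector_derivative[OF 1 2])
  also have "mop (\<lambda>_. ph (?c t)) ((- v) *\<^sub>R tr (- (v * t + y)) ?g1 + (v\<^sup>2 / 4 + \<omega>) *\<^sub>R J (tr (- (v * t + y)) ?g)) =
      (- v) *\<^sub>R gal \<omega> v y \<gamma> t (F1 + (v / 2) *\<^sub>R J F) + (v\<^sup>2 / 4 + \<omega>) *\<^sub>R gal \<omega> v y \<gamma> t (J F)"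
    unfolding gal_eq by (simp add: J_mop_ph tr_J linear_simps[OF mop_bounded_linear, of "\<lambda>_. ph (?c t)"])
  also have "\<dots> = J (G2 t) + gal \<omega> v y \<gamma> t (J (\<omega> *\<^sub>R F - F2))"
    unfolding G2_def by (simp add: linear_simps[OF bounded_linear_gal] linear_simps[OF bounded_linear_J] J_J gal_J algebra_simps power2_eq_square flip: scaleR_left_distrib)
       (simp flip: scaleR_left_distrib add: field_simps)?
  finally show "((\<lambda>t. gal \<omega> v y \<gamma> t F) has_vector_derivative (J (G2 t) + gal \<omega> v y \<gamma> t (J (\<omega> *\<^sub>R F - F2)))) (at t)" .
qed

text \<open>The graph of H on equivalence classes, with derivatives taken as generators of
  translations. As a relation it carries the domain along.\<close>

definition Hl :: "real \<Rightarrow> (real \<Rightarrow> real) \<Rightarrow> (real \<Rightarrow> real) \<Rightarrow> l2 \<Rightarrow> l2 \<Rightarrow> bool" where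
  "Hl \<omega> U W F H \<longleftrightarrow> (\<exists>F1 F2. wd F F1 \<and> wd F1 F2 \<and>
     H = mop (\<lambda>_. sigma3) (\<omega> *\<^sub>R F - F2) + mop (potential U W) F)"

lemma H_graph_Hl:
  assumes b: "bdpot U W C" and H: "H_graph \<omega> U W f h"
  shows "Hl \<omega> U W (cls f) (cls h)"
proof -
  obtain f1 f2 where f: "L2 f" "L2 h" "L2 f1" "L2 f2" "weak_derivative f f1" "weak_derivative f1 f2"
    "AE x in lborel. h x = sigma3 *v (- f2 x + \<omega> *\<^sub>R f x) + potential U W x *v f x"
    using H unfolding H_graph_def by blast
  have L: "L2 (\<lambda>x. sigma3 *v (\<omega> *\<^sub>R f x - f2 x))" "L2 (\<lambda>x. potential U W x *v f x)"
    using f by (auto intro!: L2_bmat L2_diff L2_scaleR bmat_potential[OF b])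
  have "cls h = cls (\<lambda>x. sigma3 *v (\<omega> *\<^sub>R f x - f2 x) + potential U W x *v f x)"
    using f(7) by (subst cls_eq_iff) (auto intro: L2_add L f)
  also have "\<dots> = mop (\<lambda>_. sigma3) (\<omega> *\<^sub>R cls f - cls f2) + mop (potential U W) (cls f)"
    by (simp add: cls_add[OF L] mop_cls bmat_potential[OF b] f L2_diff L2_scaleR flip: cls_scaleR cls_diff)
  finally show ?thesis unfolding Hl_def
    using wd_weak_derivative f by blast
qed

lemma mop_neg_i_potential: "bdpot U W C \<Longrightarrow> mop (\<lambda>x. mat (- \<i>) ** potential U W x) u = - cs \<i> (mop (potential U W) u)"
  by (subst mop_mult[symmetric]) (simp_all add: bmat_potential flip: cs_def cs_minus_left)

lemma J_cs: "J u = cs \<i> (mop (\<lambda>_. sigma3) u)"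
  by (simp add: cs_def mop_mult jm_def)

lemma mop_mov_gal:
  assumes "bdpot U W C"
  shows "mop (mov \<omega> U W v y \<gamma> t) (gal \<omega> v y \<gamma> t u) = gal \<omega> v y \<gamma> t (mop (\<lambda>x. mat (- \<i>) ** potential U W x) u)"
  by (simp add: mop_mov[OF assms] gali_gal)

lemma cexp_has_vector_derivative:
  "((\<lambda>t. exp (c * of_real t :: complex)) has_vector_derivative c * exp (c * of_real t)) (at t within X)"
  by (rule has_vector_derivative_real_field) (auto intro!: derivative_eq_intros)

text \<open>The eigenvalue equation makes the resting operator produce i \<mu> F, which the
  derivative of the scalar factor cancels; the action of the accompanying potential is what
  remains.\<close>

lemma eigen_weak_solution:
  fixes v y \<gamma> :: real
  assumes b: "bdpot U W C" and H: "Hl \<omega> U W F (cs \<mu> F)"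
  defines "P \<equiv> \<lambda>t. cs (exp (- \<i> * \<mu> * of_real t)) (gal \<omega> v y \<gamma> t F)"
  shows "weak_solution core P (\<lambda>t. mop (mov \<omega> U W v y \<gamma> t) (P t))" "continuous_on {0..} P"
proof -
  obtain F1 F2 where F: "wd F F1" "wd F1 F2" and eq: "cs \<mu> F = mop (\<lambda>_. sigma3) (\<omega> *\<^sub>R F - F2) + mop (potential U W) F"
    using H unfolding Hl_def by blast
  let ?V = "mop (\<lambda>x. mat (- \<i>) ** potential U W x)" and ?e = "\<lambda>t. exp (- \<i> * \<mu> * of_real t)"
  have JF: "J (\<omega> *\<^sub>R F - F2) = cs (\<i> * \<mu>) F + ?V F"
    using arg_cong[OF eq, of "cs \<i>"] by (simp add: J_cs mop_neg_i_potential[OF b] cs_simps)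
  define G1 where "G1 t = gal \<omega> v y \<gamma> t (F1 + (v / 2) *\<^sub>R J F)" for t
  define G2 where "G2 t = gal \<omega> v y \<gamma> t ((F2 + (v / 2) *\<^sub>R J F1) + (v / 2) *\<^sub>R J (F1 + (v / 2) *\<^sub>R J F))" for t
  note G = gal_has_vector_derivative[OF F, of \<omega> v y \<gamma>, folded G1_def G2_def]
  have d: "(P has_vector_derivative (J (cs (?e t) (G2 t)) + mop (mov \<omega> U W v y \<gamma> t) (P t))) (at t within {0..})" for t
  proof -
    have "(?e has_vector_derivative (- \<i> * \<mu>) * ?e t) (at t)"
      by (rule cexp_has_vector_derivative)
    from bounded_bilinear.has_vector_derivative[OF bounded_bilinear_cs this G(3)]
    have "(P has_vector_derivative (cs (?e t) (J (G2 t) + gal \<omega> v y \<gamma> t (cs (\<i> * \<mu>) F + ?V F)) + cs ((- \<i> * \<mu>) * ?e t) (gal \<omega> v y \<gamma> t F))) (at t)"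
      unfolding P_def JF .
    moreover have "cs (?e t) (J (G2 t) + gal \<omega> v y \<gamma> t (cs (\<i> * \<mu>) F + ?V F)) + cs ((- \<i> * \<mu>) * ?e t) (gal \<omega> v y \<gamma> t F) =
        J (cs (?e t) (G2 t)) + mop (mov \<omega> U W v y \<gamma> t) (P t)"
    proof -
      have "mop (mov \<omega> U W v y \<gamma> t) (P t) = cs (?e t) (gal \<omega> v y \<gamma> t (?V F))"
        unfolding P_def by (simp add: mop_cs bmat_mov[OF b] mop_mov_gal[OF b])
      then show ?thesis
        by (simp add: cs_simps mop_cs gal_cs linear_simps[OF bounded_linear_gal] cs_minus_left mult.commute mult.left_commute)
    qed
    ultimately show ?thesis by (auto intro: has_vector_derivative_at_within)
  qed
  show "weak_solution core P (\<lambda>t. mop (mov \<omega> U W v y \<gamma> t) (P t))"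
  proof (rule weak_solution_strong[OF d])
    show "wd (P t) (cs (?e t) (G1 t))" "wd (cs (?e t) (G1 t)) (cs (?e t) (G2 t))" for t
      unfolding P_def by (intro wd_cs G)+
  qed
  show "continuous_on {0..} P" by (rule continuous_on_if_has_vector_derivative[OF d])
qed

lemma generalized_weak_solution:
  fixes v y \<gamma> :: real
  assumes b: "bdpot U W C" and z: "Hl \<omega> U W Z (cs \<i> F)" and f: "Hl \<omega> U W F 0"
  defines "P \<equiv> \<lambda>t. gal \<omega> v y \<gamma> t Z + t *\<^sub>R gal \<omega> v y \<gamma> t F"
  shows "weak_solution core P (\<lambda>t. mop (mov \<omega> U W v y \<gamma> t) (P t))" "continuous_on {0..} P"
proof -
  obtain F1 F2 where F: "wd F F1" "wd F1 F2" and eqF: "0 = mop (\<lambda>_. sigma3) (\<omega> *\<^sub>R F - F2) + mop (potential U W) F"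
    using f unfolding Hl_def by blast
  obtain Z1 Z2 where Z: "wd Z Z1" "wd Z1 Z2" and eqZ: "cs \<i> F = mop (\<lambda>_. sigma3) (\<omega> *\<^sub>R Z - Z2) + mop (potential U W) Z"
    using z unfolding Hl_def by blast
  let ?V = "mop (\<lambda>x. mat (- \<i>) ** potential U W x)"
  have JF: "J (\<omega> *\<^sub>R F - F2) = ?V F"
    using arg_cong[OF eqF, of "cs \<i>"] by (simp add: J_cs mop_neg_i_potential[OF b] cs_simps eq_neg_iff_add_eq_0)
  \<comment> \<open>The term \<open>- F\<close> coming from the Jordan chain is compensated by the
    time derivative of the factor t in front of
    \<open>gal \<omega> v y \<gamma> t F\<close>.\<close>
  have JZ: "J (\<omega> *\<^sub>R Z - Z2) = - F + ?V Z"
    using arg_cong[OF eqZ, of "cs \<i>"] by (simp add: J_cs mop_neg_i_potential[OF b] cs_simps cs_minus_left)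
  define G1 where "G1 t = gal \<omega> v y \<gamma> t (F1 + (v / 2) *\<^sub>R J F)" for t
  define G2 where "G2 t = gal \<omega> v y \<gamma> t ((F2 + (v / 2) *\<^sub>R J F1) + (v / 2) *\<^sub>R J (F1 + (v / 2) *\<^sub>R J F))" for t
  note G = gal_has_vector_derivative[OF F, of \<omega> v y \<gamma>, folded G1_def G2_def]
  define K1 where "K1 t = gal \<omega> v y \<gamma> t (Z1 + (v / 2) *\<^sub>R J Z)" for t
  define K2 where "K2 t = gal \<omega> v y \<gamma> t ((Z2 + (v / 2) *\<^sub>R J Z1) + (v / 2) *\<^sub>R J (Z1 + (v / 2) *\<^sub>R J Z))" for t
  note K = gal_has_vector_derivative[OF Z, of \<omega> v y \<gamma>, folded K1_def K2_def]
  have d: "(P has_vector_derivative (J (K2 t + t *\<^sub>R G2 t) + mop (mov \<omega> U W v y \<gamma> t) (P t))) (at t within {0..})" for t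
  proof -
    have "(P has_vector_derivative ((J (K2 t) + gal \<omega> v y \<gamma> t (- F + ?V Z)) +
        (t *\<^sub>R (J (G2 t) + gal \<omega> v y \<gamma> t (?V F)) + 1 *\<^sub>R gal \<omega> v y \<gamma> t F))) (at t)"
      unfolding P_def using K(3)[of t] G(3)[of t] unfolding JF JZ
      by (intro has_vector_derivative_add has_vector_derivative_scaleR) auto
    moreover have "((J (K2 t) + gal \<omega> v y \<gamma> t (- F + ?V Z)) +
        (t *\<^sub>R (J (G2 t) + gal \<omega> v y \<gamma> t (?V F)) + 1 *\<^sub>R gal \<omega> v y \<gamma> t F)) =
        J (K2 t + t *\<^sub>R G2 t) + mop (mov \<omega> U W v y \<gamma> t) (P t)"
    proof -
      have "mop (mov \<omega> U W v y \<gamma> t) (P t) = gal \<omega> v y \<gamma> t (?V Z) + t *\<^sub>R gal \<omega> v y \<gamma> t (?V F)"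
        unfolding P_def by (simp add: mop_add mop_scaleR bmat_mov[OF b] mop_mov_gal[OF b])
      then show ?thesis
        by (simp add: linear_simps[OF bounded_linear_gal] linear_simps[OF bounded_linear_J] scaleR_add_right)
    qed
    ultimately show ?thesis by (auto intro: has_vector_derivative_at_within)
  qed
  show "weak_solution core P (\<lambda>t. mop (mov \<omega> U W v y \<gamma> t) (P t))"
  proof (rule weak_solution_strong[OF d])
    show "wd (P t) (K1 t + t *\<^sub>R G1 t)" "wd (K1 t + t *\<^sub>R G1 t) (K2 t + t *\<^sub>R G2 t)" for t
      unfolding P_def by (intro wd_add wd_scaleR G K)+
  qed
  show "continuous_on {0..} P" by (rule continuous_on_if_has_vector_derivative[OF d])
qed

subsection \<open>Exponential decay of eigenfunctions\<close>

definition ind :: "real set \<Rightarrow> l2 \<Rightarrow> l2" where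
  "ind S = mop (\<lambda>x. mat (of_real (indicator S x)))"

lemma bmat_ind:
  assumes "S \<in> sets borel"
  shows "bmat (\<lambda>x. mat (of_real (indicator S x)))"
proof -
  have "(\<lambda>x. (mat (of_real (indicator S x)) :: complex ^ 2 ^ 2) $ i $ j) \<in> borel_measurable borel" for i j
    using assms by (cases "i = j") (auto simp: mat_def)
  then show ?thesis unfolding bmat_def
    by (auto intro!: exI[of _ 1] simp: mat_mv norm_smult indicator_def)
qed

lemma ind_cls:
  assumes "S \<in> sets borel" "L2 f"
  shows "ind S (cls f) = cls (\<lambda>x. indicator S x *\<^sub>R f x)"
  unfolding ind_def by (subst mop_cls[OF bmat_ind]) (use assms in \<open>auto simp: mat_mv smult_of_real\<close>)

lemma L2_ind: "S \<in> sets borel \<Longrightarrow> L2 f \<Longrightarrow> L2 (\<lambda>x. indicator S x *\<^sub>R f x)"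
  using L2_bmat[OF bmat_ind] by (simp add: mat_mv smult_of_real)

lemma bounded_linear_ind: "S \<in> sets borel \<Longrightarrow> bounded_linear (ind S)"
  unfolding ind_def by (rule mop_bounded_linear[OF bmat_ind])

lemma ind_cover:
  assumes "S \<in> sets borel" "T \<in> sets borel" "T' \<in> sets borel" "S \<subseteq> T \<union> T'"
  shows "norm (ind S u) \<le> norm (ind T u) + norm (ind T' u)"
proof -
  obtain f where f: "L2 f" "u = cls f" by (rule l2_cases)
  have "norm (cls (\<lambda>x. indicator S x *\<^sub>R f x)) \<le> 1 * norm (cls (\<lambda>x. indicator T x *\<^sub>R f x + indicator T' x *\<^sub>R f x))"
  proof (rule cls_norm_le)
    show "AE x in lborel. norm (indicator S x *\<^sub>R f x) \<le> 1 * norm (indicator T x *\<^sub>R f x + indicator T' x *\<^sub>R f x)"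
      using assms(4) by (intro AE_I2) (auto simp: indicator_def simp flip: scaleR_2)
  qed (use assms f in \<open>auto intro!: L2_add L2_ind\<close>)
  also have "1 * norm (cls (\<lambda>x. indicator T x *\<^sub>R f x + indicator T' x *\<^sub>R f x)) \<le> norm (ind T u) + norm (ind T' u)"
    unfolding f(2) ind_cls[OF assms(2) f(1)] ind_cls[OF assms(3) f(1)]
    by (simp add: cls_add L2_ind assms f norm_triangle_ineq)
  finally show ?thesis by (simp add: f(2) ind_cls assms f)
qed

lemma ind_norm_le: "S \<in> sets borel \<Longrightarrow> norm (ind S u) \<le> norm u"
  unfolding ind_def using mop_norm_le[OF bmat_ind, of S 1 u]
  by (auto simp: mat_mv norm_smult indicator_def)

lemma ind_mono:
  assumes "S \<in> sets borel" "T \<in> sets borel" "S \<subseteq> T"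
  shows "norm (ind S u) \<le> norm (ind T u)"
proof -
  obtain f where f: "L2 f" "u = cls f" by (rule l2_cases)
  have "norm (cls (\<lambda>x. indicator S x *\<^sub>R f x)) \<le> 1 * norm (cls (\<lambda>x. indicator T x *\<^sub>R f x))"
  proof (rule cls_norm_le)
    show "AE x in lborel. norm (indicator S x *\<^sub>R f x) \<le> 1 * norm (indicator T x *\<^sub>R f x)"
      using assms(3) by (intro AE_I2) (auto simp: indicator_def)
  qed (use assms f in \<open>auto intro!: L2_ind\<close>)
  then show ?thesis by (simp add: f(2) ind_cls assms f)
qed

lemma ind_mop:
  assumes "S \<in> sets borel" "bmat M"
  shows "ind S (mop M u) = mop M (ind S u)"
  unfolding ind_def by (simp add: mop_mult bmat_ind assms mat_commute)

lemma ind_cs: "S \<in> sets borel \<Longrightarrow> ind S (cs c u) = cs c (ind S u)"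
  unfolding cs_def by (rule ind_mop) auto

lemma ind_tr:
  assumes "S \<in> sets borel" "T = {x. x - s \<in> S}"
  shows "ind S (tr s u) = tr s (ind T u)"
proof -
  have T: "T \<in> sets borel" unfolding assms(2)
    using measurable_sets[of "\<lambda>x. x - s" borel borel S] assms(1) by (simp add: vimage_def)
  have "indicator S x = (indicator T (x + s) :: real)" for x by (auto simp: assms(2) indicator_def)
  then show ?thesis unfolding ind_def tr_mop[OF bmat_ind[OF T]] by simp
qed

abbreviation "ctl a \<equiv> ind {a..}"

lemma cut_tr: "ctl a (tr s u) = tr s (ctl (a + s) u)"
  by (rule ind_tr) auto

lemma cut_tendsto_0: "(\<lambda>n. norm (ctl (a + real n) u)) \<longlonglongrightarrow> 0"
proof -
  obtain f where f: "L2 f" "u = cls f" by (rule l2_cases)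
  note [measurable] = L2_measurable[OF f(1)]
  have "(\<lambda>n. \<integral>x. (norm (indicator {a + real n..} x *\<^sub>R f x))\<^sup>2 \<partial>lborel) \<longlonglongrightarrow> (\<integral>x. (0 :: real) \<partial>(lborel :: real measure))"
  proof (rule integral_dominated_convergence[where w = "\<lambda>x. (norm (f x))\<^sup>2"])
    show "integrable lborel (\<lambda>x. (norm (f x))\<^sup>2)" by (rule L2_square_integrable[OF f(1)])
    show "AE x in lborel. (\<lambda>n. (norm (indicator {a + real n..} x *\<^sub>R f x))\<^sup>2) \<longlonglongrightarrow> 0"
    proof (rule AE_I2, rule tendsto_eventually)
      fix x
      obtain N :: nat where "x - a < real N" using reals_Archimedean2 by blast
      then show "\<forall>\<^sub>F n in sequentially. (norm (indicator {a + real n..} x *\<^sub>R f x))\<^sup>2 = 0"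
        unfolding eventually_sequentially by (intro exI[of _ N]) (auto simp: indicator_def)
    qed
    show "AE x in lborel. norm ((norm (indicator {a + real n..} x *\<^sub>R f x))\<^sup>2) \<le> (norm (f x))\<^sup>2" for n
      by (intro AE_I2) (auto simp: indicator_def)
  qed auto
  then have "(\<lambda>n. (norm (ctl (a + real n) u))\<^sup>2) \<longlonglongrightarrow> 0"
    by (simp add: f(2) ind_cls f(1) cls_norm_square L2_ind del: norm_scaleR)
  from tendsto_real_sqrt[OF this] show ?thesis by simp
qed

section \<open>First and second order equations with exponentially decaying source\<close>

lemma deriv_exp_bound:
  fixes \<psi> :: "real \<Rightarrow> 'a::banach"
  assumes S: "0 \<le> S" and b: "0 < b" and d: "\<And>s. s \<in> {0..S} \<Longrightarrow> (\<psi> has_vector_derivative \<psi>' s) (at s within {0..S})"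
    and le: "\<And>s. s \<in> {0..S} \<Longrightarrow> norm (\<psi>' s) \<le> c * exp (- b * s)" and c: "0 \<le> c"
  shows "norm (\<psi> S - \<psi> 0) \<le> c / b"
proof -
  have I: "(\<psi>' has_integral (\<psi> S - \<psi> 0)) {0..S}" by (rule fundamental_theorem_of_calculus[OF S d])
  have J: "((\<lambda>s. c * exp (- b * s)) has_integral (- (c / b) * exp (- b * S) - - (c / b) * exp (- b * 0))) {0..S}"
    by (rule fundamental_theorem_of_calculus[OF S])
      (use b in \<open>auto intro!: derivative_eq_intros simp: has_real_derivative_iff_has_vector_derivative[symmetric] field_simps\<close>)
  have "norm (\<psi> S - \<psi> 0) \<le> - (c / b) * exp (- b * S) - - (c / b) * exp (- b * 0)"
    using integral_norm_bound_integral[OF has_integral_integrable[OF I] has_integral_integrable[OF J] le]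
    unfolding integral_unique[OF I] integral_unique[OF J] .
  also have "\<dots> \<le> c / b" using b c by simp
  finally show ?thesis .
qed

definition tail1 :: "real \<Rightarrow> real \<Rightarrow> l2 \<Rightarrow> bool" where
  "tail1 b G u \<longleftrightarrow> (\<forall>a\<ge>0. norm (ctl a u) \<le> G * exp (- b * a))"

lemma tail1_nonneg: "tail1 b G u \<Longrightarrow> 0 \<le> G"
  unfolding tail1_def using order_trans[OF norm_ge_zero, of "ctl 0 u" "G * exp (- b * 0)"] by auto

text \<open>For Re \<kappa> nonnegative the homogeneous solution does not decay to the right, so
  \<open>w\<close> is determined by integrating from infinity. Along the shift by s, weighted with
  exp (- \<kappa> s), only the source beyond a + s contributes; the boundary term vanishes because
  tails of an L^2 function tend to 0.\<close>

lemma tail1_solution_growing: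
  assumes w: "wd w (cs \<kappa> w - g)" and k: "0 \<le> Re \<kappa>" and b: "0 < b" and g: "tail1 b G g"
  shows "tail1 b (G / b) w"
  unfolding tail1_def
proof (intro allI impI)
  fix a :: real assume a: "0 \<le> a"
  have G: "0 \<le> G" by (rule tail1_nonneg[OF g])
  define \<psi> where "\<psi> s = ctl a (cs (exp (- \<kappa> * of_real s)) (tr s w))" for s
  define \<psi>' where "\<psi>' s = - ctl a (cs (exp (- \<kappa> * of_real s)) (tr s g))" for s
  have d: "(\<psi> has_vector_derivative \<psi>' s) (at s within X)" for s X
  proof -
    have "((\<lambda>s. cs (exp (- \<kappa> * of_real s)) (tr s w)) has_vector_derivative
        (cs (exp (- \<kappa> * of_real s)) (tr s (cs \<kappa> w - g)) + cs (- \<kappa> * exp (- \<kappa> * of_real s)) (tr s w))) (at s within X)"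
      by (rule bounded_bilinear.has_vector_derivative[OF bounded_bilinear_cs cexp_has_vector_derivative])
        (use w in \<open>auto simp: wd_def intro: has_vector_derivative_at_within\<close>)
    also have "cs (exp (- \<kappa> * of_real s)) (tr s (cs \<kappa> w - g)) + cs (- \<kappa> * exp (- \<kappa> * of_real s)) (tr s w) =
        - cs (exp (- \<kappa> * of_real s)) (tr s g)"
      by (simp add: tr_diff tr_cs cs_simps cs_minus_left mult.commute)
    finally have "(\<psi> has_vector_derivative ctl a (- cs (exp (- \<kappa> * of_real s)) (tr s g))) (at s within X)"
      unfolding \<psi>_def by (rule bounded_linear.has_vector_derivative[OF bounded_linear_ind, rotated]) simp
    then show ?thesis by (simp add: \<psi>'_def linear_simps[OF bounded_linear_ind])
  qed
  have le: "norm (\<psi>' s) \<le> (G * exp (- b * a)) * exp (- b * s)" if "0 \<le> s" for s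
  proof -
    have "norm (\<psi>' s) = exp (- Re \<kappa> * s) * norm (ctl (a + s) g)"
      by (simp add: \<psi>'_def ind_cs cut_tr norm_exp_eq_Re)
    also have "\<dots> \<le> 1 * (G * exp (- b * (a + s)))"
      using g a that k by (intro mult_mono) (auto simp: tail1_def)
    also have "exp (- b * (a + s)) = exp (- b * a) * exp (- b * s)"
      by (simp add: distrib_left flip: exp_add)
    finally show ?thesis by (simp only: mult.assoc mult_1)
  qed
  have "norm (ctl a w) \<le> norm (ctl (a + real n) w) + G * exp (- b * a) / b" for n
  proof -
    have "norm (\<psi> (real n) - \<psi> 0) \<le> G * exp (- b * a) / b"
      by (rule deriv_exp_bound[OF _ b d le]) (use G in auto)
    moreover have "norm (\<psi> (real n)) \<le> 1 * norm (ctl (a + real n) w)"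
      using k by (simp add: \<psi>_def ind_cs cut_tr norm_exp_eq_Re mult_left_le_one_le)
    moreover have "\<psi> 0 = ctl a w" by (simp add: \<psi>_def)
    ultimately show ?thesis using norm_triangle_ineq2[of "\<psi> 0" "\<psi> (real n)"] by (simp add: norm_minus_commute)
  qed
  moreover have "(\<lambda>n. norm (ctl (a + real n) w) + G * exp (- b * a) / b) \<longlonglongrightarrow> 0 + G * exp (- b * a) / b"
    by (intro tendsto_add cut_tendsto_0 tendsto_const)
  ultimately have "norm (ctl a w) \<le> 0 + G * exp (- b * a) / b"
    by (intro LIMSEQ_le_const[of "\<lambda>n. norm (ctl (a + real n) w) + G * exp (- b * a) / b"]) auto
  then show "norm (ctl a w) \<le> G / b * exp (- b * a)" by simp
qed

text \<open>The homogeneous solution now decays at least at rate \<delta>, so the equation is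
  integrated from the left over the distance a. The boundary term carries exp (- \<delta> a), and
  the source beyond a - s is weighted with exp (- \<delta> s); the margin \<delta> - b makes the
  resulting integral converge.\<close>

lemma tail1_solution_decaying:
  assumes u: "wd u (w - cs \<kappa> u)" and k: "\<delta> \<le> Re \<kappa>" and b: "0 < b" "b < \<delta>" and w: "tail1 b G w"
  shows "tail1 b (norm u + G / (\<delta> - b)) u"
  unfolding tail1_def
proof (intro allI impI)
  fix a :: real assume a: "0 \<le> a"
  have G: "0 \<le> G" by (rule tail1_nonneg[OF w])
  define \<psi> where "\<psi> s = ctl a (cs (exp (- \<kappa> * of_real s)) (tr (- s) u))" for s
  define \<psi>' where "\<psi>' s = - ctl a (cs (exp (- \<kappa> * of_real s)) (tr (- s) w))" for s
  have d: "(\<psi> has_vector_derivative \<psi>' s) (at s within X)" for s X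
  proof -
    have "((\<lambda>s. - s) has_vector_derivative - 1) (at s)" by (auto intro!: derivative_eq_intros)
    from vector_diff_chain_at[OF this u[unfolded wd_def, rule_format]]
    have "((\<lambda>s. tr (- s) u) has_vector_derivative - tr (- s) (w - cs \<kappa> u)) (at s)" by (simp add: o_def)
    then have "((\<lambda>s. tr (- s) u) has_vector_derivative - tr (- s) (w - cs \<kappa> u)) (at s within X)"
      by (rule has_vector_derivative_at_within)
    from bounded_bilinear.has_vector_derivative[OF bounded_bilinear_cs cexp_has_vector_derivative this]
    have "((\<lambda>s. cs (exp (- \<kappa> * of_real s)) (tr (- s) u)) has_vector_derivative
        (cs (exp (- \<kappa> * of_real s)) (- tr (- s) (w - cs \<kappa> u)) + cs (- \<kappa> * exp (- \<kappa> * of_real s)) (tr (- s) u))) (at s within X)" .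
    also have "cs (exp (- \<kappa> * of_real s)) (- tr (- s) (w - cs \<kappa> u)) + cs (- \<kappa> * exp (- \<kappa> * of_real s)) (tr (- s) u) =
        - cs (exp (- \<kappa> * of_real s)) (tr (- s) w)"
      by (simp add: tr_diff tr_cs cs_simps cs_minus_left mult.commute)
    finally have "(\<psi> has_vector_derivative ctl a (- cs (exp (- \<kappa> * of_real s)) (tr (- s) w))) (at s within X)"
      unfolding \<psi>_def by (rule bounded_linear.has_vector_derivative[OF bounded_linear_ind, rotated]) simp
    then show ?thesis by (simp add: \<psi>'_def linear_simps[OF bounded_linear_ind])
  qed
  have le: "norm (\<psi>' s) \<le> (G * exp (- b * a)) * exp (- (\<delta> - b) * s)" if "s \<in> {0..a}" for s
  proof -
    have "norm (\<psi>' s) = exp (- Re \<kappa> * s) * norm (ctl (a - s) w)"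
      by (simp add: \<psi>'_def ind_cs cut_tr norm_exp_eq_Re)
    also have "\<dots> \<le> exp (- \<delta> * s) * (G * exp (- b * (a - s)))"
      using w a that k by (intro mult_mono) (auto simp: tail1_def mult_right_mono)
    also have "\<dots> = (G * exp (- b * a)) * exp (- (\<delta> - b) * s)"
      by (simp add: algebra_simps flip: exp_add)
    finally show ?thesis .
  qed
  have "norm (\<psi> a - \<psi> 0) \<le> G * exp (- b * a) / (\<delta> - b)"
    by (rule deriv_exp_bound[OF a _ d le]) (use b G in auto)
  moreover have "norm (\<psi> a) \<le> exp (- b * a) * norm u"
  proof -
    have "norm (\<psi> a) \<le> norm (cs (exp (- \<kappa> * of_real a)) (tr (- a) u))"
      unfolding \<psi>_def by (rule ind_norm_le) simp
    also have "\<dots> = exp (- Re \<kappa> * a) * norm u" by (simp add: norm_exp_eq_Re)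
    also have "\<dots> \<le> exp (- b * a) * norm u"
      using k b a by (intro mult_right_mono) (auto intro: mult_right_mono)
    finally show ?thesis .
  qed
  moreover have "\<psi> 0 = ctl a u" by (simp add: \<psi>_def)
  ultimately have "norm (ctl a u) \<le> exp (- b * a) * norm u + G * exp (- b * a) / (\<delta> - b)"
    using norm_triangle_ineq2[of "\<psi> 0" "\<psi> a"] by (simp add: norm_minus_commute)
  then show "norm (ctl a u) \<le> (norm u + G / (\<delta> - b)) * exp (- b * a)" by (simp add: algebra_simps)
qed

lemma tail1_mono: "tail1 b G u \<Longrightarrow> G \<le> G' \<Longrightarrow> tail1 b G' u"
  unfolding tail1_def by (meson exp_ge_zero mult_right_mono order_trans)

text \<open>Factorize \<open>\<partial>\<^sup>2 - \<kappa>\<^sup>2 = (\<partial> - \<kappa>) (\<partial> + \<kappa>)\<close>. If \<open>Re \<kappa> = 0\<close>, then both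
  first order equations are integrated from infinity.\<close>

lemma tail1_second_order:
  assumes u: "wd u u1" "wd u1 (cs (\<kappa>\<^sup>2) u - g)" and k: "Re \<kappa> = 0 \<or> \<delta> \<le> Re \<kappa>"
    and b: "0 < b" "b < \<delta>" and g: "tail1 b G g"
  shows "tail1 b (norm u + G * (1 / b * (1 / b + 1 / (\<delta> - b)))) u"
proof -
  \<comment> \<open>The inner factor \<partial> + \<kappa> applied to \<open>u\<close>, which solves
    the growing first order equation.\<close>
  define w where "w = u1 + cs \<kappa> u"
  have G: "0 \<le> G" by (rule tail1_nonneg[OF g])
  have k0: "0 \<le> Re \<kappa>" using k b by linarith
  have "wd w (cs (\<kappa>\<^sup>2) u - g + cs \<kappa> u1)" unfolding w_def by (intro wd_add wd_cs u)
  also have "cs (\<kappa>\<^sup>2) u - g + cs \<kappa> u1 = cs \<kappa> w - g" by (simp add: w_def cs_simps power2_eq_square)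
  finally have w: "tail1 b (G / b) w" by (rule tail1_solution_growing[OF _ k0 b(1) g])
  have u1: "wd u (w - cs \<kappa> u)" using u(1) by (simp add: w_def)
  from k show ?thesis
  proof
    assume k: "Re \<kappa> = 0"
    have wu: "wd u (cs (- \<kappa>) u - (- w))" using u1 by (simp add: cs_minus_left)
    have w': "tail1 b (G / b) (- w)" using w by (simp add: tail1_def linear_simps[OF bounded_linear_ind])
    have "tail1 b (G / b / b) u" by (rule tail1_solution_growing[OF wu _ b(1) w']) (simp add: k)
    then show ?thesis using G b by (rule_tac tail1_mono) (auto simp: algebra_simps intro: add_increasing2)
  next
    assume "\<delta> \<le> Re \<kappa>"
    from tail1_solution_decaying[OF u1 this b w] show ?thesis
      by (rule tail1_mono) (use G b in \<open>auto simp: algebra_simps intro: add_increasing2\<close>)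
  qed
qed

text \<open>Reflection at the origin turns left tails into right tails, and the second order
  equation keeps its form under it.\<close>

definition rf :: "l2 \<Rightarrow> l2" where "rf u = cls (\<lambda>x. rep_l2 u (- x))"

lemma L2_reflect:
  assumes "L2 f"
  shows "L2 (\<lambda>x. f (- x))"
proof -
  note [measurable] = L2_measurable[OF assms]
  show ?thesis unfolding L2_def
    using lborel_integrable_real_affine[OF L2_square_integrable[OF assms], of "-1" 0] by simp
qed

lemma rf_cls:
  assumes "L2 f"
  shows "rf (cls f) = cls (\<lambda>x. f (- x))"
proof -
  note [measurable] = L2_measurable[OF assms] L2_measurable[OF L2_rep]
  have "AE x in lborel. rep_l2 (cls f) (0 + - 1 * x) = f (0 + - 1 * x)"
    by (rule AE_borel_affine[OF _ _ rep_cls_AE[OF assms]]) auto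
  then show ?thesis unfolding rf_def by (simp add: cls_eq_iff L2_reflect assms)
qed

lemma rf_add: "rf (u + v) = rf u + rf v"
  by (cases u rule: l2_cases; cases v rule: l2_cases) (simp add: rf_cls L2_add L2_reflect flip: cls_add)

lemma rf_scaleR: "rf (c *\<^sub>R u) = c *\<^sub>R rf u"
  by (cases u rule: l2_cases) (simp add: rf_cls L2_scaleR L2_reflect flip: cls_scaleR)

lemma rf_norm [simp]: "norm (rf u) = norm u"
proof -
  obtain f where f: "L2 f" "u = cls f" by (rule l2_cases)
  have "(\<integral>x. (norm (f (- x)))\<^sup>2 \<partial>lborel) = (\<integral>x. (norm (f x))\<^sup>2 \<partial>lborel)"
    using lborel_integral_real_affine[of "-1" "\<lambda>x. (norm (f x))\<^sup>2" 0] by simp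
  then show ?thesis by (simp add: f rf_cls cls_norm L2_reflect L2norm_def)
qed

lemma bounded_linear_rf: "bounded_linear rf"
  by (rule bounded_linear_intro[of _ 1]) (auto simp: rf_add rf_scaleR)

lemma tr_rf: "tr s (rf u) = rf (tr (- s) u)"
proof -
  obtain f where f: "L2 f" "u = cls f" by (rule l2_cases)
  have "rf (cls (\<lambda>x. f (x + - s))) = cls (\<lambda>x. f (- x + - s))"
    by (rule rf_cls[OF L2_shift[OF f(1)]])
  then show ?thesis using f by (simp add: tr_cls rf_cls L2_reflect)
qed

lemma rf_cs: "rf (cs c u) = cs c (rf u)"
  by (cases u rule: l2_cases) (simp add: cs_cls rf_cls L2_reflect L2_smult)

lemma wd_rf:
  assumes "wd u u'"
  shows "wd (rf u) (- rf u')"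
  unfolding wd_def
proof
  fix s
  have "((\<lambda>s. - s) has_vector_derivative - 1) (at s)" by (auto intro!: derivative_eq_intros)
  from vector_diff_chain_at[OF this assms[unfolded wd_def, rule_format]]
  have "((\<lambda>s. tr (- s) u) has_vector_derivative - tr (- s) u') (at s)" by (simp add: o_def)
  from bounded_linear.has_vector_derivative[OF bounded_linear_rf this]
  show "((\<lambda>s. tr s (rf u)) has_vector_derivative tr s (- rf u')) (at s)"
    by (simp add: tr_rf tr_minus linear_simps[OF bounded_linear_rf])
qed

lemma ind_rf:
  assumes "S \<in> sets borel" "T = {x. - x \<in> S}"
  shows "ind S (rf u) = rf (ind T u)"
proof -
  have T: "T \<in> sets borel" unfolding assms(2)
    using measurable_sets[of "\<lambda>x. - x" borel borel S] assms(1) by (simp add: vimage_def)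
  have "indicator S x = (indicator T (- x) :: real)" for x by (auto simp: assms(2) indicator_def)
  then show ?thesis
    by (cases u rule: l2_cases) (simp add: ind_cls T assms(1) rf_cls L2_ind L2_reflect)
qed

section \<open>Two-sided tails and decay for the matrix operator\<close>

abbreviation "out a \<equiv> ind {x. \<bar>x\<bar> \<ge> a}"

lemma out_sets [simp]: "{x::real. \<bar>x\<bar> \<ge> a} \<in> sets borel" by measurable

definition tail2 :: "real \<Rightarrow> real \<Rightarrow> l2 \<Rightarrow> bool" where
  "tail2 b G u \<longleftrightarrow> (\<forall>a\<ge>0. norm (out a u) \<le> G * exp (- b * a))"

lemma tail2_imp_tail1: "tail2 b G u \<Longrightarrow> tail1 b G u" "tail2 b G u \<Longrightarrow> tail1 b G (rf u)"
proof -
  assume u: "tail2 b G u"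
  have "norm (ctl a u) \<le> norm (out a u)" for a by (rule ind_mono) auto
  then show "tail1 b G u" using u order_trans unfolding tail1_def tail2_def by blast
  have "ind {a..} (rf u) = rf (ind {..-a} u)" for a by (rule ind_rf) auto
  moreover have "norm (ind {..-a} u) \<le> norm (out a u)" for a by (rule ind_mono) auto
  ultimately show "tail1 b G (rf u)" using u order_trans unfolding tail1_def tail2_def by (metis rf_norm)
qed

lemma tail1_imp_tail2:
  assumes "tail1 b G u" "tail1 b G (rf u)"
  shows "tail2 b (2 * G) u"
  unfolding tail2_def
proof (intro allI impI)
  fix a :: real assume a: "0 \<le> a"
  have "ind {a..} (rf u) = rf (ind {..-a} u)" by (rule ind_rf) auto
  then have "norm (ind {..-a} u) = norm (ctl a (rf u))" by simp
  moreover have "norm (out a u) \<le> norm (ctl a u) + norm (ind {..-a} u)" by (rule ind_cover) auto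
  moreover have "norm (ctl a u) \<le> G * exp (- b * a)" "norm (ctl a (rf u)) \<le> G * exp (- b * a)"
    using assms a by (auto simp: tail1_def)
  ultimately show "norm (out a u) \<le> 2 * G * exp (- b * a)" by linarith
qed

lemma tail2_second_order:
  assumes u: "wd u u1" "wd u1 (cs (\<kappa>\<^sup>2) u - g)" and k: "Re \<kappa> = 0 \<or> \<delta> \<le> Re \<kappa>"
    and b: "0 < b" "b < \<delta>" and g: "tail2 b G g"
  shows "tail2 b (2 * (norm u + G * (1 / b * (1 / b + 1 / (\<delta> - b))))) u"
proof (rule tail1_imp_tail2)
  show "tail1 b (norm u + G * (1 / b * (1 / b + 1 / (\<delta> - b)))) u"
    by (rule tail1_second_order[OF u k b tail2_imp_tail1(1)[OF g]])
  have "wd (rf u) (- rf u1)" "wd (- rf u1) (rf (cs (\<kappa>\<^sup>2) u - g))"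
    using wd_rf[OF u(1)] wd_scaleR[OF wd_rf[OF u(2)], of "-1"] by auto
  moreover have "rf (cs (\<kappa>\<^sup>2) u - g) = cs (\<kappa>\<^sup>2) (rf u) - rf g"
    by (simp add: linear_simps[OF bounded_linear_rf] rf_cs)
  ultimately show "tail1 b (norm u + G * (1 / b * (1 / b + 1 / (\<delta> - b)))) (rf u)"
    using tail1_second_order[of "rf u" "- rf u1" \<kappa> "rf g", OF _ _ k b tail2_imp_tail1(2)[OF g]] by simp
qed

definition decaying :: "real \<Rightarrow> real \<Rightarrow> (real \<Rightarrow> real) \<Rightarrow> (real \<Rightarrow> real) \<Rightarrow> bool" where
  "decaying \<alpha> C U W \<longleftrightarrow> U \<in> borel_measurable borel \<and> W \<in> borel_measurable borel \<and> 0 \<le> C \<and> 0 < \<alpha> \<and>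
     (\<forall>x. \<bar>U x\<bar> \<le> C * exp (- \<alpha> * \<bar>x\<bar>) \<and> \<bar>W x\<bar> \<le> C * exp (- \<alpha> * \<bar>x\<bar>))"

lemma decaying_bdpot:
  assumes "decaying \<alpha> C U W"
  shows "bdpot U W C"
proof -
  have "C * exp (- \<alpha> * \<bar>x\<bar>) \<le> C * 1" for x
    using assms by (intro mult_left_mono) (auto simp: decaying_def)
  then show ?thesis using assms order_trans unfolding bdpot_def decaying_def by fastforce
qed

lemma potential_norm_le:
  assumes "\<bar>U x\<bar> \<le> B" "\<bar>W x\<bar> \<le> B"
  shows "norm (potential U W x *v w) \<le> 4 * B * norm w"
proof -
  have n: "norm ((\<lambda>_::real. potential U W x) z $ i $ j) \<le> B" for z i j
    using exhaust_2[of i] exhaust_2[of j] assms by (auto simp: potential_def)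
  show ?thesis using bmatI(2)[OF _ n] by simp
qed

lemma potential_out_le:
  assumes d: "decaying \<alpha> C U W" and a: "0 \<le> a"
  shows "norm (out a (mop (potential U W) u)) \<le> 4 * C * exp (- \<alpha> * a) * norm u"
proof -
  let ?S = "{x::real. \<bar>x\<bar> \<ge> a}"
  have b: "bmat (potential U W)" by (rule bmat_potential[OF decaying_bdpot[OF d]])
  obtain f where f: "L2 f" "u = cls f" by (rule l2_cases)
  have "norm (cls (\<lambda>x. indicator ?S x *\<^sub>R (potential U W x *v f x))) \<le> 4 * (C * exp (- \<alpha> * a)) * norm (cls f)"
  proof (rule cls_norm_le)
    have "norm (potential U W x *v f x) \<le> 4 * (C * exp (- \<alpha> * a)) * norm (f x)" if "\<bar>x\<bar> \<ge> a" for x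
    proof (rule potential_norm_le)
      have "C * exp (- \<alpha> * \<bar>x\<bar>) \<le> C * exp (- \<alpha> * a)"
        using d that by (intro mult_left_mono) (auto simp: decaying_def)
      then show "\<bar>U x\<bar> \<le> C * exp (- \<alpha> * a)" "\<bar>W x\<bar> \<le> C * exp (- \<alpha> * a)"
        using d by (auto simp: decaying_def intro: order_trans)
    qed
    then show "AE x in lborel. norm (indicator ?S x *\<^sub>R (potential U W x *v f x)) \<le> 4 * (C * exp (- \<alpha> * a)) * norm (f x)"
      using d by (intro AE_I2) (auto simp: indicator_def decaying_def)
  qed (use d f in \<open>auto intro!: L2_ind L2_bmat b simp: decaying_def\<close>)
  then show ?thesis by (simp add: f(2) mop_cls[OF b f(1)] ind_cls L2_bmat[OF b f(1)] mult.assoc)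
qed

text \<open>Projections onto the two components. Apart from the potential, the equation (H - \<mu>)
  F = R splits along them into scalar second order equations; the eigenvalue of \<sigma>3 on each
  component is \<open>sgc\<close>.\<close>

definition pr :: "bool \<Rightarrow> complex ^ 2 ^ 2" where
  "pr c = (if c then vector [vector [1, 0], vector [0, 0]] else vector [vector [0, 0], vector [0, 1]])"

lemma pr_nth: "pr True $ 1 $ 1 = 1" "pr True $ 1 $ 2 = 0" "pr True $ 2 $ 1 = 0" "pr True $ 2 $ 2 = 0"
  "pr False $ 1 $ 1 = 0" "pr False $ 1 $ 2 = 0" "pr False $ 2 $ 1 = 0" "pr False $ 2 $ 2 = 1"
  by (simp_all add: pr_def)

definition sgc :: "bool \<Rightarrow> real" where "sgc c = (if c then 1 else - 1)"

lemma pr_norm_le: "norm (pr c *v w) \<le> norm w"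
  by (cases c) (simp_all add: norm_vec_def L2_set_def sum_2 matrix_vector_2 pr_def)

lemma pr_sigma3: "mop (\<lambda>_. pr c) (mop (\<lambda>_. sigma3) u) = sgc c *\<^sub>R mop (\<lambda>_. pr c) u"
proof -
  have "pr c *v (sigma3 *v w) = sgc c *\<^sub>R (pr c *v w)" for w
    by (cases c) (simp_all add: vec_eq_iff forall_2 matrix_vector_2[of "pr _"] pr_nth sgc_def sigma3_mv)
  then show ?thesis
    by (cases u rule: l2_cases) (simp add: mop_cls L2_bmat flip: cls_scaleR)
qed

lemma sigma3_sigma3: "mop (\<lambda>_. sigma3) (mop (\<lambda>_. sigma3) u) = u"
proof -
  have "sigma3 *v (sigma3 *v w) = w" for w by (simp add: vec_eq_iff forall_2 sigma3_mv)
  then show ?thesis by (cases u rule: l2_cases) (simp add: mop_cls L2_bmat)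
qed

lemma pr_sum: "mop (\<lambda>_. pr True) u + mop (\<lambda>_. pr False) u = u"
proof -
  have "pr True *v w + pr False *v w = w" for w
    by (simp add: vec_eq_iff forall_2 matrix_vector_2 pr_def)
  then show ?thesis by (cases u rule: l2_cases) (simp add: mop_cls L2_bmat flip: cls_add)
qed

lemma mop_pr_norm_le: "norm (mop (\<lambda>_. pr c) u) \<le> norm u"
  using mop_norm_le[OF bmat_const pr_norm_le[THEN order_trans], of 1] by simp

text \<open>Solutions of \<open>H F = \<mu> F + R\<close> decay at a rate that depends on \<open>\<mu>\<close> only through the
  real parts of \<open>\<surd>(\<omega> \<mp> \<mu>)\<close>; a vanishing real part is harmless, because \<open>F\<close> has no
  oscillating tail in \<open>L\<^sup>2\<close>.\<close>

lemma resolvent_equation_decay: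
  assumes d: "decaying \<alpha> C U W" and H: "Hl \<omega> U W F (cs \<mu> F + R)"
    and k: "\<And>c. Re (csqrt (of_real \<omega> - of_real (sgc c) * \<mu>)) = 0 \<or> \<delta> \<le> Re (csqrt (of_real \<omega> - of_real (sgc c) * \<mu>))"
    and b: "0 < b" "b < \<delta>" "b \<le> \<alpha>" and R: "tail2 b G R"
  shows "tail2 b (4 * (norm F + (G + 4 * C * norm F) * (1 / b * (1 / b + 1 / (\<delta> - b))))) F"
proof -
  obtain F1 F2 where F: "wd F F1" "wd F1 F2" and eq: "cs \<mu> F + R = mop (\<lambda>_. sigma3) (\<omega> *\<^sub>R F - F2) + mop (potential U W) F"
    using H unfolding Hl_def by blast
  let ?V = "mop (potential U W) F"
  let ?c0 = "1 / b * (1 / b + 1 / (\<delta> - b))"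
  have c0: "0 \<le> ?c0" using b by simp
  have C: "0 \<le> C" using d by (simp add: decaying_def)
  have F2: "F2 = \<omega> *\<^sub>R F - mop (\<lambda>_. sigma3) (cs \<mu> F + R - ?V)"
    unfolding eq by (simp add: sigma3_sigma3)
  have tlg: "tail2 b (G + 4 * C * norm F) (sgc c *\<^sub>R mop (\<lambda>_. pr c) (R - ?V))" for c
    unfolding tail2_def
  proof (intro allI impI)
    fix a :: real assume a: "0 \<le> a"
    have "norm (out a (sgc c *\<^sub>R mop (\<lambda>_. pr c) (R - ?V))) = norm (mop (\<lambda>_. pr c) (out a (R - ?V)))"
      by (simp add: linear_simps[OF bounded_linear_ind] ind_mop sgc_def)
    also have "\<dots> \<le> norm (out a R - out a ?V)"
      using mop_pr_norm_le by (simp add: linear_simps[OF bounded_linear_ind])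
    also have "\<dots> \<le> norm (out a R) + norm (out a ?V)" by (rule norm_triangle_ineq4)
    also have "\<dots> \<le> G * exp (- b * a) + 4 * C * exp (- \<alpha> * a) * norm F"
      using R a by (intro add_mono potential_out_le[OF d a]) (auto simp: tail2_def)
    also have "\<dots> \<le> G * exp (- b * a) + 4 * C * exp (- b * a) * norm F"
      using b(3) a C by (intro add_left_mono mult_right_mono mult_left_mono) (auto intro: mult_right_mono)
    finally show "norm (out a (sgc c *\<^sub>R mop (\<lambda>_. pr c) (R - ?V))) \<le> (G + 4 * C * norm F) * exp (- b * a)"
      by (simp add: algebra_simps)
  qed
  have comp: "tail2 b (2 * (norm F + (G + 4 * C * norm F) * ?c0)) (mop (\<lambda>_. pr c) F)" for c
  proof -
    let ?u = "mop (\<lambda>_. pr c) F" and ?z = "of_real \<omega> - of_real (sgc c) * \<mu>"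
    \<comment> \<open>On one component \<sigma>3 is the sign \<open>sgc c\<close>, so the equation
      reads u'' = \<kappa>^2 u - g with \<kappa>^2 = \<omega> - sgc c \<mu>. The potential term
      belongs to the source g, since it already decays through the coefficients.\<close>
    have "mop (\<lambda>_. pr c) F2 = cs ?z ?u - sgc c *\<^sub>R mop (\<lambda>_. pr c) (R - ?V)"
      unfolding F2 mop_diff[OF bmat_const] pr_sigma3 mop_scaleR[OF bmat_const]
      by (simp add: mop_add mop_diff mop_cs cs_add_left[of _ "- _", simplified] cs_minus_left cs_of_real scaleR_diff_right scaleR_add_right
          flip: cs_cs)
    moreover have "wd ?u (mop (\<lambda>_. pr c) F1)" "wd (mop (\<lambda>_. pr c) F1) (mop (\<lambda>_. pr c) F2)"
      by (intro wd_mop F)+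
    ultimately have "tail2 b (2 * (norm ?u + (G + 4 * C * norm F) * ?c0)) ?u"
      using k[of c] by (intro tail2_second_order[OF _ _ _ b(1,2) tlg, where \<kappa> = "csqrt ?z"]) simp_all
    then show ?thesis
      unfolding tail2_def using mop_pr_norm_le[of c F] by (meson add_mono exp_ge_zero mult_left_mono mult_right_mono order_trans order_refl zero_le_numeral)
  qed
  show ?thesis unfolding tail2_def
  proof (intro allI impI)
    fix a :: real assume a: "0 \<le> a"
    have "norm (out a F) \<le> norm (out a (mop (\<lambda>_. pr True) F)) + norm (out a (mop (\<lambda>_. pr False) F))"
      using norm_triangle_ineq[of "out a (mop (\<lambda>_. pr True) F)" "out a (mop (\<lambda>_. pr False) F)"]
      by (simp add: pr_sum flip: linear_simps(1)[OF bounded_linear_ind])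
    also have "\<dots> \<le> (2 * (norm F + (G + 4 * C * norm F) * ?c0)) * exp (- b * a) + (2 * (norm F + (G + 4 * C * norm F) * ?c0)) * exp (- b * a)"
      using comp a by (intro add_mono) (auto simp: tail2_def)
    also have "\<dots> = 4 * (norm F + (G + 4 * C * norm F) * ?c0) * exp (- b * a)"
      using distrib_right[of 2 2 "(norm F + (G + 4 * C * norm F) * ?c0) * exp (- b * a)"]
      by (simp only: mult.assoc)
    finally show "norm (out a F) \<le> 4 * (norm F + (G + 4 * C * norm F) * ?c0) * exp (- b * a)" .
  qed
qed

subsection \<open>Finiteness of the non-real spectrum\<close>

text \<open>The graph of the symmetric operator \<open>\<sigma>\<^sub>3 H\<close>.\<close>

definition Ll :: "real \<Rightarrow> (real \<Rightarrow> real) \<Rightarrow> (real \<Rightarrow> real) \<Rightarrow> l2 \<Rightarrow> l2 \<Rightarrow> bool" where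
  "Ll \<omega> U W F K \<longleftrightarrow> (\<exists>F1 F2. wd F F1 \<and> wd F1 F2 \<and>
     K = \<omega> *\<^sub>R F - F2 + mop (\<lambda>_. sigma3) (mop (potential U W) F))"

lemma Hl_imp_Ll: "Hl \<omega> U W F H \<Longrightarrow> Ll \<omega> U W F (mop (\<lambda>_. sigma3) H)"
  unfolding Hl_def Ll_def by (auto simp: mop_add sigma3_sigma3)

lemma potential_nth: "potential U W x $ 1 $ 1 = of_real (U x)" "potential U W x $ 1 $ 2 = - of_real (W x)"
  "potential U W x $ 2 $ 1 = of_real (W x)" "potential U W x $ 2 $ 2 = - of_real (U x)"
  by (simp_all add: potential_def)

lemma sigma3_potential_symmetric:
  assumes "bdpot U W C"
  shows "inner (mop (\<lambda>_. sigma3) (mop (potential U W) u)) v = inner u (mop (\<lambda>_. sigma3) (mop (potential U W) v))"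
proof -
  have b: "bmat (potential U W)" by (rule bmat_potential[OF assms])
  have "inner ((sigma3 ** potential U W x) *v w) z = inner w ((sigma3 ** potential U W x) *v z)" for x w z
    by (simp add: inner_vec_def sum_2 sigma3_mv matrix_vector_2[of "potential _ _ _"] potential_nth inner_complex_def algebra_simps
      flip: matrix_vector_mul_assoc)
  then show ?thesis by (simp add: mop_mult b mop_adjoint bmat_mult)
qed

lemma Ll_symmetric:
  assumes b: "bdpot U W C" and F: "Ll \<omega> U W F K" and G: "Ll \<omega> U W G K'"
  shows "inner K G = inner F K'"
proof -
  obtain F1 F2 where F: "wd F F1" "wd F1 F2" "K = \<omega> *\<^sub>R F - F2 + mop (\<lambda>_. sigma3) (mop (potential U W) F)"
    using F unfolding Ll_def by blast
  obtain G1 G2 where G: "wd G G1" "wd G1 G2" "K' = \<omega> *\<^sub>R G - G2 + mop (\<lambda>_. sigma3) (mop (potential U W) G)"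
    using G unfolding Ll_def by blast
  have "inner F2 G = inner F G2"
    using wd_by_parts[OF F(2) G(1)] wd_by_parts[OF F(1) G(2)] by simp
  then show ?thesis unfolding F(3) G(3)
    by (simp add: inner_add_left inner_add_right inner_diff_left inner_diff_right sigma3_potential_symmetric[OF b])
qed

text \<open>Generators of translations are unique, so the graph has only the value 0 at 0. This
  stands in for applying an operator to both sides of a linear relation.\<close>

lemma Ll_zero:
  assumes "bdpot U W C" "Ll \<omega> U W 0 K"
  shows "K = 0"
proof -
  obtain F1 F2 where F: "wd 0 F1" "wd F1 F2" "K = \<omega> *\<^sub>R 0 - F2 + mop (\<lambda>_. sigma3) (mop (potential U W) 0)"
    using assms(2) unfolding Ll_def by blast
  have "F1 = 0" by (rule wd_unique[OF F(1) wd_zero])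
  moreover from this have "F2 = 0" using wd_unique[OF F(2)] wd_zero by blast
  ultimately show ?thesis using F(3) linear_simps(3)[OF mop_bounded_linear[OF bmat_potential(1)[OF assms(1)]]]
    linear_simps(3)[OF mop_bounded_linear[OF bmat_const]] by simp
qed

lemma Ll_add:
  assumes "bdpot U W C" "Ll \<omega> U W F K" "Ll \<omega> U W G K'"
  shows "Ll \<omega> U W (F + G) (K + K')"
proof -
  obtain F1 F2 where F: "wd F F1" "wd F1 F2" "K = \<omega> *\<^sub>R F - F2 + mop (\<lambda>_. sigma3) (mop (potential U W) F)"
    using assms(2) unfolding Ll_def by blast
  obtain G1 G2 where G: "wd G G1" "wd G1 G2" "K' = \<omega> *\<^sub>R G - G2 + mop (\<lambda>_. sigma3) (mop (potential U W) G)"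
    using assms(3) unfolding Ll_def by blast
  show ?thesis unfolding Ll_def
    by (intro exI[of _ "F1 + G1"] exI[of _ "F2 + G2"] conjI wd_add F G)
      (simp add: F(3) G(3) mop_add bmat_potential[OF assms(1)] algebra_simps)
qed

lemma Ll_cs:
  assumes "bdpot U W C" "Ll \<omega> U W F K"
  shows "Ll \<omega> U W (cs c F) (cs c K)"
proof -
  obtain F1 F2 where F: "wd F F1" "wd F1 F2" "K = \<omega> *\<^sub>R F - F2 + mop (\<lambda>_. sigma3) (mop (potential U W) F)"
    using assms(2) unfolding Ll_def by blast
  show ?thesis unfolding Ll_def
    by (intro exI[of _ "cs c F1"] exI[of _ "cs c F2"] conjI wd_cs F)
      (simp add: F(3) mop_cs bmat_potential[OF assms(1)] cs_simps)
qed

lemma Ll_zero_zero: "bdpot U W C \<Longrightarrow> Ll \<omega> U W 0 0"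
  unfolding Ll_def by (intro exI[of _ 0] conjI wd_zero)
    (simp add: linear_simps[OF mop_bounded_linear] bmat_potential)

lemma Ll_subspace:
  assumes "bdpot U W C"
  shows "subspace {(F, K). Ll \<omega> U W F K}"
proof (rule subspaceI)
  show "0 \<in> {(F, K). Ll \<omega> U W F K}" by (simp add: zero_prod_def Ll_zero_zero[OF assms])
  show "c *\<^sub>R x \<in> {(F, K). Ll \<omega> U W F K}" if "x \<in> {(F, K). Ll \<omega> U W F K}" for c x
    using Ll_cs[OF assms, of \<omega> "fst x" "snd x" "of_real c"] that by (auto simp: cs_of_real)
qed (auto intro: Ll_add[OF assms])

section \<open>A Poincare inequality and positivity in finite codimension\<close>

lemma nn_local_oscillation:
  assumes f: "L2 f" and I: "I \<in> sets borel" "emeasure lborel I = ennreal h" "0 \<le> h"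
    and zero: "(\<integral>y. indicator I y *\<^sub>R f y \<partial>lborel) = 0"
  shows "ennreal (h * (norm (f x))\<^sup>2) \<le> (\<integral>\<^sup>+y. ennreal (indicator I y * (norm (f x - f y))\<^sup>2) \<partial>lborel)"
proof -
  note [measurable] = L2_measurable[OF f] I(1)
  have fin: "emeasure lborel I < \<infinity>" using I(2) by simp
  have i1: "integrable lborel (\<lambda>y. indicator I y * (norm (f y))\<^sup>2)"
    using integrable_mult_indicator[OF _ L2_square_integrable[OF f], of I] by simp
  have i0: "integrable lborel (\<lambda>y. indicator I y :: real)"
    using fin by (intro integrable_real_indicator) auto
  have i2: "integrable lborel (\<lambda>y. indicator I y *\<^sub>R f y)"
  proof (rule Bochner_Integration.integrable_bound)
    show "integrable lborel (\<lambda>y. indicator I y + indicator I y * (norm (f y))\<^sup>2)"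
      by (intro Bochner_Integration.integrable_add i0 i1)
    have "norm v \<le> 1 + (norm v)\<^sup>2" for v :: "complex ^ 2"
      using sum_squares_bound[of 1 "norm v"] norm_ge_zero[of v] unfolding power_one by linarith
    then show "AE y in lborel. norm (indicator I y *\<^sub>R f y) \<le> norm (indicator I y + indicator I y * (norm (f y))\<^sup>2)"
      by (intro AE_I2) (auto simp: indicator_def)
  qed simp
  have i3: "integrable lborel (\<lambda>y. inner (f x) (indicator I y *\<^sub>R f y))"
    by (intro integrable_inner_right i2)
  \<comment> \<open>After integration over y the middle term vanishes by the mean value condition
    and the last one is nonnegative, which is the whole inequality.\<close>
  have eq: "indicator I y * (norm (f x - f y))\<^sup>2 = (norm (f x))\<^sup>2 * indicator I y - 2 * inner (f x) (indicator I y *\<^sub>R f y) + indicator I y * (norm (f y))\<^sup>2" for y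
    by (simp add: power2_norm_eq_inner inner_diff_left inner_diff_right inner_commute algebra_simps)
  have int: "integrable lborel (\<lambda>y. indicator I y * (norm (f x - f y))\<^sup>2)"
    unfolding eq by (intro Bochner_Integration.integrable_add Bochner_Integration.integrable_diff integrable_mult_right i0 i1 i3)
  have "h * (norm (f x))\<^sup>2 = (norm (f x))\<^sup>2 * (\<integral>y. indicator I y \<partial>lborel) - 2 * inner (f x) (\<integral>y. indicator I y *\<^sub>R f y \<partial>lborel)"
    using I(2,3) by (simp add: zero measure_def)
  also have "\<dots> = (\<integral>y. (norm (f x))\<^sup>2 * indicator I y - 2 * inner (f x) (indicator I y *\<^sub>R f y) \<partial>lborel)"
    by (subst Bochner_Integration.integral_diff)
      (intro integrable_mult_right i0 i3, intro integrable_mult_right i0 i3,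
        simp only: integral_mult_right_zero integral_inner_right[OF i2])
  also have "\<dots> \<le> (\<integral>y. indicator I y * (norm (f x - f y))\<^sup>2 \<partial>lborel)"
    by (intro integral_mono int Bochner_Integration.integrable_diff integrable_mult_right i0 i3) (simp add: eq)
  finally have "ennreal (h * (norm (f x))\<^sup>2) \<le> ennreal (\<integral>y. indicator I y * (norm (f x - f y))\<^sup>2 \<partial>lborel)"
    by (rule ennreal_leI)
  also have "\<dots> = (\<integral>\<^sup>+y. ennreal (indicator I y * (norm (f x - f y))\<^sup>2) \<partial>lborel)"
    by (rule nn_integral_eq_integral[OF int, symmetric]) simp
  finally show ?thesis .
qed

lemma L2_indicator:
  assumes "(a::real) \<le> b"
  shows "L2 (\<lambda>x. indicator {a..<b} x *\<^sub>R e)"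
  unfolding L2_def
proof
  have "(\<lambda>x. (norm (indicator {a..<b} x *\<^sub>R e))\<^sup>2) = (\<lambda>x. (norm e)\<^sup>2 * indicator {a..<b} x)"
    by (auto simp: indicator_def fun_eq_iff)
  then show "integrable lborel (\<lambda>x. (norm (indicator {a..<b} x *\<^sub>R e))\<^sup>2)"
    using assms by simp
qed simp

lemma L2_indicator_integrable:
  assumes "L2 f"
  shows "integrable lborel (\<lambda>y. indicator {a..<b::real} y *\<^sub>R f y)"
proof (cases "a \<le> b")
  case True
  note [measurable] = L2_measurable[OF assms]
  show ?thesis
  proof (rule Bochner_Integration.integrable_bound)
    show "integrable lborel (\<lambda>y. indicator {a..<b} y + (norm (f y))\<^sup>2)"
      using True by (intro Bochner_Integration.integrable_add L2_square_integrable[OF assms]) simp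
    have "norm v \<le> 1 + (norm v)\<^sup>2" for v :: "complex ^ 2"
      using sum_squares_bound[of 1 "norm v"] norm_ge_zero[of v] unfolding power_one by linarith
    then show "AE y in lborel. norm (indicator {a..<b} y *\<^sub>R f y) \<le> norm (indicator {a..<b} y + (norm (f y))\<^sup>2)"
      by (intro AE_I2) (auto simp: indicator_def)
  qed simp
qed simp

lemma poincare_partition:
  assumes F: "wd F F1" and h: "0 < h"
    and zero: "\<And>j e. j < N \<Longrightarrow> e \<in> Basis \<Longrightarrow>
      inner (cls (\<lambda>x. indicator {R + real j * h..<R + (real j + 1) * h} x *\<^sub>R e)) F = 0"
  shows "(norm (ind {R..<R + real N * h} F))\<^sup>2 \<le> 2 * h\<^sup>2 * (norm F1)\<^sup>2"
proof -
  obtain f where f: "L2 f" "F = cls f" by (rule l2_cases)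
  note [measurable] = L2_measurable[OF f(1)]
  let ?I = "\<lambda>j. {R + real j * h..<R + (real j + 1) * h}" and ?S = "{R..<R + real N * h}"
  have z: "(\<integral>y. indicator (?I j) y *\<^sub>R f y \<partial>lborel) = 0" if "j < N" for j
  proof (rule euclidean_eqI)
    fix e :: "complex ^ 2" assume e: "e \<in> Basis"
    have le: "R + real j * h \<le> R + (real j + 1) * h" using h by simp
    have "0 = (\<integral>x. inner e (indicator (?I j) x *\<^sub>R f x) \<partial>lborel)"
      using zero[OF that e] by (simp add: f(2) cls_inner L2_indicator[OF le] f(1))
    also have "\<dots> = inner e (\<integral>x. indicator (?I j) x *\<^sub>R f x \<partial>lborel)"
      by (rule integral_inner_right[OF L2_indicator_integrable[OF f(1)]])
    finally show "inner (\<integral>y. indicator (?I j) y *\<^sub>R f y \<partial>lborel) e = inner 0 e"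
      by (simp add: inner_commute)
  qed
  have pt: "ennreal h * ennreal ((norm (indicator ?S x *\<^sub>R f x))\<^sup>2) \<le>
      (\<integral>\<^sup>+s. ennreal (indicator {-h..h} s * (norm (f x - f (x + s)))\<^sup>2) \<partial>lborel)" for x
  proof (cases "x \<in> ?S")
    case True
    define j where "j = nat \<lfloor>(x - R) / h\<rfloor>"
    have fl: "0 \<le> \<lfloor>(x - R) / h\<rfloor>" using True h by simp
    then have jr: "real j = of_int \<lfloor>(x - R) / h\<rfloor>" by (simp add: j_def)
    have "real j \<le> (x - R) / h" "(x - R) / h < real j + 1"
      unfolding jr by linarith+
    then have j1: "real j * h \<le> x - R" "x - R < (real j + 1) * h"
      using h by (simp_all add: pos_le_divide_eq pos_divide_less_eq)
    have "real j * h < real N * h" using j1(1) True by simp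
    then have jN: "j < N" using h by simp
    have "ennreal h * ennreal ((norm (indicator ?S x *\<^sub>R f x))\<^sup>2) = ennreal (h * (norm (f x))\<^sup>2)"
      using True h by (simp add: ennreal_mult)
    also have "\<dots> \<le> (\<integral>\<^sup>+y. ennreal (indicator (?I j) y * (norm (f x - f y))\<^sup>2) \<partial>lborel)"
    proof (rule nn_local_oscillation[OF f(1) _ _ _ z[OF jN]])
      show "emeasure lborel (?I j) = ennreal h" using h by (simp add: algebra_simps)
    qed (use h in auto)
    also have "\<dots> = (\<integral>\<^sup>+s. ennreal (indicator (?I j) (x + s) * (norm (f x - f (x + s)))\<^sup>2) \<partial>lborel)"
      by (subst nn_integral_real_affine[of _ 1 x]) auto
    also have "\<dots> \<le> (\<integral>\<^sup>+s. ennreal (indicator {-h..h} s * (norm (f x - f (x + s)))\<^sup>2) \<partial>lborel)"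
      using j1 by (intro nn_integral_mono ennreal_leI mult_right_mono) (auto simp: indicator_def algebra_simps)
    finally show ?thesis .
  qed simp
  have "ennreal h * ennreal ((norm (ind ?S F))\<^sup>2) = (\<integral>\<^sup>+x. ennreal h * ennreal ((norm (indicator ?S x *\<^sub>R f x))\<^sup>2) \<partial>lborel)"
    by (simp add: f(2) ind_cls f(1) l2_norm_square_nn[symmetric] L2_ind nn_integral_cmult del: norm_scaleR)
  also have "\<dots> \<le> (\<integral>\<^sup>+x. \<integral>\<^sup>+s. ennreal (indicator {-h..h} s * (norm (f x - f (x + s)))\<^sup>2) \<partial>lborel \<partial>lborel)"
    by (intro nn_integral_mono pt)
  also have "\<dots> = (\<integral>\<^sup>+s. \<integral>\<^sup>+x. ennreal (indicator {-h..h} s * (norm (f x - f (x + s)))\<^sup>2) \<partial>lborel \<partial>lborel)"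
    by (intro lborel_pair.Fubini') simp
  also have "\<dots> \<le> (\<integral>\<^sup>+s. ennreal (h\<^sup>2 * (norm F1)\<^sup>2) * indicator {-h..h} s \<partial>lborel)"
  proof (rule nn_integral_mono)
    fix s
    show "(\<integral>\<^sup>+x. ennreal (indicator {-h..h} s * (norm (f x - f (x + s)))\<^sup>2) \<partial>lborel) \<le> ennreal (h\<^sup>2 * (norm F1)\<^sup>2) * indicator {-h..h} s"
    proof (cases "s \<in> {-h..h}")
      case True
      have "norm (F - tr s F) \<le> \<bar>s\<bar> * norm F1" using wd_norm_le[OF F, of s] by (simp add: norm_minus_commute)
      also have "\<dots> \<le> h * norm F1" using True by (intro mult_right_mono) auto
      finally have "(norm (F - tr s F))\<^sup>2 \<le> (h * norm F1)\<^sup>2" by (rule power_mono) simp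
      moreover have "F - tr s F = cls (\<lambda>x. f x - f (x + s))"
        by (simp add: f(2) tr_cls f(1) L2_shift cls_diff)
      ultimately show ?thesis using True
        by (simp add: l2_norm_square_nn L2_diff f(1) L2_shift power_mult_distrib ennreal_leI)
    qed simp
  qed
  also have "\<dots> = ennreal (h\<^sup>2 * (norm F1)\<^sup>2) * ennreal (2 * h)"
    using h by (simp add: nn_integral_cmult_indicator)
  finally have "ennreal (h * (norm (ind ?S F))\<^sup>2) \<le> ennreal (h * (2 * h\<^sup>2 * (norm F1)\<^sup>2))"
    using h by (simp add: ennreal_mult'[symmetric] mult_ac)
  then have "h * (norm (ind ?S F))\<^sup>2 \<le> h * (2 * h\<^sup>2 * (norm F1)\<^sup>2)"
    using h by (subst (asm) ennreal_le_iff) auto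
  then show ?thesis using h by simp
qed

lemma mop_sigma3_norm [simp]: "norm (mop (\<lambda>_. sigma3) u) = norm u"
proof -
  have "norm (sigma3 *v w) = norm w" for w
    by (simp add: norm_vec_def L2_set_def sum_2 sigma3_mv)
  then show ?thesis
    by (cases u rule: l2_cases) (simp add: mop_cls L2_bmat cls_norm L2norm_def)
qed

lemma ind_idem: "S \<in> sets borel \<Longrightarrow> ind S (ind S u) = ind S u"
proof -
  have "(\<lambda>x. indicator S x *\<^sub>R (indicator S x *\<^sub>R f x)) = (\<lambda>x. indicator S x *\<^sub>R (f x :: complex ^ 2))" for f
    by (auto simp: indicator_def fun_eq_iff)
  then show "S \<in> sets borel \<Longrightarrow> ind S (ind S u) = ind S u"
    by (cases u rule: l2_cases) (simp only: ind_cls L2_ind)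
qed

lemma ind_adjoint: "S \<in> sets borel \<Longrightarrow> inner (ind S u) v = inner u (ind S v)"
  unfolding ind_def by (rule mop_adjoint) (auto intro!: bmat_ind simp: mat_mv smult_of_real)

text \<open>The form equals \<omega> |F|^2 + |F1|^2 plus the potential term. Outside a large
  interval the potential is at most \<omega> / 2; inside, mean zero on each cell of a fine partition
  lets |F1|^2 absorb it. \<open>P\<close> consists of the indicators of these finitely many cells
  times the real basis of C^2.\<close>

lemma Ll_positive_finite_codim:
  assumes d: "decaying \<alpha> C U W" and om: "0 < \<omega>"
  shows "\<exists>P. finite P \<and> (\<forall>F K. Ll \<omega> U W F K \<longrightarrow> (\<forall>p\<in>P. inner p F = 0) \<longrightarrow> inner F K = 0 \<longrightarrow> F = 0)"
proof -
  have C: "0 \<le> C" "0 < \<alpha>" using d by (auto simp: decaying_def)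
  note b = decaying_bdpot[OF d]
  have bV: "bmat (potential U W)" by (rule bmat_potential[OF b])
  \<comment> \<open>Beyond this radius the bound 4 C exp (- \<alpha> R) on the potential is at most
    \<omega> / 2; the added 1 keeps the argument of the logarithm positive if C = 0.\<close>
  define R where "R = \<bar>ln ((8 * C + 1) / \<omega>)\<bar> / \<alpha>"
  have R0: "0 \<le> R" using C by (simp add: R_def)
  have RC: "4 * C * exp (- \<alpha> * R) \<le> \<omega> / 2"
  proof -
    have "exp (- \<alpha> * R) \<le> exp (- ln ((8 * C + 1) / \<omega>))" using C by (simp add: R_def)
    also have "\<dots> = \<omega> / (8 * C + 1)" using C om by (simp add: exp_minus)
    finally have "4 * C * exp (- \<alpha> * R) \<le> 4 * C * (\<omega> / (8 * C + 1))" using C by (intro mult_left_mono) auto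
    also have "\<dots> \<le> \<omega> / 2" using C om by (simp add: field_simps)
    finally show ?thesis .
  qed
  \<comment> \<open>By the Poincare inequality the potential inside costs at most 4 C times 2 h^2
    |F1|^2, and this mesh makes the factor 8 C h^2 at most 1.\<close>
  define h where "h = 1 / sqrt (8 * C + 1)"
  have h: "0 < h" "8 * C * h\<^sup>2 \<le> 1" using C by (auto simp: h_def power_divide)
  obtain N :: nat where N: "2 * R / h < real N" using reals_Archimedean2 by blast
  then have RN: "R < - R + real N * h" using h(1) by (simp add: field_simps)
  define P where "P = (\<lambda>(j, e). cls (\<lambda>x. indicator {- R + real j * h..<- R + (real j + 1) * h} x *\<^sub>R e)) ` ({..<N} \<times> (Basis :: (complex ^ 2) set))"
  have "finite P" by (simp add: P_def)
  moreover have "F = 0" if L: "Ll \<omega> U W F K" and P0: "\<forall>p\<in>P. inner p F = 0" and iso: "inner F K = 0" for F K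
  proof -
    obtain F1 F2 where F: "wd F F1" "wd F1 F2" "K = \<omega> *\<^sub>R F - F2 + mop (\<lambda>_. sigma3) (mop (potential U W) F)"
      using L unfolding Ll_def by blast
    let ?V = "\<lambda>u. mop (\<lambda>_. sigma3) (mop (potential U W) u)"
    let ?S = "{- R..<- R + real N * h}"
    have S: "?S \<in> sets borel" "- ?S \<in> sets borel" by auto
    have V: "norm (?V u) \<le> 4 * C * norm u" for u
      using mop_norm_le[OF bV potential_norm_le, of C u] b C by (auto simp: bdpot_def)
    have Vadd: "?V (u + v) = ?V u + ?V v" for u v by (simp add: mop_add bV)
    have "F = ind ?S F + ind (- ?S) F"
    proof -
      obtain f where f: "L2 f" "F = cls f" by (rule l2_cases)
      have "(\<lambda>x. indicator ?S x *\<^sub>R f x + indicator (- ?S) x *\<^sub>R f x) = f"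
        by (auto simp: indicator_def fun_eq_iff)
      then show ?thesis using f S by (simp add: ind_cls L2_ind flip: cls_add)
    qed
    then have "inner F (?V F) = inner F (?V (ind ?S F)) + inner F (?V (ind (- ?S) F))"
      by (metis Vadd inner_add_right)
    moreover have "\<bar>inner F (?V (ind ?S F))\<bar> \<le> 4 * C * (norm (ind ?S F))\<^sup>2"
    proof -
      have "?V (ind ?S F) = ind ?S (?V (ind ?S F))" by (simp add: ind_mop bV ind_idem)
      then have "inner F (?V (ind ?S F)) = inner (ind ?S F) (?V (ind ?S F))"
        using ind_adjoint[OF S(1), of F "?V (ind ?S F)"] by simp
      also have "\<bar>\<dots>\<bar> \<le> norm (ind ?S F) * (4 * C * norm (ind ?S F))"
        using order_trans[OF Cauchy_Schwarz_ineq2 mult_left_mono[OF V norm_ge_zero]] .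
      finally show ?thesis by (simp add: power2_eq_square mult_ac)
    qed
    moreover have "\<bar>inner F (?V (ind (- ?S) F))\<bar> \<le> \<omega> / 2 * (norm F)\<^sup>2"
    proof -
      have "norm (?V (ind (- ?S) F)) = norm (ind (- ?S) (mop (potential U W) F))" by (simp add: ind_mop bV)
      also have "\<dots> \<le> norm (out R (mop (potential U W) F))" using RN by (intro ind_mono) auto
      also have "\<dots> \<le> 4 * C * exp (- \<alpha> * R) * norm F" by (rule potential_out_le[OF d R0])
      also have "\<dots> \<le> \<omega> / 2 * norm F" by (intro mult_right_mono RC) simp
      finally have "norm F * norm (?V (ind (- ?S) F)) \<le> norm F * (\<omega> / 2 * norm F)" by (rule mult_left_mono) simp
      with Cauchy_Schwarz_ineq2 have "\<bar>inner F (?V (ind (- ?S) F))\<bar> \<le> norm F * (\<omega> / 2 * norm F)" by (rule order_trans)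
      then show ?thesis by (simp add: power2_eq_square mult_ac)
    qed
    moreover have "4 * C * (norm (ind ?S F))\<^sup>2 \<le> (norm F1)\<^sup>2"
    proof -
      have "(norm (ind ?S F))\<^sup>2 \<le> 2 * h\<^sup>2 * (norm F1)\<^sup>2"
        by (rule poincare_partition[OF F(1) h(1)]) (use P0 in \<open>force simp: P_def\<close>)
      then have "4 * C * (norm (ind ?S F))\<^sup>2 \<le> 4 * C * (2 * h\<^sup>2 * (norm F1)\<^sup>2)" using C by (intro mult_left_mono) auto
      also have "\<dots> = (8 * C * h\<^sup>2) * (norm F1)\<^sup>2" by simp
      also have "\<dots> \<le> 1 * (norm F1)\<^sup>2" by (intro mult_right_mono h) simp
      finally show ?thesis by simp
    qed
    moreover have "inner F K = \<omega> * (norm F)\<^sup>2 + (norm F1)\<^sup>2 + inner F (?V F)"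
      unfolding F(3) using wd_by_parts[OF F(1,2)]
      by (simp add: inner_add_right inner_diff_right power2_norm_eq_inner)
    ultimately have "\<omega> / 2 * (norm F)\<^sup>2 \<le> 0" using iso by linarith
    then show ?thesis using om by (simp add: mult_le_0_iff)
  qed
  ultimately show ?thesis by blast
qed

text \<open>Each functional removes at most one dimension: were its kernel in \<open>X\<close>
  finitely spanned, one vector outside the kernel could be added to span all of
  \<open>X\<close>.\<close>

lemma infinite_dimensional_kernel:
  fixes X :: "'a::real_vector set" and \<Phi> :: "('a \<Rightarrow> real) set"
  assumes "finite \<Phi>" "\<And>l. l \<in> \<Phi> \<Longrightarrow> linear l" "subspace X" "\<And>B. finite B \<Longrightarrow> \<not> X \<subseteq> span B"
  shows "\<exists>w\<in>X. w \<noteq> 0 \<and> (\<forall>l\<in>\<Phi>. l w = 0)"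
  using assms
proof (induction \<Phi> arbitrary: X rule: finite_induct)
  case empty
  then have "\<not> X \<subseteq> span {}" by blast
  then show ?case by auto
next
  case (insert l \<Phi>)
  define Y where "Y = {w \<in> X. l w = 0}"
  have l: "linear l" using insert by blast
  have "subspace Y" unfolding Y_def using insert.prems(2) l
    by (auto simp: subspace_def linear_add linear_scale linear_0)
  moreover have "\<not> Y \<subseteq> span B" if B: "finite B" for B
  proof
    assume Y: "Y \<subseteq> span B"
    show False
    proof (cases "\<exists>w\<in>X. l w \<noteq> 0")
      case True
      then obtain w where w: "w \<in> X" "l w \<noteq> 0" by blast
      have "x \<in> span (insert w B)" if x: "x \<in> X" for x
      proof -
        have "l (x - (l x / l w) *\<^sub>R w) = 0" using w(2) by (simp add: linear_diff[OF l] linear_scale[OF l])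
        then have "x - (l x / l w) *\<^sub>R w \<in> Y"
          unfolding Y_def using insert.prems(2) x w by (auto intro: subspace_diff subspace_scale)
        then have "x - (l x / l w) *\<^sub>R w \<in> span (insert w B)" using Y span_mono[of B "insert w B"] by blast
        moreover have "(l x / l w) *\<^sub>R w \<in> span (insert w B)" by (intro span_scale span_base) simp
        ultimately have "(x - (l x / l w) *\<^sub>R w) + (l x / l w) *\<^sub>R w \<in> span (insert w B)" by (rule span_add)
        then show ?thesis by simp
      qed
      then show False using insert.prems(3)[of "insert w B"] B by blast
    next
      case False
      then have "Y = X" by (auto simp: Y_def)
      then show False using Y insert.prems(3) B by blast
    qed
  qed
  ultimately obtain w where "w \<in> Y" "w \<noteq> 0" "\<forall>l\<in>\<Phi>. l w = 0"
    using insert.IH[of Y] insert.prems(1) by blast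
  then show ?case by (auto simp: Y_def)
qed

section \<open>Isotropic families of eigenvectors\<close>

definition eig :: "real \<Rightarrow> (real \<Rightarrow> real) \<Rightarrow> (real \<Rightarrow> real) \<Rightarrow> complex \<Rightarrow> bool" where
  "eig \<omega> U W \<mu> \<longleftrightarrow> (\<exists>F. F \<noteq> 0 \<and> Hl \<omega> U W F (cs \<mu> F))"

lemma sigma3_adjoint: "inner (mop (\<lambda>_. sigma3) u) v = inner u (mop (\<lambda>_. sigma3) v)"
  by (rule mop_adjoint) (simp_all add: inner_vec_def sum_2 sigma3_mv)

lemma cs_adjoint: "inner (cs c u) v = inner u (cs (cnj c) v)"
  unfolding cs_def by (rule mop_adjoint) (simp_all add: mat_mv inner_vec_def sum_2 inner_complex_def algebra_simps)

text \<open>The usual elimination of one eigenvalue \<nu> by applying H - \<nu>. As H is a relation,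
  the vanishing combination is fed into the graph of \<sigma>3 H, whose value at 0 is 0, and
  \<sigma>3 is removed because it is isometric.\<close>

lemma eigenvectors_independent:
  assumes b: "bdpot U W C" and F: "\<And>\<mu>. \<mu> \<in> E \<Longrightarrow> F \<mu> \<noteq> 0 \<and> Hl \<omega> U W (F \<mu>) (cs \<mu> (F \<mu>))"
    and T: "finite T" "T \<subseteq> E" and zero: "(\<Sum>\<mu>\<in>T. cs (c \<mu>) (F \<mu>)) = 0" and \<mu>: "\<mu> \<in> T"
  shows "c \<mu> = 0"
  using T zero \<mu>
proof (induction T arbitrary: c \<mu> rule: finite_induct)
  case (insert \<nu> T)
  let ?s = "mop (\<lambda>_. sigma3)"
  have L: "Ll \<omega> U W (\<Sum>\<mu>\<in>T'. cs (c \<mu>) (F \<mu>)) (\<Sum>\<mu>\<in>T'. cs (c \<mu>) (?s (cs \<mu> (F \<mu>))))" if "finite T'" "T' \<subseteq> E" for T'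
    using that
  proof (induction T' rule: finite_induct)
    case empty
    then show ?case by (simp add: Ll_zero_zero[OF b])
  next
    case (insert \<nu> T')
    then show ?case using F by (auto intro!: Ll_add[OF b] Ll_cs[OF b] Hl_imp_Ll)
  qed
  have "Ll \<omega> U W 0 (\<Sum>\<mu>\<in>insert \<nu> T. cs (c \<mu>) (?s (cs \<mu> (F \<mu>))))"
    using L[of "insert \<nu> T"] insert.hyps insert.prems by auto
  then have "(\<Sum>\<mu>\<in>insert \<nu> T. cs (c \<mu>) (?s (cs \<mu> (F \<mu>)))) = 0" by (rule Ll_zero[OF b])
  then have "?s (\<Sum>\<mu>\<in>insert \<nu> T. cs (c \<mu> * \<mu>) (F \<mu>)) = 0"
    by (simp add: linear_sum[OF bounded_linear.linear[OF mop_bounded_linear]] mop_cs)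
  then have s1: "(\<Sum>\<mu>\<in>insert \<nu> T. cs (c \<mu> * \<mu>) (F \<mu>)) = 0"
    by (metis mop_sigma3_norm norm_eq_zero)
  have s2: "(\<Sum>\<mu>\<in>insert \<nu> T. cs (c \<mu> * \<nu>) (F \<mu>)) = 0"
    using arg_cong[OF insert.prems(2), of "cs \<nu>"]
    by (simp add: linear_sum[OF bounded_linear.linear[OF bounded_linear_cs]] cs_simps mult.commute del: sum.insert)
  have "(\<Sum>\<mu>\<in>insert \<nu> T. cs (c \<mu> * (\<mu> - \<nu>)) (F \<mu>)) = (\<Sum>\<mu>\<in>insert \<nu> T. cs (c \<mu> * \<mu>) (F \<mu>) - cs (c \<mu> * \<nu>) (F \<mu>))"
    by (intro sum.cong refl) (simp add: right_diff_distrib cs_add_left[of _ "- _", simplified] cs_minus_left)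
  also have "\<dots> = 0" unfolding sum_subtractf s1 s2 by simp
  finally have "(\<Sum>\<mu>\<in>T. cs (c \<mu> * (\<mu> - \<nu>)) (F \<mu>)) = 0" using insert.hyps by simp
  then have "c \<mu> * (\<mu> - \<nu>) = 0" if "\<mu> \<in> T" for \<mu>
    using insert.IH[of "\<lambda>\<mu>. c \<mu> * (\<mu> - \<nu>)"] insert.prems(1) that by blast
  then have cT: "c \<mu> = 0" if "\<mu> \<in> T" for \<mu> using that insert.hyps by auto
  have "(\<Sum>\<mu>\<in>T. cs (c \<mu>) (F \<mu>)) = 0" by (rule sum.neutral) (simp add: cT)
  then have "cs (c \<nu>) (F \<nu>) = 0" using insert.prems(2) insert.hyps by simp
  then have "norm (c \<nu>) * norm (F \<nu>) = 0" by (simp flip: cs_norm)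
  then have "c \<nu> = 0" using F insert.prems(1) by auto
  then show ?case using cT insert.prems(3) by blast
qed simp

text \<open>By symmetry of \<open>\<sigma>\<^sub>3 H\<close>, eigenfunctions satisfy \<open>(\<nu> - cnj \<mu>) \<langle>F\<^sub>\<mu>, \<sigma>\<^sub>3 F\<^sub>\<nu>\<rangle> = 0\<close>, so the
  form of \<open>\<sigma>\<^sub>3 H\<close> vanishes on their span.\<close>

lemma isotropic_eigenvalues_finite:
  assumes d: "decaying \<alpha> C U W" and om: "0 < \<omega>" and eig: "\<And>\<mu>. \<mu> \<in> E \<Longrightarrow> eig \<omega> U W \<mu>"
    and nc: "\<And>\<mu> \<nu>. \<mu> \<in> E \<Longrightarrow> \<nu> \<in> E \<Longrightarrow> \<nu> \<noteq> cnj \<mu>"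
  shows "finite E"
proof (rule ccontr)
  assume inf: "infinite E"
  note b = decaying_bdpot[OF d]
  let ?s = "mop (\<lambda>_. sigma3)"
  obtain F where F: "\<And>\<mu>. \<mu> \<in> E \<Longrightarrow> F \<mu> \<noteq> 0 \<and> Hl \<omega> U W (F \<mu>) (cs \<mu> (F \<mu>))"
    using eig unfolding eig_def by metis
  \<comment> \<open>Whole graph pairs are combined instead of eigenvectors, so that a vector of the
    span comes together with its image.\<close>
  define g where "g \<mu> = (F \<mu>, ?s (cs \<mu> (F \<mu>)))" for \<mu>
  have Lg: "Ll \<omega> U W (F \<mu>) (?s (cs \<mu> (F \<mu>)))" if "\<mu> \<in> E" for \<mu>
    using F[OF that] Hl_imp_Ll by blast
  have iso: "inner (F \<mu>) (?s (cs c (F \<nu>))) = 0" if "\<mu> \<in> E" "\<nu> \<in> E" for \<mu> \<nu> c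
  proof -
    \<comment> \<open>Dividing by the nonzero number \<nu> - cnj \<mu> lets symmetry give
      orthogonality for every complex factor c, although the inner product is only real.\<close>
    define e where "e = c / (\<nu> - cnj \<mu>)"
    have "e * (\<nu> - cnj \<mu>) = c" using nc[OF that] by (simp add: e_def)
    then have e: "e * \<nu> - cnj \<mu> * e = c" by (simp add: right_diff_distrib mult.commute)
    have "inner (?s (cs \<mu> (F \<mu>))) (cs e (F \<nu>)) = inner (F \<mu>) (cs e (?s (cs \<nu> (F \<nu>))))"
      by (rule Ll_symmetric[OF b Lg[OF that(1)] Ll_cs[OF b Lg[OF that(2)]]])
    then have "inner (F \<mu>) (?s (cs (cnj \<mu> * e) (F \<nu>))) = inner (F \<mu>) (?s (cs (e * \<nu>) (F \<nu>)))"
      by (simp add: sigma3_adjoint cs_adjoint mop_cs)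
    then have "inner (F \<mu>) (?s (cs (e * \<nu> - cnj \<mu> * e) (F \<nu>))) = 0"
      using cs_add_left[of "e * \<nu>" "- (cnj \<mu> * e)" "F \<nu>"] by (simp add: cs_minus_left mop_diff inner_diff_right)
    then show ?thesis unfolding e .
  qed
  obtain P where P: "finite P" "\<And>F K. Ll \<omega> U W F K \<Longrightarrow> (\<And>p. p \<in> P \<Longrightarrow> inner p F = 0) \<Longrightarrow> inner F K = 0 \<Longrightarrow> F = 0"
    using Ll_positive_finite_codim[OF d om] by blast
  have inj: "inj_on g E"
  proof (rule inj_onI)
    fix \<mu> \<nu> assume *: "\<mu> \<in> E" "\<nu> \<in> E" "g \<mu> = g \<nu>"
    then have FF: "F \<mu> = F \<nu>" and "?s (cs \<mu> (F \<mu>)) = ?s (cs \<nu> (F \<nu>))" by (auto simp: g_def)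
    then have "?s (cs (\<mu> - \<nu>) (F \<mu>)) = 0"
      using cs_add_left[of \<mu> "- \<nu>" "F \<mu>"] by (simp add: cs_minus_left mop_diff)
    then have "norm (?s (cs (\<mu> - \<nu>) (F \<mu>))) = 0" by simp
    then show "\<mu> = \<nu>" using F[OF *(1)] by simp
  qed
  have indep: "independent (g ` E)"
    unfolding independent_explicit_module
  proof (intro allI impI)
    fix t u v assume t: "finite t" "t \<subseteq> g ` E" "(\<Sum>v\<in>t. u v *\<^sub>R v) = 0" "v \<in> t"
    obtain T where T: "T \<subseteq> E" "t = g ` T" by (meson subset_imageE t(2))
    have injT: "inj_on g T" using inj T(1) inj_on_subset by blast
    then have fT: "finite T" using t(1) T(2) finite_image_iff by blast
    have "(\<Sum>\<mu>\<in>T. u (g \<mu>) *\<^sub>R g \<mu>) = 0" using t(3) unfolding T(2) sum.reindex[OF injT] by simp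
    then have "fst (\<Sum>\<mu>\<in>T. u (g \<mu>) *\<^sub>R g \<mu>) = 0" by simp
    then have "(\<Sum>\<mu>\<in>T. cs (of_real (u (g \<mu>))) (F \<mu>)) = 0"
      by (simp add: fst_sum g_def cs_of_real)
    from eigenvectors_independent[OF b F fT T(1) this] have "\<forall>\<mu>\<in>T. u (g \<mu>) = 0" by simp
    then show "u v = 0" using t(4) T(2) by auto
  qed
  \<comment> \<open>An infinite independent set has no finite spanning set, so the finitely many
    positivity conditions leave a nonzero \<open>w\<close> in the span, on which the form
    vanishes.\<close>
  have "\<not> span (g ` E) \<subseteq> span B" if "finite B" for B
    using independent_span_bound[OF that indep] span_superset[of "g ` E"] inf finite_image_iff[OF inj] by blast
  then have "\<exists>w\<in>span (g ` E). w \<noteq> 0 \<and> (\<forall>l\<in>(\<lambda>p w. inner p (fst w)) ` P. l w = 0)"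
    by (intro infinite_dimensional_kernel subspace_span)
      (auto simp: P(1) linear_iff inner_add_right)
  then obtain w where w: "w \<in> span (g ` E)" "w \<noteq> 0" "\<And>p. p \<in> P \<Longrightarrow> inner p (fst w) = 0" by auto
  have "span (g ` E) \<subseteq> {(F, K). Ll \<omega> U W F K}"
    by (rule span_minimal[OF _ Ll_subspace[OF b]]) (auto simp: g_def Lg)
  then have Lw: "Ll \<omega> U W (fst w) (snd w)" using w(1) by auto
  have 1: "inner (F \<mu>) (snd z) = 0" if "\<mu> \<in> E" "z \<in> span (g ` E)" for \<mu> z
    using that(2)
  proof (induction rule: span_induct_alt)
    case (step c x y)
    then show ?case using iso[OF that(1)] by (auto simp: g_def inner_add_right)
  qed simp
  have 2: "inner (fst z) (snd w) = 0" if "z \<in> span (g ` E)" for z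
    using that
  proof (induction rule: span_induct_alt)
    case (step c x y)
    then show ?case using 1[OF _ w(1)] by (auto simp: g_def inner_add_left)
  qed simp
  have "fst w = 0" by (rule P(2)[OF Lw w(3) 2[OF w(1)]])
  then have "snd w = 0" using Ll_zero[OF b] Lw by simp
  with \<open>fst w = 0\<close> w(2) show False by (simp add: prod_eq_iff)
qed

lemma nonreal_eigenvalues_finite:
  assumes "decaying \<alpha> C U W" "0 < \<omega>"
  shows "finite {\<mu>. eig \<omega> U W \<mu> \<and> Im \<mu> \<noteq> 0}"
proof -
  have "finite {\<mu>. eig \<omega> U W \<mu> \<and> 0 < Im \<mu>}" "finite {\<mu>. eig \<omega> U W \<mu> \<and> Im \<mu> < 0}"
    by (rule isotropic_eigenvalues_finite[OF assms]; fastforce)+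
  then have "finite ({\<mu>. eig \<omega> U W \<mu> \<and> 0 < Im \<mu>} \<union> {\<mu>. eig \<omega> U W \<mu> \<and> Im \<mu> < 0})" by simp
  then show ?thesis by (rule finite_subset[rotated]) auto
qed

subsection \<open>Uniform decay of the eigenfunctions\<close>

lemma csqrt_Re_zero:
  assumes "Re (csqrt z) = 0"
  shows "Im z = 0" "Re z \<le> 0"
proof -
  define w where "w = csqrt z"
  have z: "z = w\<^sup>2" by (simp add: w_def)
  have "Re w = 0" using assms by (simp add: w_def)
  then show "Im z = 0" "Re z \<le> 0" unfolding z by (simp_all add: Re_power2 Im_power2)
qed

lemma H_kernel_1_Hl:
  assumes b: "bdpot U W C" and H: "H_kernel \<omega> U W \<mu> 1 f"
  shows "L2 f" "Hl \<omega> U W (cls f) (cs \<mu> (cls f))"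
proof -
  obtain h where h: "H_graph \<omega> U W f h" "AE x in lborel. h x - \<mu> *s f x = 0"
    using H by auto
  then have L: "L2 f" "L2 h" by (auto simp: H_graph_def)
  have "cls h = cls (\<lambda>x. \<mu> *s f x)"
    using h(2) by (subst cls_eq_iff) (auto simp: L L2_smult)
  then show "L2 f" "Hl \<omega> U W (cls f) (cs \<mu> (cls f))"
    using H_graph_Hl[OF b h(1)] L by (auto simp: cs_cls)
qed

lemma eigenvalue_imp_eig:
  assumes b: "bdpot U W C" and "eigenvalue \<omega> U W \<mu>"
  shows "eig \<omega> U W \<mu>"
proof -
  obtain f where f: "H_kernel \<omega> U W \<mu> 1 f" "\<not> (AE x in lborel. f x = 0)"
    using assms(2) by (auto simp: eigenvalue_def)
  note F = H_kernel_1_Hl[OF b f(1)]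
  have "cls f \<noteq> 0" using f(2) cls_eq_iff[OF F(1) L2_zero] by (simp add: cls_zero)
  then show ?thesis using F(2) by (auto simp: eig_def)
qed

lemma tail2_mono: "tail2 b G u \<Longrightarrow> b' \<le> b \<Longrightarrow> G \<le> G' \<Longrightarrow> tail2 b' G' u"
proof -
  assume u: "tail2 b G u" and b: "b' \<le> b" and G: "G \<le> G'"
  have "0 \<le> G" using u unfolding tail2_def using order_trans[OF norm_ge_zero, of "out 0 u" "G * exp (- b * 0)"] by auto
  then have "G * exp (- b * a) \<le> G' * exp (- b' * a)" if "0 \<le> a" for a
    using that b G by (intro mult_mono) (auto intro: mult_right_mono)
  then show ?thesis using u order_trans unfolding tail2_def by blast
qed

text \<open>H is unbounded, so the bound does not follow from applying it to \<open>Z\<close>.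
  Instead |F|^2 is the inner product of \<sigma>3 H Z with G = \<sigma>3 i F, and the symmetric
  operator is moved onto \<open>G\<close>, where H F = 0 replaces \<omega> - \<partial>^2 by the
  bounded potential.\<close>

lemma generalized_kernel_norm_le:
  assumes b: "bdpot U W C" and C: "0 \<le> C" and Z: "Hl \<omega> U W Z (cs \<i> F)" and F: "Hl \<omega> U W F 0"
  shows "norm F \<le> 8 * C * norm Z"
proof -
  let ?s = "mop (\<lambda>_. sigma3)" and ?V = "mop (potential U W)"
  have bV: "bmat (potential U W)" by (rule bmat_potential[OF b])
  have V: "norm (?V u) \<le> 4 * C * norm u" for u
    using mop_norm_le[OF bV potential_norm_le, of C u] b C by (auto simp: bdpot_def)
  obtain F1 F2 where F: "wd F F1" "wd F1 F2" "0 = ?s (\<omega> *\<^sub>R F - F2) + ?V F"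
    using F unfolding Hl_def by blast
  have "\<omega> *\<^sub>R F - F2 = ?s (?s (\<omega> *\<^sub>R F - F2))" by (simp add: sigma3_sigma3)
  also have "?s (\<omega> *\<^sub>R F - F2) = - ?V F" using F(3) by (simp add: eq_neg_iff_add_eq_0)
  finally have eqF: "\<omega> *\<^sub>R F - F2 = - ?s (?V F)" by (simp add: mop_minus)
  define G where "G = ?s (cs \<i> F)"
  define K where "K = - cs \<i> (?V F) + ?s (?V G)"
  have "\<omega> *\<^sub>R G - ?s (cs \<i> F2) = ?s (cs \<i> (\<omega> *\<^sub>R F - F2))"
    by (simp add: G_def mop_diff mop_scaleR cs_simps)
  also have "\<dots> = - cs \<i> (?V F)"
    unfolding eqF by (simp add: cs_simps mop_minus mop_cs sigma3_sigma3)
  finally have "K = \<omega> *\<^sub>R G - ?s (cs \<i> F2) + ?s (?V G)" by (simp add: K_def)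
  moreover have "wd G (?s (cs \<i> F1))" "wd (?s (cs \<i> F1)) (?s (cs \<i> F2))"
    unfolding G_def by (intro wd_mop wd_cs F)+
  ultimately have "Ll \<omega> U W G K" unfolding Ll_def by blast
  from Ll_symmetric[OF b Hl_imp_Ll[OF Z] this]
  have "(norm F)\<^sup>2 = inner Z K" by (simp add: G_def power2_norm_eq_inner[symmetric])
  also have "\<dots> \<le> norm Z * norm K" by (rule norm_cauchy_schwarz)
  also have "norm K \<le> 4 * C * norm F + 4 * C * norm G"
    unfolding K_def using V by (intro order_trans[OF norm_triangle_ineq] add_mono) simp_all
  then have "norm Z * norm K \<le> norm Z * (8 * C * norm F)"
    by (intro mult_left_mono) (simp_all add: G_def)
  finally have "norm F * norm F \<le> norm F * (8 * C * norm Z)"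
    by (simp add: power2_eq_square mult_ac)
  then show ?thesis using C by (cases "norm F = 0") auto
qed

text \<open>The finite set \<open>E\<close> collects the non-real eigenvalues and the nonzero real
  ones of modulus below \<omega>. There the square roots of \<omega> - \<mu> and \<omega> + \<mu>
  have positive real parts, with a positive minimum. Every other eigenvalue is 0 or real of modulus
  at least \<omega>, and then each root is purely imaginary or at least sqrt \<omega>. So one rate
  and one bound on imaginary parts serve all eigenvalues.\<close>

lemma uniform_decay:
  assumes d: "decaying \<alpha> C U W" and om: "0 < \<omega>" and H2: "hypothesis_H2 \<omega> U W"
  shows "\<exists>b K \<Gamma>. 0 < b \<and> b \<le> \<alpha> \<and> 0 \<le> K \<and> 0 \<le> \<Gamma> \<and>
    (\<forall>\<mu> F. eigenvalue \<omega> U W \<mu> \<longrightarrow> Hl \<omega> U W F (cs \<mu> F) \<longrightarrow> \<bar>Im \<mu>\<bar> \<le> \<Gamma> \<and> tail2 b (K * norm F) F) \<and>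
    (\<forall>Z F. Hl \<omega> U W Z (cs \<i> F) \<longrightarrow> Hl \<omega> U W F 0 \<longrightarrow> tail2 b (K * norm Z) Z \<and> tail2 b (K * norm Z) F)"
proof -
  note b = decaying_bdpot[OF d]
  have C: "0 \<le> C" "0 < \<alpha>" using d by (auto simp: decaying_def)
  let ?z = "\<lambda>\<mu> c. of_real \<omega> - of_real (sgc c) * \<mu>"
  define E where "E = {\<mu>. eig \<omega> U W \<mu> \<and> Im \<mu> \<noteq> 0} \<union> real_eigenvalues \<omega> U W"
  have finE: "finite E"
    using nonreal_eigenvalues_finite[OF d om] H2 by (simp add: E_def hypothesis_H2_def)
  define \<rho> where "\<rho> = (\<lambda>(\<mu>, c). Re (csqrt (?z \<mu> c)))"
  have \<rho>: "0 < \<rho> (\<mu>, c)" if "\<mu> \<in> E" for \<mu> c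
  proof (rule ccontr)
    assume "\<not> 0 < \<rho> (\<mu>, c)"
    then have "Re (csqrt (?z \<mu> c)) = 0" using csqrt_principal[of "?z \<mu> c"] by (auto simp: \<rho>_def)
    from csqrt_Re_zero[OF this] have "Im \<mu> = 0" "\<omega> \<le> sgc c * Re \<mu>" by (auto simp: sgc_def split: if_splits)
    moreover have "norm \<mu> < \<omega>" if "Im \<mu> = 0" using \<open>\<mu> \<in> E\<close> that by (auto simp: E_def real_eigenvalues_def)
    ultimately show False using abs_Re_le_cmod[of \<mu>] by (auto simp: sgc_def split: if_splits)
  qed
  define \<delta> where "\<delta> = Min (insert (sqrt \<omega>) (\<rho> ` (E \<times> UNIV)))"
  have \<delta>0: "0 < \<delta>" using finE \<rho> om by (auto simp: \<delta>_def)
  have \<delta>le: "\<delta> \<le> sqrt \<omega>" "\<And>\<mu> c. \<mu> \<in> E \<Longrightarrow> \<delta> \<le> \<rho> (\<mu>, c)" using finE by (auto simp: \<delta>_def)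
  have rate_real: "Re (csqrt (?z \<mu> c)) = 0 \<or> \<delta> \<le> Re (csqrt (?z \<mu> c))" if "Im \<mu> = 0" "\<omega> \<le> \<bar>Re \<mu>\<bar> \<or> \<mu> = 0" for \<mu> c
  proof (cases "Re (?z \<mu> c) \<le> 0")
    case True
    then show ?thesis using that by (simp add: csqrt_of_real_nonpos)
  next
    case False
    then have "\<omega> \<le> Re (?z \<mu> c)" using that om by (auto simp: sgc_def split: if_splits)
    then have "\<delta> \<le> sqrt (Re (?z \<mu> c))" using \<delta>le(1) order_trans by (auto intro: order_trans[OF _ real_sqrt_le_mono])
    then show ?thesis using False that by (simp add: csqrt_of_real_nonneg)
  qed
  have rate: "Re (csqrt (?z \<mu> c)) = 0 \<or> \<delta> \<le> Re (csqrt (?z \<mu> c))" if "eigenvalue \<omega> U W \<mu>" for \<mu> c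
  proof (cases "\<mu> \<in> E")
    case True
    then show ?thesis using \<delta>le(2)[of \<mu> c] by (simp add: \<rho>_def)
  next
    case False
    then have im: "Im \<mu> = 0" using eigenvalue_imp_eig[OF b that] by (auto simp: E_def)
    moreover have "\<omega> \<le> \<bar>Re \<mu>\<bar> \<or> \<mu> = 0"
      using False im that by (auto simp: E_def real_eigenvalues_def cmod_eq_Re)
    ultimately show ?thesis by (rule rate_real)
  qed
  \<comment> \<open>Half of \<delta> leaves the margin \<delta> - \<beta> for the decaying first
    order equation; the cap \<alpha> is there because the source contains the potential.\<close>
  define \<beta> where "\<beta> = min \<alpha> (\<delta> / 2)"
  have \<beta>: "0 < \<beta>" "\<beta> < \<delta>" "\<beta> \<le> \<alpha>" using C \<delta>0 by (auto simp: \<beta>_def)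
  define c0 where "c0 = 1 / \<beta> * (1 / \<beta> + 1 / (\<delta> - \<beta>))"
  have c0: "0 \<le> c0" using \<beta> by (simp add: c0_def)
  define K1 where "K1 = 4 * (1 + 4 * C * c0)"
  have K1: "0 \<le> K1" using C c0 by (simp add: K1_def)
  have tail_0: "tail2 \<beta> 0 0" by (simp add: tail2_def linear_simps[OF bounded_linear_ind])
  have dec1: "tail2 \<beta> (K1 * norm F) F" if "Hl \<omega> U W F (cs \<mu> F)" "\<And>c. Re (csqrt (?z \<mu> c)) = 0 \<or> \<delta> \<le> Re (csqrt (?z \<mu> c))" for \<mu> F
  proof -
    have "Hl \<omega> U W F (cs \<mu> F + 0)" using that(1) by simp
    from resolvent_equation_decay[OF d this that(2) \<beta> tail_0, folded c0_def]
    have "tail2 \<beta> (4 * (norm F + (0 + 4 * C * norm F) * c0)) F" .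
    also have "4 * (norm F + (0 + 4 * C * norm F) * c0) = K1 * norm F" by (simp add: K1_def algebra_simps)
    finally show ?thesis .
  qed
  have rate0: "\<And>c. Re (csqrt (?z 0 c)) = 0 \<or> \<delta> \<le> Re (csqrt (?z 0 c))" by (rule rate_real) auto
  \<comment> \<open>In the equation for Z the function i F is an additional source; its tail
    constant, expressed through |Z|, is K1 times 8 C.\<close>
  define K2 where "K2 = 4 * (1 + (K1 * (8 * C) + 4 * C) * c0)"
  define \<Gamma> where "\<Gamma> = Max (insert 0 ((\<lambda>\<mu>. \<bar>Im \<mu>\<bar>) ` E))"
  have \<Gamma>: "0 \<le> \<Gamma>" "\<And>\<mu>. \<mu> \<in> E \<Longrightarrow> \<bar>Im \<mu>\<bar> \<le> \<Gamma>" using finE by (auto simp: \<Gamma>_def)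
  define K where "K = K1 + K1 * (8 * C) + K2"
  have K: "0 \<le> K" "K1 \<le> K" "K1 * (8 * C) \<le> K" "K2 \<le> K" using K1 C c0 by (auto simp: K_def K2_def)
  have main1: "\<bar>Im \<mu>\<bar> \<le> \<Gamma> \<and> tail2 \<beta> (K * norm F) F" if "eigenvalue \<omega> U W \<mu>" "Hl \<omega> U W F (cs \<mu> F)" for \<mu> F
  proof
    show "\<bar>Im \<mu>\<bar> \<le> \<Gamma>"
      using \<Gamma> eigenvalue_imp_eig[OF b that(1)] by (cases "Im \<mu> = 0") (auto simp: E_def)
    show "tail2 \<beta> (K * norm F) F"
      by (rule tail2_mono[OF dec1[OF that(2) rate[OF that(1)]]]) (auto intro: mult_right_mono K)
  qed
  have main2: "tail2 \<beta> (K * norm Z) Z \<and> tail2 \<beta> (K * norm Z) F" if Z: "Hl \<omega> U W Z (cs \<i> F)" and F: "Hl \<omega> U W F 0" for Z F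
  proof -
    have nF: "norm F \<le> 8 * C * norm Z" by (rule generalized_kernel_norm_le[OF b C(1) Z F])
    have "tail2 \<beta> (K1 * norm F) F" using F by (intro dec1[OF _ rate0]) simp
    then have tF: "tail2 \<beta> (K1 * (8 * C) * norm Z) F"
      using nF K1 by (elim tail2_mono) (auto simp: mult.assoc intro: mult_left_mono)
    then have "tail2 \<beta> (K1 * (8 * C) * norm Z) (cs \<i> F)" by (simp add: tail2_def ind_cs)
    moreover have "Hl \<omega> U W Z (cs 0 Z + cs \<i> F)" using Z by simp
    ultimately have "tail2 \<beta> (4 * (norm Z + (K1 * (8 * C) * norm Z + 4 * C * norm Z) * c0)) Z"
      using resolvent_equation_decay[OF d _ rate0 \<beta>, folded c0_def] by blast
    also have "4 * (norm Z + (K1 * (8 * C) * norm Z + 4 * C * norm Z) * c0) = K2 * norm Z"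
      by (simp add: K2_def algebra_simps)
    finally have "tail2 \<beta> (K2 * norm Z) Z" .
    then show ?thesis
      using tF by (auto elim!: tail2_mono intro!: mult_right_mono K)
  qed
  show ?thesis
    using main1 main2 \<beta> K(1) \<Gamma>(1) by blast
qed

subsection \<open>Interaction of separated potentials\<close>

text \<open>Neighbouring gaps telescope, and nonnegativity of the minimum allows all but one of them
  to be discarded.\<close>

lemma min_gap_le:
  assumes "1 \<le> i" "i < j" "j \<le> m" "0 \<le> min_gap m a"
  shows "min_gap m a \<le> a i - a j"
  using assms(2,3)
proof (induction j rule: less_induct)
  case (less j)
  obtain k where k: "j = Suc k" using less.prems by (cases j) auto
  have gap: "min_gap m a \<le> a k - a (k + 1)"
    unfolding min_gap_def using less.prems assms(1) k by (intro Min_le) auto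
  show ?case
  proof (cases "i = k")
    case False
    then have "min_gap m a \<le> a i - a k" using less.IH[of k] less.prems k by auto
    then show ?thesis using gap assms(4) k by simp
  qed (use gap k in simp)
qed

lemma separated_le:
  assumes "k \<in> {1..m}" "l \<in> {1..m}" "l \<noteq> k" "0 \<le> min_gap m y" "0 \<le> min_gap m v" "0 \<le> t"
  shows "min_gap m y + min_gap m v * t \<le> \<bar>(v l * t + y l) - (v k * t + y k)\<bar>"
proof -
  have main: "min_gap m y + min_gap m v * t \<le> (v i * t + y i) - (v j * t + y j)" if "i < j" "1 \<le> i" "j \<le> m" for i j
    using min_gap_le[OF that(2,1,3) assms(4)] mult_right_mono[OF min_gap_le[OF that(2,1,3) assms(5)] assms(6)]
    by (simp add: algebra_simps)
  show ?thesis using main[of l k] main[of k l] assms by (cases "l < k") auto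
qed

text \<open>In the frame of the potential the line is split at half the distance D of the two
  centres. Far from the potential its own decay is used; near it the profile \<open>F\<close> is at
  least D / 2 away from its own centre, where its tail is small. The split costs half of the
  rate.\<close>

lemma interaction_le:
  assumes d: "decaying \<alpha> C U W" and b: "0 < b" "b \<le> \<alpha>" and F: "tail2 b G F"
  shows "norm (mop (mov \<omega> U W v y \<gamma> t) (gal \<omega>' v' y' \<gamma>' t F)) \<le>
    4 * C * (norm F + G) * exp (- (b / 2) * \<bar>(v * t + y) - (v' * t + y')\<bar>)"
proof -
  note bd = decaying_bdpot[OF d]
  have C: "0 \<le> C" "0 < \<alpha>" using d by (auto simp: decaying_def)
  define w where "w = gali \<omega> v y \<gamma> t (gal \<omega>' v' y' \<gamma>' t F)"
  define D where "D = \<bar>(v * t + y) - (v' * t + y')\<bar>"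
  let ?V = "mop (potential U W)" and ?S = "{x::real. \<bar>x\<bar> < D / 2}"
  have bV: "bmat (potential U W)" by (rule bmat_potential[OF bd])
  have V: "norm (?V u) \<le> 4 * C * norm u" for u
    using mop_norm_le[OF bV potential_norm_le, of C u] bd C by (auto simp: bdpot_def)
  have S: "?S \<in> sets borel" by measurable
  have "norm (ind ?S w) = norm (ind {x. \<bar>x + (v' * t + y') - (v * t + y)\<bar> < D / 2} F)"
  proof -
    let ?T = "{x. \<bar>x - (v * t + y)\<bar> < D / 2}"
    have T: "?T \<in> sets borel" by measurable
    have "ind ?S w = tr (v * t + y) (ind ?T (mop (\<lambda>x. ph (- phase \<omega> v \<gamma> t x)) (gal \<omega>' v' y' \<gamma>' t F)))"
      unfolding w_def gali_def by (rule ind_tr[OF S]) auto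
    moreover have "ind ?T (mop (\<lambda>x. ph (- phase \<omega> v \<gamma> t x)) u) = mop (\<lambda>x. ph (- phase \<omega> v \<gamma> t x)) (ind ?T u)" for u
      by (rule ind_mop[OF T bmat_ph]) measurable
    moreover have "ind ?T (gal \<omega>' v' y' \<gamma>' t F) = mop (\<lambda>x. ph (phase \<omega>' v' \<gamma>' t x)) (ind ?T (tr (- (v' * t + y')) F))"
      unfolding gal_def by (rule ind_mop[OF T bmat_ph]) measurable
    moreover have "ind ?T (tr (- (v' * t + y')) F) = tr (- (v' * t + y')) (ind {x. \<bar>x + (v' * t + y') - (v * t + y)\<bar> < D / 2} F)"
      by (rule ind_tr[OF T]) (auto simp: algebra_simps)
    ultimately show ?thesis by (simp only: tr_norm mop_ph_norm[OF phase_measurable] mop_ph_norm[OF borel_measurable_uminus[OF phase_measurable]])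
  qed
  also have "\<dots> \<le> norm (out (D / 2) F)"
  proof (rule ind_mono)
    have "\<bar>q - p\<bar> / 2 \<le> \<bar>x\<bar>" if "\<bar>x + p - q\<bar> < \<bar>q - p\<bar> / 2" for p q x :: real
    proof -
      have "x - (x + p - q) = q - p" by simp
      then show ?thesis using that abs_triangle_ineq4[of x "x + p - q"] by simp
    qed
    then show "{x. \<bar>x + (v' * t + y') - (v * t + y)\<bar> < D / 2} \<subseteq> {x. D / 2 \<le> \<bar>x\<bar>}"
      unfolding D_def by blast
  qed measurable
  also have "\<dots> \<le> G * exp (- b * (D / 2))" using F[unfolded tail2_def, rule_format, of "D / 2"] by (simp add: D_def)
  finally have near: "norm (ind ?S w) \<le> G * exp (- b * (D / 2))" .
  have "norm (out (D / 2) (?V w)) \<le> 4 * C * exp (- \<alpha> * (D / 2)) * norm w"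
    by (rule potential_out_le[OF d]) (simp add: D_def)
  also have "\<dots> \<le> 4 * C * exp (- b * (D / 2)) * norm F"
    using b C by (auto simp: w_def D_def intro!: mult_right_mono mult_left_mono)
  finally have far: "norm (out (D / 2) (?V w)) \<le> 4 * C * exp (- b * (D / 2)) * norm F" .
  have "norm (mop (mov \<omega> U W v y \<gamma> t) (gal \<omega>' v' y' \<gamma>' t F)) = norm (?V w)"
    by (simp add: mop_mov[OF bd] w_def mop_neg_i_potential[OF bd])
  also have "\<dots> = norm (ind UNIV (?V w))"
    unfolding ind_def by simp
  also have "\<dots> \<le> norm (out (D / 2) (?V w)) + norm (ind ?S (?V w))"
    by (rule ind_cover) (use S in auto)
  also have "norm (ind ?S (?V w)) \<le> 4 * C * norm (ind ?S w)"
    unfolding ind_mop[OF S bV] by (rule V)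
  finally have "norm (mop (mov \<omega> U W v y \<gamma> t) (gal \<omega>' v' y' \<gamma>' t F)) \<le> norm (out (D / 2) (?V w)) + 4 * C * norm (ind ?S w)"
    by simp
  also have "\<dots> \<le> 4 * C * exp (- b * (D / 2)) * norm F + 4 * C * (G * exp (- b * (D / 2)))"
    using C by (intro add_mono far mult_left_mono near) auto
  also have "\<dots> = 4 * C * (norm F + G) * exp (- (b / 2) * D)" by (simp add: algebra_simps)
  finally show ?thesis by (simp only: D_def)
qed

text \<open>The remainder solves the perturbed equation whose source \<open>F\<close> is the defect
  of the main term. The bound \<open>Bd\<close> lies above the decay that existence delivers and
  below some multiple of the same exponential, which is what uniqueness asks for.\<close>

lemma unique_CT_solution_near_if_small_forcing:
  assumes b: "\<And>l. l \<in> {1..m} \<Longrightarrow> bdpot (U l) (W l) (C l)"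
    and Pf: "\<And>t. L2 (Pf t)" and Pc: "continuous_on {0..} (\<lambda>t. cls (Pf t))"
    and Pw: "weak_solution core (\<lambda>t. cls (Pf t)) (\<lambda>t. Bop m \<omega> U W v y \<gamma> t (cls (Pf t)) - F t)"
    and F: "continuous_on {0..} F" "\<And>t. 0 \<le> t \<Longrightarrow> norm (F t) \<le> c * exp (- lam * t)"
    and lam: "0 < lam" "2 * (\<Sum>l=1..m. 4 * C l) \<le> lam" and M: "0 \<le> (\<Sum>l=1..m. 4 * C l)"
    and B: "\<And>t. 0 \<le> t \<Longrightarrow> 2 * c / lam * exp (- lam * t) \<le> Bd t" "\<And>t. 0 \<le> t \<Longrightarrow> Bd t \<le> N * exp (- lam * t)"
  shows "unique_CT_solution_near m \<omega> U W v y \<gamma> Pf Bd"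
proof -
  let ?B = "Bop m \<omega> U W v y \<gamma>"
  have Badd: "?B t (p + q) = ?B t p + ?B t q" for t p q
    by (rule Bop_linear(2)[where C = C, OF b])
  note iff = CT_solution_iff_weak_solution[where m = m and U = U and W = W and C = C and \<omega> = \<omega> and v = v and y = y and \<gamma> = \<gamma>, OF b]
  obtain r where r: "continuous_on {0..} r" "weak_solution core r (\<lambda>t. ?B t (r t) + F t)"
    "\<And>t. 0 \<le> t \<Longrightarrow> norm (r t) \<le> 2 * c / lam * exp (- lam * t)"
    using free.perturbed_solution_exists[of ?B "\<Sum>l=1..m. 4 * C l", OF Bop_norm_le[OF b] Bop_linear(1)[OF b] Bop_continuous[OF b] F lam M]
    by blast
  define ad where "ad r \<longleftrightarrow> CT_solution m \<omega> U W v y \<gamma> (\<lambda>t x. Pf t x + r t x) \<and> (\<forall>t\<ge>0. L2 (r t) \<and> L2norm (r t) \<le> Bd t)" for r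
  define R where "R t = rep_l2 (r t)" for t
  have LR: "L2 (R t)" for t by (simp add: R_def)
  have "ad R"
    unfolding ad_def
  proof (intro conjI allI impI)
    have eq: "cls (\<lambda>x. Pf t x + R t x) = cls (Pf t) + r t" for t by (simp add: cls_add Pf R_def)
    have "weak_solution core (\<lambda>t. cls (Pf t) + r t) (\<lambda>t. (?B t (cls (Pf t)) - F t) + (?B t (r t) + F t))"
      by (rule weak_solution_add[OF Pw r(2)])
    then have "weak_solution core (\<lambda>t. cls (Pf t) + r t) (\<lambda>t. ?B t (cls (Pf t) + r t))"
      by (simp add: Badd)
    then show "CT_solution m \<omega> U W v y \<gamma> (\<lambda>t x. Pf t x + R t x)"
      by (subst iff) (auto simp: eq L2_add Pf LR intro!: continuous_on_add Pc r(1))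
    show "L2 (R t)" "L2norm (R t) \<le> Bd t" if "0 \<le> t" for t
      using order_trans[OF r(3) B(1)] that by (auto simp: R_def simp flip: cls_norm)
  qed
  moreover have "AE x in lborel. r' t x = R t x" if r': "ad r'" and t: "0 \<le> t" for r' t
  proof -
    have L: "L2 (r' t)" "L2norm (r' t) \<le> Bd t" if "0 \<le> t" for t using r' that by (auto simp: ad_def)
    define u where "u t = cls (r' t)" for t
    have eq: "cls (\<lambda>x. Pf t x + r' t x) = cls (Pf t) + u t" if "0 \<le> t" for t
      using L that by (simp add: cls_add Pf u_def)
    have "CT_solution m \<omega> U W v y \<gamma> (\<lambda>t x. Pf t x + r' t x)" using r' by (simp add: ad_def)
    then have uc: "continuous_on {0..} (\<lambda>t. cls (\<lambda>x. Pf t x + r' t x))"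
      and uw: "weak_solution core (\<lambda>t. cls (\<lambda>x. Pf t x + r' t x)) (\<lambda>t. ?B t (cls (\<lambda>x. Pf t x + r' t x)))"
      using iff[of "\<lambda>t x. Pf t x + r' t x"] L by (auto simp: L2_add Pf)
    have "continuous_on {0..} (\<lambda>t. cls (\<lambda>x. Pf t x + r' t x) - cls (Pf t))" by (intro continuous_on_diff uc Pc)
    then have c: "continuous_on {0..} u" by (rule continuous_on_eq) (simp add: eq)
    have "weak_solution core (\<lambda>t. cls (\<lambda>x. Pf t x + r' t x) - cls (Pf t)) (\<lambda>t. ?B t (cls (\<lambda>x. Pf t x + r' t x)) - (?B t (cls (Pf t)) - F t))"
      by (rule weak_solution_diff[OF uw Pw])
    then have w: "weak_solution core u (\<lambda>t. ?B t (u t) + F t)"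
      by (rule weak_solution_cong) (simp_all add: eq Badd)
    have "norm (u t - r t) \<le> (N + 2 * c / lam) * exp (- lam * t)" if "0 \<le> t" for t
    proof -
      have "norm (u t) \<le> N * exp (- lam * t)"
        using order_trans[OF L(2) B(2)] that L(1) by (simp add: u_def cls_norm)
      then show ?thesis unfolding distrib_right by (intro norm_triangle_le_diff add_mono r(3) that)
    qed
    from free.perturbed_solution_unique[of ?B "\<Sum>l=1..m. 4 * C l", OF Bop_norm_le[OF b] Bop_linear(1)[OF b] Bop_continuous[OF b] lam c w r(1,2) this t]
    have "cls (r' t) = cls (R t)" by (simp add: u_def R_def)
    then show ?thesis using cls_eq_iff[OF L(1)[OF t] LR] by simp
  qed
  ultimately show ?thesis
    unfolding unique_CT_solution_near_def Let_def ad_def[symmetric] by blast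
qed

section \<open>Application to separated potentials\<close>

lemma decaying_if_potential_le:
  assumes s: "smooth U" "smooth W" and a: "0 < a"
    and le: "\<And>x. norm (potential U W x) \<le> C * exp (- a * \<bar>x\<bar>)"
  shows "decaying a (max C 0) U W"
proof -
  have "\<bar>U x\<bar> \<le> max C 0 * exp (- a * \<bar>x\<bar>) \<and> \<bar>W x\<bar> \<le> max C 0 * exp (- a * \<bar>x\<bar>)" for x
  proof -
    have "norm (potential U W x $ i $ j) \<le> norm (potential U W x)" for i j
      by (rule order_trans[OF Finite_Cartesian_Product.norm_nth_le Finite_Cartesian_Product.norm_nth_le])
    from this[of 1 1] this[of 2 1] have "\<bar>U x\<bar> \<le> norm (potential U W x)" "\<bar>W x\<bar> \<le> norm (potential U W x)"
      by (simp_all add: potential_nth)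
    moreover have "norm (potential U W x) \<le> max C 0 * exp (- a * \<bar>x\<bar>)"
      by (rule order_trans[OF le]) (intro mult_right_mono, auto)
    ultimately show ?thesis by linarith
  qed
  then show ?thesis using s a by (auto simp: decaying_def intro: smooth_measurable)
qed

lemma Bop_split:
  assumes "k \<in> {1..m}"
  shows "Bop m \<omega> U W v y \<gamma> t u = mop (mov (\<omega> k) (U k) (W k) (v k) (y k) (\<gamma> k) t) u +
    (\<Sum>l\<in>{1..m} - {k}. mop (mov (\<omega> l) (U l) (W l) (v l) (y l) (\<gamma> l) t) u)"
  unfolding Bop_def using assms by (intro sum.remove) auto

text \<open>The common end of both cases of the theorem: \<open>\<Gamma>\<close> bounds the growth
  of the main term and \<open>b\<close> is the tail rate of its profile. The velocity threshold
  ensures that the final rate is at least 1, at least \<open>\<Gamma>\<close> and at least twice the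
  bound on the whole potential.\<close>

lemma unique_CT_solution_near_separated:
  fixes C :: "nat \<Rightarrow> real"
  assumes b: "\<And>l. l \<in> {1..m} \<Longrightarrow> bdpot (U l) (W l) (C l)" and C: "\<And>l. l \<in> {1..m} \<Longrightarrow> 0 \<le> C l"
    and k: "k \<in> {1..m}"
    and Pf: "\<And>t. L2 (Pf t)" and Pc: "continuous_on {0..} (\<lambda>t. cls (Pf t))"
    and Pw: "weak_solution core (\<lambda>t. cls (Pf t)) (\<lambda>t. mop (mov (\<omega> k) (U k) (W k) (v k) (y k) (\<gamma> k) t) (cls (Pf t)))"
    and int: "\<And>l t. l \<in> {1..m} \<Longrightarrow> l \<noteq> k \<Longrightarrow> 0 \<le> t \<Longrightarrow>
      norm (mop (mov (\<omega> l) (U l) (W l) (v l) (y l) (\<gamma> l) t) (cls (Pf t))) \<le>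
      4 * C l * Q * (exp (\<Gamma> * t) * exp (- (b / 2) * (min_gap m y + min_gap m v * t)))"
    and bpos: "0 < b" and \<Gamma>: "0 \<le> \<Gamma>" and Q: "0 \<le> Q"
    and gy: "gap_exceeds m y 2" and gv: "gap_exceeds m v (2 + (4 + 4 * \<Gamma> + 8 * (\<Sum>l=1..m. 4 * C l)) / b)"
    and K: "2 * (\<Sum>l=1..m. 4 * C l) * Q \<le> K"
  shows "unique_CT_solution_near m \<omega> U W v y \<gamma> Pf (\<lambda>t. K * separation_decay m y v (b / 4) t)"
proof -
  define M where "M = (\<Sum>l=1..m. 4 * C l)"
  have M: "0 \<le> M" unfolding M_def using C by (intro sum_nonneg) auto
  define F where "F t = (\<Sum>l\<in>{1..m} - {k}. mop (mov (\<omega> l) (U l) (W l) (v l) (y l) (\<gamma> l) t) (cls (Pf t)))" for t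
  have PF: "mop (mov (\<omega> k) (U k) (W k) (v k) (y k) (\<gamma> k) t) (cls (Pf t)) = Bop m \<omega> U W v y \<gamma> t (cls (Pf t)) - F t" for t
    unfolding F_def by (simp add: Bop_split[OF k])
  have Pw': "weak_solution core (\<lambda>t. cls (Pf t)) (\<lambda>t. Bop m \<omega> U W v y \<gamma> t (cls (Pf t)) - F t)"
    using Pw unfolding PF .
  have cmov: "continuous_on {0..} (\<lambda>t. mop (mov (\<omega> l) (U l) (W l) (v l) (y l) (\<gamma> l) t) (cls (Pf t)))" if "l \<in> {1..m}" for l
    unfolding mop_mov[OF b[OF that]]
    by (intro continuous_on_gal continuous_on_mop bmat_potential[OF b[OF that]] continuous_on_gali Pc)
  have Fc: "continuous_on {0..} F"
    unfolding F_def by (intro continuous_on_sum cmov) auto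
  show ?thesis
  proof (cases "2 \<le> m")
    case True
    define Y where "Y = min_gap m y"
    define X where "X = min_gap m v"
    have Y: "2 < Y" using gy True by (simp add: gap_exceeds_def Y_def)
    have X: "2 + (4 + 4 * \<Gamma> + 8 * M) / b < X" using gv True by (simp add: gap_exceeds_def X_def M_def)
    have "(4 + 4 * \<Gamma> + 8 * M) / b < X" using X by simp
    then have bX: "4 + 4 * \<Gamma> + 8 * M < b * X" using bpos by (simp add: pos_divide_less_eq mult.commute)
    \<comment> \<open>Of the rate b X / 2 that the interaction provides, one half pays for exp
      (\<Gamma> t) and the other half is kept as decay.\<close>
    define lam where "lam = b / 4 * X"
    have lam: "1 \<le> lam" "2 * M \<le> lam" "\<Gamma> \<le> lam" using bX \<Gamma> M by (auto simp: lam_def)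
    \<comment> \<open>The rate in the position gap is lowered from b / 2 to b / 4, so that the same
      \<beta> stands in both exponents.\<close>
    define c where "c = M * Q * exp (- (b / 4) * Y)"
    have c0: "0 \<le> c" using M Q by (simp add: c_def)
    have Fle: "norm (F t) \<le> c * exp (- lam * t)" if t: "0 \<le> t" for t
    proof -
      have "exp (\<Gamma> * t) * exp (- (b / 2) * (Y + X * t)) \<le> exp (- (b / 4) * Y) * exp (- lam * t)"
      proof -
        have "\<Gamma> * t \<le> lam * t" using lam(3) t by (rule mult_right_mono)
        moreover have "0 \<le> b * Y" using bpos Y by simp
        moreover have "- (b / 2) * (Y + X * t) = - (b / 2) * Y - 2 * (lam * t)" by (simp add: lam_def algebra_simps)
        ultimately have "\<Gamma> * t + - (b / 2) * (Y + X * t) \<le> - (b / 4) * Y + - lam * t" by simp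
        then show ?thesis by (simp only: exp_le_cancel_iff flip: exp_add)
      qed
      note E = this
      have "norm (F t) \<le> (\<Sum>l\<in>{1..m} - {k}. 4 * C l * (Q * (exp (- (b / 4) * Y) * exp (- lam * t))))"
        unfolding F_def
      proof (rule sum_norm_le)
        fix l assume l: "l \<in> {1..m} - {k}"
        then have "norm (mop (mov (\<omega> l) (U l) (W l) (v l) (y l) (\<gamma> l) t) (cls (Pf t))) \<le>
            4 * C l * Q * (exp (\<Gamma> * t) * exp (- (b / 2) * (Y + X * t)))"
          unfolding Y_def X_def by (intro int t) auto
        also have "\<dots> \<le> 4 * C l * Q * (exp (- (b / 4) * Y) * exp (- lam * t))"
          using C l Q by (intro mult_left_mono E) auto
        finally show "norm (mop (mov (\<omega> l) (U l) (W l) (v l) (y l) (\<gamma> l) t) (cls (Pf t))) \<le>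
            4 * C l * (Q * (exp (- (b / 4) * Y) * exp (- lam * t)))" by (simp add: mult.assoc)
      qed
      also have "\<dots> \<le> (\<Sum>l=1..m. 4 * C l * (Q * (exp (- (b / 4) * Y) * exp (- lam * t))))"
        using C Q by (intro sum_mono2) auto
      also have "\<dots> = c * exp (- lam * t)"
        by (simp only: c_def M_def mult.assoc sum_distrib_right)
      finally show ?thesis .
    qed
    have sd: "separation_decay m y v (b / 4) t = exp (- (b / 4) * Y) * exp (- lam * t)" for t
      using True by (simp add: separation_decay_def Y_def X_def lam_def flip: exp_add)
    show ?thesis
    proof (rule unique_CT_solution_near_if_small_forcing[OF b Pf Pc Pw' Fc Fle])
      show "0 < lam" using lam by simp
      show "2 * (\<Sum>l=1..m. 4 * C l) \<le> lam" "0 \<le> (\<Sum>l=1..m. 4 * C l)" using lam M by (simp_all add: M_def)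
      fix t :: real
      \<comment> \<open>As lam is at least 1, the division by it is dropped, which keeps the
        constant independent of the velocities.\<close>
      have "2 * c / lam \<le> 2 * c" using c0 lam(1) mult_left_mono[of 1 lam "2 * c"] by (simp add: pos_divide_le_eq)
      also have "\<dots> \<le> K * exp (- (b / 4) * Y)"
        using mult_right_mono[OF K, of "exp (- (b / 4) * Y)"] by (simp add: c_def M_def mult.assoc)
      finally have "2 * c / lam * exp (- lam * t) \<le> K * exp (- (b / 4) * Y) * exp (- lam * t)"
        by (rule mult_right_mono) simp
      then show "2 * c / lam * exp (- lam * t) \<le> K * separation_decay m y v (b / 4) t"
        by (simp only: sd mult.assoc)
      show "K * separation_decay m y v (b / 4) t \<le> (K * exp (- (b / 4) * Y)) * exp (- lam * t)"
        by (simp only: sd mult.assoc order_refl)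
    qed
  next
    \<comment> \<open>A single potential: the source is absent and the prescribed bound is 0, so the
      rate only has to be positive and at least 2 M.\<close>
    case False
    then have "{1..m} - {k} = {}" using k by auto
    then have F0: "F t = 0" for t unfolding F_def by (simp only: sum.empty)
    show ?thesis
    proof (rule unique_CT_solution_near_if_small_forcing[OF b Pf Pc Pw' Fc])
      show "norm (F t) \<le> 0 * exp (- (2 * M + 1) * t)" for t by (simp add: F0)
      show "0 < 2 * M + 1" "2 * (\<Sum>l=1..m. 4 * C l) \<le> 2 * M + 1" "0 \<le> (\<Sum>l=1..m. 4 * C l)" using M by (simp_all add: M_def)
      show "2 * 0 / (2 * M + 1) * exp (- (2 * M + 1) * t) \<le> K * separation_decay m y v (b / 4) t"
        "K * separation_decay m y v (b / 4) t \<le> 0 * exp (- (2 * M + 1) * t)" for t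
        using False by (simp_all add: separation_decay_def)
    qed
  qed
qed

text \<open>Kernel elements may be multiplied by arbitrary scalars, hence the factor max 1 of the
  norm, which is 1 for normalized ones. The constants are chosen before k, the velocities,
  positions, phases and the eigenvalue; this is how dependence on the potentials alone is
  expressed.\<close>

theorem theorem1p11:
  fixes m :: nat
    and \<omega> :: "nat \<Rightarrow> real"
    and U W :: "nat \<Rightarrow> real \<Rightarrow> real"
  assumes "\<And>l. l \<in> {1..m} \<Longrightarrow> 0 < \<omega> l"
    and "\<And>l. l \<in> {1..m} \<Longrightarrow> smooth (U l) \<and> smooth (W l)"
    and "\<And>l x. l \<in> {1..m} \<Longrightarrow> potential (U l) (W l) x = potential (U l) (W l) (- x)"
    and "\<exists>a. 0 < a \<and> a < 1 \<and> (\<forall>l\<in>{1..m}. \<forall>k. \<exists>C. \<forall>x::real.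
           norm (potential ((deriv ^^ k) (U l)) ((deriv ^^ k) (W l)) x) \<le> C * exp (- a * \<bar>x\<bar>))"
    and "\<And>l. l \<in> {1..m} \<Longrightarrow> hypothesis_H1 (\<omega> l) (U l) (W l)"
    and "\<And>l. l \<in> {1..m} \<Longrightarrow> hypothesis_H2 (\<omega> l) (U l) (W l)"
    and "\<And>l. l \<in> {1..m} \<Longrightarrow> hypothesis_H3 (\<omega> l) (U l) (W l)"
  shows "\<exists>K L C \<beta> :: real. 0 < K \<and> 1 < L \<and> 1 < C \<and> 0 < \<beta> \<and>
    (\<forall>k\<in>{1..m}. \<forall>v y \<gamma> :: nat \<Rightarrow> real.
       (\<forall>l\<in>{1..<m}. v l > v (l + 1)) \<longrightarrow> (\<forall>l\<in>{1..<m}. y l > y (l + 1)) \<longrightarrow>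
       gap_exceeds m y L \<longrightarrow> gap_exceeds m v C \<longrightarrow>
       (\<forall>\<mu> f. eigenvalue (\<omega> k) (U k) (W k) \<mu> \<longrightarrow> H_kernel (\<omega> k) (U k) (W k) \<mu> 1 f \<longrightarrow>
          unique_CT_solution_near m \<omega> U W v y \<gamma>
            (\<lambda>t x. exp (- \<i> * \<mu> * of_real t) *s galilei (\<omega> k) (v k) (y k) (\<gamma> k) f t x)
            (\<lambda>t. K * max 1 (L2norm f) * separation_decay m y v \<beta> t)) \<and>
       (\<forall>z f. H_kernel (\<omega> k) (U k) (W k) 0 2 z \<longrightarrow> H_kernel (\<omega> k) (U k) (W k) 0 1 f \<longrightarrow>
          H_graph (\<omega> k) (U k) (W k) z (\<lambda>x. \<i> *s f x) \<longrightarrow>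
          unique_CT_solution_near m \<omega> U W v y \<gamma>
            (\<lambda>t x. galilei (\<omega> k) (v k) (y k) (\<gamma> k) z t x
                   + t *\<^sub>R galilei (\<omega> k) (v k) (y k) (\<gamma> k) f t x)
            (\<lambda>t. K * max 1 (L2norm z) * separation_decay m y v \<beta> t)))"
proof -
  obtain a where a: "0 < a" and "\<forall>l\<in>{1..m}. \<forall>k. \<exists>C. \<forall>x::real.
           norm (potential ((deriv ^^ k) (U l)) ((deriv ^^ k) (W l)) x) \<le> C * exp (- a * \<bar>x\<bar>)"
    using assms(4) by blast
  then have "\<forall>l\<in>{1..m}. \<exists>C. \<forall>x::real. norm (potential (U l) (W l) x) \<le> C * exp (- a * \<bar>x\<bar>)"
    by (metis funpow_0)
  then obtain C' where C': "\<And>l x. l \<in> {1..m} \<Longrightarrow> norm (potential (U l) (W l) x) \<le> C' l * exp (- a * \<bar>x\<bar>)"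
    by metis
  define C where "C l = max (C' l) 0" for l
  have dec: "decaying a (C l) (U l) (W l)" if "l \<in> {1..m}" for l
    unfolding C_def using assms(2)[OF that] C'[OF that] by (intro decaying_if_potential_le a) auto
  have bd: "\<And>l. l \<in> {1..m} \<Longrightarrow> bdpot (U l) (W l) (C l)" by (rule decaying_bdpot[OF dec])
  have C0: "0 \<le> C l" for l by (simp add: C_def)
  have "\<forall>k\<in>{1..m}. \<exists>b K \<Gamma>. 0 < b \<and> b \<le> a \<and> 0 \<le> K \<and> 0 \<le> \<Gamma> \<and>
    (\<forall>\<mu> F. eigenvalue (\<omega> k) (U k) (W k) \<mu> \<longrightarrow> Hl (\<omega> k) (U k) (W k) F (cs \<mu> F) \<longrightarrow> \<bar>Im \<mu>\<bar> \<le> \<Gamma> \<and> tail2 b (K * norm F) F) \<and>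
    (\<forall>Z F. Hl (\<omega> k) (U k) (W k) Z (cs \<i> F) \<longrightarrow> Hl (\<omega> k) (U k) (W k) F 0 \<longrightarrow> tail2 b (K * norm Z) Z \<and> tail2 b (K * norm Z) F)"
    by (intro ballI uniform_decay[OF dec assms(1) assms(6)])
  then obtain b K \<Gamma> where bK: "\<And>k. k \<in> {1..m} \<Longrightarrow> 0 < b k \<and> b k \<le> a \<and> 0 \<le> K k \<and> 0 \<le> \<Gamma> k"
    and ev: "\<And>k \<mu> F. k \<in> {1..m} \<Longrightarrow> eigenvalue (\<omega> k) (U k) (W k) \<mu> \<Longrightarrow> Hl (\<omega> k) (U k) (W k) F (cs \<mu> F) \<Longrightarrow>
        \<bar>Im \<mu>\<bar> \<le> \<Gamma> k \<and> tail2 (b k) (K k * norm F) F"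
    and gen: "\<And>k Z F. k \<in> {1..m} \<Longrightarrow> Hl (\<omega> k) (U k) (W k) Z (cs \<i> F) \<Longrightarrow> Hl (\<omega> k) (U k) (W k) F 0 \<Longrightarrow>
        tail2 (b k) (K k * norm Z) Z \<and> tail2 (b k) (K k * norm Z) F"
    by metis
  \<comment> \<open>One tail rate for all k; a tail bound may be weakened to a smaller rate.\<close>
  define b0 where "b0 = Min (insert a (b ` {1..m}))"
  have b0: "0 < b0" "b0 \<le> a" "\<And>k. k \<in> {1..m} \<Longrightarrow> b0 \<le> b k"
  proof -
    show "0 < b0" "b0 \<le> a" using a bK by (auto simp: b0_def)
    show "b0 \<le> b k" if "k \<in> {1..m}" for k unfolding b0_def using that by (intro Min_le) blast+
  qed
  define K0 where "K0 = (\<Sum>k=1..m. K k)"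
  have K0: "0 \<le> K0" "\<And>k. k \<in> {1..m} \<Longrightarrow> K k \<le> K0"
    unfolding K0_def using bK by (auto intro!: sum_nonneg member_le_sum)
  \<comment> \<open>The summand 2 serves the generalized kernel, where the linear factor 1 + 2 t has
    to stay below exp (\<Gamma>0 t).\<close>
  define \<Gamma>0 where "\<Gamma>0 = 2 + (\<Sum>k=1..m. \<Gamma> k)"
  have \<Gamma>0: "2 \<le> \<Gamma>0" "\<And>k. k \<in> {1..m} \<Longrightarrow> \<Gamma> k \<le> \<Gamma>0"
  proof -
    show "2 \<le> \<Gamma>0" unfolding \<Gamma>0_def using bK by (auto intro!: sum_nonneg)
    have "\<Gamma> k \<le> (\<Sum>k=1..m. \<Gamma> k)" if "k \<in> {1..m}" for k using bK that by (intro member_le_sum) auto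
    then show "\<And>k. k \<in> {1..m} \<Longrightarrow> \<Gamma> k \<le> \<Gamma>0" unfolding \<Gamma>0_def by fastforce
  qed
  define M where "M = (\<Sum>l=1..m. 4 * C l)"
  have M: "0 \<le> M" unfolding M_def using C0 by (intro sum_nonneg) auto
  \<comment> \<open>1 + K0 adds the norm of the profile to its tail constant, 2 M comes from the
    remainder bound 2 c / lam with lam at least 1, and the last 1 ensures positivity.\<close>
  define KK where "KK = 2 * M * (1 + K0) + 1"
  define CC where "CC = 2 + (4 + 4 * \<Gamma>0 + 8 * M) / b0"
  have "0 < KK" using M K0 by (simp add: KK_def add_nonneg_pos)
  moreover have "1 < CC" using M b0 \<Gamma>0(1) by (simp add: CC_def add_pos_nonneg)
  moreover have interaction: "norm (mop (mov (\<omega> l) (U l) (W l) (v l) (y l) (\<gamma> l) t) (gal \<omega>' (v k) (y k) \<gamma>' t F)) \<le>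
      4 * C l * (norm F + G) * exp (- (b0 / 2) * (min_gap m y + min_gap m v * t))"
    if "k \<in> {1..m}" "l \<in> {1..m}" "l \<noteq> k" "0 \<le> t" "gap_exceeds m y 2" "gap_exceeds m v CC" "tail2 b0 G F"
    for k l t v y \<gamma> F G \<omega>' \<gamma>'
  proof -
    have "2 \<le> m" using that(1-3) by auto
    then have g: "0 \<le> min_gap m y" "0 \<le> min_gap m v"
      using that(5,6) \<open>1 < CC\<close> by (auto simp: gap_exceeds_def)
    have G: "0 \<le> G" using that(7) unfolding tail2_def using order_trans[OF norm_ge_zero, of "out 0 F" "G * exp (- b0 * 0)"] by auto
    have "norm (mop (mov (\<omega> l) (U l) (W l) (v l) (y l) (\<gamma> l) t) (gal \<omega>' (v k) (y k) \<gamma>' t F)) \<le>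
        4 * C l * (norm F + G) * exp (- (b0 / 2) * \<bar>(v l * t + y l) - (v k * t + y k)\<bar>)"
      by (rule interaction_le[OF dec[OF that(2)] b0(1,2) that(7)])
    also have "\<dots> \<le> 4 * C l * (norm F + G) * exp (- (b0 / 2) * (min_gap m y + min_gap m v * t))"
      using separated_le[OF that(1-3) g that(4)] b0(1) C0 G
      by (intro mult_left_mono) (auto simp: mult_left_mono)
    finally show ?thesis .
  qed
  moreover have "unique_CT_solution_near m \<omega> U W v y \<gamma>
            (\<lambda>t x. exp (- \<i> * \<mu> * of_real t) *s galilei (\<omega> k) (v k) (y k) (\<gamma> k) f t x)
            (\<lambda>t. KK * max 1 (L2norm f) * separation_decay m y v (b0 / 4) t)"
    if k: "k \<in> {1..m}" and gaps: "gap_exceeds m y 2" "gap_exceeds m v CC"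
      and e: "eigenvalue (\<omega> k) (U k) (W k) \<mu>" "H_kernel (\<omega> k) (U k) (W k) \<mu> 1 f" for k v y \<gamma> \<mu> f
  proof -
    note f = H_kernel_1_Hl[OF bd[OF k] e(2)]
    note evk = ev[OF k e(1) f(2)]
    let ?Pf = "\<lambda>t x. exp (- \<i> * \<mu> * of_real t) *s galilei (\<omega> k) (v k) (y k) (\<gamma> k) f t x"
    have cP: "cls (?Pf t) = cs (exp (- \<i> * \<mu> * of_real t)) (gal (\<omega> k) (v k) (y k) (\<gamma> k) t (cls f))" for t
      using cs_cls[OF cls_galilei(1)[OF f(1)]] by (simp add: cls_galilei[OF f(1)])
    have tf: "tail2 b0 (K0 * norm (cls f)) (cls f)"
      using evk b0(3)[OF k] K0(2)[OF k] by (auto elim!: tail2_mono intro!: mult_right_mono)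
    show ?thesis
    proof (rule unique_CT_solution_near_separated[where C = C and Q = "(1 + K0) * norm (cls f)" and \<Gamma> = \<Gamma>0, OF bd C0 k])
      show "L2 (?Pf t)" for t by (intro L2_smult cls_galilei f)
      show "continuous_on {0..} (\<lambda>t. cls (?Pf t))"
        "weak_solution core (\<lambda>t. cls (?Pf t)) (\<lambda>t. mop (mov (\<omega> k) (U k) (W k) (v k) (y k) (\<gamma> k) t) (cls (?Pf t)))"
        unfolding cP by (rule eigen_weak_solution[OF bd[OF k] f(2)])+
      show "0 < b0" "0 \<le> \<Gamma>0" "0 \<le> (1 + K0) * norm (cls f)" using b0 \<Gamma>0 K0 by auto
      show "gap_exceeds m y 2" "gap_exceeds m v (2 + (4 + 4 * \<Gamma>0 + 8 * (\<Sum>l=1..m. 4 * C l)) / b0)"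
        using gaps by (auto simp: CC_def M_def)
      have "2 * M * (1 + K0) * norm (cls f) \<le> KK * max 1 (L2norm f)"
        using M K0 cls_norm[OF f(1)] norm_ge_zero[of "cls f"] by (intro mult_mono) (auto simp del: norm_ge_zero simp: KK_def)
      then show "2 * (\<Sum>l=1..m. 4 * C l) * ((1 + K0) * norm (cls f)) \<le> KK * max 1 (L2norm f)"
        by (simp add: M_def mult.assoc)
      fix l t assume l: "l \<in> {1..m}" "l \<noteq> k" "0 \<le> (t::real)"
      have "norm (exp (- \<i> * \<mu> * of_real t)) \<le> exp (\<Gamma>0 * t)"
      proof -
        have "Im \<mu> * t \<le> \<Gamma>0 * t" using evk \<Gamma>0(2)[OF k] l(3) by (intro mult_right_mono) auto
        then show ?thesis by (simp add: norm_exp_eq_Re)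
      qed
      moreover have "norm (mop (mov (\<omega> l) (U l) (W l) (v l) (y l) (\<gamma> l) t) (gal (\<omega> k) (v k) (y k) (\<gamma> k) t (cls f))) \<le>
          4 * C l * (norm (cls f) + K0 * norm (cls f)) * exp (- (b0 / 2) * (min_gap m y + min_gap m v * t))"
        by (rule interaction[OF k l gaps tf])
      ultimately have "norm (mop (mov (\<omega> l) (U l) (W l) (v l) (y l) (\<gamma> l) t) (cls (?Pf t))) \<le>
          exp (\<Gamma>0 * t) * (4 * C l * (norm (cls f) + K0 * norm (cls f)) * exp (- (b0 / 2) * (min_gap m y + min_gap m v * t)))"
        unfolding cP mop_cs[OF bmat_mov(1)[OF bd[OF l(1)]]] cs_norm by (intro mult_mono) auto
      then show "norm (mop (mov (\<omega> l) (U l) (W l) (v l) (y l) (\<gamma> l) t) (cls (?Pf t))) \<le>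
          4 * C l * ((1 + K0) * norm (cls f)) * (exp (\<Gamma>0 * t) * exp (- (b0 / 2) * (min_gap m y + min_gap m v * t)))"
        by (simp add: distrib_right mult_ac)
    qed
  qed
  moreover have "unique_CT_solution_near m \<omega> U W v y \<gamma>
            (\<lambda>t x. galilei (\<omega> k) (v k) (y k) (\<gamma> k) z t x
                   + t *\<^sub>R galilei (\<omega> k) (v k) (y k) (\<gamma> k) f t x)
            (\<lambda>t. KK * max 1 (L2norm z) * separation_decay m y v (b0 / 4) t)"
    if k: "k \<in> {1..m}" and gaps: "gap_exceeds m y 2" "gap_exceeds m v CC"
      and e: "H_kernel (\<omega> k) (U k) (W k) 0 1 f" "H_graph (\<omega> k) (U k) (W k) z (\<lambda>x. \<i> *s f x)" for k v y \<gamma> z f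
  proof -
    note f = H_kernel_1_Hl[OF bd[OF k] e(1)]
    have z: "L2 z" using e(2) by (simp add: H_graph_def)
    have HF: "Hl (\<omega> k) (U k) (W k) (cls f) 0" using f(2) by simp
    have HZ: "Hl (\<omega> k) (U k) (W k) (cls z) (cs \<i> (cls f))"
      using H_graph_Hl[OF bd[OF k] e(2)] by (simp add: cs_cls f)
    note genk = gen[OF k HZ HF]
    let ?Pf = "\<lambda>t x. galilei (\<omega> k) (v k) (y k) (\<gamma> k) z t x + t *\<^sub>R galilei (\<omega> k) (v k) (y k) (\<gamma> k) f t x"
    have cP: "cls (?Pf t) = gal (\<omega> k) (v k) (y k) (\<gamma> k) t (cls z) + t *\<^sub>R gal (\<omega> k) (v k) (y k) (\<gamma> k) t (cls f)" for t
      by (simp add: cls_add cls_scaleR cls_galilei L2_scaleR f z)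
    have tz: "tail2 b0 (K0 * norm (cls z)) (cls z)" and tf: "tail2 b0 (K0 * norm (cls z)) (cls f)"
      using genk b0(3)[OF k] K0(2)[OF k] by (auto elim!: tail2_mono intro!: mult_right_mono)
    \<comment> \<open>The tail from a = 0 is the whole function, so the tail bound also controls the
      norm of \<open>f\<close> by that of \<open>z\<close>.\<close>
    have nf: "norm (cls f) \<le> K0 * norm (cls z)"
      using tf[unfolded tail2_def, rule_format, of 0] by (simp add: ind_def)
    show ?thesis
    proof (rule unique_CT_solution_near_separated[where C = C and Q = "(1 + K0) * norm (cls z)" and \<Gamma> = \<Gamma>0, OF bd C0 k])
      show "L2 (?Pf t)" for t by (intro L2_add L2_scaleR cls_galilei f z)
      show "continuous_on {0..} (\<lambda>t. cls (?Pf t))"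
        "weak_solution core (\<lambda>t. cls (?Pf t)) (\<lambda>t. mop (mov (\<omega> k) (U k) (W k) (v k) (y k) (\<gamma> k) t) (cls (?Pf t)))"
        unfolding cP by (rule generalized_weak_solution[OF bd[OF k] HZ HF])+
      show "0 < b0" "0 \<le> \<Gamma>0" "0 \<le> (1 + K0) * norm (cls z)" using b0 \<Gamma>0 K0 by auto
      show "gap_exceeds m y 2" "gap_exceeds m v (2 + (4 + 4 * \<Gamma>0 + 8 * (\<Sum>l=1..m. 4 * C l)) / b0)"
        using gaps by (auto simp: CC_def M_def)
      have "2 * M * (1 + K0) * norm (cls z) \<le> KK * max 1 (L2norm z)"
        using M K0 cls_norm[OF z] norm_ge_zero[of "cls z"] by (intro mult_mono) (auto simp del: norm_ge_zero simp: KK_def)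
      then show "2 * (\<Sum>l=1..m. 4 * C l) * ((1 + K0) * norm (cls z)) \<le> KK * max 1 (L2norm z)"
        by (simp add: M_def mult.assoc)
      fix l t assume l: "l \<in> {1..m}" "l \<noteq> k" "0 \<le> (t::real)"
      let ?V = "mop (mov (\<omega> l) (U l) (W l) (v l) (y l) (\<gamma> l) t)"
      let ?e = "exp (- (b0 / 2) * (min_gap m y + min_gap m v * t))"
      let ?q = "4 * C l * ((1 + K0) * norm (cls z)) * ?e"
      have q: "0 \<le> ?q" using C0 K0 by simp
      have "norm (?V (gal (\<omega> k) (v k) (y k) (\<gamma> k) t (cls z))) \<le> 4 * C l * (norm (cls z) + K0 * norm (cls z)) * ?e"
        by (rule interaction[OF k l gaps tz])
      then have 1: "norm (?V (gal (\<omega> k) (v k) (y k) (\<gamma> k) t (cls z))) \<le> ?q" by (simp add: distrib_right)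
      have "norm (?V (gal (\<omega> k) (v k) (y k) (\<gamma> k) t (cls f))) \<le> 4 * C l * (norm (cls f) + K0 * norm (cls z)) * ?e"
        by (rule interaction[OF k l gaps tf])
      \<comment> \<open>Both summands are at most (1 + K0) |z|; the resulting 2 multiplies t below
        and is absorbed by \<open>\<Gamma>0\<close>.\<close>
      also have "\<dots> \<le> 4 * C l * (2 * ((1 + K0) * norm (cls z))) * ?e"
        using nf C0 by (intro mult_right_mono mult_left_mono) (auto simp: distrib_right intro: add_increasing2)
      finally have 2: "norm (?V (gal (\<omega> k) (v k) (y k) (\<gamma> k) t (cls f))) \<le> 2 * ?q" by (simp add: mult_ac)
      have "norm (?V (cls (?Pf t))) \<le> ?q + t * (2 * ?q)"
        unfolding cP mop_add[OF bmat_mov(1)[OF bd[OF l(1)]]] mop_scaleR[OF bmat_mov(1)[OF bd[OF l(1)]]]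
        using 1 mult_left_mono[OF 2 l(3)] l(3) by (intro norm_triangle_le add_mono) simp_all
      also have "\<dots> = (1 + 2 * t) * ?q" by (simp add: algebra_simps)
      also have "\<dots> \<le> exp (\<Gamma>0 * t) * ?q"
      proof (rule mult_right_mono[OF _ q])
        have "1 + 2 * t \<le> 1 + \<Gamma>0 * t" using mult_right_mono[OF \<Gamma>0(1) l(3)] by simp
        also have "\<dots> \<le> exp (\<Gamma>0 * t)" by (rule exp_ge_add_one_self)
        finally show "1 + 2 * t \<le> exp (\<Gamma>0 * t)" .
      qed
      finally show "norm (?V (cls (?Pf t))) \<le> 4 * C l * ((1 + K0) * norm (cls z)) * (exp (\<Gamma>0 * t) * ?e)"
        by (simp add: mult_ac)
    qed
  qed
  ultimately show ?thesis
    \<comment> \<open>The contraction is driven by the velocity gap, while the position gap enters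
      the estimates through its positivity and the decay factor; L = 2 is taken to meet 1 <
      L.\<close>
    using b0(1) by (intro exI[of _ KK] exI[of _ 2] exI[of _ CC] exI[of _ "b0 / 4"]) (auto intro!: conjI ballI allI impI)
qed

end
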